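(* Let $k$ be a field of characteristic $0$, $x_1,\ldots,x_m$ indeterminates over $k$, and let $R$ be either $k[x_1,\ldots,x_m]_{\mathfrak q}/I$ (with $\mathfrak q\in\operatorname{Spec}k[x_1,\ldots,x_m]$) or $k[[x_1,\ldots,x_m]]/I$, where $I$ is a proper radical ideal. Write $t=\operatorname{depth}R$. Suppose there exists an integer $r$ with $0\le r\le t$ such that $\Omega_{R/k}$ satisfies $(\widetilde S_r)$ and, if $r<t$, $\operatorname{Ext}_R^i(\Omega_{R/k},R)=0$ for all $1\le i\le t-r$. If $\operatorname{pd}_R\operatorname{Der}_k(R)<\infty$, then $R$ is regular (i.e., the strong Zariski--Lipman conjecture holds for $R$). In particular, if $R$ is Cohen--Macaulay, $\Omega_{R/k}$ is maximal Cohen--Macaulay, and $\operatorname{pd}_R\operatorname{Der}_k(R)<\infty$, then $R$ is regular.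
   Context: $\operatorname{Der}_k(R)$ is the $R$-module of $k$-derivations $R\to R$ (additive maps vanishing on $k$ and satisfying the Leibniz rule). $\Omega_{R/k}$ is the universally finite $k$-differential module of $R$, a finite (finitely generated) $R$-module universal for $k$-derivations of $R$ into finite $R$-modules; in the first case it is the module of Kähler differentials, and in both cases it is the quotient of the free module $\bigoplus_{i=1}^m R\,dx_i$ by the submodule generated by $\sum_i \frac{\partial f}{\partial x_i}dx_i$, $f\in I$. A finite $R$-module $M$ satisfies $(\widetilde S_n)$ if $\operatorname{depth}_{R_{\mathfrak p}}M_{\mathfrak p}\ge\min\{n,\operatorname{depth}R_{\mathfrak p}\}$ for all $\mathfrak p\in\operatorname{Spec}(R)$, with $\operatorname{depth}0=\infty$. $\operatorname{pd}$ is projective dimension. The strong Zariski--Lipman (Herzog--Vasconcelos--Zariski--Lipman) conjecture predicts that, if $k$ is a field of characteristic $0$, $x_1,\ldots,x_m$ are indeterminates over $k$, and $R$ is either $k[x_1,\ldots,x_m]_{\mathfrak q}/I$ (with $\mathfrak q\in\operatorname{Spec}k[x_1,\ldots,x_m]$) or $k[[x_1,\ldots,x_m]]/I$ with $I$ a proper radical ideal, then $R$ is regular whenever $\operatorname{pd}_R\operatorname{Der}_k(R)<\infty$. *)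

theory Defs
  imports "HOL-Algebra.Algebra" "HOL-Algebra.Indexed_Polynomials" "HOL-Library.Extended_Nat"
begin

section \<open>Power series and polynomial rings in \<open>m\<close> indeterminates\<close>

text \<open>
  As in \<^theory>\<open>HOL-Algebra.Indexed_Polynomials\<close>, a monomial is a multiset of indeterminates
  and a series is its coefficient function. The indeterminates are \<open>0, \<dots>, m - 1\<close>, and
  \<open>indexed_const\<close> embeds the coefficients.
\<close>

definition power_series_ring :: "('k, 'c) ring_scheme \<Rightarrow> nat \<Rightarrow> (nat multiset \<Rightarrow> 'k) ring" where
  "power_series_ring K m =
    \<lparr> carrier = {f. (\<forall>\<mu>. f \<mu> \<in> carrier K) \<and> (\<forall>\<mu>. \<not> set_mset \<mu> \<subseteq> {..<m} \<longrightarrow> f \<mu> = \<zero>\<^bsub>K\<^esub>)},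
      monoid.mult = (\<lambda>f g \<mu>. \<Oplus>\<^bsub>K\<^esub>\<nu> \<in> {\<nu>. \<nu> \<subseteq># \<mu>}. f \<nu> \<otimes>\<^bsub>K\<^esub> g (\<mu> - \<nu>)),
      one = ring.indexed_const K \<one>\<^bsub>K\<^esub>,
      ring.zero = ring.indexed_const K \<zero>\<^bsub>K\<^esub>,
      ring.add = (\<lambda>f g \<mu>. f \<mu> \<oplus>\<^bsub>K\<^esub> g \<mu>) \<rparr>"

definition polynomial_ring :: "('k, 'c) ring_scheme \<Rightarrow> nat \<Rightarrow> (nat multiset \<Rightarrow> 'k) ring" where
  "polynomial_ring K m = (power_series_ring K m)
    \<lparr> carrier := {f \<in> carrier (power_series_ring K m). finite {\<mu>. f \<mu> \<noteq> \<zero>\<^bsub>K\<^esub>}} \<rparr>"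


section \<open>Modules\<close>

text \<open>
  The type of modules extends the type of rings; the fields \<open>mult\<close> and \<open>one\<close> play no role for a
  module and are left unspecified unless the module is the ring itself. Homomorphisms are extensional functions, so that
  equality of homomorphisms is equality of functions.
\<close>

definition self_module :: "('r, 'c) ring_scheme \<Rightarrow> ('r, 'r) module" where
  "self_module R = \<lparr> carrier = carrier R, monoid.mult = monoid.mult R, one = one R,
    ring.zero = ring.zero R, ring.add = ring.add R, smult = monoid.mult R \<rparr>"

definition finite_module :: "('r, 'c) ring_scheme \<Rightarrow> ('r, 'm, 'd) module_scheme \<Rightarrow> bool" where
  "finite_module R M \<longleftrightarrow> module R M \<and>
    (\<exists>A. finite A \<and> A \<subseteq> carrier M \<and> (\<forall>H. submodule H R M \<and> A \<subseteq> H \<longrightarrow> H = carrier M))"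

definition mod_hom ::
  "('r, 'c) ring_scheme \<Rightarrow> ('r, 'm, 'd) module_scheme \<Rightarrow> ('r, 'n, 'e) module_scheme \<Rightarrow> ('m \<Rightarrow> 'n) set"
  where
  "mod_hom R M N = {h \<in> carrier M \<rightarrow>\<^sub>E carrier N.
     (\<forall>x\<in>carrier M. \<forall>y\<in>carrier M. h (x \<oplus>\<^bsub>M\<^esub> y) = h x \<oplus>\<^bsub>N\<^esub> h y) \<and>
     (\<forall>a\<in>carrier R. \<forall>x\<in>carrier M. h (a \<odot>\<^bsub>M\<^esub> x) = a \<odot>\<^bsub>N\<^esub> h x)}"

definition Hom_module ::
  "('r, 'c) ring_scheme \<Rightarrow> ('r, 'm, 'd) module_scheme \<Rightarrow> ('r, 'n, 'e) module_scheme \<Rightarrow> ('r, 'm \<Rightarrow> 'n) module"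
  where
  "Hom_module R M N = \<lparr> carrier = mod_hom R M N, monoid.mult = undefined, one = undefined,
     ring.zero = (\<lambda>x\<in>carrier M. \<zero>\<^bsub>N\<^esub>),
     ring.add = (\<lambda>f g. \<lambda>x\<in>carrier M. f x \<oplus>\<^bsub>N\<^esub> g x),
     smult = (\<lambda>a f. \<lambda>x\<in>carrier M. a \<odot>\<^bsub>N\<^esub> f x) \<rparr>"

definition free_module :: "('r, 'c) ring_scheme \<Rightarrow> 'x set \<Rightarrow> ('r, 'x \<Rightarrow> 'r) module" where
  "free_module R J =
    \<lparr> carrier = {f. (\<forall>x. f x \<in> carrier R) \<and> (\<forall>x. x \<notin> J \<longrightarrow> f x = \<zero>\<^bsub>R\<^esub>) \<and> finite {x. f x \<noteq> \<zero>\<^bsub>R\<^esub>}},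
      monoid.mult = undefined, one = undefined,
      ring.zero = (\<lambda>x. \<zero>\<^bsub>R\<^esub>),
      ring.add = (\<lambda>f g x. f x \<oplus>\<^bsub>R\<^esub> g x),
      smult = (\<lambda>a f x. a \<otimes>\<^bsub>R\<^esub> f x) \<rparr>"

text \<open>
  A projective module is a direct summand of a free module. The index set may be taken in the
  type of the elements of \<open>P\<close>, because \<open>P\<close> is a quotient of the free module on \<open>carrier P\<close>.
\<close>

definition projective_module :: "('r, 'c) ring_scheme \<Rightarrow> ('r, 'p, 'd) module_scheme \<Rightarrow> bool" where
  "projective_module R P \<longleftrightarrow> module R P \<and>
    (\<exists>(J :: 'p set) s r. s \<in> mod_hom R P (free_module R J) \<and>
       r \<in> mod_hom R (free_module R J) P \<and> (\<forall>x\<in>carrier P. r (s x) = x))"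


section \<open>Projective resolutions, projective dimension and Ext\<close>

text \<open>The resolution is \<open>\<dots> \<rightarrow> P 2 \<rightarrow> P 1 \<rightarrow> P 0 \<rightarrow> M \<rightarrow> 0\<close>, with \<open>d i\<close> from \<open>P (i + 1)\<close> to \<open>P i\<close>
  and augmentation \<open>\<epsilon>\<close>.\<close>

definition projective_resolution ::
  "('r, 'c) ring_scheme \<Rightarrow> ('r, 'm, 'd) module_scheme \<Rightarrow>
    (nat \<Rightarrow> ('r, 'p) module) \<Rightarrow> (nat \<Rightarrow> 'p \<Rightarrow> 'p) \<Rightarrow> ('p \<Rightarrow> 'm) \<Rightarrow> bool"
  where
  "projective_resolution R M P d \<epsilon> \<longleftrightarrow>
     module R M \<and> (\<forall>i. projective_module R (P i)) \<and>
     (\<forall>i. d i \<in> mod_hom R (P (Suc i)) (P i)) \<and>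
     \<epsilon> \<in> mod_hom R (P 0) M \<and> \<epsilon> ` carrier (P 0) = carrier M \<and>
     d 0 ` carrier (P 1) = {x \<in> carrier (P 0). \<epsilon> x = \<zero>\<^bsub>M\<^esub>} \<and>
     (\<forall>i. d (Suc i) ` carrier (P (Suc (Suc i))) = {x \<in> carrier (P (Suc i)). d i x = \<zero>\<^bsub>P i\<^esub>})"

text \<open>
  Below, the terms of a resolution have carriers of type \<open>nat \<Rightarrow> 'r\<close>. This loses nothing for a
  finite module over a Noetherian ring: it has a resolution by modules \<open>R\<^sup>n\<close>, and if it has
  projective dimension at most \<open>n\<close>, then a resolution of length \<open>n\<close> is obtained from finite free
  modules and a submodule of one of them.
\<close>

definition proj_dim :: "('r, 'c) ring_scheme \<Rightarrow> ('r, 'm, 'd) module_scheme \<Rightarrow> enat" where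
  "proj_dim R M = Inf {enat n | n.
     \<exists>(P :: nat \<Rightarrow> ('r, nat \<Rightarrow> 'r) module) d \<epsilon>.
       projective_resolution R M P d \<epsilon> \<and> (\<forall>i>n. carrier (P i) = {\<zero>\<^bsub>P i\<^esub>})}"

definition chosen_resolution ::
  "('r, 'c) ring_scheme \<Rightarrow> ('r, 'm, 'd) module_scheme \<Rightarrow>
    (nat \<Rightarrow> ('r, nat \<Rightarrow> 'r) module) \<times> (nat \<Rightarrow> (nat \<Rightarrow> 'r) \<Rightarrow> (nat \<Rightarrow> 'r)) \<times> ((nat \<Rightarrow> 'r) \<Rightarrow> 'm)"
  where
  "chosen_resolution R M = (SOME (P, d, \<epsilon>). projective_resolution R M P d \<epsilon>)"

definition Hom_cocycles ::
  "('r, 'c) ring_scheme \<Rightarrow> (nat \<Rightarrow> ('r, 'p) module) \<Rightarrow> (nat \<Rightarrow> 'p \<Rightarrow> 'p) \<Rightarrow>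
    ('r, 'n, 'e) module_scheme \<Rightarrow> nat \<Rightarrow> ('p \<Rightarrow> 'n) set"
  where
  "Hom_cocycles R P d N i =
     {f \<in> mod_hom R (P i) N.
        compose (carrier (P (Suc i))) f (d i) = \<zero>\<^bsub>Hom_module R (P (Suc i)) N\<^esub>}"

primrec Hom_coboundaries ::
  "('r, 'c) ring_scheme \<Rightarrow> (nat \<Rightarrow> ('r, 'p) module) \<Rightarrow> (nat \<Rightarrow> 'p \<Rightarrow> 'p) \<Rightarrow>
    ('r, 'n, 'e) module_scheme \<Rightarrow> nat \<Rightarrow> ('p \<Rightarrow> 'n) set"
  where
  "Hom_coboundaries R P d N 0 = {\<zero>\<^bsub>Hom_module R (P 0) N\<^esub>}"
| "Hom_coboundaries R P d N (Suc i) =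
     (\<lambda>g. compose (carrier (P (Suc i))) g (d i)) ` mod_hom R (P i) N"

text \<open>\<open>Ext i R M N\<close> is the additive group underlying the \<open>i\<close>-th Ext module of \<open>M\<close> and \<open>N\<close>.\<close>

definition Ext ::
  "nat \<Rightarrow> ('r, 'c) ring_scheme \<Rightarrow> ('r, 'm, 'd) module_scheme \<Rightarrow> ('r, 'n, 'e) module_scheme \<Rightarrow>
    ((nat \<Rightarrow> 'r) \<Rightarrow> 'n) set monoid"
  where
  "Ext i R M N = (case chosen_resolution R M of (P, d, \<epsilon>) \<Rightarrow>
     (add_monoid (Hom_module R (P i) N)) \<lparr> carrier := Hom_cocycles R P d N i \<rparr>
       Mod Hom_coboundaries R P d N i)"


section \<open>Localization\<close>

text \<open>\<open>fraction R S M x s\<close> is the class of \<open>x / s\<close>, a set of pairs.\<close>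

definition fraction ::
  "('r, 'c) ring_scheme \<Rightarrow> 'r set \<Rightarrow> ('r, 'm, 'd) module_scheme \<Rightarrow> 'm \<Rightarrow> 'r \<Rightarrow> ('m \<times> 'r) set"
  where
  "fraction R S M x s =
     {(y, t). y \<in> carrier M \<and> t \<in> S \<and> (\<exists>u\<in>S. u \<odot>\<^bsub>M\<^esub> (t \<odot>\<^bsub>M\<^esub> x) = u \<odot>\<^bsub>M\<^esub> (s \<odot>\<^bsub>M\<^esub> y))}"

text \<open>
  The operations on classes are unions over all representatives; for a multiplicatively closed set
  \<open>S\<close> all members of such a union coincide.
\<close>

definition localized_module ::
  "('r, 'c) ring_scheme \<Rightarrow> 'r set \<Rightarrow> ('r, 'm, 'd) module_scheme \<Rightarrow> (('r \<times> 'r) set, ('m \<times> 'r) set) module"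
  where
  "localized_module R S M =
    \<lparr> carrier = {fraction R S M x s | x s. x \<in> carrier M \<and> s \<in> S},
      monoid.mult = undefined, one = undefined,
      ring.zero = fraction R S M \<zero>\<^bsub>M\<^esub> \<one>\<^bsub>R\<^esub>,
      ring.add = (\<lambda>A B. \<Union>(x, s)\<in>A. \<Union>(y, t)\<in>B.
        fraction R S M ((t \<odot>\<^bsub>M\<^esub> x) \<oplus>\<^bsub>M\<^esub> (s \<odot>\<^bsub>M\<^esub> y)) (s \<otimes>\<^bsub>R\<^esub> t)),
      smult = (\<lambda>A B. \<Union>(a, s)\<in>A. \<Union>(x, t)\<in>B. fraction R S M (a \<odot>\<^bsub>M\<^esub> x) (s \<otimes>\<^bsub>R\<^esub> t)) \<rparr>"

definition localized_ring :: "('r, 'c) ring_scheme \<Rightarrow> 'r set \<Rightarrow> ('r \<times> 'r) set ring" where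
  "localized_ring R S = (let L = localized_module R S (self_module R) in
    \<lparr> carrier = carrier L,
      monoid.mult = smult L,
      one = fraction R S (self_module R) \<one>\<^bsub>R\<^esub> \<one>\<^bsub>R\<^esub>,
      ring.zero = ring.zero L,
      ring.add = ring.add L \<rparr>)"

abbreviation ring_at_prime :: "('r, 'c) ring_scheme \<Rightarrow> 'r set \<Rightarrow> ('r \<times> 'r) set ring" where
  "ring_at_prime R p \<equiv> localized_ring R (carrier R - p)"

abbreviation module_at_prime ::
  "('r, 'c) ring_scheme \<Rightarrow> 'r set \<Rightarrow> ('r, 'm, 'd) module_scheme \<Rightarrow> (('r \<times> 'r) set, ('m \<times> 'r) set) module"
  where
  "module_at_prime R p M \<equiv> localized_module R (carrier R - p) M"


section \<open>Local rings, depth and dimension\<close>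

definition local_ring :: "('r, 'c) ring_scheme \<Rightarrow> bool" where
  "local_ring R \<longleftrightarrow> cring R \<and> (\<exists>!\<mm>. maximalideal \<mm> R)"

definition max_ideal :: "('r, 'c) ring_scheme \<Rightarrow> 'r set" where
  "max_ideal R = (THE \<mm>. maximalideal \<mm> R)"

text \<open>\<open>ideal_times R M [x\<^sub>1, \<dots>, x\<^sub>n]\<close> is the submodule \<open>(x\<^sub>1, \<dots>, x\<^sub>n) M\<close>.\<close>

primrec ideal_times ::
  "('r, 'c) ring_scheme \<Rightarrow> ('r, 'm, 'd) module_scheme \<Rightarrow> 'r list \<Rightarrow> 'm set"
  where
  "ideal_times R M [] = {\<zero>\<^bsub>M\<^esub>}"
| "ideal_times R M (x # xs) = {(x \<odot>\<^bsub>M\<^esub> y) \<oplus>\<^bsub>M\<^esub> z | y z. y \<in> carrier M \<and> z \<in> ideal_times R M xs}"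

definition regular_sequence ::
  "('r, 'c) ring_scheme \<Rightarrow> ('r, 'm, 'd) module_scheme \<Rightarrow> 'r list \<Rightarrow> bool"
  where
  "regular_sequence R M xs \<longleftrightarrow> set xs \<subseteq> carrier R \<and>
     (\<forall>i<length xs. \<forall>y\<in>carrier M.
        (xs ! i) \<odot>\<^bsub>M\<^esub> y \<in> ideal_times R M (take i xs) \<longrightarrow> y \<in> ideal_times R M (take i xs)) \<and>
     ideal_times R M xs \<noteq> carrier M"

text \<open>This is the depth of a finite module over a Noetherian local ring, with the convention that the depth of
  the zero module is infinite.\<close>

definition depth :: "('r, 'c) ring_scheme \<Rightarrow> ('r, 'm, 'd) module_scheme \<Rightarrow> enat" where
  "depth R M = (if carrier M = {\<zero>\<^bsub>M\<^esub>} then \<infinity>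
     else Sup {enat (length xs) | xs. set xs \<subseteq> max_ideal R \<and> regular_sequence R M xs})"

abbreviation ring_depth :: "('r, 'c) ring_scheme \<Rightarrow> enat" where
  "ring_depth R \<equiv> depth R (self_module R)"

definition krull_dim :: "('r, 'c) ring_scheme \<Rightarrow> enat" where
  "krull_dim R = Sup {enat n | n.
     \<exists>P :: nat \<Rightarrow> 'r set. (\<forall>i\<le>n. primeideal (P i) R) \<and> (\<forall>i<n. P i \<subset> P (Suc i))}"

definition regular_local_ring :: "('r, 'c) ring_scheme \<Rightarrow> bool" where
  "regular_local_ring R \<longleftrightarrow> noetherian_ring R \<and> local_ring R \<and>
     (\<exists>A. finite A \<and> A \<subseteq> carrier R \<and> Idl\<^bsub>R\<^esub> A = max_ideal R \<and> enat (card A) = krull_dim R)"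

definition cohen_macaulay_local_ring :: "('r, 'c) ring_scheme \<Rightarrow> bool" where
  "cohen_macaulay_local_ring R \<longleftrightarrow>
     noetherian_ring R \<and> local_ring R \<and> ring_depth R = krull_dim R"

definition maximal_cohen_macaulay ::
  "('r, 'c) ring_scheme \<Rightarrow> ('r, 'm, 'd) module_scheme \<Rightarrow> bool"
  where
  "maximal_cohen_macaulay R M \<longleftrightarrow> finite_module R M \<and> depth R M = krull_dim R"

text \<open>The condition that the depth of \<open>M\<close> at each prime \<open>p\<close> is at least the minimum of \<open>n\<close> and the
  depth of the local ring at \<open>p\<close> (not the minimum of \<open>n\<close> and its dimension).\<close>

definition serre_tilde ::
  "nat \<Rightarrow> ('r, 'c) ring_scheme \<Rightarrow> ('r, 'm, 'd) module_scheme \<Rightarrow> bool"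
  where
  "serre_tilde n R M \<longleftrightarrow> (\<forall>p. primeideal p R \<longrightarrow>
     depth (ring_at_prime R p) (module_at_prime R p M)
       \<ge> min (enat n) (ring_depth (ring_at_prime R p)))"


section \<open>Derivations and differentials\<close>

text \<open>The \<open>k\<close>-algebra structure of \<open>R\<close> is given by a map \<open>\<phi>\<close> from \<open>K\<close> to \<open>R\<close>.\<close>

definition derivations ::
  "('k, 'b) ring_scheme \<Rightarrow> ('k \<Rightarrow> 'r) \<Rightarrow> ('r, 'c) ring_scheme \<Rightarrow> ('r, 'm, 'd) module_scheme \<Rightarrow>
    ('r \<Rightarrow> 'm) set"
  where
  "derivations K \<phi> R M = {D \<in> carrier R \<rightarrow>\<^sub>E carrier M.
     (\<forall>a\<in>carrier R. \<forall>b\<in>carrier R. D (a \<oplus>\<^bsub>R\<^esub> b) = D a \<oplus>\<^bsub>M\<^esub> D b) \<and>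
     (\<forall>a\<in>carrier R. \<forall>b\<in>carrier R. D (a \<otimes>\<^bsub>R\<^esub> b) = (a \<odot>\<^bsub>M\<^esub> D b) \<oplus>\<^bsub>M\<^esub> (b \<odot>\<^bsub>M\<^esub> D a)) \<and>
     (\<forall>c\<in>carrier K. D (\<phi> c) = \<zero>\<^bsub>M\<^esub>)}"

definition Der ::
  "('k, 'b) ring_scheme \<Rightarrow> ('k \<Rightarrow> 'r) \<Rightarrow> ('r, 'c) ring_scheme \<Rightarrow> ('r, 'r \<Rightarrow> 'r) module"
  where
  "Der K \<phi> R = \<lparr> carrier = derivations K \<phi> R (self_module R),
     monoid.mult = undefined, one = undefined,
     ring.zero = (\<lambda>x\<in>carrier R. \<zero>\<^bsub>R\<^esub>),
     ring.add = (\<lambda>D E. \<lambda>x\<in>carrier R. D x \<oplus>\<^bsub>R\<^esub> E x),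
     smult = (\<lambda>a D. \<lambda>x\<in>carrier R. a \<otimes>\<^bsub>R\<^esub> D x) \<rparr>"

text \<open>
  The universal property is required against finite modules with carriers of type
  \<open>(nat \<Rightarrow> 'r) set\<close>. Every finite \<open>R\<close>-module is isomorphic to such a module, namely to a quotient
  of some \<open>R\<^sup>n\<close> with cosets as elements.
\<close>

definition universally_finite_differentials ::
  "('k, 'b) ring_scheme \<Rightarrow> ('k \<Rightarrow> 'r) \<Rightarrow> ('r, 'c) ring_scheme \<Rightarrow> ('r, 'm, 'd) module_scheme \<Rightarrow>
    ('r \<Rightarrow> 'm) \<Rightarrow> bool"
  where
  "universally_finite_differentials K \<phi> R \<Omega> d \<longleftrightarrow>
     finite_module R \<Omega> \<and> d \<in> derivations K \<phi> R \<Omega> \<and>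
     (\<forall>(N :: ('r, (nat \<Rightarrow> 'r) set) module) D.
        finite_module R N \<and> D \<in> derivations K \<phi> R N \<longrightarrow>
        (\<exists>!h. h \<in> mod_hom R \<Omega> N \<and> (\<forall>a\<in>carrier R. h (d a) = D a)))"


section \<open>Presentations of the rings\<close>

definition radical_ideal :: "'r set \<Rightarrow> ('r, 'c) ring_scheme \<Rightarrow> bool" where
  "radical_ideal I R \<longleftrightarrow> ideal I R \<and> (\<forall>a\<in>carrier R. \<forall>n::nat. a [^]\<^bsub>R\<^esub> n \<in> I \<longrightarrow> a \<in> I)"

text \<open>\<open>R\<close> with structure map \<open>\<phi>\<close> is isomorphic, as a \<open>k\<close>-algebra, to the quotient by a proper
  radical ideal of a localization \<open>k[x\<^sub>1, \<dots>, x\<^sub>m]\<^sub>q\<close>, respectively of \<open>k[[x\<^sub>1, \<dots>, x\<^sub>m]]\<close>.\<close>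

definition localized_affine_presentation ::
  "('k, 'b) ring_scheme \<Rightarrow> nat \<Rightarrow> ('k \<Rightarrow> 'r) \<Rightarrow> ('r, 'c) ring_scheme \<Rightarrow> bool"
  where
  "localized_affine_presentation K m \<phi> R \<longleftrightarrow>
     (\<exists>q I \<psi>. let A = polynomial_ring K m; L = ring_at_prime A q in
        primeideal q A \<and> radical_ideal I L \<and> I \<noteq> carrier L \<and>
        \<psi> \<in> ring_iso (L Quot I) R \<and>
        (\<forall>c\<in>carrier K. \<phi> c =
           \<psi> (I +>\<^bsub>L\<^esub> fraction A (carrier A - q) (self_module A) (ring.indexed_const K c) \<one>\<^bsub>A\<^esub>)))"

definition power_series_presentation ::
  "('k, 'b) ring_scheme \<Rightarrow> nat \<Rightarrow> ('k \<Rightarrow> 'r) \<Rightarrow> ('r, 'c) ring_scheme \<Rightarrow> bool"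
  where
  "power_series_presentation K m \<phi> R \<longleftrightarrow>
     (\<exists>I \<psi>. let A = power_series_ring K m in
        radical_ideal I A \<and> I \<noteq> carrier A \<and>
        \<psi> \<in> ring_iso (A Quot I) R \<and>
        (\<forall>c\<in>carrier K. \<phi> c = \<psi> (I +>\<^bsub>A\<^esub> ring.indexed_const K c)))"

end

(* Let n = t - r, resolve Omega by finite free modules F and Der = Hom(Omega, R) by finite free
   modules G, with G finite because pd Der < infinity. Splicing G with the dual of F yields a complex
   L : 0 -> G_q -> ... -> G_0 -> F_0* -> ... -> F_(n+1)*, exact on the left by the choice of G and in the
   middle by the vanishing of Ext^i(Omega, R), 1 <= i <= n. Were it not split exact there, localize at a
   minimal prime over the annihilator of the homology of its dual: the homology has finite length, and
   the depth of Omega granted by the Serre condition contradicts the acyclicity lemma and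
   Auslander-Buchsbaum. So L stays exact modulo m, that is, every map from Omega to the residue field lifts
   to R. A coefficient subring modulo m^2 (Zorn; characteristic 0) provides derivations R -> R/m dual to
   minimal generators y_1, ..., y_e of m; they lift to derivations D_i of R with D_i y_j = delta_ij modulo m,
   and these force y_1, ..., y_e to be a regular sequence, so that e = dim R. *)

theory Submission
  imports Defs "HOL-Library.Function_Algebras" "HOL-Library.Set_Algebras" "HOL-Library.Multiset_Order"
    "HOL-Computational_Algebra.Polynomial"
begin

text \<open>Auslander-Buchsbaum enters as follows. If the ring has depth d, dividing by a maximal
  regular sequence spoils exactness of a finite complex of free modules only at its d lowest places
  and yields an element \<open>u\<close> outside the new ideal with \<open>m * u\<close> inside it.
  At the other places \<open>u\<close> forces the leftmost map to be injective modulo m; it splits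
  off, and induction on the length goes on. The acyclicity lemma enters through cokernels in the
  dual: along exact places their depth falls by at most one per step, so no socle element appears
  before the depth is used up. With n = t - r the n-th syzygy of Omega, gaining one per step over r,
  reaches depth min(t, depth) at every prime. Characteristic 0 serves twice: minimal polynomials
  over the coefficient ring are separable, and factorials are units when a derivation with D y = 1
  is used to show that y is a nonzerodivisor. Reduction and localization change the ring, but a ring
  with a carrier is not a type; exactness, linearity and depth are therefore stated as congruences
  modulo an ideal, and localization through an abstract interface.\<close>

abbreviation (input) add_in ("_ +{_} _" [65, 0, 66] 65) where "x +{R} y == x \<oplus>\<^bsub>R\<^esub> y"
abbreviation (input) mult_in ("_ *{_} _" [70, 0, 71] 70) where "x *{R} y == x \<otimes>\<^bsub>R\<^esub> y"
abbreviation (input) scale_in ("_ **{_} _" [70, 0, 71] 70) where "a **{M} x == a \<odot>\<^bsub>M\<^esub> x"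
abbreviation (input) zero_in ("0{_}") where "0{R} == \<zero>\<^bsub>R\<^esub>"
abbreviation (input) one_in ("1{_}") where "1{R} == \<one>\<^bsub>R\<^esub>"

section \<open>Ideals and submodules modulo an ideal\<close>

text \<open>A ring is encoded as \<open>X / J\<close> with \<open>X\<close> a type of class \<^class>\<open>comm_ring_1\<close>, and a
 module as \<open>V / U\<close> with \<open>V\<close> the type \<open>nat => X\<close>: a free module with finite basis \<open>N\<close> is \<open>V\<close>
 modulo \<open>fr N J\<close>, and \<open>dep m k U\<close> says that \<open>V / U\<close> has depth at least \<open>k\<close>.\<close>

definition idl :: "'a::comm_ring_1 set => bool" where
 "idl I \<longleftrightarrow> 0 : I & (ALL a:I. ALL b:I. a + b : I) & (ALL c. ALL a:I. c * a : I)"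

definition prime_idl :: "'a::comm_ring_1 set => bool" where
 "prime_idl P \<longleftrightarrow> idl P & 1 ~: P & (ALL a b. a * b : P --> a : P | b : P)"

definition sm :: "'a::comm_ring_1 => (nat => 'a) => nat => 'a" where
 "sm c v = (%i. c * v i)"

definition submod :: "(nat => 'a::comm_ring_1) set => bool" where
 "submod U \<longleftrightarrow> 0 : U & (ALL u:U. ALL v:U. u + v : U) & (ALL c. ALL u:U. sm c u : U)"

definition fr :: "nat set => 'a::comm_ring_1 set => (nat => 'a) set" where
 "fr N I = {v. ALL i:N. v i : I}"

definition lin :: "((nat => 'a::comm_ring_1) => nat => 'a) => bool" where
 "lin f \<longleftrightarrow> (ALL u v. f (u + v) = f u + f v) & (ALL c v. f (sm c v) = sm c (f v))"

definition functional :: "((nat => 'a::comm_ring_1) => 'a) => bool" where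
 "functional f \<longleftrightarrow> (ALL u v. f (u + v) = f u + f v) & (ALL c v. f (sm c v) = c * f v)"

definition mv :: "nat set => (nat => nat => 'a::comm_ring_1) => (nat => 'a) => nat => 'a" where
 "mv N M c = (%i. SUM j:N. M i j * c j)"

definition un :: "nat => nat => 'a::comm_ring_1" where
 "un j = (%i. if i = j then 1 else 0)"

definition ann :: "(nat => 'a::comm_ring_1) set => (nat => 'a) => 'a set" where
 "ann U v = {a. sm a v : U}"

definition reg :: "'a::comm_ring_1 => (nat => 'a) set => bool" where
 "reg x U \<longleftrightarrow> (ALL v. sm x v : U --> v : U)"

lemma idl_0: "idl I ==> 0 : I" by (simp add: idl_def)
lemma idl_add: "idl I ==> a : I ==> b : I ==> a + b : I" by (simp add: idl_def)
lemma idl_mult: "idl I ==> a : I ==> c * a : I" by (simp add: idl_def)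
lemma idl_mult2: "idl I ==> a : I ==> a * c : I" by (metis idl_mult mult.commute)
lemma idl_uminus: "idl I ==> a : I ==> - a : I" using idl_mult[of I a "-1"] by simp
lemma idl_diff: "idl I ==> a : I ==> b : I ==> a - b : I" using idl_add[of I a "-b"] idl_uminus[of I b] by simp
lemma idl_sum: "idl I ==> (!!x. x : S ==> f x : I) ==> sum f S : I" by (induction S rule: infinite_finite_induct) (auto simp: idl_0 idl_add)
lemma idl_cong: "idl I ==> a - b : I ==> a : I \<longleftrightarrow> b : I" by (metis add_diff_cancel_left' idl_add idl_diff diff_add_cancel)
lemma idl_cong2: "idl I ==> a - b : I ==> b : I ==> a : I" using idl_cong by blast
lemma idl_minus_commute: "idl I ==> a - b : I ==> b - a : I" using idl_uminus[of I "a - b"] by simp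
lemma idl_trans: "idl I ==> a - b : I ==> b - c : I ==> a - c : I" using idl_add[of I "a - b" "b - c"] by simp

lemma prime_idl_idl: "prime_idl P ==> idl P" by (simp add: prime_idl_def)

lemma sm_simps [simp]: "sm c 0 = 0" "sm 0 v = 0" "sm 1 v = v" "sm c (sm d v) = sm (c * d) v"
 "sm c (u + v) = sm c u + sm c v" "sm c (u - v) = sm c u - sm c v" "sm c (- u) = - sm c u" by (auto simp: sm_def fun_eq_iff algebra_simps)

lemma sm_apply: "sm c v i = c * v i" by (simp add: sm_def)
lemma sm_add_left: "sm (c + d) v = sm c v + sm d v" by (auto simp: sm_def algebra_simps)
lemma sm_diff_left: "sm (c - d) v = sm c v - sm d v" by (auto simp: sm_def algebra_simps)
lemma sm_minus_left: "sm (- c) v = - sm c v" by (auto simp: sm_def)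

lemma sum_fun: "(SUM j:N. F j) i = (SUM j:N. F j i)" for F :: "'j => 'i => 'a::comm_monoid_add" by (induction N rule: infinite_finite_induct) auto

lemma sm_sum: "sm c (SUM j:N. F j) = (SUM j:N. sm c (F j))" by (simp add: fun_eq_iff sm_def sum_fun sum_distrib_left)

lemma submod_0: "submod U ==> 0 : U" by (simp add: submod_def)
lemma submod_add: "submod U ==> a : U ==> b : U ==> a + b : U" by (simp add: submod_def)
lemma submod_sm: "submod U ==> a : U ==> sm c a : U" by (simp add: submod_def)
lemma submod_uminus: "submod U ==> a : U ==> - a : U" using submod_sm[of U a "-1"] by (simp add: sm_minus_left)
lemma submod_diff: "submod U ==> a : U ==> b : U ==> a - b : U" using submod_add[of U a "-b"] submod_uminus[of U b] by simp
lemma submod_sum: "submod I ==> (!!x. x : S ==> f x : I) ==> sum f S : I"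
 by (induction S rule: infinite_finite_induct) (auto simp: submod_0 submod_add)
lemma submod_cong: "submod I ==> a - b : I ==> a : I \<longleftrightarrow> b : I"
 by (metis add_diff_cancel_left' submod_add submod_diff diff_add_cancel)
lemma submod_minus_commute: "submod I ==> a - b : I ==> b - a : I" using submod_uminus[of I "a - b"] by simp
lemma submod_trans: "submod I ==> a - b : I ==> b - c : I ==> a - c : I" using submod_add[of I "a - b" "b - c"] by simp

lemma lin_add: "lin f ==> f (u + v) = f u + f v" by (simp add: lin_def)
lemma lin_sm: "lin f ==> f (sm c v) = sm c (f v)" by (simp add: lin_def)
lemma lin_0: "lin f ==> f 0 = 0" using lin_sm[of f 0 0] by simp
lemma lin_uminus: "lin f ==> f (- v) = - f v" using lin_sm[of f "-1" v] by (simp add: sm_minus_left)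
lemma lin_diff: "lin f ==> f (u - v) = f u - f v" using lin_add[of f u "-v"] lin_uminus[of f v] by simp
lemma lin_sum: "lin f ==> f (SUM j:N. F j) = (SUM j:N. f (F j))" by (induction N rule: infinite_finite_induct) (auto simp: lin_0 lin_add)

lemma fun_add: "functional f ==> f (u + v) = f u + f v" by (simp add: functional_def)
lemma fun_sm: "functional f ==> f (sm c v) = c * f v" by (simp add: functional_def)
lemma fun_0: "functional f ==> f 0 = 0" using fun_sm[of f 0 0] by simp
lemma fun_uminus: "functional f ==> f (- v) = - f v" using fun_sm[of f "-1" v] by (simp add: sm_minus_left)
lemma fun_diff: "functional f ==> f (u - v) = f u - f v" using fun_add[of f u "-v"] fun_uminus[of f v] by simp
lemma fun_sum: "functional f ==> f (SUM j:N. F j) = (SUM j:N. f (F j))" by (induction N rule: infinite_finite_induct) (auto simp: fun_0 fun_add)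

lemma lin_comp: "lin f ==> lin g ==> lin (%v. f (g v))" by (simp add: lin_def)
lemma fun_comp: "functional f ==> lin g ==> functional (%v. f (g v))" by (simp add: lin_def functional_def)
lemma lin_mv: "lin (mv N M)" by (auto simp: lin_def mv_def sm_def algebra_simps sum.distrib sum_distrib_left)
lemma lin_sm_fun: "lin (sm c)" by (auto simp: lin_def mult.commute)

section \<open>Sums, images and preimages of submodules\<close>

lemma set_plus_iff: "x : A + B \<longleftrightarrow> (EX a:A. EX b:B. x = a + b)" by (simp add: set_plus_def)
lemma set_plus_diff_iff: "x : A + B \<longleftrightarrow> (EX a:A. x - a : B)" for x :: "'v::ab_group_add" by (force simp: set_plus_def)
lemma set_plus_diff_iff2: "x : A + B \<longleftrightarrow> (EX b:B. x - b : A)" for x :: "'v::ab_group_add"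
 by (subst add.commute) (rule set_plus_diff_iff)

lemma submod_plus:
 assumes U: "submod U" and W: "submod W" shows "submod (U + W)"
proof -
 have "u + v : U + W" if "u : U + W" "v : U + W" for u v
 proof -
  from that obtain a b c d where "a : U" "b : W" "c : U" "d : W" "u = a + b" "v = c + d" by (auto simp: set_plus_iff)
  moreover have "u + v = (a + c) + (b + d)" using calculation by simp
  ultimately show ?thesis using submod_add[OF U] submod_add[OF W] by (metis set_plus_iff)
 qed
 moreover have "sm c u : U + W" if "u : U + W" for c u using that by (auto simp: set_plus_iff) (metis U W submod_sm)
 moreover have "0 : U + W" using submod_0[OF U] submod_0[OF W] by (metis set_plus_iff add_0)
 ultimately show ?thesis by (auto simp: submod_def)
qed

lemma submod_range: "lin f ==> submod (range f)" unfolding submod_def by (auto simp: lin_add[symmetric] lin_sm[symmetric]) (metis lin_0 rangeI)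

lemma submod_vimage: "lin f ==> submod U ==> submod (f -` U)" unfolding submod_def by (auto simp only: mem_Collect_eq lin_0 lin_add lin_sm)

lemma submod_fr: "idl I ==> submod (fr N I)" by (auto simp: submod_def fr_def sm_def idl_0 idl_add idl_mult)

lemma subset_plus1: "submod W ==> U <= U + W" by (metis add.right_neutral set_plus_iff submod_0 subsetI)
lemma subset_plus2: "submod W ==> U <= W + U" by (metis add.left_neutral set_plus_iff submod_0 subsetI)
lemma plus_subset: "submod U ==> A <= U ==> B <= U ==> A + B <= U" using submod_add by (fastforce simp: set_plus_def)

text \<open>Coordinates outside \<open>N\<close> are unconstrained in this encoding, so the values
  on the basis vectors \<open>un j\<close> determine \<open>f\<close> only modulo \<open>U\<close>,
  and only when vectors vanishing on \<open>N\<close> are sent into \<open>U\<close>.\<close>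

lemma lin_expand:
 assumes f: "lin f" and N: "finite N" and U: "f ` fr N {0} <= U"
 shows "f v - (SUM j:N. sm (v j) (f (un j))) : U"
proof -
 have "f (v - (SUM j:N. sm (v j) (un j))) : U" using N U by (auto simp: fr_def sum_fun sm_def un_def if_distrib cong: if_cong)
 thus ?thesis by (simp add: lin_diff[OF f] lin_sum[OF f] lin_sm[OF f])
qed

lemma fun_expand:
 assumes f: "functional f" and N: "finite N" and U: "f ` fr N {0} <= U"
 shows "f v - (SUM j:N. v j * f (un j)) : U"
proof -
 have "v - (SUM j:N. sm (v j) (un j)) : fr N {0}" using N by (auto simp: fr_def sum_fun sm_def un_def if_distrib cong: if_cong)
 thus ?thesis using U by (auto simp: fun_diff f fun_sum fun_sm)
qed

lemma idl_ann: "submod U ==> idl (ann U v)" by (auto simp: idl_def ann_def sm_add_left submod_0 submod_add) (metis sm_simps(4) submod_sm)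

text \<open>Otherwise pick q_j in Q_j outside P for every j; their product lies in every Q_j, hence
  in P, against primality.\<close>

lemma prime_idl_prod:
 assumes "prime_idl P" and "!!j. j < n ==> idl (Q j)" and "!!a. (ALL j<n. a : Q j) ==> a : P"
 shows "EX j<(n::nat). Q j <= P"
proof (rule ccontr)
 assume "~?thesis"
 then obtain q where q: "!!j. j < n ==> q j : Q j & q j ~: P" by (meson subsetI)
 have np: "prod q S ~: P" if "finite S" "S <= {..<n}" for S using that assms(1) q by (induction S) (auto simp: prime_idl_def)
 have "prod q {..<n} : Q j" if "j < n" for j using idl_mult2[OF assms(2)[OF that], of "q j" "prod q ({..<n} - {j})"] q[OF that] that
   prod.remove[of "{..<n}" j q] by simp
 thus False using np[of "{..<n}"] assms(3) by auto
qed

text \<open>By induction each prime P contains an element \<open>x P\<close> of I that lies in no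
  other member. The sum of \<open>x P0\<close> and the product of all other \<open>x P\<close> is in
  I but in none of the primes.\<close>

lemma prime_avoidance:
 assumes "finite Ps" and "!!P. P : Ps ==> prime_idl P" and "idl I" and "I <= \<Union>Ps"
 shows "EX P:Ps. I <= P" using assms
proof (induction "card Ps" arbitrary: Ps rule: less_induct)
 case less
 show ?case
 proof (rule ccontr)
  assume neg: "~?case"
  have "EX x:I. x ~: \<Union>(Ps - {P})" if "P : Ps" for P
  proof (rule ccontr)
   assume "~?thesis"
   hence "I <= \<Union>(Ps - {P})" by auto
   thus False using less.hyps[of "Ps - {P}"] less.prems that neg by (metis DiffD1 card_Diff1_less finite_Diff)
  qed
  then obtain x where x: "!!P. P : Ps ==> x P : I & x P ~: \<Union>(Ps - {P})" by metis
  have xP: "x P : P" if "P : Ps" for P using x[OF that] less.prems(4) by auto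
  obtain P0 where P0: "P0 : Ps" using less.prems(3,4) idl_0 by blast
  have "EX Q. Q : Ps - {P0}"
  proof (rule ccontr)
   assume "~?thesis"
   thus False using P0 neg less.prems(4) by blast
  qed
  then obtain P1 where P1: "P1 : Ps - {P0}" by auto
  define w where "w = prod x (Ps - {P0})"
  have fin: "finite (Ps - {P0})" using less.prems(1) by auto
  have wmem: "w : A" if "idl A" "P : Ps - {P0}" "x P : A" for A P unfolding w_def using idl_mult2[OF that(1,3), of "prod x (Ps - {P0} - {P})"]
   by (simp add: prod.remove[OF fin that(2)])
  have "w : I" using wmem[OF less.prems(3) P1] x P1 by auto
  then obtain P where P: "P : Ps" "x P0 + w : P" using idl_add[OF less.prems(3)] x P0 less.prems(4) by blast
  have iP: "idl P" using less.prems(2) P prime_idl_idl by blast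
  show False
  proof (cases "P = P0")
   case True
   have "w : P0" using idl_diff[OF iP P(2), of "x P0"] xP[OF P0] True by simp
   moreover have "prod x S ~: P0" if "finite S" "S <= Ps - {P0}" for S using that
   proof (induction S)
    case empty thus ?case using less.prems(2)[OF P0] by (simp add: prime_idl_def)
   next
    case (insert Q F)
    thus ?case using x[of Q] P0 less.prems(2)[OF P0] by (simp add: prime_idl_def) blast
   qed
   ultimately show False using fin w_def by auto
  next
   case False
   thus False using wmem[OF iP] xP idl_diff[OF iP P(2), of w] x[OF P0] P by auto
  qed
 qed
qed

lemma acc_max:
 assumes ne: "C ~= {}"
  and acc: "!!S::nat => 'x set. (!!k. S k : C) ==> (!!k. S k <= S (Suc k)) ==> EX k. (\<Union>i. S i) <= S k"
 shows "EX W:C. ALL W':C. W <= W' --> W' = W"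
proof (rule ccontr)
 assume "~?thesis"
 then obtain f where f: "!!W. W : C ==> f W : C & W \<subset> f W" by (metis psubsetI)
 obtain W0 where W0: "W0 : C" using ne by auto
 define S where "S k = (f ^^ k) W0" for k
 have S: "S k : C" for k by (induction k) (auto simp: S_def W0 f)
 have Sk: "S k \<subset> S (Suc k)" for k using f[OF S[of k]] by (simp add: S_def)
 obtain k where "(\<Union>i. S i) <= S k" using acc[of S] S Sk by blast
 thus False using Sk[of k] by blast
qed

lemma chain_collect:
 assumes "!!k::nat. S k <= S (Suc k)" and "ALL j<(n::nat). g j : (\<Union>i. S i)"
 shows "EX k. ALL j<n. g j : S k" using assms(2)
proof (induction n)
 case (Suc n)
 then obtain k l where k: "ALL j<n. g j : S k" and l: "g n : S l" by auto
 have "ALL j<Suc n. g j : S (max k l)" using k l by (metis lift_Suc_mono_le assms less_SucE max.cobounded1 max.cobounded2 subsetD)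
 thus ?case ..
qed auto


section \<open>Noetherian rings and associated primes\<close>

locale noeth =
 fixes J :: "'a::comm_ring_1 set"
 assumes idJ: "idl J"
  and fg: "!!I. idl I ==> J <= I ==> EX n g. (ALL j<(n::nat). g j : I) & (ALL a:I. EX c. a - (SUM j<n. c j * g j) : J)"
begin

text \<open>V / U is then a quotient of a free module of finite rank over the encoded ring; this is
  the encoding of a finite module.\<close>

definition good :: "(nat => 'a) set => bool" where
 "good U \<longleftrightarrow> submod U & (EX N. finite N & fr N J <= U)"

definition fgmod :: "(nat => 'a) set => (nat => 'a) set => bool" where
 "fgmod U W \<longleftrightarrow> (EX n g. (ALL j<(n::nat). g j : W) & (ALL w:W. EX c. w - (SUM j<n. sm (c j) (g j)) : U))"

lemma good_submod: "good U ==> submod U" by (simp add: good_def)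

lemma good_mono: "good U ==> submod W ==> U <= W ==> good W" by (auto simp: good_def)

lemma good_fr: "finite N ==> idl I ==> J <= I ==> good (fr N I)" unfolding good_def by (intro conjI submod_fr exI[of _ N]) (auto simp: fr_def)

lemma good_J:
 assumes "good U" "a : J" shows "sm a v : U" using assms idl_mult2 idJ by (force simp: good_def fr_def sm_def)

text \<open>Hilbert's induction on the rank: generators of the ideal of \<open>k\<close>-th
  coordinates of \<open>W\<close> reduce an element to one whose \<open>k\<close>-th coordinate is
  in \<open>J\<close>, and such elements are governed by the smaller rank.\<close>

lemma fgmod_fr:
 assumes "finite N" shows "submod W ==> fr N J <= W ==> fgmod (fr N J) W" using assms
proof (induction N arbitrary: W rule: finite_induct)
 case empty
 show ?case unfolding fgmod_def by (rule exI[of _ 0]) (auto simp: fr_def)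
next
 case (insert k N)
 note W = \<open>submod W\<close>
 define I where "I = (%v. v k) ` W"
 have "idl I" unfolding idl_def
 proof (intro conjI ballI allI)
  show "0 : I" unfolding I_def by (rule image_eqI[OF _ submod_0[OF W]]) simp
  show "a + b : I" if "a : I" "b : I" for a b
  proof -
   from that obtain u v where "u : W" "v : W" "a = u k" "b = v k" by (auto simp: I_def)
   thus ?thesis unfolding I_def using submod_add[OF W, of u v] by (intro image_eqI[of _ _ "u + v"]) auto
  qed
  show "c * a : I" if "a : I" for c a
  proof -
   from that obtain u where "u : W" "a = u k" by (auto simp: I_def)
   thus ?thesis unfolding I_def using submod_sm[OF W, of u c] by (intro image_eqI[of _ _ "sm c u"]) (auto simp: sm_def)
  qed
 qed
 moreover have "J <= I" using insert.prems by (auto simp: fr_def I_def)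
 ultimately obtain n g where g: "ALL j<(n::nat). g j : I"
  and gI: "ALL a:I. EX c. a - (SUM j<n. c j * g j) : J" using fg by blast
 have "EX h. h : W & h k = g j" if "j < n" for j using g that by (force simp: I_def)
 then obtain h where h: "!!j. j < n ==> h j : W & h j k = g j" by metis
 \<comment> \<open>Only the coordinates in \<open>N\<close> are prescribed, so that
   \<open>W'\<close> contains \<open>fr N J\<close>, as the induction hypothesis demands.\<close>
 define W' where "W' = {v. EX w:W. w k : J & (ALL i:N. v i = w i)}"
 have W': "submod W'" unfolding submod_def
 proof (intro conjI ballI allI)
  show "0 : W'" unfolding W'_def using submod_0[OF W] idl_0[OF idJ] by (intro CollectI bexI[of _ 0]) auto
  show "u + v : W'" if "u : W'" "v : W'" for u v
  proof -
   from that obtain a b where ab: "a : W" "a k : J" "ALL i:N. u i = a i"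
    "b : W" "b k : J" "ALL i:N. v i = b i" by (auto simp: W'_def)
   thus ?thesis unfolding W'_def using submod_add[OF W ab(1,4)] idl_add[OF idJ ab(2,5)] by (intro CollectI bexI[of _ "a + b"]) auto
  qed
  show "sm c u : W'" if "u : W'" for c u
  proof -
   from that obtain a where ab: "a : W" "a k : J" "ALL i:N. u i = a i" by (auto simp: W'_def)
   thus ?thesis unfolding W'_def using submod_sm[OF W ab(1)] idl_mult[OF idJ ab(2)] by (intro CollectI bexI[of _ "sm c a"]) (auto simp: sm_def)
  qed
 qed
 have "fr N J <= W'"
 proof
  fix v assume v: "v : fr N J"
  hence "v(k := 0) : fr (insert k N) J" using idl_0[OF idJ] by (auto simp: fr_def)
  thus "v : W'" using insert.prems insert.hyps idl_0[OF idJ] unfolding W'_def by (intro CollectI bexI[of _ "v(k := 0)"]) auto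
 qed
 then obtain n' g' where g': "ALL j<(n'::nat). g' j : W'"
  and gW': "ALL w:W'. EX c. w - (SUM j<n'. sm (c j) (g' j)) : fr N J" using insert.IH[OF W'] unfolding fgmod_def by blast
 have "ALL j<n'. EX h. h : W & h k : J & (ALL i:N. g' j i = h i)" using g' by (auto simp: W'_def)
 then obtain h' where h': "!!j. j < n' ==> h' j : W & h' j k : J & (ALL i:N. g' j i = h' j i)" by metis
 define H where "H j = (if j < n then h j else h' (j - n))" for j
 have sumH: "(SUM j<n+n'. sm (c j) (H j)) = (SUM j<n. sm (c j) (h j)) + (SUM j<n'. sm (c (n + j)) (h' j))" for c
 proof -
  have "(SUM j<n+n'. F j) = (SUM j<n. F j) + (SUM j<n'. F (n + j))" for F :: "nat => nat => 'a" by (induction n') (simp_all add: add.assoc)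
  moreover have "(SUM j<n. sm (c j) (H j)) = (SUM j<n. sm (c j) (h j))" by (intro sum.cong) (auto simp: H_def)
  ultimately show ?thesis by (simp add: H_def)
 qed
 have "EX c. w - (SUM j<n+n'. sm (c j) (H j)) : fr (insert k N) J" if w: "w : W" for w
 proof -
  obtain c where c: "w k - (SUM j<n. c j * g j) : J" using w gI by (auto simp: I_def)
  define w1 where "w1 = w - (SUM j<n. sm (c j) (h j))"
  have w1: "w1 : W" unfolding w1_def using h by (intro submod_diff[OF W w] submod_sum[OF W] submod_sm[OF W]) auto
  have w1k: "w1 k : J" using c h by (simp add: w1_def sum_fun sm_def)
  obtain c' where c': "w1 - (SUM j<n'. sm (c' j) (g' j)) : fr N J" using w1 w1k gW' by (auto simp: W'_def)
  define C where "C j = (if j < n then c j else c' (j - n))" for j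
  have eq: "w - (SUM j<n+n'. sm (C j) (H j)) = w1 - (SUM j<n'. sm (c' j) (h' j))" using sumH by (auto simp: C_def w1_def)
  have "(w1 - (SUM j<n'. sm (c' j) (h' j))) i : J" if "i : insert k N" for i
  proof (cases "i = k")
   case True
   thus ?thesis using w1k h' by (auto simp: sum_fun sm_def intro!: idl_diff[OF idJ] idl_sum[OF idJ] idl_mult[OF idJ])
  next
   case False
   hence iN: "i : N" using that by auto
   show ?thesis using h' c' iN unfolding sum_fun sm_def by (auto simp: fr_def)
  qed
  thus ?thesis unfolding eq[symmetric] by (intro exI[of _ C]) (auto simp: fr_def)
 qed
 moreover have "ALL j<n+n'. H j : W" using h h' by (auto simp: H_def)
 ultimately show ?case unfolding fgmod_def by blast
qed

lemma fgmod_good: assumes "good U" "submod W" "U <= W" shows "fgmod U W"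
proof -
 obtain N where N: "finite N" "fr N J <= U" using assms(1) by (auto simp: good_def)
 obtain n g where g: "ALL j<(n::nat). g j : W"
  "ALL w:W. EX c. w - (SUM j<n. sm (c j) (g j)) : fr N J" using fgmod_fr[OF N(1) assms(2)] N assms unfolding fgmod_def by blast
 have "EX c. w - (SUM j<n. sm (c j) (g j)) : U" if w: "w : W" for w by (metis g w subsetD N exI)
 thus ?thesis using g(1) unfolding fgmod_def by auto
qed

text \<open>The union of an ascending chain is finitely generated modulo \<open>U\<close>, so it is
  reached at a finite stage.\<close>

lemma good_max:
 assumes U: "good U" and ne: "C ~= {}" and C: "!!W. W : C ==> submod W & U <= W"
 shows "EX W:C. ALL W':C. W <= W' --> W' = W"
proof (rule acc_max[OF ne])
 fix S :: "nat => (nat => 'a) set"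
 assume S: "!!k. S k : C" and Sk: "!!k. S k <= S (Suc k)"
 have mono: "S a <= S b" if "a <= b" for a b by (rule lift_Suc_mono_le[OF _ that]) (rule Sk)
 have "submod (\<Union>i. S i)" unfolding submod_def
 proof (intro conjI ballI allI)
  show "0 : (\<Union>i. S i)" using submod_0 C S by blast
  show "u + v : (\<Union>i. S i)" if "u : (\<Union>i. S i)" "v : (\<Union>i. S i)" for u v
  proof -
   from that obtain i j where "u : S i" "v : S j" by auto
   hence "u : S (max i j)" "v : S (max i j)" using mono[of i "max i j"] mono[of j "max i j"] by auto
   thus ?thesis using submod_add C[OF S] by blast
  qed
  show "sm c u : (\<Union>i. S i)" if "u : (\<Union>i. S i)" for c u using that submod_sm C[OF S] by blast
 qed
 hence "fgmod U (\<Union>i. S i)" using fgmod_good[OF U] C[OF S] by blast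
 then obtain n g where g: "ALL j<(n::nat). g j : (\<Union>i. S i)"
  and gw: "ALL w:(\<Union>i. S i). EX c. w - (SUM j<n. sm (c j) (g j)) : U" unfolding fgmod_def by blast
 obtain k where k: "ALL j<n. g j : S k" using chain_collect[of S, OF Sk g] by blast
 have sk: "submod (S k)" "U <= S k" using C[OF S] by auto
 have "w : S k" if "w : (\<Union>i. S i)" for w
 proof -
  obtain c where c: "w - (SUM j<n. sm (c j) (g j)) : U" using gw \<open>w : (\<Union>i. S i)\<close> by blast
  have "(SUM j<n. sm (c j) (g j)) : S k" using k by (intro submod_sum[OF sk(1)] submod_sm[OF sk(1)]) auto
  thus ?thesis using c sk submod_cong[OF sk(1)] by (metis subsetD)
 qed
 thus "EX k. (\<Union>i. S i) <= S k" by blast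
qed

text \<open>Rank one of \<open>good_max\<close>, an ideal \<open>A\<close> being encoded as
  \<open>fr {0} A\<close>.\<close>

lemma idl_max:
 assumes ne: "C ~= {}" and C: "!!W. W : C ==> idl W & J <= W"
 shows "EX W:C. ALL W':C. W <= W' --> W' = W"
proof -
 have inj: "fr {0} A = fr {0} B ==> A = B" for A B :: "'a set" by (auto simp: fr_def)
 have "EX W:fr {0} ` C. ALL W':fr {0} ` C. W <= W' --> W' = W"
 proof (rule good_max[of "fr {0} J"])
  show "good (fr {0} J)" using good_fr idJ by auto
  show "fr {0} ` C ~= {}" using ne by auto
  show "submod W & fr {0} J <= W" if "W : fr {0} ` C" for W
  proof -
   obtain A where A: "A : C" "W = fr {0} A" using \<open>W : fr {0} ` C\<close> by blast
   thus ?thesis using C[OF A(1)] submod_fr[of A "{0}"] by (auto simp: fr_def)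
  qed
 qed
 then obtain W where W: "W : C" "!!W'. W' : C ==> fr {0} W <= fr {0} W' ==> fr {0} W' = fr {0} W" by auto
 have "W' = W" if "W' : C" "W <= W'" for W' using that(2) W(2)[OF that(1)] inj by (auto simp: fr_def)
 thus ?thesis using W(1) by blast
qed

section \<open>Associated primes and zero divisors\<close>

lemma ann_J: "good U ==> J <= ann U v" using good_J by (auto simp: ann_def)

lemma ann_mono: "submod U ==> ann U v <= ann U (sm c v)"
proof
 fix a assume U: "submod U" and "a : ann U v"
 thus "a : ann U (sm c v)" using submod_sm[OF U, of "sm a v" c] by (simp add: ann_def mult.commute)
qed

text \<open>If a b kills z and b does not, then b z has the same annihilator as z, and a kills
  it.\<close>

lemma ann_max_prime:
 assumes U: "submod U" and z: "z ~: U"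
  and max: "!!c. sm c z ~: U ==> ann U (sm c z) = ann U z"
 shows "prime_idl (ann U z)" unfolding prime_idl_def using idl_ann U z max by (auto simp: ann_def)

text \<open>Among the annihilators of the nonzero multiples of \<open>z\<close> a maximal one exists
  by the chain condition, and it is prime.\<close>

lemma ann_prime:
 assumes U: "good U" and z: "z ~: U"
 shows "EX c. sm c z ~: U & prime_idl (ann U (sm c z)) & ann U z <= ann U (sm c z)"
proof -
 have sU: "submod U" using U good_submod by blast
 let ?C = "{ann U (sm c z) |c. sm c z ~: U}"
 have "ann U (sm 1 z) : ?C" using z by (metis (mono_tags, lifting) mem_Collect_eq sm_simps(3))
 hence "EX W:?C. ALL W':?C. W <= W' --> W' = W" by (intro idl_max) (auto simp: idl_ann[OF sU] ann_J[OF U, THEN subsetD])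
 then obtain W where W: "W : ?C" "!!W'. W' : ?C ==> W <= W' ==> W' = W" by auto
 then obtain c where cW: "sm c z ~: U" "W = ann U (sm c z)" by auto
 have c: "sm c z ~: U"
  "!!d. sm d z ~: U ==> ann U (sm c z) <= ann U (sm d z) ==> ann U (sm d z) = ann U (sm c z)" using cW W(2) by auto
 have "prime_idl (ann U (sm c z))"
 proof (rule ann_max_prime[OF sU c(1)])
  fix d assume d: "sm d (sm c z) ~: U"
  show "ann U (sm d (sm c z)) = ann U (sm c z)" using c(2)[of "d * c"] d ann_mono[OF sU, of "sm c z" d] by simp
 qed
 thus ?thesis using c ann_mono[OF sU] by blast
qed

text \<open>Finiteness comes from the elements with maximal annihilator: finitely many of them
  generate the submodule spanned by all, so each such prime annihilator contains the intersection of
  theirs, hence one of theirs, and equals it by maximality.\<close>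

lemma zero_divisors:
 assumes U: "good U"
 shows "EX Ps. finite Ps & (ALL P:Ps. prime_idl P & (EX v. v ~: U & P = ann U v)) & (ALL x. ~reg x U --> x : \<Union>Ps)"
proof -
 have sU: "submod U" using U good_submod by blast
 define T where "T = {v. v ~: U & (ALL w. w ~: U --> ann U v <= ann U w --> ann U w = ann U v)}"
 have T_prime: "prime_idl (ann U v)" if "v : T" for v using ann_max_prime sU that ann_mono by (force simp: T_def)
 define sp where "sp n g = {w. EX c. w - (SUM j<(n::nat). sm (c j) (g j)) : U}" for n and g :: "nat => nat => 'a"
 have sp_sub: "submod (sp n g)" for n g unfolding submod_def
 proof (intro conjI ballI allI)
  show "0 : sp n g" unfolding sp_def using submod_0[OF sU] by (auto intro!: exI[of _ "%_. 0"])
  show "u + v : sp n g" if "u : sp n g" "v : sp n g" for u v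
  proof -
   from that obtain c d where cd: "u - (SUM j<n. sm (c j) (g j)) : U" "v - (SUM j<n. sm (d j) (g j)) : U" by (auto simp: sp_def)
   have "u + v - (SUM j<n. sm (c j + d j) (g j)) : U" using submod_add[OF sU cd] by (simp add: sm_add_left sum.distrib algebra_simps)
   thus ?thesis unfolding sp_def by (intro CollectI exI[of _ "%j. c j + d j"])
  qed
  show "sm a u : sp n g" if "u : sp n g" for a u
  proof -
   from that obtain c where cd: "u - (SUM j<n. sm (c j) (g j)) : U" by (auto simp: sp_def)
   show ?thesis
    using submod_sm[OF sU cd, of a] unfolding sp_def by (auto simp: sm_sum)
  qed
 qed
 have sp_U: "U <= sp n g" for n g unfolding sp_def by (auto intro!: exI[of _ "%_. 0"])
 let ?C = "{sp n g |n g. ALL j<n. g j : T}" have "EX W:?C. ALL W':?C. W <= W' --> W' = W"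
  by (intro good_max[OF U]) (auto simp: sp_sub sp_U[THEN subsetD])
 then obtain Q where Q: "Q : ?C" "!!W'. W' : ?C ==> Q <= W' ==> W' = Q" by auto
 then obtain n g where g: "ALL j<n. g j : T" and Qn: "Q = sp n g" by auto
 have max: "sp n' g' = sp n g" if "ALL j<n'. g' j : T" "sp n g <= sp n' g'" for n' g' using Q(2)[of "sp n' g'"] that Qn by auto
 have mem: "v : sp n g" if "v : T" for v
 proof -
  define g' where "g' = g(n := v)"
  have "sp n g <= sp (Suc n) g'"
  proof
   fix w assume "w : sp n g"
   then obtain c where c: "w - (SUM j<n. sm (c j) (g j)) : U" by (auto simp: sp_def)
   have "w - (SUM j<Suc n. sm ((c(n := 0)) j) (g' j)) : U" using c g'_def by force
   thus "w : sp (Suc n) g'" unfolding sp_def by blast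
  qed
  moreover have "ALL j<Suc n. g' j : T" using g that by (auto simp: g'_def)
  ultimately have eq: "sp (Suc n) g' = sp n g" using max by blast
  have "v - (SUM j<Suc n. sm ((%j. if j = n then 1 else 0) j) (g' j)) = 0" by (simp add: g'_def)
  hence "v : sp (Suc n) g'" unfolding sp_def using submod_0[OF sU] by (intro CollectI exI[of _ "%j. if j = n then 1 else 0"]) simp
  thus ?thesis using eq by simp
 qed
 have "ann U ` T <= (%j. ann U (g j)) ` {..<n}"
 proof
  fix P assume "P : ann U ` T"
  then obtain v where v: "v : T" "P = ann U v" by auto
  obtain c where c: "v - (SUM j<n. sm (c j) (g j)) : U" using mem[OF v(1)] by (auto simp: sp_def)
  have "EX j<n. ann U (g j) <= P"
  proof (rule prime_idl_prod)
   show "prime_idl P" using T_prime v by auto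
   show "idl (ann U (g j))" for j by (rule idl_ann[OF sU])
   fix a assume a: "ALL j<n. a : ann U (g j)"
   have "sm a (SUM j<n. sm (c j) (g j)) : U" unfolding sm_sum
   proof (rule submod_sum[OF sU])
    fix j assume "j : {..<n}"
    hence "sm a (g j) : U" using a by (simp add: ann_def)
    hence "sm (c j) (sm a (g j)) : U" by (rule submod_sm[OF sU])
    thus "sm a (sm (c j) (g j)) : U" by (simp add: mult.commute)
   qed
   moreover have "sm a v - sm a (SUM j<n. sm (c j) (g j)) : U" using submod_sm[OF sU c, of a] by simp
   ultimately show "a : P" unfolding v ann_def using submod_cong[OF sU] by blast
  qed
  then obtain j where j: "j < n" "ann U (g j) <= P" by blast
  show "P : (%j. ann U (g j)) ` {..<n}" using g v j unfolding T_def by auto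
 qed
 hence "finite (ann U ` T)" by (rule finite_subset) auto
 moreover have "x : \<Union>(ann U ` T)" if nr: "~reg x U" for x
 proof -
  obtain w where w: "sm x w : U" "w ~: U" using nr unfolding reg_def not_all not_imp by (elim exE conjE)
  let ?D = "{ann U v |v. v ~: U & ann U w <= ann U v}"
  have "EX W:?D. ALL W':?D. W <= W' --> W' = W"
  proof (rule idl_max)
   show "?D ~= {}" using w by blast
   show "idl W & J <= W" if "W : ?D" for W using that idl_ann[OF sU] ann_J[OF U] by blast
  qed
  then obtain Q where Q: "Q : ?D" "!!W'. W' : ?D ==> Q <= W' ==> W' = Q" by auto
  then obtain v where v: "v ~: U" "ann U w <= ann U v" "Q = ann U v" by auto
  have "ann U v' = ann U v" if "v' ~: U" "ann U v <= ann U v'" for v' using Q(2)[of "ann U v'"] that v by auto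
  hence "v : T" using v(1) unfolding T_def by blast
  moreover have "x : ann U v" using w v by (auto simp: ann_def)
  ultimately show ?thesis by blast
 qed
 moreover have "ALL P:ann U ` T. prime_idl P & (EX v. v ~: U & P = ann U v)" using T_prime by (auto simp: T_def)
 ultimately show ?thesis by blast
qed

text \<open>Prime avoidance over the associated primes of all members at once; the later depth
  arguments need one element that is regular on several modules.\<close>

lemma regular_element:
 assumes I: "idl I" and fin: "finite UU" and good: "!!U. U : UU ==> good U"
  and no: "!!U v. U : UU ==> v ~: U ==> prime_idl (ann U v) ==> ~I <= ann U v"
 shows "EX x:I. ALL U:UU. reg x U"
proof (rule ccontr)
 assume neg: "~?thesis"
 have "ALL U:UU. EX Ps. finite Ps & (ALL P:Ps. prime_idl P & (EX v. v ~: U & P = ann U v)) &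
  (ALL x. ~reg x U --> x : \<Union>Ps)" using zero_divisors good by blast from bchoice[OF this] obtain PP where "ALL U:UU. finite (PP U) &
   (ALL P:PP U. prime_idl P & (EX v. v ~: U & P = ann U v)) & (ALL x. ~reg x U --> x : \<Union>(PP U))" .. note PP = bspec[OF this]
 have "I <= \<Union>(\<Union>(PP ` UU))"
 proof
  fix x assume "x : I"
  then obtain U where U: "U : UU" "~reg x U" using neg by auto
  hence "x : \<Union>(PP U)" using PP by auto
  thus "x : \<Union>(\<Union>(PP ` UU))" using U(1) by auto
 qed
 moreover have "finite (\<Union>(PP ` UU))" using PP fin by auto
 moreover have "!!P. P : \<Union>(PP ` UU) ==> prime_idl P" using PP by auto
 ultimately have "EX P:\<Union>(PP ` UU). I <= P" by (intro prime_avoidance[OF _ _ I])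
 then obtain U P where P: "U : UU" "P : PP U" "I <= P" by auto
 then obtain v where "prime_idl P" "v ~: U" "P = ann U v" using PP[OF P(1)] by auto
 thus False using no[OF P(1), of v] P(3) by auto
qed

text \<open>Nakayama's lemma at the prime \<open>n\<close>, phrased with multipliers outside
  \<open>n\<close> instead of localization. The relation for the last generator has the coefficient
  \<open>s0 - c0 k\<close> outside \<open>n\<close>; multiplying by it eliminates that generator
  from all other relations.\<close>

lemma nakayama_sat:
 assumes U: "submod U" and n: "prime_idl n"
  and W: "!!w. w : W ==> EX s c. s ~: n & (ALL j<k. c j : n) & sm s w - (SUM j<k. sm (c j) (g j)) : U"
  and g: "ALL j<(k::nat). g j : W"
 shows "w : W ==> EX s. s ~: n & sm s w : U" using g W
proof (induction k)
 case 0
 thus ?case by auto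
next
 case (Suc k)
 have idn: "idl n" using n prime_idl_idl by auto
 obtain s0 c0 where s0: "s0 ~: n" "ALL j<Suc k. c0 j : n"
   "sm s0 (g k) - (SUM j<Suc k. sm (c0 j) (g j)) : U" using Suc.prems(3)[of "g k"] Suc.prems(2) by blast
 define t where "t = s0 - c0 k"
 have t: "t ~: n" using s0 idl_cong2[OF idn, of s0 "c0 k"] by (auto simp: t_def)
 have tk: "sm t (g k) - (SUM j<k. sm (c0 j) (g j)) : U" using s0(3) by (simp add: t_def sm_diff_left algebra_simps)
 show ?case
 proof (rule Suc.IH[OF Suc.prems(1)])
  show "ALL j<k. g j : W" using Suc.prems by auto
  fix w assume "w : W"
  then obtain s c where s: "s ~: n" "ALL j<Suc k. c j : n" "sm s w - (SUM j<Suc k. sm (c j) (g j)) : U" using Suc.prems(3) by blast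
  have "sm (t * s) w - (SUM j<k. sm (t * c j + c k * c0 j) (g j)) =
    sm t (sm s w - (SUM j<Suc k. sm (c j) (g j))) + sm (c k) (sm t (g k) - (SUM j<k. sm (c0 j) (g j)))"
   by (simp add: sm_sum sm_add_left sum.distrib algebra_simps)
  also have "... : U" by (intro submod_add[OF U] submod_sm[OF U] s tk)
  finally have "sm (t * s) w - (SUM j<k. sm (t * c j + c k * c0 j) (g j)) : U" .
  moreover have "t * s ~: n" using t s n by (auto simp: prime_idl_def)
  moreover have "ALL j<k. t * c j + c k * c0 j : n" using s s0 by (auto intro!: idl_add[OF idn] idl_mult[OF idn])
  ultimately show "EX s c. s ~: n & (ALL j<k. c j : n) & sm s w - (SUM j<k. sm (c j) (g j)) : U"
   by (intro exI[of _ "t * s"] exI[of _ "%j. t * c j + c k * c0 j"]) simp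
 qed
qed

end


section \<open>Depth over a Noetherian local ring\<close>

primrec dep :: "'a::comm_ring_1 set => nat => (nat => 'a) set => bool" where
 "dep m 0 U \<longleftrightarrow> True"
| "dep m (Suc k) U \<longleftrightarrow> (EX x:m. reg x U & dep m k (U + range (sm x)))"

lemma mem_plus_range: "v : U + range f \<longleftrightarrow> (EX w. v - f w : U)" for v :: "'v::ab_group_add" unfolding set_plus_diff_iff2 by simp

lemma mem_range_plus: "v : range f + U \<longleftrightarrow> (EX w. v - f w : U)" for v :: "'v::ab_group_add" unfolding set_plus_diff_iff by simp

lemma idl_plus:
 assumes U: "idl U" and W: "idl W" shows "idl (U + W)" unfolding idl_def
proof (intro conjI ballI allI)
 show "0 : U + W" using idl_0[OF U] idl_0[OF W] by (metis set_plus_iff add_0)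
 fix u assume "u : U + W"
 then obtain a b where ab: "a : U" "b : W" "u = a + b" unfolding set_plus_iff by blast
 show "c * u : U + W" for c unfolding ab distrib_left using idl_mult[OF U ab(1), of c] idl_mult[OF W ab(2), of c] by blast
 fix v assume "v : U + W"
 then obtain c d where cd: "c : U" "d : W" "v = c + d" unfolding set_plus_iff by blast
 have "u + v = (a + c) + (b + d)" using ab cd by simp
 thus "u + v : U + W" unfolding set_plus_iff using idl_add[OF U ab(1) cd(1)] idl_add[OF W ab(2) cd(2)] by blast
qed

lemma idl_range: "idl (range ((*) x))" unfolding idl_def
proof (intro conjI ballI allI)
 show "0 : range ((*) x)" by (rule range_eqI[of _ _ 0]) simp
 fix u assume "u : range ((*) x)"
 then obtain a where a: "u = x * a" by blast
 show "c * u : range ((*) x)" for c by (rule range_eqI[of _ _ "c * a"]) (simp add: a mult.left_commute)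
 fix v assume "v : range ((*) x)"
 then obtain b where b: "v = x * b" by blast
 show "u + v : range ((*) x)" by (rule range_eqI[of _ _ "a + b"]) (simp add: a b algebra_simps)
qed

lemma fr_plus_range: "fr N I + range (sm x) = fr N (I + range ((*) x))"
proof (intro Set.set_eqI iffI)
 fix v assume "v : fr N I + range (sm x)"
 then obtain w where "v - sm x w : fr N I" unfolding mem_plus_range by blast
 hence "v i - x * w i : I" if "i : N" for i using that by (simp add: fr_def sm_def)
 thus "v : fr N (I + range ((*) x))" unfolding fr_def mem_plus_range by blast
next
 fix v assume "v : fr N (I + range ((*) x))"
 hence "ALL i:N. EX w. v i - x * w : I" unfolding fr_def mem_plus_range by blast
 then obtain w where "ALL i:N. v i - x * w i : I" by metis
 thus "v : fr N I + range (sm x)" unfolding mem_plus_range by (auto simp: fr_def sm_def)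
qed

lemma reg_fr: "finite N ==> reg x (fr {0} I) ==> reg x (fr N I)" unfolding reg_def by (auto simp: fr_def sm_def)

lemma reg_fr_iff: "reg x (fr {0} I) \<longleftrightarrow> (ALL a. x * a : I --> a : I)" by (auto simp: reg_def fr_def sm_def)

lemma dep_fr: "finite N ==> dep m k (fr {0} I) ==> dep m k (fr N I)"
proof (induction k arbitrary: I)
 case (Suc k)
 then obtain x where x: "x : m" "reg x (fr {0} I)" "dep m k (fr {0} (I + range ((*) x)))" by (auto simp: fr_plus_range)
 thus ?case using Suc.IH[OF Suc.prems(1) x(3)] reg_fr[OF Suc.prems(1) x(2)] by (auto simp: fr_plus_range)
qed simp

lemma dep_Suc_D: "dep m (Suc k) U ==> dep m k U"
proof (induction k arbitrary: U)
 case (Suc k)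
 then obtain x where "x : m" "reg x U" "dep m (Suc k) (U + range (sm x))" by auto
 thus ?case using Suc.IH by auto
qed simp

lemma dep_mono: "dep m k U ==> l <= k ==> dep m l U" by (induction k) (auto simp: le_Suc_eq dest: dep_Suc_D simp del: dep.simps(2))

text \<open>On the zero module even 0 is regular, which reproduces the convention depth 0 =
  infinity.\<close>

lemma dep_UNIV: "idl m ==> dep m k UNIV"
proof (induction k)
 case (Suc k) show ?case using Suc idl_0[of m] by (auto simp: reg_def intro!: bexI[of _ 0])
qed simp

locale nloc = noeth J for J :: "'a::comm_ring_1 set" +
 fixes m :: "'a set"
 assumes idm: "idl m" and Jm: "J <= m" and one_m: "1 ~: m"
  and unit: "!!s. s ~: m ==> EX t. s * t - 1 : J"
begin

section \<open>Regular elements, socles and the depth lemma\<close>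

lemma prime_m: "prime_idl m" unfolding prime_idl_def
proof (intro conjI allI impI idm one_m)
 fix a b assume ab: "a * b : m"
 show "a : m | b : m"
 proof (rule ccontr)
  assume "~?thesis"
  then obtain s t where "a * s - 1 : m" "b * t - 1 : m" using unit Jm by (metis subsetD)
  hence "a * s * (b * t - 1) + (a * s - 1) : m" using idl_add[OF idm] idl_mult[OF idm] by blast
  moreover have "a * s * (b * t - 1) + (a * s - 1) = a * b * (s * t) - 1" by (simp add: algebra_simps)
  ultimately show False using idl_cong[OF idm] idl_mult2[OF idm ab, of "s * t"] one_m by (metis )
 qed
qed

lemma good_plus: "good U ==> good (U + range (sm x))"
 by (rule good_mono[OF _ submod_plus[OF good_submod submod_range[OF lin_sm_fun]] subset_plus1[OF submod_range[OF lin_sm_fun]]])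

text \<open>A nonzero socle of V / U; for finite modules this is exactly the failure of depth at
  least 1.\<close>

definition soc :: "(nat => 'a) set => bool" where
 "soc U \<longleftrightarrow> (EX v. v ~: U & (ALL a:m. sm a v : U))"

lemma not_socD: "~soc U ==> (!!a. a : m ==> sm a v : U) ==> v : U" unfolding soc_def by metis

lemma regular_ex:
 assumes "finite UU" "!!U. U : UU ==> good U & ~soc U"
 shows "EX x:m. ALL U:UU. reg x U" by (rule regular_element[OF idm assms(1)]) (use assms(2) in \<open>auto simp: soc_def ann_def subset_iff\<close>)

lemma reg_not_soc: "x : m ==> reg x U ==> ~soc U" unfolding soc_def reg_def by metis

lemma dep_not_soc: "dep m (Suc k) U ==> ~soc U" using reg_not_soc by auto

lemma dep_1: "good U ==> ~soc U ==> dep m (Suc 0) U" using regular_ex[of "{U}"] by auto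

text \<open>The half of the permutability of regular sequences that holds over any commutative
  ring.\<close>

lemma reg_swap:
 assumes U: "submod U" and "reg a U" "reg z (U + range (sm a))" shows "reg a (U + range (sm z))" unfolding reg_def
proof (intro allI impI)
 fix f assume "sm a f : U + range (sm z)"
 then obtain g where g: "sm a f - sm z g : U" unfolding mem_plus_range by blast
 have "sm z g - sm a f : U" using submod_minus_commute[OF U g] .
 then obtain h where h: "g - sm a h : U" using assms(3) unfolding reg_def unfolding mem_plus_range by blast
 have "sm a (f - sm z h) = (sm a f - sm z g) + sm z (g - sm a h)" by (simp add: mult.commute)
 also have "... : U" by (rule submod_add[OF U g submod_sm[OF U h]])
 finally have "f - sm z h : U" using assms(2) unfolding reg_def by blast
 thus "f : U + range (sm z)" unfolding mem_plus_range by blast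
qed

text \<open>A socle element g modulo x satisfies a g = x f modulo U for some f, and f is a socle
  element modulo a. Both socles are Ext^1 of the residue field into V / U.\<close>

lemma soc_swap:
 assumes U: "submod U" and a: "a : m" "reg a U" and x: "x : m" "reg x U"
  and ns: "~soc (U + range (sm a))"
 shows "~soc (U + range (sm x))"
proof
 assume "soc (U + range (sm x))"
 then obtain g where g: "g ~: U + range (sm x)" "!!y. y : m ==> sm y g : U + range (sm x)" unfolding soc_def by blast
 obtain f where f: "sm a g - sm x f : U" using g(2)[OF a(1)] unfolding mem_plus_range by blast
 have "f : U + range (sm a)"
 proof (rule not_socD[OF ns])
  fix y assume "y : m"
  then obtain h where h: "sm y g - sm x h : U" using g(2) unfolding mem_plus_range by blast
  have "sm x (sm y f - sm a h) = sm a (sm y g - sm x h) - sm y (sm a g - sm x f)" by (simp add: mult.commute)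
  also have "... : U" by (rule submod_diff[OF U submod_sm[OF U h] submod_sm[OF U f]])
  finally have "sm y f - sm a h : U" using x(2) unfolding reg_def by blast
  thus "sm y f : U + range (sm a)" unfolding mem_plus_range by blast
 qed
 then obtain k where k: "f - sm a k : U" unfolding mem_plus_range by blast
 have "sm a (g - sm x k) = (sm a g - sm x f) + sm x (f - sm a k)" by (simp add: mult.commute)
 also have "... : U" by (rule submod_add[OF U f submod_sm[OF U k]])
 finally have "g - sm x k : U" using a(2) unfolding reg_def by blast
 thus False using g(1) unfolding mem_plus_range by blast
qed

lemma range_plus_swap: "U + range (sm a) + range (sm z) = U + range (sm z) + range (sm a)" by (simp add: ac_simps)

text \<open>Depth does not depend on the first regular element chosen: an element z regular on the
  quotients by a and by x can be exchanged with either of them, and after division by z the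
  induction hypothesis applies.\<close>

lemma dep_reg: "good U ==> dep m (Suc k) U ==> x : m ==> reg x U ==> dep m k (U + range (sm x))"
proof (induction k arbitrary: U x)
 case (Suc k)
 note U = \<open>good U\<close>
 have sU: "submod U" using U good_submod by blast
 obtain a where a: "a : m" "reg a U" "dep m (Suc k) (U + range (sm a))" using Suc.prems(2) by auto
 have nsa: "~soc (U + range (sm a))" using dep_not_soc a(3) by blast
 obtain z where z: "z : m" "reg z (U + range (sm a))" "reg z (U + range (sm x))"
  using regular_ex[of "{U + range (sm a), U + range (sm x)}"] nsa soc_swap[OF sU a(1,2) Suc.prems(3,4) nsa] good_plus[OF U] by auto
 have 1: "dep m k (U + range (sm a) + range (sm z))" by (rule Suc.IH[OF good_plus[OF U] a(3) z(1,2)])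
 have "reg a (U + range (sm z))" by (rule reg_swap[OF sU a(2) z(2)])
 hence 2: "dep m (Suc k) (U + range (sm z))" using a(1) 1 by (auto simp: range_plus_swap[of U z a])
 have "reg x (U + range (sm z))" by (rule reg_swap[OF sU Suc.prems(4) z(3)])
 hence "dep m k (U + range (sm z) + range (sm x))" by (rule Suc.IH[OF good_plus[OF U] 2 Suc.prems(3)])
 thus ?case using z by (auto simp: range_plus_swap[of U z x])
qed simp

text \<open>The sequence 0 -> V / f^-1 U -> V / U -> V / (f V + U) -> 0 stays exact modulo x because
  x is regular on its last term.\<close>

lemma vimage_plus:
 assumes f: "lin f" and U: "submod U" and x: "reg x (range f + U)"
 shows "f -` (U + range (sm x)) = f -` U + range (sm x)"
proof (intro Set.set_eqI iffI)
 fix v assume "v : f -` (U + range (sm x))"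
 then obtain w where w: "f v - sm x w : U" unfolding vimage_def mem_plus_range by blast
 obtain w' where w': "w - f w' : U" using x unfolding reg_def unfolding mem_range_plus by (metis submod_minus_commute U w)
 have "f (v - sm x w') = (f v - sm x w) + sm x (w - f w')" by (simp add: lin_diff[OF f] lin_sm[OF f])
 also have "... : U" by (rule submod_add[OF U w submod_sm[OF U w']])
 finally have "v - sm x w' : f -` U" by auto
 thus "v : f -` U + range (sm x)" unfolding mem_plus_range by blast
next
 fix v assume "v : f -` U + range (sm x)"
 then obtain w where "v - sm x w : f -` U" unfolding mem_plus_range by blast
 thus "v : f -` (U + range (sm x))" unfolding vimage_eq mem_plus_range by (metis lin_diff f lin_sm)
qed

text \<open>Depth lemma for the sequence of \<open>vimage_plus\<close>: the cokernel loses at most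
  one. Divide by an element regular on all three terms; it exists as soon as none of them has a
  socle.\<close>

lemma depth_quotient:
 assumes f: "lin f"
 shows "good U ==> good (f -` U) ==> dep m k (f -` U) ==> dep m k U ==> dep m (k - 1) (range f + U)"
proof (induction k arbitrary: U)
 case (Suc k)
 note U = \<open>good U\<close> and U1 = \<open>good (f -` U)\<close>
 have sU: "submod U" "submod (f -` U)" using U U1 good_submod by blast+
 show ?case
 proof (cases k)
  case (Suc l)
  have ns: "~soc (f -` U)" "~soc U" using dep_not_soc Suc.prems by blast+
  then obtain a where a: "a : m" "reg a (f -` U)" "reg a U"
   using regular_ex[of "{f -` U, U}"] U U1 by auto
   have nsa: "~soc (f -` U + range (sm a))" using dep_not_soc Suc by (metis dep_reg Suc.prems a)
  \<comment> \<open>A socle element v of the cokernel gives a v = f b, with b killed by m modulo a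
    in the left term. As depth 2 excludes a socle there, b = a b', and v = f b' because a is regular
    in the middle.\<close>
  have ns3: "~soc (range f + U)"
  proof
   assume "soc (range f + U)"
   then obtain v where v: "v ~: range f + U" "!!y. y : m ==> sm y v : range f + U" unfolding soc_def by blast
   obtain b where b: "sm a v - f b : U" using v(2)[OF a(1)] unfolding mem_range_plus by blast
   have "b : f -` U + range (sm a)"
   proof (rule not_socD[OF nsa])
    fix y assume "y : m"
    then obtain h where h: "sm y v - f h : U" using v(2) unfolding mem_range_plus by blast
    have "f (sm y b - sm a h) = sm a (sm y v - f h) - sm y (sm a v - f b)" by (simp add: lin_diff[OF f] lin_sm[OF f] mult.commute)
    also have "... : U" by (rule submod_diff[OF sU(1) submod_sm[OF sU(1) h] submod_sm[OF sU(1) b]])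
    finally have "sm y b - sm a h : f -` U" by auto
    thus "sm y b : f -` U + range (sm a)" unfolding mem_plus_range by blast
   qed
   then obtain b' where "b - sm a b' : f -` U" unfolding mem_plus_range by blast
   hence b': "f b - sm a (f b') : U" by (simp only: vimage_eq lin_diff[OF f] lin_sm[OF f])
   have "sm a (v - f b') = (sm a v - f b) + (f b - sm a (f b'))" by simp
   also have "... : U" by (rule submod_add[OF sU(1) b b'])
   finally have "v - f b' : U" using a(3) unfolding reg_def by blast
   thus False using v(1) unfolding mem_range_plus by blast
  qed
  obtain x where x: "x : m" "reg x (f -` U)" "reg x U" "reg x (range f + U)" using regular_ex[of "{f -` U, U, range f + U}"] U U1 good_mono[OF U submod_plus[OF submod_range[OF f] sU(1)] subset_plus2[OF submod_range[OF f]]] ns ns3 by auto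
  note vp = vimage_plus[OF f sU(1) x(4)]
  have 1: "dep m k (f -` (U + range (sm x)))" unfolding vp by (rule dep_reg[OF U1 Suc.prems(3) x(1,2)])
  have 2: "dep m k (U + range (sm x))" by (rule dep_reg[OF U Suc.prems(4) x(1,3)])
  have "dep m (k - 1) (range f + (U + range (sm x)))" by (rule Suc.IH[OF good_plus[OF U] _ 1 2]) (unfold vp, rule good_plus[OF U1])
  thus ?thesis using x Suc by (auto simp: add.assoc)
 qed simp
qed simp

text \<open>Depth lemma for the same sequence, read for the left term: it gains one over the
  cokernel as long as the middle term allows it.\<close>

lemma depth_syzygy:
 assumes f: "lin f"
 shows "good U ==> good (f -` U) ==> dep m k (range f + U) ==> dep m (Suc k) U ==> dep m (Suc k) (f -` U)"
proof (induction k arbitrary: U)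
 case 0
 then obtain a where a: "a : m" "reg a U" by auto
 show ?case using a by (auto simp: lin_sm f reg_def)
next
 case (Suc k)
 note U = \<open>good U\<close> and U1 = \<open>good (f -` U)\<close>
 have sU: "submod U" "submod (f -` U)" using U U1 good_submod by blast+
 have g3: "good (range f + U)"
  by (rule good_mono[OF U submod_plus[OF submod_range[OF f] sU(1)] subset_plus2[OF submod_range[OF f]]])
  obtain x where x: "x : m" "reg x U" "reg x (range f + U)" using dep_not_soc Suc.prems
  using regular_ex[of "{U, range f + U}"] g3 by blast+
 note vp = vimage_plus[OF f sU(1) x(3)]
 have 1: "dep m k (range f + (U + range (sm x)))" using dep_reg[OF g3 Suc.prems(3) x(1,3)] by (simp add: add.assoc)
 have 2: "dep m (Suc k) (U + range (sm x))" by (rule dep_reg[OF U Suc.prems(4) x(1,2)])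
 have "dep m (Suc k) (f -` (U + range (sm x)))" by (rule Suc.IH[OF good_plus[OF U] _ 1 2]) (unfold vp, rule good_plus[OF U1])
 moreover have "reg x (f -` U)" unfolding reg_def by (metis vimage_eq lin_sm f x reg_def)
 ultimately show ?case unfolding vp using x(1) by auto
qed

lemma unit_cancel:
 assumes U: "good U" and s: "s ~: m" "sm s w : U" shows "w : U"
proof -
 have sU: "submod U" using U good_submod by blast
 obtain t where t: "s * t - 1 : J" using unit s by blast
 have "sm (s * t - 1) w : U" by (rule good_J[OF U t])
 moreover have "sm t (sm s w) : U" by (rule submod_sm[OF sU s(2)])
 ultimately have "sm t (sm s w) - sm (s * t - 1) w : U" using submod_diff[OF sU] by blast
 thus ?thesis by (simp add: sm_diff_left mult.commute)
qed

section \<open>Nakayama's lemma and the bound of the depth by chains of primes\<close>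

lemma nakayama:
 assumes U: "good U" and N: "submod N" "U <= N"
  and h: "!!w. w : N ==> EX (S::nat set) c h. finite S & (ALL i:S. c i : m & h i : N) & w - (SUM i:S. sm (c i) (h i)) : U"
 shows "N <= U"
proof
 fix w assume w: "w : N"
 have sU: "submod U" using U good_submod by blast
 obtain n g where g: "ALL j<(n::nat). g j : N" and gN: "ALL w:N. EX c. w - (SUM j<n. sm (c j) (g j)) : U"
  using fgmod_good[OF U N] unfolding fgmod_def by auto
 have "EX s. s ~: m & sm s w : U"
 proof (rule nakayama_sat[OF sU prime_m _ g w])
  fix w assume "w : N"
  then obtain S :: "nat set" and c h where S: "finite S" "ALL i:S. c i : m & h i : N" "w - (SUM i:S. sm (c i) (h i)) : U"
   using h[OF \<open>w : N\<close>] by (elim exE conjE)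
  have "ALL i:S. EX d. h i - (SUM j<n. sm (d j) (g j)) : U" using gN S(2) by auto
  from bchoice[OF this] obtain d where "ALL i:S. h i - (SUM j<n. sm (d i j) (g j)) : U" ..
  note d = bspec[OF this]
  define e where "e j = (SUM i:S. c i * d i j)" for j
  have "(SUM i:S. sm (c i) (h i)) - (SUM j<n. sm (e j) (g j)) = (SUM i:S. sm (c i) (h i - (SUM j<n. sm (d i j) (g j))))"
  proof -
   have "(SUM j<n. sm (e j) (g j)) = (SUM j<n. SUM i:S. sm (c i) (sm (d i j) (g j)))"
    unfolding e_def by (intro sum.cong refl) (simp add: fun_eq_iff sum_fun sm_def sum_distrib_right mult.assoc)
   also have "... = (SUM i:S. SUM j<n. sm (c i) (sm (d i j) (g j)))" by (rule sum.swap)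
   finally show ?thesis by (simp only: sm_simps(6) sum_subtractf sm_sum)
  qed
  also have "... : U" by (intro submod_sum[OF sU] submod_sm[OF sU] d)
  finally have "w - (SUM j<n. sm (e j) (g j)) : U" using submod_trans[OF sU S(3)] by blast
  moreover have "ALL j<n. e j : m" unfolding e_def using S(2) by (auto intro!: idl_sum[OF idm] idl_mult2[OF idm])
  ultimately show "EX s c. s ~: m & (ALL j<n. c j : m) & sm s w - (SUM j<n. sm (c j) (g j)) : U" by (intro exI[of _ 1] exI[of _ e]) (simp add: one_m)
 qed
 thus "w : U" using unit_cancel[OF U] by blast
qed

text \<open>Let p be the given associated prime of M = V / U. After division by a regular x, some
  associated prime of M / x M contains p and x; so every element of a regular sequence adds a strict
  step above p.\<close>

lemma dep_chain:
 "good U ==> dep m k U ==> v ~: U ==> prime_idl (ann U v) ==> EX Q. Q 0 = ann U v & (ALL i<=k. prime_idl (Q i)) & (ALL i<k. Q i \<subset> Q (Suc i))"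
proof (induction k arbitrary: U v)
 case 0
 thus ?case by auto
next
 case (Suc k)
 note U = \<open>good U\<close>
 have sU: "submod U" using U good_submod by blast
 obtain x where x: "x : m" "reg x U" "dep m k (U + range (sm x))" using Suc.prems(2) by auto
 \<comment> \<open>The elements killed by p modulo U. If all of them were multiples of x modulo U,
   the cofactors would again be killed by p since x is regular, and Nakayama would put N into
   U.\<close>
 define N where "N = {w. ALL a:ann U v. sm a w : U}"
 have N: "submod N" "U <= N" unfolding N_def submod_def by (auto simp: submod_0[OF sU] submod_add[OF sU] submod_sm[OF sU])
   (metis mult.commute sm_simps(4) submod_sm[OF sU])
 have "~N <= U" using Suc.prems(3) by (auto simp: N_def ann_def)
 hence "~(ALL w:N. w : U + range (sm x))"
 proof (rule contrapos_nn)
  assume a: "ALL w:N. w : U + range (sm x)"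
  show "N <= U"
  proof (rule nakayama[OF U N])
   fix w assume w: "w : N"
   then obtain w' where w': "w - sm x w' : U" using a unfolding mem_plus_range by blast
   have "w' : N" unfolding N_def
   proof (intro CollectI ballI)
    fix b assume b: "b : ann U v"
    have "sm b w : U" using w b by (auto simp: N_def)
    moreover have "sm b (w - sm x w') : U" by (rule submod_sm[OF sU w'])
    ultimately have "sm b w - sm b (w - sm x w') : U" using submod_diff[OF sU] by blast
    thus "sm b w' : U" using x(2) unfolding reg_def by (simp add: mult.commute)
   qed
   thus "EX (S::nat set) c h. finite S & (ALL i:S. c i : m & h i : N) & w - (SUM i:S. sm (c i) (h i)) : U"
    using x(1) w' by (intro exI[of _ "{0}"] exI[of _ "%_. x"] exI[of _ "%_. w'"]) simp
  qed
 qed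
 then obtain w where w: "w : N" "w ~: U + range (sm x)" by blast
 have gx: "good (U + range (sm x))" by (rule good_plus[OF U])
 obtain c where c: "sm c w ~: U + range (sm x)" "prime_idl (ann (U + range (sm x)) (sm c w))"
  "ann (U + range (sm x)) w <= ann (U + range (sm x)) (sm c w)" using ann_prime[OF gx w(2)] by blast
 obtain Q where Q: "Q 0 = ann (U + range (sm x)) (sm c w)" "ALL i<=k. prime_idl (Q i)" "ALL i<k. Q i \<subset> Q (Suc i)"
  using Suc.IH[OF gx x(3) c(1,2)] by blast
 have "ann U v <= Q 0" using w subset_plus1 submod_range lin_sm_fun c Q unfolding N_def ann_def by blast
 moreover have "x : Q 0"
 proof -
  have "sm x w : U + range (sm x)" unfolding mem_plus_range by (rule exI[of _ w]) (simp add: submod_0[OF sU])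
  thus ?thesis using c(3) Q(1) by (auto simp: ann_def)
 qed
 moreover have "x ~: ann U v" using x(2) Suc.prems(3) by (auto simp: ann_def reg_def)
 ultimately have lt: "ann U v \<subset> Q 0" by blast
 define Q' where "Q' i = (case i of 0 => ann U v | Suc j => Q j)" for i
 have "ALL i<=Suc k. prime_idl (Q' i)" using Q(2) Suc.prems(4) by (auto simp: Q'_def split: nat.split)
 moreover have "ALL i<Suc k. Q' i \<subset> Q' (Suc i)"
 proof (intro allI impI)
  fix i assume "i < Suc k"
  thus "Q' i \<subset> Q' (Suc i)" using Q(3) lt by (cases i) (auto simp: Q'_def)
 qed
 ultimately show ?case by (intro exI[of _ Q']) (simp add: Q'_def)
qed

end


section \<open>Finite complexes of free modules\<close>

context nloc begin

definition adm :: "nat set => ((nat => 'a) => 'a) => bool" where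
 "adm N f \<longleftrightarrow> functional f & f ` fr N {0} <= J"

definition lmap :: "nat set => nat set => ((nat => 'a) => nat => 'a) => bool" where
 "lmap N B f \<longleftrightarrow> finite N & finite B & lin f & f ` fr N {0} <= fr B J"

definition exact_mod :: "'a set => nat set => ((nat => 'a) => nat => 'a) => nat set => ((nat => 'a) => nat => 'a) => bool" where
 "exact_mod I B F N H \<longleftrightarrow> (ALL v. F v : fr B I --> v : range H + fr N I)"

text \<open>Exactness of the dual complex at the dual of the free module on
  \<open>N\<close>.\<close>

definition dual_exact :: "nat set => ((nat => 'a) => nat => 'a) => nat set => ((nat => 'a) => nat => 'a) => bool" where
 "dual_exact B F N H \<longleftrightarrow> (ALL f. adm N f & (ALL v. f (H v) : J) --> (EX g. adm B g & (ALL v. f v - g (F v) : J)))"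

abbreviation (input) exact_at where "exact_at I l F j == exact_mod I (l j) (F j) (l (Suc j)) (F (Suc j))"
abbreviation (input) dual_at where "dual_at l F j == dual_exact (l j) (F j) (l (Suc j)) (F (Suc j))"

lemma lmap_fr:
 assumes f: "lmap N B f" and I: "idl I" "J <= I" and v: "v : fr N I" shows "f v : fr B I"
proof -
 have 1: "f v - (SUM j:N. sm (v j) (f (un j))) : fr B I" using lin_expand[of f N "fr B J" v] f I by (auto simp: lmap_def fr_def)
 have 2: "(SUM j:N. sm (v j) (f (un j))) : fr B I" using v by (intro submod_sum submod_fr I) (auto simp: fr_def sm_def intro!: idl_mult2[OF I(1)])
 show ?thesis using submod_add[OF submod_fr[OF I(1)] 1 2] by simp
qed

lemma adm_fr:
 assumes f: "adm N f" and N: "finite N" and I: "idl I" "J <= I" and v: "v : fr N I" shows "f v : I"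
proof -
 have 1: "f v - (SUM j:N. v j * f (un j)) : I" using fun_expand[of f N J v] f N I by (auto simp: adm_def)
 have 2: "(SUM j:N. v j * f (un j)) : I" using v by (intro idl_sum[OF I(1)] idl_mult2[OF I(1)]) (auto simp: fr_def)
 show ?thesis using idl_add[OF I(1) 1 2] by simp
qed

lemma lmap_J: "lmap N B f ==> v : fr N J ==> f v : fr B J" using lmap_fr idJ by blast
lemma lmap_m: "lmap N B f ==> v : fr N m ==> f v : fr B m" using lmap_fr idm Jm by blast
lemma adm_J: "adm N f ==> finite N ==> v : fr N J ==> f v : J" using adm_fr idJ by blast
lemma lmap_lin: "lmap N B f ==> lin f" by (simp add: lmap_def)
lemma adm_fun: "adm N f ==> functional f" by (simp add: adm_def)
lemma lmap_0: "finite N ==> finite B ==> lmap N B (%_. 0)" by (simp add: lmap_def lin_def submod_0[OF submod_fr[OF idJ]] image_subset_iff)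
lemma lmap_comp: "lmap N B f ==> lmap B C g ==> lmap N C (%v. g (f v))"
 by (simp add: lmap_def lin_comp image_subset_iff) (metis lmap_J lmap_def image_subset_iff)
lemma adm_comp: "lmap N B f ==> adm B g ==> adm N (%v. g (f v))" unfolding adm_def[of N] using fun_comp adm_fun adm_J by (auto simp: lmap_def)

lemma sJ: "submod (fr N J)" by (rule submod_fr[OF idJ])
lemma s_m: "submod (fr N m)" by (rule submod_fr[OF idm])

lemma fr_mono: "I <= I' ==> fr N I <= fr N I'" by (auto simp: fr_def)

text \<open>Maps are numbered by their targets: \<open>F j\<close> goes from
  \<open>l (Suc j)\<close> to \<open>l j\<close>, so \<open>exact_at\<close> and
  \<open>dual_at\<close> with index j concern the spot \<open>l (Suc j)\<close>.\<close>

definition cpx :: "(nat => nat set) => (nat => (nat => 'a) => nat => 'a) => bool" where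
 "cpx l F \<longleftrightarrow> (ALL j. lmap (l (Suc j)) (l j) (F j)) & (ALL j v. F j (F (Suc j) v) : fr (l j) J)"

text \<open>In the long exact sequence of 0 -> L -> L -> L/xL -> 0 the homology of L/xL at one spot
  lies between the homology of L there and at the next lower spot. This is why one place is lost at
  the bottom.\<close>

lemma exact_mod_regular:
 assumes c: "cpx l F" and I: "idl I" "J <= I" and x: "ALL a. x * a : I --> a : I"
  and ex: "!!j. k <= j ==> j < s ==> exact_at I l F j"
  and j: "Suc k <= j" "j < s"
 shows "exact_mod (I + range ((*) x)) (l j) (F j) (l (Suc j)) (F (Suc j))" unfolding exact_mod_def fr_plus_range[symmetric]
proof (intro allI impI)
 fix v assume "F j v : fr (l j) I + range (sm x)"
 then obtain w where w: "F j v - sm x w : fr (l j) I" unfolding mem_plus_range by blast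
 obtain i where i: "j = Suc i" "k <= i" using j by (cases j) auto
 have lm: "lmap (l (Suc j)) (l j) (F j)" "lmap (l (Suc i)) (l i) (F i)" using c by (auto simp: cpx_def)
 note linj = lmap_lin[OF lm(1)] and lini = lmap_lin[OF lm(2)]
 have sI: "submod (fr N I)" for N by (rule submod_fr[OF I(1)])
 have "F i (F j v - sm x w) : fr (l i) I" using lmap_fr[OF lm(2) I] w i by blast
 moreover have "F i (F j v) : fr (l i) I" by (metis subsetD fr_mono I c i cpx_def)
 ultimately have "F i (F j v) - F i (F j v - sm x w) : fr (l i) I" using submod_diff[OF sI] by blast
 hence "sm x (F i w) : fr (l i) I" by (simp add: lin_diff[OF lini] lin_sm[OF lini])
 hence "F i w : fr (l i) I" using x by (auto simp: fr_def sm_def)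
 moreover have "exact_at I l F i" using ex[of i] i j by auto
 ultimately have "w : range (F j) + fr (l j) I" using i by (simp add: exact_mod_def)
 then obtain w' where w': "w - F j w' : fr (l j) I" unfolding mem_range_plus by blast
 have "F j (v - sm x w') = (F j v - sm x w) + sm x (w - F j w')" by (simp add: lin_diff[OF linj] lin_sm[OF linj])
 also have "... : fr (l j) I" by (rule submod_add[OF sI w submod_sm[OF sI w']])
 finally have "v - sm x w' : range (F (Suc j)) + fr (l (Suc j)) I" using ex[of j] j by (simp add: exact_mod_def)
 then obtain u where "v - sm x w' - F (Suc j) u : fr (l (Suc j)) I" unfolding mem_range_plus by blast
 hence "v - F (Suc j) u : fr (l (Suc j)) I + range (sm x)" unfolding mem_plus_range by (metis algebra_simps)
 thus "v : range (F (Suc j)) + (fr (l (Suc j)) I + range (sm x))" unfolding mem_range_plus by blast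
qed

text \<open>Divide by a maximal regular sequence: the last quotient has depth 0, which gives the
  socle element \<open>u\<close>, and each of the \<open>d\<close> divisions costs the lowest exact
  place.\<close>

lemma depth_socle_exact:
 assumes c: "cpx l F"
 shows "idl I ==> J <= I ==> dep m d (fr {0} I) ==> ~dep m (Suc d) (fr {0} I) ==>
  (!!j. k <= j ==> j < s ==> exact_at I l F j) ==>
  EX I' u. idl I' & J <= I' & u ~: I' & (ALL a:m. a * u : I') &
   (ALL j. k + d <= j & j < s --> exact_at I' l F j)"
proof (induction d arbitrary: I k)
 case 0
 have "good (fr {0} I)" using good_fr 0 by auto
 then obtain v where v: "v ~: fr {0} I" "ALL a:m. sm a v : fr {0} I" using dep_1 0(4) by (metis soc_def)
 show ?case using 0 v by (intro exI[of _ I] exI[of _ "v 0"]) (auto simp: fr_def sm_def)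
next
 case (Suc d)
 from Suc.prems(3) obtain x where x: "x : m" "reg x (fr {0} I)" "dep m d (fr {0} (I + range ((*) x)))" by (auto simp: fr_plus_range)
 have n: "~dep m (Suc d) (fr {0} (I + range ((*) x)))"
  using Suc.prems(4) x by (auto simp: fr_plus_range simp del: dep.simps(2) simp: dep.simps(2)[of m "Suc d"])
 have sub: "I <= I + range ((*) x)" using idl_0[OF idl_range, of x] by (metis add.right_neutral set_plus_iff subsetI)
 have x': "ALL a. x * a : I --> a : I" using x(2) reg_fr_iff by blast
 have ex: "exact_mod (I + range ((*) x)) (l j) (F j) (l (Suc j)) (F (Suc j))" if "Suc k <= j" "j < s" for j
  by (rule exact_mod_regular[OF c Suc.prems(1,2) x' Suc.prems(5) that])
 obtain I' u where I': "idl I'" "J <= I'" "u ~: I'" "ALL a:m. a * u : I'"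
   "ALL j. Suc k + d <= j & j < s --> exact_at I' l F j"
  using Suc.IH[OF idl_plus[OF Suc.prems(1) idl_range] subset_trans[OF Suc.prems(2) sub] x(3) n, of "Suc k"] ex
  by (elim exE conjE impE meta_impE) (assumption | simp | blast)+
 show ?case using I' by (intro exI[of _ I'] exI[of _ u]) simp
qed

text \<open>Gaussian elimination over a local ring. A matrix that is injective modulo m acquires a
  unit pivot in each column, so its cokernel is free: \<open>pj\<close> is the projection onto it
  and \<open>sg\<close> a section.\<close>

lemma pivots:
 assumes "finite N"
 shows "lmap N B Ph ==> (!!v. Ph v : fr B m ==> v : fr N m) ==>
  EX pj sg B'. lmap B B' pj & lmap B' B sg & (ALL w. pj w : fr B' J \<longleftrightarrow> w : range Ph + fr B J) &
   (ALL c. pj (sg c) - c : fr B' J)" using assms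
proof (induction N arbitrary: Ph rule: finite_induct)
 case empty
 have "Ph v : fr B J" for v using empty(1) by (auto simp: lmap_def fr_def)
 hence "range Ph + fr B J <= fr B J" by (intro plus_subset[OF sJ]) auto
 hence 1: "w : range Ph + fr B J \<longleftrightarrow> w : fr B J" for w
  using subset_plus2[OF submod_range[OF lmap_lin[OF empty(1)]], of "fr B J"] by blast
 have "lmap B B (%v. v)" using empty(1) by (auto simp: lmap_def lin_def fr_def idl_0[OF idJ])
 thus ?case using 1 by (intro exI[of _ "%v. v"] exI[of _ "%v. v"] exI[of _ B]) (auto simp: fr_def idl_0[OF idJ])
next
 case (insert k N)
 note lPh = \<open>lmap (insert k N) B Ph\<close>
 have linPh: "lin Ph" by (rule lmap_lin[OF lPh])
 define rh :: "(nat => 'a) => nat => 'a" where "rh v = (%i. if i : N then v i else 0)" for v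
 have linrh: "lin rh" by (auto simp: lin_def rh_def sm_def)
 have "rh v = 0" if "v : fr N {0}" for v using that by (auto simp: rh_def fr_def)
 hence lPh': "lmap N B (%v. Ph (rh v))" using lPh lin_comp[OF linPh linrh] by (auto simp: lmap_def lin_0[OF linPh] submod_0[OF sJ])
 have "v : fr N m" if "Ph (rh v) : fr B m" for v using insert.prems(2)[OF that] by (auto simp: fr_def rh_def)
 then obtain pj sg B' where pj: "lmap B B' pj" and sg: "lmap B' B sg"
  and ker: "!!w. pj w : fr B' J \<longleftrightarrow> w : range (%v. Ph (rh v)) + fr B J"
  and sec: "!!c. pj (sg c) - c : fr B' J" using insert.IH[OF lPh'] by blast
 have linpj: "lin pj" and linsg: "lin sg" using pj sg lmap_lin by auto
 define w where "w = pj (Ph (un k))"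
 \<comment> \<open>Otherwise the new column, corrected by a combination of the previous ones, would
   vanish modulo m although its own coefficient is 1.\<close>
 have "EX i0:B'. w i0 ~: m"
 proof (rule ccontr)
  assume "~?thesis"
  hence w: "w : fr B' m" by (auto simp: fr_def)
  have "pj (Ph (un k) - sg w) : fr B' J" using submod_uminus[OF sJ sec] by (simp add: w_def lin_diff[OF linpj])
  then obtain c where "Ph (un k) - sg w - Ph (rh c) : fr B J" unfolding ker mem_range_plus by blast
  hence 1: "Ph (un k) - sg w - Ph (rh c) : fr B m" using fr_mono[OF Jm] by blast
  have "Ph (un k - rh c) = (Ph (un k) - sg w - Ph (rh c)) + sg w" by (simp add: lin_diff[OF linPh])
  also have "... : fr B m" by (rule submod_add[OF s_m 1 lmap_m[OF sg w]])
  finally have "un k - rh c : fr (insert k N) m" by (rule insert.prems(2))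
  thus False using one_m insert.hyps by (auto simp: fr_def un_def rh_def)
 qed
 then obtain i0 where i0: "i0 : B'" "w i0 ~: m" by blast
 obtain t where t: "w i0 * t - 1 : J" using unit i0 by blast
 \<comment> \<open>Subtracting the multiple of \<open>w\<close> that clears coordinate
   \<open>i0\<close> divides the previous cokernel by the new column; \<open>t\<close> inverts the
   pivot.\<close>
 define pj' where "pj' z = (%i. pj z i - w i * (t * pj z i0))" for z
 define sg' where "sg' c = sg (c(i0 := 0))" for c
 define B'' where "B'' = B' - {i0}"
 have finB: "finite B" "finite B'" "finite B''" using pj by (auto simp: lmap_def B''_def)
 have linpj': "lin pj'" by (auto simp: lin_def pj'_def lin_add[OF linpj] lin_sm[OF linpj] sm_apply algebra_simps)
 have "lin (%c::nat=>'a. c(i0 := 0))" by (auto simp: lin_def sm_def)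
 hence linsg': "lin sg'" unfolding sg'_def by (rule lin_comp[OF linsg])
 have pj'J: "pj' z : fr B'' J" if "pj z : fr B' J" for z
  using that i0(1) by (auto simp: fr_def pj'_def B''_def intro!: idl_diff[OF idJ] idl_mult[OF idJ])
 have lpj': "lmap B B'' pj'" using finB linpj' pj'J pj by (auto simp: lmap_def)
 have "c(i0 := 0) : fr B' {0}" if "c : fr B'' {0}" for c :: "nat => 'a" using that by (auto simp: fr_def B''_def)
 hence lsg': "lmap B'' B sg'" using finB linsg' sg by (auto simp: lmap_def sg'_def)
 have "pj' (sg' c) i - c i : J" if "i : B''" for c i
 proof -
  define y where "y = pj (sg (c(i0 := 0)))"
  have y: "y - c(i0 := 0) : fr B' J" unfolding y_def by (rule sec)
  have "y i - c i : J" "y i0 : J" using y that i0(1) by (auto simp: fr_def B''_def)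
  hence "y i - c i - w i * (t * y i0) : J" by (rule idl_diff[OF idJ _ idl_mult[OF idJ idl_mult[OF idJ]]])
  thus ?thesis by (simp add: pj'_def sg'_def y_def algebra_simps)
 qed
 hence sec': "ALL c. pj' (sg' c) - c : fr B'' J" by (simp add: fr_def)
 have "pj' z : fr B'' J \<longleftrightarrow> z : range Ph + fr B J" for z
 proof
  assume z: "pj' z : fr B'' J"
  define c where "c = t * pj z i0"
  have "pj (z - sm c (Ph (un k))) i : J" if i: "i : B'" for i
  proof (cases "i = i0")
   case True
   have "- (pj z i0 * (w i0 * t - 1)) : J" by (rule idl_uminus[OF idJ idl_mult[OF idJ t]])
   thus ?thesis using True by (simp add: lin_diff[OF linpj] lin_sm[OF linpj] w_def[symmetric] sm_apply c_def algebra_simps)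
  next
   case False
   thus ?thesis using z i by (auto simp: fr_def B''_def lin_diff linpj lin_sm w_def sm_apply c_def pj'_def algebra_simps)
  qed
  hence "pj (z - sm c (Ph (un k))) : fr B' J" by (simp add: fr_def)
  then obtain d where d: "z - sm c (Ph (un k)) - Ph (rh d) : fr B J" unfolding ker mem_range_plus by blast
  have "z - Ph (sm c (un k) + rh d) : fr B J" using d by (simp add: lin_add[OF linPh] lin_sm[OF linPh] algebra_simps)
  thus "z : range Ph + fr B J" unfolding mem_range_plus by blast
 next
  assume "z : range Ph + fr B J"
  then obtain v where v: "z - Ph v : fr B J" unfolding mem_range_plus by blast
  have "v - (rh v + sm (v k) (un k)) : fr (insert k N) {0}" using insert.hyps by (auto simp: fr_def rh_def sm_def un_def)
  hence "z - Ph v + Ph (v - (rh v + sm (v k) (un k))) : fr B J" using lPh submod_add[OF sJ v] by (auto simp: lmap_def)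
  hence z1: "z - Ph (rh v) - sm (v k) (Ph (un k)) : fr B J" by (simp add: lin_add[OF linPh] lin_diff[OF linPh] lin_sm[OF linPh] algebra_simps)
  have "Ph (rh v) : range (%v. Ph (rh v)) + fr B J" unfolding mem_range_plus by (rule exI[of _ v]) (simp add: submod_0[OF sJ])
  hence z2: "pj (Ph (rh v)) : fr B' J" unfolding ker .
  have "pj (z - Ph (rh v) - sm (v k) (Ph (un k))) + pj (Ph (rh v)) : fr B' J" by (rule submod_add[OF sJ lmap_J[OF pj z1] z2])
  hence z3: "pj z - sm (v k) w : fr B' J" by (simp add: lin_diff[OF linpj] lin_sm[OF linpj] w_def)
  have "pj' z i : J" if "i : B''" for i
  proof -
   have a: "pj z i - v k * w i : J" "pj z i0 - v k * w i0 : J" using z3 that i0(1) by (auto simp: fr_def B''_def sm_def)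
   have "pj' z i = (pj z i - v k * w i) - w i * t * (pj z i0 - v k * w i0) - w i * v k * (w i0 * t - 1)" by (simp add: pj'_def algebra_simps)
   also have "... : J" by (intro idl_diff[OF idJ] idl_mult[OF idJ] a t)
   finally show ?thesis .
  qed
  thus "pj' z : fr B'' J" by (simp add: fr_def)
 qed
 thus ?case using lpj' lsg' sec' by blast
qed

text \<open>Splitting from the left end. The leftmost map is injective modulo m, either by dual
  exactness or, at places not below the depth, by the socle element of
  \<open>depth_socle_exact\<close>. It is therefore a split injection, and replacing
  \<open>l s\<close> by its cokernel shortens the complex.\<close>

theorem split_exact:
 assumes "dep m d (fr {0} J)" "~dep m (Suc d) (fr {0} J)"
 shows "cpx l F ==> l (Suc s) = {} ==> (!!j. j < s ==> exact_at J l F j) ==>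
  (!!j. k <= j ==> j < s ==> dual_at l F j | d <= j) ==>
  k <= j ==> j < s ==>
  dual_at l F j & exact_at m l F j"
proof (induction s arbitrary: l F j)
 case (Suc s)
 note c = \<open>cpx l F\<close>
 have lm: "lmap (l (Suc j)) (l j) (F j)" for j using c by (auto simp: cpx_def)
 have FF: "F j (F (Suc j) v) : fr (l j) J" for j v using c by (auto simp: cpx_def)
 have fin: "finite (l j)" for j using lm[of j] by (auto simp: lmap_def)
 have linF: "lin (F j)" for j using lm lmap_lin by blast
 have top: "F (Suc s) v : fr (l (Suc s)) J" for v using lm[of "Suc s"] Suc.prems(2) by (auto simp: lmap_def fr_def)
 have top': "v : fr (l (Suc s)) J" if "v : range (F (Suc s)) + fr (l (Suc s)) J" for v
 proof -
  have "range (F (Suc s)) + fr (l (Suc s)) J <= fr (l (Suc s)) J" using top by (intro plus_subset[OF sJ]) auto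
  thus ?thesis using that by blast
 qed
 have inj: "v : fr (l (Suc s)) m" if v: "F s v : fr (l s) m" for v
 proof (cases "dual_at l F s")
  case True
  have "v i : m" if i: "i : l (Suc s)" for i
  proof -
   have "adm (l (Suc s)) (%v. v i)" using i by (auto simp: adm_def functional_def sm_def fr_def idl_0[OF idJ])
   moreover have "ALL v. F (Suc s) v i : J" using top i by (auto simp: fr_def)
   ultimately obtain g where g: "adm (l s) g" "!!v. v i - g (F s v) : J" using True unfolding dual_exact_def by blast
   have "g (F s v) : m" by (rule adm_fr[OF g(1) fin idm Jm v])
   thus ?thesis using idl_cong[OF idm] g(2)[of v] Jm by blast
  qed
  thus ?thesis by (simp add: fr_def)
 next
  case False
  \<comment> \<open>Exactness modulo \<open>I'\<close> survives at place s. If \<open>F s v\<close>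
    vanishes modulo m, then u v is in the kernel modulo \<open>I'\<close>, hence 0 there; a unit
    coordinate of v would put u into \<open>I'\<close>.\<close>
  hence ds: "d <= s" using Suc.prems(4)[of s] Suc.prems(5,6) by auto
  obtain I' u where I': "idl I'" "J <= I'" "u ~: I'" "ALL a:m. a * u : I'"
   "ALL j. 0 + d <= j & j < Suc s --> exact_at I' l F j"
   using depth_socle_exact[OF c idJ subset_refl assms, of 0 "Suc s"] Suc.prems(3) by blast
  have "sm u (F s v) : fr (l s) I'" using v I'(4) by (auto simp: fr_def sm_def mult.commute)
  hence uv: "sm u v : range (F (Suc s)) + fr (l (Suc s)) I'" using I'(5) ds unfolding exact_mod_def by (simp add: lin_sm[OF linF])
  have "range (F (Suc s)) + fr (l (Suc s)) I' <= fr (l (Suc s)) I'" using top fr_mono[OF I'(2)] by (intro plus_subset[OF submod_fr[OF I'(1)]]) blast+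
  hence uv: "u * v i : I'" if "i : l (Suc s)" for i using uv that by (auto simp: fr_def sm_def)
  have "v i : m" if i: "i : l (Suc s)" for i
  proof (rule ccontr)
   assume "v i ~: m"
   then obtain t where t: "v i * t - 1 : J" using unit by blast
   have "u * v i * t - u * (v i * t - 1) : I'" using I'(2) t by (intro idl_diff[OF I'(1) idl_mult2[OF I'(1) uv[OF i]]] idl_mult[OF I'(1)]) auto
   thus False using I'(3) by (simp add: algebra_simps)
  qed
  thus ?thesis by (simp add: fr_def)
 qed
 obtain pj sg B' where pj: "lmap (l s) B' pj" and sg: "lmap B' (l s) sg"
  and ker: "!!w. pj w : fr B' J \<longleftrightarrow> w : range (F s) + fr (l s) J"
  and sec: "!!c. pj (sg c) - c : fr B' J" using pivots[OF fin lm[of s] inj] by blast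
 have linpj: "lin pj" and linsg: "lin sg" using pj sg lmap_lin by auto
 have pjF: "pj (F s v) : fr B' J" for v unfolding ker mem_range_plus by (rule exI[of _ v]) (simp add: submod_0[OF sJ])
 have sgpj: "EX c. w - sg (pj w) - F s c : fr (l s) J" for w
 proof -
  have "pj (w - sg (pj w)) : fr B' J" using submod_uminus[OF sJ sec] by (simp add: lin_diff[OF linpj])
  thus ?thesis unfolding ker mem_range_plus .
 qed
 have topm: "exact_at m l F s" unfolding exact_mod_def using inj subset_plus2[OF submod_range[OF linF]] by blast
 have topd: "dual_at l F s" unfolding dual_exact_def
 proof (intro allI impI, elim conjE)
  fix f assume f: "adm (l (Suc s)) f"
  \<comment> \<open>The vectors \<open>ps i\<close> are the columns of a left inverse of
    \<open>F s\<close>: the difference \<open>w - sg (pj w)\<close> is the component of w in the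
    image of \<open>F s\<close>. Composing f with this inverse extends f along
    \<open>F s\<close>.\<close>
  have "ALL i. EX c. un i - sg (pj (un i)) - F s c : fr (l s) J" using sgpj by blast
  from choice[OF this] obtain ps where ps: "ALL i. un i - sg (pj (un i)) - F s (ps i) : fr (l s) J" ..
  define g where "g w = (SUM i:l s. w i * f (ps i))" for w
  have "functional g" by (auto simp: functional_def g_def sm_def algebra_simps sum.distrib sum_distrib_left)
  moreover have "g w = 0" if "w : fr (l s) {0}" for w using that by (auto simp: g_def fr_def intro: sum.neutral)
  ultimately have "adm (l s) g" by (auto simp: adm_def idl_0[OF idJ])
  moreover have "f v - g (F s v) : J" for v
  proof -
   define w where "w = F s v"
   define c where "c = (SUM i:l s. sm (w i) (ps i))"
   have lin1: "lin (%w. w - sg (pj w))" by (auto simp: lin_def lin_add[OF linpj] lin_add[OF linsg] lin_sm[OF linpj] lin_sm[OF linsg])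
   have "w - sg (pj w) : fr (l s) J" if "w : fr (l s) {0}" for w
   proof (rule submod_diff[OF sJ])
    show w: "w : fr (l s) J" using that fr_mono[of "{0}" J] idl_0[OF idJ] by blast
    show "sg (pj w) : fr (l s) J" by (rule lmap_J[OF sg lmap_J[OF pj w]])
   qed
   hence e1: "w - sg (pj w) - (SUM i:l s. sm (w i) (un i - sg (pj (un i)))) : fr (l s) J"
    using lin_expand[OF lin1 fin[of s], of "fr (l s) J" w] by auto
   have e2: "(SUM i:l s. sm (w i) (un i - sg (pj (un i)) - F s (ps i))) : fr (l s) J" using ps by (intro submod_sum[OF sJ] submod_sm[OF sJ]) blast
   have e2': "(SUM i:l s. sm (w i) (un i - sg (pj (un i)) - F s (ps i))) = (SUM i:l s. sm (w i) (un i - sg (pj (un i)))) - F s c"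
    unfolding c_def lin_sum[OF linF] lin_sm[OF linF] sum_subtractf[symmetric] by (intro sum.cong) auto
   have e3: "sg (pj w) : fr (l s) J" unfolding w_def by (rule lmap_J[OF sg pjF])
   have "F s (v - c) = (w - sg (pj w) - (SUM i:l s. sm (w i) (un i - sg (pj (un i)))))
     + (SUM i:l s. sm (w i) (un i - sg (pj (un i)) - F s (ps i))) + sg (pj w)" unfolding e2' by (simp add: lin_diff[OF linF] w_def)
   also have "... : fr (l s) J" by (intro submod_add[OF sJ] e1 e2 e3)
   finally have "v - c : range (F (Suc s)) + fr (l (Suc s)) J" using Suc.prems(3)[of s] by (auto simp: exact_mod_def)
   hence "f (v - c) : J" using adm_J[OF f fin] top' by blast
   moreover have "f c = g w" unfolding c_def g_def fun_sum[OF adm_fun[OF f]] fun_sm[OF adm_fun[OF f]] ..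
   ultimately show ?thesis by (simp add: fun_diff[OF adm_fun[OF f]] w_def)
  qed
  ultimately show "EX g. adm (l s) g & (ALL v. f v - g (F s v) : J)" by blast
 qed
 show ?case
 proof (cases "j = s")
  case True
  thus ?thesis using topm topd by simp
 next
  case False
  hence js: "j < s" using Suc.prems by auto
  then obtain r where r: "s = Suc r" by (cases s) auto
  define l' where "l' i = (if i < s then l i else if i = s then B' else {})" for i
  define F' where "F' i = (if i < r then F i else if i = r then (%v. F r (sg v)) else (%_. 0))" for i
  \<comment> \<open>\<open>F r\<close> kills the image of \<open>F s\<close> and hence depends only
    on \<open>pj w\<close>; this transports exactness and duality between the old and the shortened
    complex.\<close>
  have K: "F r w - F r (sg (pj w)) : fr (l r) J" for w
  proof -
   obtain c where c: "w - sg (pj w) - F s c : fr (l s) J" using sgpj by blast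
   have "F r (w - sg (pj w) - F s c) + F r (F s c) : fr (l r) J" using lmap_J[OF lm[of r]] c FF[of r c] r by (intro submod_add[OF sJ]) auto
   thus ?thesis by (simp add: lin_diff[OF linF])
  qed
  have ll: "l' (Suc i) = l (Suc i)" "l' i = l i" "F' i = F i" if "i < r" for i using that r by (auto simp: l'_def F'_def)
  have lr: "l' r = l r" "l' s = B'" "F' r = (%v. F r (sg v))" "F' s = (%_. 0)" using r by (auto simp: l'_def F'_def)
  have finB': "finite B'" using pj by (auto simp: lmap_def)
  have c': "cpx l' F'" unfolding cpx_def
  proof (intro conjI allI)
   fix i v
   have fin': "finite (l' i)" for i using fin finB' by (auto simp: l'_def)
   show "lmap (l' (Suc i)) (l' i) (F' i)" by (metis r lm ll lmap_comp sg lr lmap_0 fin' F'_def)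
   show "F' i (F' (Suc i) v) : fr (l' i) J"
   proof (cases "Suc i" r rule: linorder_cases)
    case less
    thus ?thesis using FF[of i v] ll[of i] ll[of "Suc i"] by simp
   next
    case equal
    thus ?thesis using FF[of i "sg v"] ll[of i] lr by simp
   next
    case greater
    hence "F' (Suc i) v = 0" by (simp add: F'_def)
    moreover have "F' i 0 = 0" by (simp add: F'_def lin_0[OF linF] lin_0[OF linsg])
    ultimately show ?thesis by (simp add: submod_0[OF sJ])
   qed
  qed
  have l's: "l' (Suc s) = {}" by (simp add: l'_def)
  have ex': "exact_at J l' F' i" if i: "i < s" for i
  proof (cases "Suc i" r rule: linorder_cases)
   case less
   thus ?thesis using Suc.prems(3)[of i] ll[of i] ll[of "Suc i"] i by simp
  next
   case equal
   have "v : range (F' r) + fr (l r) J" if v: "v : range (F r) + fr (l r) J" for v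
   proof -
    obtain w where w: "v - F r w : fr (l r) J" using v unfolding mem_range_plus by (elim exE)
    have "v - F r w + (F r w - F r (sg (pj w))) : fr (l r) J" by (rule submod_add[OF sJ w K])
    thus ?thesis unfolding mem_range_plus by (auto simp: lr)
   qed
   thus ?thesis using Suc.prems(3)[of i] i equal ll[of i] unfolding exact_mod_def by auto
  next
   case greater
   hence ir: "i = r" using i r by auto
   have "v : range (F' s) + fr B' J" if "F r (sg v) : fr (l r) J" for v
   proof -
    have "sg v : range (F s) + fr (l s) J" using Suc.prems(3)[of r] r that by (auto simp: exact_mod_def)
    hence "pj (sg v) - (pj (sg v) - v) : fr B' J" using ker submod_diff[OF sJ _ sec] by blast
    thus ?thesis by (simp add: lr)
   qed
   thus ?thesis unfolding exact_mod_def ir using lr r by simp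
  qed
  have d': "dual_at l' F' i"
   if i: "i < s" and de: "dual_at l F i" for i
  proof (cases "Suc i" r rule: linorder_cases)
   case less
   thus ?thesis using de ll[of i] ll[of "Suc i"] by simp
  next
   case equal
   have "f (F r v) : J" if f: "adm (l r) f" "ALL v. f (F' r v) : J" for f v
   proof -
    have "f (F r v - F r (sg (pj v))) + f (F' r (pj v)) : J" using idl_add[OF idJ] by (metis adm_J f fin K)
    thus ?thesis by (simp add: lr fun_diff[OF adm_fun[OF f(1)]])
   qed
   thus ?thesis using de equal ll[of i] unfolding dual_exact_def by auto
  next
   case greater
   hence ir: "i = r" using i r by auto
   show ?thesis unfolding dual_exact_def ir
   proof (intro allI impI, elim conjE)
    fix f' assume f': "adm (l' (Suc r)) f'"
    hence f'B: "adm B' f'" using lr r by simp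
    have "adm (l s) (%v. f' (pj v))" by (rule adm_comp[OF pj f'B])
    moreover have "ALL v. f' (pj (F s v)) : J" using adm_J[OF f'B finB' pjF] by blast
    ultimately obtain g where g: "adm (l r) g" "!!v. f' (pj v) - g (F r v) : J" using de unfolding dual_exact_def ir r by blast
    have "f' v - g (F' r v) : J" for v
    proof -
     have "(f' (pj (sg v)) - g (F r (sg v))) - f' (pj (sg v) - v) : J" using idl_diff[OF idJ g(2)] by (metis adm_J f'B finB' sec)
     thus ?thesis by (simp add: lr fun_diff[OF adm_fun[OF f'B]])
    qed
    thus "EX g. adm (l' r) g & (ALL v. f' v - g (F' r v) : J)" using g(1) lr by auto
   qed
  qed
  have IH: "dual_at l' F' j & exact_at m l' F' j" by (metis Suc.IH c' l's ex' Suc.prems js d' less_SucI)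
  show ?thesis
  proof (cases "Suc j" r rule: linorder_cases)
   case less
   thus ?thesis using IH ll[of j] ll[of "Suc j"] by simp
  next
   case equal
   have 2: "v : range (F r) + fr (l r) m" if "v : range (F' r) + fr (l r) m" for v using that unfolding mem_range_plus lr by blast
   show ?thesis using IH 2 equal ll[of j] lr unfolding dual_exact_def exact_mod_def by auto
  next
   case greater
   hence jr: "j = r" using js r by auto
   have IHd: "dual_exact (l r) (F' r) B' (%_. 0)" and IHm: "exact_mod m (l r) (F' r) B' (%_. 0)" using IH lr jr r by auto
   have "dual_exact (l r) (F r) (l s) (F s)" unfolding dual_exact_def
   proof (intro allI impI, elim conjE)
    fix f assume f: "adm (l s) f" and fF: "ALL v. f (F s v) : J"
    have "adm B' (%v. f (sg v))" by (rule adm_comp[OF sg f])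
    moreover have "f (sg 0) : J" by (simp add: lin_0[OF linsg] fun_0[OF adm_fun[OF f]] idl_0[OF idJ])
    ultimately obtain g where g: "adm (l r) g" "!!v. f (sg v) - g (F' r v) : J" using IHd unfolding dual_exact_def by blast
    have "f v - g (F r v) : J" for v
    proof -
     obtain c where c: "v - sg (pj v) - F s c : fr (l s) J" using sgpj by blast
     have "f v - g (F r v) = f (v - sg (pj v) - F s c) + f (F s c) + (f (sg (pj v)) - g (F' r (pj v))) - g (F r v - F r (sg (pj v)))"
      by (simp add: fun_diff[OF adm_fun[OF f]] fun_diff[OF adm_fun[OF g(1)]] lr)
     also have "... : J" using fF g(2) by (intro idl_diff[OF idJ idl_add[OF idJ idl_add[OF idJ adm_J[OF f fin c]]] adm_J[OF g(1) fin K]]) auto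
     finally show ?thesis .
    qed
    thus "EX g. adm (l r) g & (ALL v. f v - g (F r v) : J)" using g(1) by blast
   qed
   moreover have "exact_mod m (l r) (F r) (l s) (F s)" unfolding exact_mod_def
   proof (intro allI impI)
    fix v assume v: "F r v : fr (l r) m"
    have "F r v - (F r v - F r (sg (pj v))) : fr (l r) m" by (intro submod_diff[OF s_m v] subsetD[OF fr_mono[OF Jm]] K)
    hence 1: "sg (pj v) : fr (l s) m" using IHm lr lmap_m sg unfolding exact_mod_def by simp
    obtain c where c: "v - sg (pj v) - F s c : fr (l s) J" using sgpj by blast
    have "(v - sg (pj v) - F s c) + sg (pj v) : fr (l s) m" by (rule submod_add[OF s_m subsetD[OF fr_mono[OF Jm] c] 1])
    thus "v : range (F s) + fr (l s) m" unfolding mem_range_plus by auto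
   qed
   ultimately show ?thesis using jr r by simp
  qed
 qed
qed simp

end


section \<open>Localization at a prime\<close>

definition tr :: "(nat => nat => 'a) => nat => nat => 'a" where
 "tr M = (%i j. M j i)"

definition prime_chain :: "'a::comm_ring_1 set => nat => (nat => 'a set) => bool" where
 "prime_chain J n Q \<longleftrightarrow> (ALL i<=n. prime_idl (Q i) & J <= Q i) & (ALL i<n. Q i \<subset> Q (Suc i))"

lemma mv_un: "finite N ==> k : N ==> mv N M (un k) = (%i. M i k)" by (auto simp: mv_def un_def fun_eq_iff if_distrib cong: if_cong)

lemma dot_mv: "(SUM i:B. f i * mv N M v i) = (SUM k:N. v k * mv B (tr M) f k)" unfolding mv_def tr_def sum_distrib_left
 by (subst sum.swap) (intro sum.cong refl, simp add: mult.commute mult.left_commute)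

context nloc begin

lemma lmap_mv: "finite N ==> finite B ==> lmap N B (mv N M)" unfolding lmap_def using lin_mv by (auto simp: mv_def fr_def idl_0[OF idJ])

lemma adm_dot: "finite N ==> adm N (%v. SUM i:N. f i * v i)"
 by (auto simp: adm_def functional_def fr_def idl_0[OF idJ] sm_def algebra_simps sum.distrib sum_distrib_left)

lemma adm_eq_dot: "finite N ==> adm N f ==> f v - (SUM i:N. f (un i) * v i) : J" using fun_expand[of f N J v] by (simp add: adm_def mult.commute)

text \<open>Every functional on a free module is a dot product modulo \<open>J\<close>, so
  precomposition with a matrix is multiplication by its transpose.\<close>

lemma dual_exact_iff:
 assumes fin: "finite B" "finite N" "finite C"
 shows "dual_exact B (mv N M) N (mv C M') \<longleftrightarrow> exact_mod J C (mv N (tr M')) N (mv B (tr M))"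
proof
 assume d: "dual_exact B (mv N M) N (mv C M')"
 show "exact_mod J C (mv N (tr M')) N (mv B (tr M))" unfolding exact_mod_def
 proof (intro allI impI)
  fix f assume f: "mv N (tr M') f : fr C J"
  have "(SUM i:N. f i * mv C M' v i) : J" for v using f by (subst dot_mv) (intro idl_sum[OF idJ] idl_mult[OF idJ], auto simp: fr_def)
  then obtain g where g: "adm B g" "!!v. (SUM i:N. f i * v i) - g (mv N M v) : J" using d adm_dot[OF fin(2)] unfolding dual_exact_def by blast
  have "(f - mv B (tr M) (%i. g (un i))) k : J" if k: "k : N" for k
  proof -
   have 1: "f k - g (mv N M (un k)) : J" using g(2)[of "un k"] k fin by (simp add: un_def if_distrib cong: if_cong)
   have "g (mv N M (un k)) - (SUM i:B. g (un i) * mv N M (un k) i) : J" by (rule adm_eq_dot[OF fin(1) g(1)])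
   thus ?thesis using idl_trans[OF idJ 1] by (simp add: mv_un[OF fin(2) k] mv_def[of B] tr_def mult.commute)
  qed
  thus "f : range (mv B (tr M)) + fr N J" unfolding mem_range_plus by (auto simp: fr_def)
 qed
next
 assume e: "exact_mod J C (mv N (tr M')) N (mv B (tr M))"
 show "dual_exact B (mv N M) N (mv C M')" unfolding dual_exact_def
 proof (intro allI impI, elim conjE)
  fix f assume f: "adm N f" and fJ: "ALL v. f (mv C M' v) : J"
  define ph where "ph = (%i. f (un i))"
  have "mv N (tr M') ph k : J" if k: "k : C" for k
  proof -
   have "f (mv C M' (un k)) - (SUM i:N. f (un i) * mv C M' (un k) i) : J" by (rule adm_eq_dot[OF fin(2) f])
   hence "f (mv C M' (un k)) - mv N (tr M') ph k : J" by (simp add: mv_un[OF fin(3) k] mv_def[of N] tr_def mult.commute ph_def)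
   thus ?thesis using fJ idl_cong[OF idJ] by blast
  qed
  hence "mv N (tr M') ph : fr C J" by (simp add: fr_def)
  then obtain gq where gq: "ph - mv B (tr M) gq : fr N J" using e unfolding exact_mod_def mem_range_plus by blast
  have "f v - (SUM i:B. gq i * mv N M v i) : J" for v
  proof -
   have 1: "f v - (SUM i:N. ph i * v i) : J" unfolding ph_def by (rule adm_eq_dot[OF fin(2) f])
   have "(SUM i:N. v i * (ph - mv B (tr M) gq) i) : J" using gq by (intro idl_sum[OF idJ] idl_mult[OF idJ]) (auto simp: fr_def)
   thus ?thesis using idl_trans[OF idJ 1] by (subst dot_mv) (simp add: algebra_simps sum_subtractf)
  qed
  thus "EX g. adm B g & (ALL v. f v - g (mv N M v) : J)" using adm_dot[OF fin(1)] by blast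
 qed
qed

end

text \<open>Localization at P up to isomorphism: elements outside P become units, each element is a
  fraction, and only elements killed by some s outside P vanish. The abstract form serves because
  the localized ring lives on another type.\<close>

locale localiz = noeth J + L: nloc J' m'
 for J :: "'a::comm_ring_1 set" and J' m' :: "'b::comm_ring_1 set" +
 fixes P :: "'a set" and io :: "'a => 'b"
 assumes P: "prime_idl P" and JP: "J <= P"
  and io_add: "!!x y. io (x + y) - (io x + io y) : J'"
  and io_mult: "!!x y. io (x * y) - io x * io y : J'"
  and io_1: "io 1 - 1 : J'"
  and io_unit: "!!s. s ~: P ==> io s ~: m'"
  and io_surj: "!!z. EX a s. s ~: P & io s * z - io a : J'"
  and io_ker: "!!a. io a : J' \<longleftrightarrow> (EX s. s ~: P & s * a : J)"
begin

lemma idP: "idl P" using P prime_idl_idl by blast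

lemma P_mult: "s ~: P ==> t ~: P ==> s * t ~: P" using P by (auto simp: prime_idl_def)

lemma one_P: "1 ~: P" using P by (auto simp: prime_idl_def)

lemma io_0: "io 0 : J'" using io_ker[of 0] one_P idl_0[OF idJ] by (metis mult_zero_right)

lemma io_J: "a : J ==> io a : J'" using io_ker[of a] one_P by (metis mult_1)

lemma io_diff: "io (x - y) - (io x - io y) : J'"
proof -
 have "- (io (x - y + y) - (io (x - y) + io y)) : J'" by (metis io_add idl_uminus L.idJ)
 thus ?thesis by (simp add: algebra_simps)
qed

lemma io_sum: "io (SUM i:N. f i) - (SUM i:N. io (f i)) : J'"
proof (induction N rule: infinite_finite_induct)
 case (insert k N)
 have "(io (f k + sum f N) - (io (f k) + io (sum f N))) + (io (sum f N) - (SUM i:N. io (f i))) : J'" by (rule idl_add[OF L.idJ io_add insert.IH])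
 thus ?case using insert by (simp add: algebra_simps)
qed (simp_all add: io_0)

lemma io_P: "a : P ==> io a : m'"
proof (rule ccontr)
 assume a: "a : P" and "io a ~: m'"
 then obtain z where z: "io a * z - 1 : J'" using L.unit by blast
 obtain b s where bs: "s ~: P" "io s * z - io b : J'" using io_surj by blast
 have "io (a * b) - io s = (io (a * b) - io a * io b) - io a * (io s * z - io b) + io s * (io a * z - 1)" by (simp add: algebra_simps)
 also have "... : J'" by (rule idl_add[OF L.idJ idl_diff[OF L.idJ io_mult idl_mult[OF L.idJ bs(2)]] idl_mult[OF L.idJ z]])
 finally have "io (a * b) - io s : J'" .
 then obtain u where u: "u ~: P" "u * (a * b - s) : J" using io_diff idl_cong[OF L.idJ] io_ker by blast
 hence "a * b - s : P" using JP P by (auto simp: prime_idl_def)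
 thus False using idl_cong[OF idP] idl_mult2[OF idP a] bs by blast
qed

definition vl :: "(nat => 'a) => nat => 'b" where "vl v = (%i. io (v i))"
definition ml :: "(nat => nat => 'a) => nat => nat => 'b" where "ml M = (%i j. io (M i j))"

lemma sJ': "submod (fr N J')" by (rule submod_fr[OF L.idJ])

lemma vl_sm: "vl (sm s v) - sm (io s) (vl v) : fr N J'" using io_mult by (auto simp: vl_def sm_def fr_def)
lemma vl_add: "vl (v + w) - (vl v + vl w) : fr N J'" using io_add by (auto simp: vl_def fr_def)
lemma vl_diff: "vl (v - w) - (vl v - vl w) : fr N J'" using io_diff by (auto simp: vl_def fr_def)
lemma vl_J: "v : fr N J ==> vl v : fr N J'" using io_J by (auto simp: vl_def fr_def)

lemma vl_mv: "vl (mv N M v) - mv N (ml M) (vl v) : fr B J'"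
proof -
 have "io (SUM j:N. M i j * v j) - (SUM j:N. io (M i j) * io (v j)) : J'" for i
 proof -
  have "(SUM j:N. io (M i j * v j) - io (M i j) * io (v j)) : J'" by (intro idl_sum[OF L.idJ] io_mult)
  hence "(SUM j:N. io (M i j * v j)) - (SUM j:N. io (M i j) * io (v j)) : J'" by (simp add: sum_subtractf)
  thus ?thesis by (rule idl_trans[OF L.idJ io_sum])
 qed
 thus ?thesis by (auto simp: vl_def ml_def mv_def fr_def)
qed

lemma common_denominator: "finite N ==> EX v s. s ~: P & sm (io s) z - vl v : fr N J'"
proof (induction N rule: finite_induct)
 case empty
 thus ?case using one_P by (auto simp: fr_def)
next
 case (insert k N)
 then obtain v s where vs: "s ~: P" "sm (io s) z - vl v : fr N J'" by blast
 obtain a u where au: "u ~: P" "io u * z k - io a : J'" using io_surj by blast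
 define w where "w = (%i. if i = k then s * a else u * v i)"
 have "io (u * s) * z i - io (w i) : J'" if "i : insert k N" for i
 proof (cases "i = k")
  case True
  have "io (u * s) * z i - io (w i) = (io (u * s) - io u * io s) * z k + io s * (io u * z k - io a) - (io (s * a) - io s * io a)"
   using True by (simp add: w_def algebra_simps)
  also have "... : J'" by (rule idl_diff[OF L.idJ idl_add[OF L.idJ idl_mult2[OF L.idJ io_mult] idl_mult[OF L.idJ au(2)]] io_mult])
  finally show ?thesis .
 next
  case False
  hence vi: "io s * z i - io (v i) : J'" using vs that by (auto simp: fr_def sm_def vl_def)
  have "io (u * s) * z i - io (w i) = (io (u * s) - io u * io s) * z i + io u * (io s * z i - io (v i)) - (io (u * v i) - io u * io (v i))"
   using False by (simp add: w_def algebra_simps)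
  also have "... : J'" by (rule idl_diff[OF L.idJ idl_add[OF L.idJ idl_mult2[OF L.idJ io_mult] idl_mult[OF L.idJ vi]] io_mult])
  finally show ?thesis .
 qed
 thus ?case using P_mult[OF au(1) vs(1)] by (auto simp: fr_def sm_def vl_def)
qed

lemma vl_ker: "finite N ==> vl v : fr N J' ==> EX s. s ~: P & sm s v : fr N J"
proof (induction N rule: finite_induct)
 case empty
 thus ?case using one_P by (auto simp: fr_def)
next
 case (insert k N)
 then obtain s where s: "s ~: P" "sm s v : fr N J" by (auto simp: fr_def)
 obtain u where u: "u ~: P" "u * v k : J" using insert io_ker by (auto simp: fr_def vl_def)
 show ?case
  using s idl_mult[OF idJ, of "s * v _" u] idl_mult[OF idJ u(2), of s] P_mult[OF u(1) s(1)] by (auto simp: fr_def sm_def mult.assoc mult.left_commute)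
qed

text \<open>The localization of U inside the free module on N: z is the fraction v / s, up to the
  relations of that free module.\<close>

definition loc :: "nat set => (nat => 'a) set => (nat => 'b) set" where
 "loc N U = {z. EX v s. v : U & s ~: P & sm (io s) z - vl v : fr N J'}"

lemma fr_sub_loc: "fr N J' <= loc N U" if "submod U" using vl_J submod_0 submod_fr idJ submod_diff sJ' submod_sm that one_P unfolding loc_def by blast

lemma loc_memI: "v : U ==> s ~: P ==> sm (io s) z - vl v : fr N J' ==> z : loc N U" unfolding loc_def by blast

lemma vl_loc: "v : U ==> vl v : loc N U"
proof (rule loc_memI[OF _ one_P])
 have "sm (io 1 - 1) (vl v) : fr N J'" using io_1 idl_mult2[OF L.idJ] by (auto simp: fr_def sm_def)
 thus "sm (io 1) (vl v) - vl v : fr N J'" by (simp add: sm_diff_left)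
qed

lemma loc_scale: "sm (io s) z - vl v : fr N J' ==> sm (io (u * s)) z - vl (sm u v) : fr N J'"
proof -
 assume a: "sm (io s) z - vl v : fr N J'"
 have 1: "sm (io (u * s) - io u * io s) z : fr N J'" using io_mult idl_mult2[OF L.idJ] by (auto simp: fr_def sm_def)
 have "sm (io (u * s)) z - vl (sm u v) = sm (io (u * s) - io u * io s) z + sm (io u) (sm (io s) z - vl v) - (vl (sm u v) - sm (io u) (vl v))"
  by (simp add: sm_diff_left)
 also have "... : fr N J'" by (rule submod_diff[OF sJ' submod_add[OF sJ' 1 submod_sm[OF sJ' a]] vl_sm])
 finally show ?thesis .
qed

lemma submod_loc: assumes U: "submod U" shows "submod (loc N U)" unfolding submod_def
proof (intro conjI ballI allI)
 show "0 : loc N U" using fr_sub_loc[OF U] submod_0[OF sJ'] by blast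
 fix z assume "z : loc N U"
 then obtain v s where v: "v : U" "s ~: P" "sm (io s) z - vl v : fr N J'" unfolding loc_def by blast
 { fix z' assume "z' : loc N U"
  then obtain v' s' where v': "v' : U" "s' ~: P" "sm (io s') z' - vl v' : fr N J'" unfolding loc_def by blast
  have 1: "sm (io (s' * s)) z - vl (sm s' v) : fr N J'" by (rule loc_scale[OF v(3)])
  have 2: "sm (io (s' * s)) z' - vl (sm s v') : fr N J'" using loc_scale[OF v'(3), of s] by (simp add: mult.commute)
  have "sm (io (s' * s)) (z + z') - vl (sm s' v + sm s v') =
    (sm (io (s' * s)) z - vl (sm s' v)) + (sm (io (s' * s)) z' - vl (sm s v')) - (vl (sm s' v + sm s v') - (vl (sm s' v) + vl (sm s v')))" by simp
  also have "... : fr N J'" by (rule submod_diff[OF sJ' submod_add[OF sJ' 1 2] vl_add])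
  finally show "z + z' : loc N U" by (rule loc_memI[OF submod_add[OF U submod_sm[OF U v(1)] submod_sm[OF U v'(1)]] P_mult[OF v'(2) v(2)]]) }
 fix c
 obtain a t where at: "t ~: P" "io t * c - io a : J'" using io_surj by blast
 have 1: "sm (io (t * s) - io t * io s) (sm c z) : fr N J'" using io_mult idl_mult2[OF L.idJ] by (auto simp: fr_def sm_def)
 have 2: "sm (io t * c - io a) (vl v) : fr N J'" using at idl_mult2[OF L.idJ] by (auto simp: fr_def sm_def)
 have "sm (io (t * s)) (sm c z) - vl (sm a v) = sm (io (t * s) - io t * io s) (sm c z) + sm (io t * c) (sm (io s) z - vl v)
   + sm (io t * c - io a) (vl v) - (vl (sm a v) - sm (io a) (vl v))" by (simp add: fun_eq_iff sm_def algebra_simps) also have "... : fr N J'"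
  by (rule submod_diff[OF sJ' submod_add[OF sJ' submod_add[OF sJ' 1 submod_sm[OF sJ' v(3)]] 2] vl_sm])
 finally show "sm c z : loc N U" by (rule loc_memI[OF submod_sm[OF U v(1)] P_mult[OF at(1) v(2)]])
qed

lemma good_loc: "finite N ==> submod U ==> L.good (loc N U)" unfolding L.good_def using submod_loc fr_sub_loc by blast

lemma vl_loc_D:
 assumes N: "finite N" and U: "submod U" "fr N J <= U" and v: "vl v : loc N U"
 shows "EX s. s ~: P & sm s v : U"
proof -
 obtain w s where w: "w : U" "s ~: P" "sm (io s) (vl v) - vl w : fr N J'" using v unfolding loc_def by blast
 have "vl (sm s v - w) = (vl (sm s v - w) - (vl (sm s v) - vl w)) + (vl (sm s v) - sm (io s) (vl v)) + (sm (io s) (vl v) - vl w)" by simp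
 also have "... : fr N J'" by (rule submod_add[OF sJ' submod_add[OF sJ' vl_diff vl_sm] w(3)])
 finally obtain u where u: "u ~: P" "sm u (sm s v - w) : fr N J" using vl_ker[OF N] by blast
 have "sm u (sm s v - w) + sm u w : U" using u(2) U(2) by (intro submod_add[OF U(1) _ submod_sm[OF U(1) w(1)]]) auto
 thus ?thesis using P_mult[OF u(1) w(2)] by auto
qed

lemma loc_frac:
 assumes N: "finite N" and U: "submod U" "fr N J <= U" and z: "z : loc N U" "s ~: P" "sm (io s) z - vl v : fr N J'"
 shows "EX u. u ~: P & sm u v : U"
proof (rule vl_loc_D[OF N U])
 have sl: "submod (loc N U)" by (rule submod_loc[OF U(1)])
 show "vl v : loc N U" using z(3) fr_sub_loc[OF U(1)] submod_cong[OF sl] submod_sm[OF sl z(1)] by blast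
qed

lemma loc_range:
 assumes fin: "finite N" "finite B"
 shows "loc B (range (mv N M) + fr B J) = range (mv N (ml M)) + fr B J'" (is "_ = ?R")
proof
 have sU: "submod (range (mv N M) + fr B J)" by (rule submod_plus[OF submod_range[OF lin_mv] submod_fr[OF idJ]])
 have sR: "submod ?R" by (rule submod_plus[OF submod_range[OF lin_mv] sJ'])
 have gR: "L.good ?R" unfolding L.good_def using sR fin(2) subset_plus2[OF submod_range[OF lin_mv]] by blast
 show "loc B (range (mv N M) + fr B J) <= ?R"
 proof
  fix z assume "z : loc B (range (mv N M) + fr B J)"
  then obtain v s where v: "v : range (mv N M) + fr B J" "s ~: P" "sm (io s) z - vl v : fr B J'" unfolding loc_def by blast
  obtain c where c: "v - mv N M c : fr B J" using v(1) unfolding mem_range_plus by blast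
  have "sm (io s) z - mv N (ml M) (vl c) = (sm (io s) z - vl v) - (vl (v - mv N M c) - (vl v - vl (mv N M c))) + vl (v - mv N M c)
    + (vl (mv N M c) - mv N (ml M) (vl c))" by simp also have "... : fr B J'"
   by (rule submod_add[OF sJ' submod_add[OF sJ' submod_diff[OF sJ' v(3) vl_diff] vl_J[OF c]] vl_mv])
  finally have "sm (io s) z : ?R" unfolding mem_range_plus by blast
  thus "z : ?R" by (rule L.unit_cancel[OF gR io_unit[OF v(2)]])
 qed
 show "?R <= loc B (range (mv N M) + fr B J)"
 proof (rule plus_subset[OF submod_loc[OF sU] _ fr_sub_loc[OF sU]], safe)
  fix c
  obtain v s where v: "s ~: P" "sm (io s) c - vl v : fr N J'" using common_denominator[OF fin(1)] by blast
  have "mv N (ml M) (sm (io s) c - vl v) : fr B J'" by (rule L.lmap_J[OF L.lmap_mv[OF fin] v(2)])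
  hence 1: "sm (io s) (mv N (ml M) c) - mv N (ml M) (vl v) : fr B J'" by (simp add: lin_diff[OF lin_mv] lin_sm[OF lin_mv])
  have "sm (io s) (mv N (ml M) c) - vl (mv N M v) : fr B J'" using submod_diff[OF sJ' 1 vl_mv[of N M v B]] by simp
  moreover have "mv N M v : range (mv N M) + fr B J" using subset_plus1[OF submod_fr[OF idJ], of "range (mv N M)" B] by blast
  ultimately show "mv N (ml M) c : loc B (range (mv N M) + fr B J)" using loc_memI[OF _ v(1)] by blast
 qed
qed

text \<open>Flatness of localization in coordinates: clear denominators, then multiply by an element
  outside P that makes the vanishing hold before localizing.\<close>

lemma exact_loc:
 assumes fin: "finite B" "finite N" "finite C"
  and ex: "!!v. mv N M v : fr B J ==> v : range (mv C M') + fr N J"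
 shows "L.exact_mod J' B (mv N (ml M)) N (mv C (ml M'))" unfolding L.exact_mod_def
proof (intro allI impI)
 fix z assume z: "mv N (ml M) z : fr B J'"
 obtain v s where v: "s ~: P" "sm (io s) z - vl v : fr N J'" using common_denominator[OF fin(2)] by blast
 have "mv N (ml M) (sm (io s) z - vl v) : fr B J'" by (rule L.lmap_J[OF L.lmap_mv[OF fin(2,1)] v(2)])
 then obtain u where u: "u ~: P" "sm u (mv N M v) : fr B J" using submod_cong[OF sJ'] submod_sm[OF sJ' z] submod_cong[OF sJ' vl_mv] vl_ker[OF fin(1)] by (metis lin_diff lin_mv lin_sm)
 hence "sm u v : range (mv C M') + fr N J" using ex[of "sm u v"] by (simp add: lin_sm[OF lin_mv])
 moreover have "sm (io (u * s)) z - vl (sm u v) : fr N J'" by (rule loc_scale[OF v(2)])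
 ultimately have "z : loc N (range (mv C M') + fr N J)" using loc_memI[OF _ P_mult[OF u(1) v(1)]] by blast
 thus "z : range (mv C (ml M')) + fr N J'" unfolding loc_range[OF fin(3,2)] .
qed

lemma loc_plus:
 assumes N: "finite N" and U: "submod U"
 shows "loc N (U + range (sm x)) = loc N U + range (sm (io x))"
proof
 show "loc N (U + range (sm x)) <= loc N U + range (sm (io x))"
 proof
  fix z assume "z : loc N (U + range (sm x))"
  then obtain v s where v: "v : U + range (sm x)" "s ~: P" "sm (io s) z - vl v : fr N J'" unfolding loc_def by blast
  obtain w where w: "v - sm x w : U" using v(1) unfolding mem_plus_range by blast
  have frl: "y : loc N U" if "y : fr N J'" for y using that fr_sub_loc[OF U] by blast
  have "sm (io s) z - sm (io x) (vl w) = (sm (io s) z - vl v) - (vl (v - sm x w) - (vl v - vl (sm x w))) + vl (v - sm x w)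
    + (vl (sm x w) - sm (io x) (vl w))" by simp also have "... : loc N U"
   by (intro submod_add[OF submod_loc[OF U]] frl[OF submod_diff[OF sJ' v(3) vl_diff]] vl_loc[OF w] frl[OF vl_sm])
  finally have "sm (io s) z : loc N U + range (sm (io x))" unfolding mem_plus_range by blast
  thus "z : loc N U + range (sm (io x))" by (rule L.unit_cancel[OF L.good_mono[OF good_loc[OF N U] submod_plus[OF submod_loc[OF U] submod_range[OF lin_sm_fun]] subset_plus1[OF submod_range[OF lin_sm_fun]]] io_unit[OF v(2)]])
 qed
 show "loc N U + range (sm (io x)) <= loc N (U + range (sm x))"
 proof (rule plus_subset[OF submod_loc[OF submod_plus[OF U submod_range[OF lin_sm_fun]]]])
  show "loc N U <= loc N (U + range (sm x))" unfolding loc_def using subset_plus1[OF submod_range[OF lin_sm_fun], of U x] by blast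
  show "range (sm (io x)) <= loc N (U + range (sm x))"
  proof safe
   fix z
   obtain v s where v: "s ~: P" "sm (io s) z - vl v : fr N J'" using common_denominator[OF N] by blast
   have "sm (io x) (sm (io s) z - vl v) - (vl (sm x v) - sm (io x) (vl v)) : fr N J'" by (rule submod_diff[OF sJ' submod_sm[OF sJ' v(2)] vl_sm])
   hence "sm (io s) (sm (io x) z) - vl (sm x v) : fr N J'" by (simp add: mult.commute)
   moreover have "sm x v : U + range (sm x)" unfolding mem_plus_range by (rule exI[of _ v]) (simp add: submod_0[OF U])
   ultimately show "sm (io x) z : loc N (U + range (sm x))" using loc_memI[OF _ v(1)] by blast
  qed
 qed
qed

lemma reg_loc:
 assumes N: "finite N" and U: "submod U" "fr N J <= U" and x: "reg x U" shows "reg (io x) (loc N U)" unfolding reg_def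
proof (intro allI impI)
 fix z assume z: "sm (io x) z : loc N U"
 obtain v s where v: "s ~: P" "sm (io s) z - vl v : fr N J'" using common_denominator[OF N] by blast
 have "sm (io x) (sm (io s) z - vl v) - (vl (sm x v) - sm (io x) (vl v)) : fr N J'" by (rule submod_diff[OF sJ' submod_sm[OF sJ' v(2)] vl_sm])
 hence "sm (io s) (sm (io x) z) - vl (sm x v) : fr N J'" by (simp add: mult.commute)
 then obtain u where u: "u ~: P" "sm u (sm x v) : U" using loc_frac[OF N U z v(1)] by blast
 show "z : loc N U" using u(2) x loc_memI[OF _ P_mult[OF u(1) v(1)] loc_scale[OF v(2)]] unfolding reg_def by (simp add: mult.commute)
qed

text \<open>Regular elements stay regular under localization, and elements of P land in
  \<open>m'\<close>. Before localizing, the depth is measured by sequences inside P.\<close>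

lemma dep_loc:
 assumes N: "finite N"
 shows "submod U ==> fr N J <= U ==> dep P k U ==> dep m' k (loc N U)"
proof (induction k arbitrary: U)
 case (Suc k)
 then obtain x where x: "x : P" "reg x U" "dep P k (U + range (sm x))" by auto
 have "dep m' k (loc N (U + range (sm x)))" using Suc.prems subset_plus1[OF submod_range[OF lin_sm_fun], of U x]
  by (intro Suc.IH[OF submod_plus[OF _ submod_range[OF lin_sm_fun]] _ x(3)]) auto
 thus ?case using io_P[OF x(1)] reg_loc[OF N Suc.prems(1,2) x(2)] by (auto simp: loc_plus[OF N Suc.prems(1)])
qed simp

lemma contract_chain:
 assumes "prime_chain J' n Q"
 shows "EX Q'. prime_chain J n Q' & (ALL i<=n. Q' i <= P)"
proof (intro exI conjI)
 let ?Q = "%i. {x. io x : Q i}"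
 have prime: "prime_idl (?Q i) & J <= ?Q i & ?Q i <= P" if i: "i <= n" for i
 proof -
  have Qi: "prime_idl (Q i)" "J' <= Q i" using assms i by (auto simp: prime_chain_def)
  have idQ: "idl (Q i)" using Qi prime_idl_idl by blast
  have cong: "a - b : J' ==> a : Q i \<longleftrightarrow> b : Q i" for a b using idl_cong[OF idQ] Qi(2) by blast
  have 1: "idl (?Q i)" unfolding idl_def
  proof (intro conjI ballI allI)
   show "0 : ?Q i" using io_0 Qi(2) by auto
   show "x + y : ?Q i" if "x : ?Q i" "y : ?Q i" for x y using that cong[OF io_add] idl_add[OF idQ] by auto
   show "c * x : ?Q i" if "x : ?Q i" for c x using that cong[OF io_mult] idl_mult[OF idQ] by auto
  qed
  have 2: "1 ~: ?Q i" using cong[OF io_1] Qi(1) by (auto simp: prime_idl_def)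
  have 3: "a : ?Q i | b : ?Q i" if "a * b : ?Q i" for a b using that cong[OF io_mult] Qi(1) by (auto simp: prime_idl_def)
  have "Q i <= m'"
  proof
   fix z assume z: "z : Q i"
   show "z : m'"
   proof (rule ccontr)
    assume "z ~: m'"
    then obtain t where "z * t - 1 : J'" using L.unit by blast
    thus False using cong idl_mult2[OF idQ z] Qi(1) by (metis prime_idl_def)
   qed
  qed
  thus ?thesis using io_unit 1 2 3 io_J Qi(2) unfolding prime_idl_def by auto
 qed
 have "?Q i \<subset> ?Q (Suc i)" if i: "i < n" for i
 proof -
  have lt: "Q i \<subset> Q (Suc i)" and J: "J' <= Q i" "J' <= Q (Suc i)" and pr: "prime_idl (Q i)" "prime_idl (Q (Suc i))"
   using assms i by (auto simp: prime_chain_def)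
  then obtain z where z: "z : Q (Suc i)" "z ~: Q i" by blast
  obtain a s where as: "s ~: P" "io s * z - io a : J'" using io_surj by blast
  have "io a : Q (Suc i)" using idl_cong[OF prime_idl_idl[OF pr(2)], of "io s * z" "io a"] as J idl_mult[OF prime_idl_idl[OF pr(2)] z(1)] by blast
  moreover have "io a ~: Q i"
  proof
   assume "io a : Q i"
   hence "io s : Q i" using idl_cong[OF prime_idl_idl[OF pr(1)], of "io s * z" "io a"] as J pr(1) z(2) by (auto simp: prime_idl_def)
   thus False using prime[of i] i as by auto
  qed
  ultimately show ?thesis using lt by auto
 qed
 thus "prime_chain J n ?Q" unfolding prime_chain_def using prime by blast
 show "ALL i<=n. ?Q i <= P" using prime by blast
qed

end

section \<open>The acyclicity argument at an arbitrary prime\<close>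

context nloc begin

lemma dep_max: "~dep m n U ==> EX d<n. dep m d U & ~dep m (Suc d) U"
proof (induction n)
 case (Suc n)
 thus ?case by (cases "dep m n U") (auto simp del: dep.simps(2) intro: less_SucI)
qed simp

text \<open>By \<open>split_exact\<close> it is enough that the dual complex is exact. The
  hypothesis \<open>local\<close> says that the cokernel of the first dual map has at every prime at
  least the depth of the ring there, capped at t.\<close>

theorem split_of_local_depth:
 assumes t: "dep m t (fr {0} J)" "~dep m (Suc t) (fr {0} J)"
  and fin: "!!j. finite (l j)"
  and comp: "!!j v. mv (l (Suc j)) (M j) (mv (l (Suc (Suc j))) (M (Suc j)) v) : fr (l j) J"
  and ls: "l (Suc s) = {}"
  and ex: "!!j. j < s ==> exact_mod J (l j) (mv (l (Suc j)) (M j)) (l (Suc j)) (mv (l (Suc (Suc j))) (M (Suc j)))"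
  and local: "!!P. prime_idl P ==> J <= P ==> EX (J'::'b::comm_ring_1 set) m' io. localiz J J' m' P io &
    (ALL e<=t. dep m' e (fr {0} J') --> dep m' e (localiz.loc J' P io (l 1) (range (mv (l 0) (tr (M 0))) + fr (l 1) J)))" and j: "j < s"
 shows "exact_mod m (l j) (mv (l (Suc j)) (M j)) (l (Suc j)) (mv (l (Suc (Suc j))) (M (Suc j)))"
proof -
 define F where "F j = mv (l (Suc j)) (M j)" for j
 define T where "T j = mv (l j) (tr (M j))" for j
 have c: "cpx l F" unfolding cpx_def F_def using lmap_mv fin comp by blast
 have exF: "exact_at J l F j" if "j < s" for j using ex[OF that] by (simp add: F_def)
 have dT: "dual_at l F j \<longleftrightarrow> exact_mod J (l (Suc (Suc j))) (T (Suc j)) (l (Suc j)) (T j)" for j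
  unfolding F_def T_def by (rule dual_exact_iff[OF fin fin fin])
 have compT: "T (Suc j) (T j f) : fr (l (Suc (Suc j))) J" for j f
 proof -
  have "T (Suc j) (T j f) k : J" if k: "k : l (Suc (Suc j))" for k
  proof -
   have "(SUM i:l j. f i * F j (F (Suc j) (un k)) i) : J" using c by (intro idl_sum[OF idJ] idl_mult[OF idJ]) (auto simp: cpx_def fr_def)
   also have "(SUM i:l j. f i * F j (F (Suc j) (un k)) i) = (SUM i:l (Suc j). T j f i * F (Suc j) (un k) i)"
    unfolding F_def T_def by (subst dot_mv) (simp add: mult.commute)
   also have "... = (SUM i:l (Suc (Suc j)). un k i * T (Suc j) (T j f) i)" unfolding F_def T_def by (rule dot_mv)
   also have "... = (SUM i:l (Suc (Suc j)). if i = k then T (Suc j) (T j f) i else 0)" by (intro sum.cong) (auto simp: un_def)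
   also have "... = T (Suc j) (T j f) k" using fin k by simp
   finally show ?thesis .
  qed
  thus ?thesis by (simp add: fr_def)
 qed
 \<comment> \<open>At places from t on, the depth of the ring alone forces dual exactness.\<close>
 have AB: "dual_at l F j" if "t <= j" "j < s" for j
  using split_exact[OF t c ls exF, where k = t and j = j] that by blast
 have all: "dual_at l F j" if "j < s" for j
 proof (rule ccontr)
  assume "~?thesis"
  hence "EX j. j < s & ~dual_at l F j" using that by blast
  then obtain j where j: "j < s" "~dual_at l F j"
   and min: "!!i. i < j ==> i < s ==> dual_at l F i"
   using exists_least_iff[of "%j. j < s & ~dual_at l F j"] by blast
  define U where "U i = range (T i) + fr (l (Suc i)) J" for i
  have linT: "lin (T i)" for i unfolding T_def by (rule lin_mv)
  have sU: "submod (U i)" for i unfolding U_def by (rule submod_plus[OF submod_range[OF linT] sJ])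
  have frU: "fr (l (Suc i)) J <= U i" for i unfolding U_def by (rule subset_plus2[OF submod_range[OF linT]])
  have gU: "good (U i)" for i unfolding good_def using sU frU fin by blast
  \<comment> \<open>z represents a nonzero class in the first nonvanishing homology of the dual; P
    will be the annihilator of a nonzero multiple of it in the cokernel of
    \<open>T j\<close>.\<close>
  obtain z where z: "T (Suc j) z : fr (l (Suc (Suc j))) J" "z ~: U j" using j(2) unfolding dT exact_mod_def U_def by blast
  obtain c where c: "sm c z ~: U j" "prime_idl (ann (U j) (sm c z))" using ann_prime[OF gU z(2)] by blast
  define P where "P = ann (U j) (sm c z)"
  define z' where "z' = sm c z"
  have z': "T (Suc j) z' : fr (l (Suc (Suc j))) J" unfolding z'_def lin_sm[OF linT] by (rule submod_sm[OF sJ z(1)])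
  have "prime_idl P" "J <= P" using c ann_J[OF gU] by (auto simp: P_def)
  from local[OF this] obtain J' :: "'b set" and m' io where lo: "localiz J J' m' P io"
   and depN: "ALL e<=t. dep m' e (fr {0} J') --> dep m' e (localiz.loc J' P io (l 1) (range (mv (l 0) (tr (M 0))) + fr (l 1) J))" by auto
  interpret Lo: localiz J J' m' P io by (rule lo)
  define U' where "U' i = Lo.loc (l (Suc i)) (U i)" for i
  define T' where "T' i = mv (l i) (Lo.ml (tr (M i)))" for i
  have linT': "lin (T' i)" for i unfolding T'_def by (rule lin_mv)
  have U': "U' i = range (T' i) + fr (l (Suc i)) J'" for i unfolding U'_def U_def T_def T'_def by (rule Lo.loc_range[OF fin fin])
  have gU': "Lo.L.good (U' i)" for i unfolding U'_def by (rule Lo.good_loc[OF fin sU])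
  have sU': "submod (U' i)" for i by (rule Lo.L.good_submod[OF gU'])
  have z'U: "Lo.vl z' ~: U' j" using Lo.vl_loc_D fin sU frU unfolding U'_def P_def z'_def ann_def by blast
  \<comment> \<open>After localization at its annihilator P the class is killed by the maximal
    ideal, so the cokernel has depth 0 there.\<close>
  have "sm x (Lo.vl z') : U' j" if x: "x : m'" for x
  proof -
   obtain a s where as: "s ~: P" "io s * x - io a : J'" using Lo.io_surj by blast
   have "io a : m'" using idl_cong[OF Lo.L.idm, of "io s * x" "io a"] as(2) Lo.L.Jm idl_mult[OF Lo.L.idm x] by blast
   hence "a : P" using Lo.io_unit by blast
   hence "sm a z' : U j" by (simp add: P_def z'_def ann_def)
   hence 1: "Lo.vl (sm a z') : U' j" unfolding U'_def by (rule Lo.vl_loc)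
   have frU': "y : U' j" if "y : fr (l (Suc j)) J'" for y using that Lo.fr_sub_loc[OF sU] unfolding U'_def by blast
   have 2: "sm (io s * x - io a) (Lo.vl z') : U' j" by (rule Lo.L.good_J[OF gU' as(2)])
   have "sm (io s) (sm x (Lo.vl z')) = sm (io s * x - io a) (Lo.vl z') - (Lo.vl (sm a z') - sm (io a) (Lo.vl z')) + Lo.vl (sm a z')"
    by (simp add: sm_diff_left)
   also have "... : U' j" by (rule submod_add[OF sU' submod_diff[OF sU' 2 frU'[OF Lo.vl_sm]] 1])
   finally show ?thesis by (rule Lo.L.unit_cancel[OF gU' Lo.io_unit[OF as(1)]])
  qed
  hence soc: "Lo.L.soc (U' j)" unfolding Lo.L.soc_def using z'U by blast
  \<comment> \<open>Below place j the dual is exact, so the cokernel of \<open>T' i\<close> embeds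
    into the next free module with the cokernel of \<open>T' (Suc i)\<close> as quotient; the depth
    lemma loses one per step.\<close>
  have step: "dep m' (e - i) (U' i)" if e: "dep m' e (fr {0} J')" "dep m' e (U' 0)" and i: "i <= j" for e i using i
  proof (induction i)
   case (Suc i)
   have "exact_mod J (l (Suc (Suc i))) (T (Suc i)) (l (Suc i)) (T i)" using min[of i] Suc.prems j(1) dT by auto
   hence "Lo.L.exact_mod J' (l (Suc (Suc i))) (T' (Suc i)) (l (Suc i)) (T' i)"
    unfolding exact_mod_def T_def T'_def by (intro Lo.exact_loc[OF fin fin fin]) blast
   hence "T' (Suc i) -` fr (l (Suc (Suc i))) J' <= U' i" unfolding Lo.L.exact_mod_def U' by blast
   moreover have "U' i <= T' (Suc i) -` fr (l (Suc (Suc i))) J'" unfolding U'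
   proof (rule plus_subset[OF submod_vimage[OF linT' Lo.sJ']])
    have "T' (Suc i) (T' i f) : fr (l (Suc (Suc i))) J'" for f
    proof -
     have "T' i f : U' i" unfolding U' using subset_plus1[OF Lo.sJ', of "range (T' i)"] by blast
     then obtain v s where v: "v : U i" "s ~: P" "sm (io s) (T' i f) - Lo.vl v : fr (l (Suc i)) J'" unfolding U'_def Lo.loc_def by blast
     obtain w where w: "v - T i w : fr (l (Suc i)) J" using v(1) unfolding U_def mem_range_plus by blast
     have lmT: "lmap (l (Suc i)) (l (Suc (Suc i))) (T (Suc i))" unfolding T_def by (rule lmap_mv[OF fin fin])
     have lmT': "Lo.L.lmap (l (Suc i)) (l (Suc (Suc i))) (T' (Suc i))" unfolding T'_def by (rule Lo.L.lmap_mv[OF fin fin])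
     have "T (Suc i) (v - T i w) + T (Suc i) (T i w) : fr (l (Suc (Suc i))) J" by (rule submod_add[OF sJ lmap_J[OF lmT w] compT])
     hence "T (Suc i) v : fr (l (Suc (Suc i))) J" by (simp add: lin_diff[OF linT])
     hence "Lo.vl (T (Suc i) v) : fr (l (Suc (Suc i))) J'" by (rule Lo.vl_J)
     hence 1: "T' (Suc i) (Lo.vl v) : fr (l (Suc (Suc i))) J'" using submod_cong[OF Lo.sJ' Lo.vl_mv] unfolding T_def T'_def by blast
     have "T' (Suc i) (sm (io s) (T' i f) - Lo.vl v) : fr (l (Suc (Suc i))) J'" by (rule Lo.L.lmap_J[OF lmT' v(3)])
     hence "T' (Suc i) (sm (io s) (T' i f) - Lo.vl v) + T' (Suc i) (Lo.vl v) : fr (l (Suc (Suc i))) J'" by (rule submod_add[OF Lo.sJ' _ 1])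
     hence "sm (io s) (T' (Suc i) (T' i f)) : fr (l (Suc (Suc i))) J'" by (simp add: lin_diff[OF linT'] lin_sm[OF linT'])
     thus ?thesis by (rule Lo.L.unit_cancel[OF Lo.L.good_fr[OF fin Lo.L.idJ subset_refl] Lo.io_unit[OF v(2)]])
    qed
    thus "range (T' i) <= T' (Suc i) -` fr (l (Suc (Suc i))) J'" by blast
    have "Lo.L.lmap (l (Suc i)) (l (Suc (Suc i))) (T' (Suc i))" unfolding T'_def by (rule Lo.L.lmap_mv[OF fin fin])
    thus "fr (l (Suc i)) J' <= T' (Suc i) -` fr (l (Suc (Suc i))) J'" using Lo.L.lmap_J by blast
   qed
   ultimately have eq: "T' (Suc i) -` fr (l (Suc (Suc i))) J' = U' i" by blast
   have "dep m' (e - i) (fr (l (Suc (Suc i))) J')" by (rule dep_mono[OF dep_fr[OF fin e(1)]]) simp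
   hence "dep m' (e - i - 1) (range (T' (Suc i)) + fr (l (Suc (Suc i))) J')"
    using Suc.prems by (intro Lo.L.depth_quotient[OF linT' Lo.L.good_fr[OF fin Lo.L.idJ subset_refl]])
     (simp_all add: eq gU' Suc.IH)
   thus ?case unfolding U' by simp
  qed (use e in simp)
  have dU0: "dep m' e (U' 0)" if "e <= t" "dep m' e (fr {0} J')" for e using depN that unfolding U'_def U_def T_def by simp
  have notlt: "~j < e" if "e <= t" "dep m' e (fr {0} J')" for e
  proof
   assume "j < e"
   then obtain k where "e - j = Suc k" by (metis Suc_diff_Suc)
   thus False using step[OF that(2) dU0[OF that], of j] soc Lo.L.dep_not_soc by auto
  qed
  show False
  proof (cases "dep m' t (fr {0} J')")
   case True
   hence "t <= j" using notlt by (meson le_refl not_less)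
   thus False using AB j by blast
  next
   case False
   then obtain d where d: "d < t" "dep m' d (fr {0} J')" "~dep m' (Suc d) (fr {0} J')" using Lo.L.dep_max by blast
   hence dj: "d <= j" using notlt by (meson less_imp_le not_less)
   \<comment> \<open>The local ring at P has depth d < t with d <= j. Applied there,
     \<open>split_exact\<close> makes the dual exact at j, against the choice of
     \<open>z'\<close>.\<close>
   define F' where "F' i = mv (l (Suc i)) (Lo.ml (M i))" for i
   have c': "Lo.L.cpx l F'" unfolding Lo.L.cpx_def
   proof (intro conjI allI)
    fix i z
    have lm: "Lo.L.lmap (l (Suc i)) (l i) (F' i)" for i unfolding F'_def by (rule Lo.L.lmap_mv[OF fin fin])
    thus "Lo.L.lmap (l (Suc i)) (l i) (F' i)" .
    have linF': "lin (F' i)" for i unfolding F'_def by (rule lin_mv)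
    obtain v s where v: "s ~: P" "sm (io s) z - Lo.vl v : fr (l (Suc (Suc i))) J'" using Lo.common_denominator[OF fin] by blast
    have b1: "Lo.vl (F (Suc i) v) - F' (Suc i) (Lo.vl v) : fr (l (Suc i)) J'" unfolding F_def F'_def by (rule Lo.vl_mv)
    have b2: "Lo.vl (F i (F (Suc i) v)) - F' i (Lo.vl (F (Suc i) v)) : fr (l i) J'" unfolding F_def F'_def by (rule Lo.vl_mv)
    have b3: "Lo.vl (F i (F (Suc i) v)) : fr (l i) J'" unfolding F_def by (rule Lo.vl_J[OF comp])
    have "sm (io s) (F' i (F' (Suc i) z)) = F' i (F' (Suc i) (sm (io s) z - Lo.vl v)) - F' i (Lo.vl (F (Suc i) v) - F' (Suc i) (Lo.vl v))
     - (Lo.vl (F i (F (Suc i) v)) - F' i (Lo.vl (F (Suc i) v))) + Lo.vl (F i (F (Suc i) v))" by (simp add: lin_diff[OF linF'] lin_sm[OF linF'])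
    also have "... : fr (l i) J'" by (rule submod_add[OF Lo.sJ' submod_diff[OF Lo.sJ' submod_diff[OF Lo.sJ' Lo.L.lmap_J[OF lm Lo.L.lmap_J[OF lm v(2)]] Lo.L.lmap_J[OF lm b1]] b2] b3])
    finally show "F' i (F' (Suc i) z) : fr (l i) J'" by (rule Lo.L.unit_cancel[OF Lo.L.good_fr[OF fin Lo.L.idJ subset_refl] Lo.io_unit[OF v(1)]])
   qed
   have ex': "Lo.L.exact_at J' l F' i" if "i < s" for i
    unfolding F'_def using ex[OF that] unfolding exact_mod_def by (intro Lo.exact_loc[OF fin fin fin]) blast
   have "Lo.L.dual_at l F' j" using Lo.L.split_exact[OF d(2,3) c' ls ex', where k = d and j = j] dj j(1) by blast
   hence "Lo.L.exact_mod J' (l (Suc (Suc j))) (mv (l (Suc j)) (tr (Lo.ml (M (Suc j))))) (l (Suc j)) (mv (l j) (tr (Lo.ml (M j))))"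
    unfolding F'_def using Lo.L.dual_exact_iff[OF fin fin fin] by blast
   moreover have "tr (Lo.ml M) = Lo.ml (tr M)" for M by (simp add: tr_def Lo.ml_def)
   ultimately have "Lo.L.exact_mod J' (l (Suc (Suc j))) (T' (Suc j)) (l (Suc j)) (T' j)" unfolding T'_def by simp
   moreover have "T' (Suc j) (Lo.vl z') : fr (l (Suc (Suc j))) J'"
    using submod_cong[OF Lo.sJ' Lo.vl_mv] Lo.vl_J[OF z'] unfolding T_def T'_def by blast
   ultimately have "Lo.vl z' : U' j" unfolding Lo.L.exact_mod_def U' by blast
   thus False using z'U by blast
  qed
 qed
 show ?thesis using split_exact[OF t c ls exF, where k = 0 and j = j] all j unfolding F_def by blast
qed

end


section \<open>Krull's principal ideal theorem and the dimension bound\<close>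

context noeth begin

text \<open>The contraction of the localization of I at n. Ideals fixed by this operation stand for
  ideals of the localized ring, so the argument stays in one ring.\<close>

definition sat :: "'a set => 'a set => 'a set" where
 "sat n I = {a. EX s. s ~: n & s * a : I}"

definition nsat :: "'a set => 'a set => bool" where
 "nsat n I \<longleftrightarrow> idl I & (ALL s a. s ~: n --> s * a : I --> a : I)"

lemma prime_mult: "prime_idl n ==> s ~: n ==> t ~: n ==> s * t ~: n" by (auto simp: prime_idl_def)

lemma nsat_sat: assumes n: "prime_idl n" and I: "idl I" shows "nsat n (sat n I)" unfolding nsat_def idl_def
proof (intro conjI ballI allI impI)
 have n1: "1 ~: n" using n by (simp add: prime_idl_def)
 show "0 : sat n I" unfolding sat_def using n1 idl_0[OF I] by auto
 fix a assume "a : sat n I"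
 then obtain s where s: "s ~: n" "s * a : I" unfolding sat_def by blast
 show "c * a : sat n I" for c unfolding sat_def using s idl_mult[OF I s(2), of c] by (auto simp: mult.left_commute)
 fix b assume "b : sat n I"
 then obtain t where t: "t ~: n" "t * b : I" unfolding sat_def by blast
 have "t * (s * a) + s * (t * b) : I" by (intro idl_add[OF I] idl_mult[OF I] s t)
 thus "a + b : sat n I" using prime_mult[OF n s(1) t(1)] unfolding sat_def by (auto simp: algebra_simps)
next
 fix s a assume s: "s ~: n" "s * a : sat n I"
 then obtain t where t: "t ~: n" "t * (s * a) : I" unfolding sat_def by blast
 thus "a : sat n I" unfolding sat_def using prime_mult[OF n t(1) s(1)] by (auto simp: mult.assoc)
qed

lemma sub_sat: "prime_idl n ==> I <= sat n I" unfolding sat_def prime_idl_def by (auto intro!: exI[of _ 1])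

lemma sat_least: "nsat n H ==> I <= H ==> sat n I <= H" unfolding sat_def nsat_def by blast

lemma sat_mono: "I <= I' ==> sat n I <= sat n I'" unfolding sat_def by blast

text \<open>Noetherian induction for the Artinian property of the localization modulo I: take
  \<open>I1\<close> maximal among the saturated ideals below a non-stationary chain. By minimality
  of n, some c has n as its annihilator modulo \<open>I1\<close>, and \<open>I2\<close> is the
  saturation of I1 + (c). The intersections with \<open>I2\<close> and the sums with
  \<open>I2\<close> are stationary, hence so is the chain.\<close>

lemma nsat_dcc:
 assumes n: "prime_idl n" and I: "nsat n I" "J <= I"
  and min: "!!Q. prime_idl Q ==> I <= Q ==> Q <= n ==> Q = n"
  and H: "!!k. nsat n (H k)" "!!k. I <= H k" "!!k. H (Suc k) <= H k"
 shows "EX k. ALL l>=k. H l = H (k::nat)"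
proof (rule ccontr)
 assume neg: "~?thesis"
 define C where "C = {I'. nsat n I' & I <= I' & (EX H. (ALL k. nsat n (H k) & I' <= H k & H (Suc k) <= H k) & ~(EX k. ALL l>=k. H l = H (k::nat)))}"
 have "I : C" unfolding C_def using I neg H by blast
 hence "EX W:C. ALL W':C. W <= W' --> W' = W"
 proof (intro idl_max)
  assume "I : C" thus "C ~= {}" by blast
 next
  fix W assume "W : C"
  thus "idl W & J <= W" using I(2) unfolding C_def nsat_def by auto
 qed
 then obtain I1 where I1: "I1 : C" "!!W. W : C ==> I1 <= W ==> W = I1" by blast
 obtain H where H: "!!k. nsat n (H k)" "!!k. I1 <= H k" "!!k. H (Suc k) <= H k"
  and Hn: "~(EX k. ALL l>=k. H l = H (k::nat))" using I1(1) unfolding C_def by blast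
 have nI1: "nsat n I1" and II1: "I <= I1" using I1(1) unfolding C_def by blast+
 have idI1: "idl I1" using nI1 by (simp add: nsat_def)
 have "1 ~: I1"
 proof
  assume "1 : I1"
  hence "I1 = UNIV" using idl_mult[OF idI1, of 1] by auto
  thus False using H(2) Hn by blast
 qed
 hence z: "(%_. 1) ~: fr {0} I1" by (simp add: fr_def)
 have g: "good (fr {0} I1)" using good_fr idI1 II1 I(2) by blast
 obtain c where c: "sm c (%_. 1) ~: fr {0} I1" "prime_idl (ann (fr {0} I1) (sm c (%_. 1)))" using ann_prime[OF g z] by blast
 define Q where "Q = ann (fr {0} I1) (sm c (%_. 1))"
 have Qc: "a : Q \<longleftrightarrow> a * c : I1" for a by (simp add: Q_def ann_def fr_def sm_def)
 have cI: "c ~: I1" using c(1) by (simp add: fr_def sm_def)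
 have "Q <= n" using Qc cI nI1 unfolding nsat_def by blast
 moreover have "I <= Q" using II1 idl_mult2[OF idI1] Qc by blast
 ultimately have Qn: "Q = n" using min c(2) unfolding Q_def by blast
 define I2 where "I2 = sat n (I1 + range ((*) c))"
 have nI2: "nsat n I2" unfolding I2_def by (rule nsat_sat[OF n idl_plus[OF idI1 idl_range]])
 have sub12: "I1 + range ((*) c) <= I2" unfolding I2_def by (rule sub_sat[OF n])
 have I12: "I1 <= I2"
 proof
  fix a assume "a : I1"
  hence "a : I1 + range ((*) c)" unfolding mem_plus_range by (auto intro!: exI[of _ 0])
  thus "a : I2" using sub12 by blast
 qed
 have c2: "c : I2"
 proof -
  have "c : I1 + range ((*) c)" unfolding mem_plus_range using idl_0[OF idI1] by (auto intro!: exI[of _ 1])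
  thus ?thesis using sub12 by blast
 qed
 \<comment> \<open>After localization, \<open>I2\<close> modulo \<open>I1\<close> is the residue
   field at n, so no saturated ideal lies strictly between.\<close>
 have atom: "K = I2" if K: "nsat n K" "I1 <= K" "K <= I2" "K ~= I1" for K
 proof -
  obtain h where h: "h : K" "h ~: I1" using K by blast
  then obtain s where s: "s ~: n" "s * h : I1 + range ((*) c)" using K(3) unfolding I2_def sat_def by blast
  then obtain a where a: "s * h - c * a : I1" unfolding mem_plus_range by blast
  have "a ~: n" by (metis Qc Qn mult.commute idl_cong a nI1 s h nsat_def)
  have idK: "idl K" using K by (simp add: nsat_def)
  have "s * h - (s * h - c * a) : K" by (rule idl_diff[OF idK idl_mult[OF idK h(1)] subsetD[OF K(2) a]])
  hence cK: "c : K" using K(1) \<open>a ~: n\<close> unfolding nsat_def by (simp add: mult.commute)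
  have "I1 + range ((*) c) <= K"
  proof
   fix v assume "v : I1 + range ((*) c)"
   then obtain w where "v - c * w : I1" unfolding mem_plus_range by blast
   thus "v : K" using K(2) idl_cong[OF idK] idl_mult2[OF idK cK] by blast
  qed
  hence "I2 <= K" unfolding I2_def by (rule sat_least[OF K(1)])
  thus ?thesis using K(3) by blast
 qed
 have Hmono: "H b <= H a" if "a <= b" for a b by (rule lift_Suc_antimono_le[OF _ that]) (rule H(3))
 have nint: "nsat n (H k \<inter> I2)" for k using H(1)[of k] nI2 unfolding nsat_def idl_def by blast
 have "EX k. ALL l>=k. H l \<inter> I2 = H k \<inter> I2"
 proof (cases "EX k. H k \<inter> I2 = I1")
  case True
  then obtain k where k: "H k \<inter> I2 = I1" by blast
  have "H l \<inter> I2 = I1" if "l >= k" for l using Hmono[OF that] k H(2)[of l] by blast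
  thus ?thesis by auto
 next
  case False
  hence "H k \<inter> I2 = I2" for k using atom[OF nint[of k]] H(2)[of k] I12 by blast
  thus ?thesis by metis
 qed
 then obtain k1 where k1: "ALL l>=k1. H l \<inter> I2 = H k1 \<inter> I2" by blast
 define G where "G k = sat n (H k + I2)" for k
 have idH: "idl (H k)" "idl I2" for k using H(1) nI2 by (simp_all add: nsat_def)
 have nG: "nsat n (G k)" for k unfolding G_def by (rule nsat_sat[OF n idl_plus[OF idH]])
 have sG: "H k + I2 <= G k" for k unfolding G_def by (rule sub_sat[OF n])
 have I2G: "I2 <= G k" for k
 proof
  fix a assume "a : I2"
  hence "a : H k + I2" unfolding set_plus_diff_iff using idl_0[OF idH(1)[of k]] by (intro bexI[of _ 0]) auto
  thus "a : G k" using sG by blast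
 qed
 have HG: "H k <= G k" for k
 proof
  fix a assume "a : H k"
  hence "a : H k + I2" unfolding set_plus_diff_iff2 using idl_0[OF idH(2)] by (intro bexI[of _ 0]) auto
  thus "a : G k" using sG by blast
 qed
 have Gmono: "G (Suc k) <= G k" for k unfolding G_def by (rule sat_mono) (use H(3)[of k] in \<open>auto simp: set_plus_def\<close>)
 have I2C: "I2 ~: C" using I1(2)[of I2] I12 c2 cI by blast
 obtain k2 where k2: "ALL l>=k2. G l = G k2" using nI2 II1 I12 nG I2G Gmono I2C unfolding C_def by blast
 define k where "k = max k1 k2"
 \<comment> \<open>Modular law: equal intersections with \<open>I2\<close> and equal saturated sums
   with \<open>I2\<close> force equality.\<close>
 have "H l = H k" if l: "l >= k" for l
 proof
  show "H l <= H k" by (rule Hmono[OF l])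
  show "H k <= H l"
  proof
   fix a assume a: "a : H k"
   have "G l = G k" using k2 l unfolding k_def by (metis le_trans max.cobounded2)
   then obtain s where s: "s ~: n" "s * a : H l + I2" using a HG unfolding G_def sat_def by blast
   then obtain b where b: "b : H l" "s * a - b : I2" unfolding set_plus_diff_iff by blast
   have "s * a - b : H k" using b Hmono[OF l] by (intro idl_diff[OF idH(1)] idl_mult[OF idH(1)] a) auto
   hence "s * a - b : H k1 \<inter> I2" using b Hmono[of k1 k] by (auto simp: k_def)
   moreover have "H l \<inter> I2 = H k1 \<inter> I2" using k1 l unfolding k_def by (metis le_trans max.cobounded1)
   ultimately show "a : H l" using idl_cong[OF idH(1)] b(1) H(1)[of l] s(1) unfolding nsat_def by blast
  qed
 qed
 thus False using Hn by blast
qed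

text \<open>Krull's argument relative to \<open>p0\<close>: if n were minimal over p0 + (x), the
  symbolic powers below p would be stationary modulo x by \<open>nsat_dcc\<close>, and then
  stationary by Nakayama. A single y in p outside p0 suffices, so powers of y replace powers of
  p.\<close>

lemma principal_ideal_theorem:
 assumes n: "prime_idl n" and p0: "prime_idl p0" "J <= p0" and p: "prime_idl p" "p0 \<subset> p" "p \<subset> n" and x: "x : n"
 shows "EX q. prime_idl q & p0 <= q & x : q & q \<subset> n"
proof (rule ccontr)
 assume neg: "~?thesis"
 have xp: "x ~: p" using neg p by blast
 obtain y where y: "y : p" "y ~: p0" using p by blast
 have id0: "idl p0" "idl p" "idl n" using p0 p n prime_idl_idl by blast+
 define I where "I = sat n (p0 + range ((*) x))"
 have p0x: "p0 <= p0 + range ((*) x)" unfolding subset_iff mem_plus_range by (auto intro!: exI[of _ 0])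
 have xx: "x : p0 + range ((*) x)" unfolding mem_plus_range using idl_0[OF id0(1)] by (auto intro!: exI[of _ 1])
 \<comment> \<open>The contraction of the ideal generated by y^k in the localization at p, all
   modulo \<open>p0\<close>.\<close>
 define q where "q k = sat p (p0 + range ((*) (y ^ k)))" for k
 have nq: "nsat p (q k)" for k unfolding q_def by (rule nsat_sat[OF p(1) idl_plus[OF id0(1) idl_range]])
 have idq: "idl (q k)" for k using nq by (simp add: nsat_def)
 have p0q: "p0 <= q k" for k
 proof -
  have "p0 <= p0 + range ((*) (y ^ k))" unfolding subset_iff mem_plus_range by (auto intro!: exI[of _ 0])
  thus ?thesis unfolding q_def using sub_sat[OF p(1)] by blast
 qed
 have qmono: "q (Suc k) <= q k" for k unfolding q_def
 proof (rule sat_mono, rule subsetI)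
  fix v assume "v : p0 + range ((*) (y ^ Suc k))"
  then obtain w where "v - y ^ Suc k * w : p0" unfolding mem_plus_range by blast
  hence "v - y ^ k * (y * w) : p0" by (simp add: mult.assoc mult.left_commute)
  thus "v : p0 + range ((*) (y ^ k))" unfolding mem_plus_range by blast
 qed
 define H where "H k = sat n (q k + range ((*) x))" for k
 have "EX k. ALL l>=k. H l = H k"
 proof (rule nsat_dcc[OF n, of I])
  show "nsat n I" unfolding I_def by (rule nsat_sat[OF n idl_plus[OF id0(1) idl_range]])
  show "J <= I" unfolding I_def using p0(2) p0x sub_sat[OF n] by blast
  show "Q = n" if "prime_idl Q" "I <= Q" "Q <= n" for Q
  proof -
   have "p0 <= Q" "x : Q" using that(2) p0x xx sub_sat[OF n] unfolding I_def by blast+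
   thus ?thesis using neg that by blast
  qed
  show "nsat n (H k)" for k unfolding H_def by (rule nsat_sat[OF n idl_plus[OF idq idl_range]])
  show "I <= H k" for k unfolding I_def H_def by (rule sat_mono) (use p0q in \<open>auto simp: set_plus_def\<close>)
  show "H (Suc k) <= H k" for k unfolding H_def by (rule sat_mono) (use qmono in \<open>auto simp: set_plus_def\<close>)
 qed
 then obtain k where k: "H k = H (Suc k)" by (metis le_SucI le_refl)
 \<comment> \<open>Up to a multiplier outside n, an element of \<open>q k\<close> is x b plus an
   element of \<open>q (Suc k)\<close>. As x is outside p and \<open>q k\<close> is saturated at p,
   b is again in \<open>q k\<close>, so Nakayama at n applies.\<close>
 have qk: "a : q (Suc k)" if a: "a : q k" for a
 proof -
  have "fgmod (fr {0} (q (Suc k))) (fr {0} (q k))"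
  proof (rule fgmod_good)
   show "good (fr {0} (q (Suc k)))" using good_fr idq p0q p0(2) by blast
   show "submod (fr {0} (q k))" by (rule submod_fr[OF idq])
   show "fr {0} (q (Suc k)) <= fr {0} (q k)" by (rule subsetI) (use qmono in \<open>auto simp: fr_def\<close>)
  qed
  then obtain N g where g: "ALL j<(N::nat). g j : fr {0} (q k)"
   and gw: "ALL w:fr {0} (q k). EX c. w - (SUM j<N. sm (c j) (g j)) : fr {0} (q (Suc k))" unfolding fgmod_def by auto
  have "EX s. s ~: n & sm s (%_. a) : fr {0} (q (Suc k))"
  proof (rule nakayama_sat[OF submod_fr[OF idq] n _ g])
   show "(%_. a) : fr {0} (q k)" using a by (simp add: fr_def)
   fix w assume w: "w : fr {0} (q k)"
   hence "w 0 - x * 0 : q k" by (simp add: fr_def)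
   hence "w 0 : q k + range ((*) x)" unfolding mem_plus_range by (rule exI)
   hence "w 0 : H k" unfolding H_def by (rule subsetD[OF sub_sat[OF n]])
   then obtain s where s: "s ~: n" "s * w 0 : q (Suc k) + range ((*) x)" using k unfolding H_def sat_def by auto
   then obtain b where b: "s * w 0 - x * b : q (Suc k)" unfolding mem_plus_range by blast
   have "s * w 0 - (s * w 0 - x * b) : q k" by (rule idl_diff[OF idq idl_mult[OF idq] subsetD[OF qmono b]]) (use w in \<open>simp add: fr_def\<close>)
   hence "(%_. b) : fr {0} (q k)" using nq xp unfolding nsat_def by (simp add: fr_def)
   from bspec[OF gw this] obtain c where c: "(%_. b) - (SUM j<N. sm (c j) (g j)) : fr {0} (q (Suc k))" .. have "(s * w 0 - x * b) + x * (b - (SUM j<N. c j * g j 0)) : q (Suc k)" using c idl_add[OF idq b] by (auto simp: fr_def sum_fun sm_def idl_mult idq)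
   hence "sm s w - (SUM j<N. sm (x * c j) (g j)) : fr {0} (q (Suc k))" by (auto simp: algebra_simps sum_distrib_left fr_def sum_fun sm_def)
   thus "EX s c. s ~: n & (ALL j<N. c j : n) & sm s w - (SUM j<N. sm (c j) (g j)) : fr {0} (q (Suc k))"
    using s(1) idl_mult2[OF id0(3) x] by (intro exI[of _ s] exI[of _ "%j. x * c j"]) auto
  qed
  then obtain s where "s ~: n" "s * a : q (Suc k)" by (auto simp: fr_def sm_def)
  thus ?thesis using nq p(3) unfolding nsat_def by blast
 qed
 \<comment> \<open>This leads to s y^k = b y^(k+1) modulo \<open>p0\<close> with s outside p; but
   neither s - y b nor y^k lies in \<open>p0\<close>.\<close>
 have "y ^ k : p0 + range ((*) (y ^ k))" unfolding mem_plus_range using idl_0[OF id0(1)] by (auto intro!: exI[of _ 1])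
 hence "y ^ k : q k" unfolding q_def using sub_sat[OF p(1)] by blast
 hence "y ^ k : q (Suc k)" by (rule qk)
 then obtain s where s: "s ~: p" "s * y ^ k : p0 + range ((*) (y ^ Suc k))" unfolding q_def sat_def by blast
 then obtain b where "s * y ^ k - y ^ Suc k * b : p0" unfolding mem_plus_range by blast
 hence "(s - y * b) * y ^ k : p0" by (simp add: algebra_simps)
 moreover have "s - y * b ~: p0" using idl_cong2[OF id0(2), of s "y * b"] idl_mult2[OF id0(2) y(1), of b] s(1) p(2) by blast
 moreover have "y ^ k ~: p0" using y(2) p0(1) by (induction k) (auto simp: prime_idl_def)
 ultimately show False using p0(1) by (auto simp: prime_idl_def)
qed

text \<open>Krull's theorem at the top of the chain replaces the second highest prime by one that
  contains x and still lies strictly above the third highest; repeating this moves x down to the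
  prime with index 1.\<close>

lemma chain_move:
 "prime_chain J (Suc d) Q ==> x : Q (Suc d) ==> EX Q'. prime_chain J (Suc d) Q' & Q' (Suc d) = Q (Suc d) & x : Q' (Suc 0)"
proof (induction d arbitrary: Q)
 case 0
 thus ?case by blast
next
 case (Suc d)
 note pc = Suc.prems(1)
 have pr: "prime_idl (Q i)" "J <= Q i" if "i <= Suc (Suc d)" for i using pc that by (auto simp: prime_chain_def)
 have lt: "Q i \<subset> Q (Suc i)" if "i < Suc (Suc d)" for i using pc that by (auto simp: prime_chain_def)
 have "EX q. prime_idl q & Q d \<subset> q & x : q & q \<subset> Q (Suc (Suc d))"
 proof (cases "x : Q (Suc d)")
  case True
  thus ?thesis using pr(1)[of "Suc d"] lt[of d] lt[of "Suc d"] by (intro exI[of _ "Q (Suc d)"]) simp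
 next
  case False
  obtain q where q: "prime_idl q" "Q d <= q" "x : q" "q \<subset> Q (Suc (Suc d))"
   using principal_ideal_theorem[OF pr(1)[of "Suc (Suc d)"] pr(1)[of d] pr(2)[of d] pr(1)[of "Suc d"] lt[of d] lt[of "Suc d"] Suc.prems(2)] by auto
  moreover have "x ~: Q d" using False lt[of d] by auto
  ultimately show ?thesis by blast
 qed
 then obtain q where q: "prime_idl q" "Q d \<subset> q" "x : q" "q \<subset> Q (Suc (Suc d))" by blast
 define R where "R = Q(Suc d := q)"
 have "prime_chain J (Suc d) R" unfolding prime_chain_def
 proof (intro conjI allI impI)
  fix i
  show "prime_idl (R i)" if "i <= Suc d" using that pr q by (auto simp: R_def)
  show "J <= R i" if "i <= Suc d" using that pr(2)[of i] pr(2)[of d] q(2) by (auto simp: R_def)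
  show "R i \<subset> R (Suc i)" if "i < Suc d" using that lt[of i] q(2) by (auto simp: R_def)
 qed
 moreover have "x : R (Suc d)" using q by (simp add: R_def)
 ultimately obtain R' where R': "prime_chain J (Suc d) R'" "R' (Suc d) = R (Suc d)" "x : R' (Suc 0)" using Suc.IH by blast
 define Q' where "Q' = R'(Suc (Suc d) := Q (Suc (Suc d)))"
 have "prime_chain J (Suc (Suc d)) Q'" using pr R' q by (auto simp: Q'_def prime_chain_def R_def)
 moreover have "Q' (Suc (Suc d)) = Q (Suc (Suc d))" "x : Q' (Suc 0)" using R'(3) by (simp_all add: Q'_def)
 ultimately show ?case by blast
qed

end

section \<open>Chains of primes are no longer than the number of generators\<close>

lemma noeth_mono: assumes "noeth J" "idl I" "J <= I" shows "noeth I"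
proof -
 interpret noeth J by fact
 show ?thesis
 proof
  fix K assume K: "idl K" "I <= K"
  hence "J <= K" using assms(3) by blast
  from fg[OF K(1) this] obtain n g where "ALL j<(n::nat). g j : K" "ALL a:K. EX c. a - (SUM j<n. c j * g j) : J" by auto
  thus "EX n g. (ALL j<(n::nat). g j : K) & (ALL a:K. EX c. a - (SUM j<n. c j * g j) : I)" using assms(3) by (intro exI[of _ n] exI[of _ g]) fast
 qed (rule assms)
qed

text \<open>Move the generator \<open>y k\<close> into the prime with index 1. Dropping the lowest
  prime leaves a chain modulo I + (y k), where one generator fewer is needed.\<close>

lemma dim_bound:
 assumes "finite N"
 shows "noeth I ==> (!!j. j : N ==> y j : M) ==> (!!a. a : M ==> EX c. a - (SUM j:N. c j * y j) : I) ==>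
  prime_chain I d Q ==> Q d = M ==> d <= card N" using assms
proof (induction N arbitrary: I d Q rule: finite_induct)
 case empty
 show ?case
 proof (rule ccontr)
  assume "~?case"
  then obtain d' where d: "d = Suc d'" by (cases d) auto
  have "M <= I" using empty(3) by auto
  moreover have "I <= Q d'" "Q d' \<subset> Q d" using empty(4) d by (auto simp: prime_chain_def)
  ultimately show False using empty(5) by blast
 qed
next
 case (insert k N)
 interpret noeth I by (rule insert.prems(1))
 show ?case
 proof (cases d)
  case (Suc d') obtain Q' where Q': "prime_chain I (Suc d') Q'" "Q' (Suc d') = M" "y k : Q' (Suc 0)" using insert.prems
   using chain_move[of d' Q "y k"] Suc by auto
  define I' where "I' = I + range ((*) (y k))"
  have I': "idl I'" "I <= I'" unfolding I'_def by (rule idl_plus[OF idJ idl_range]) (auto simp: subset_iff mem_plus_range intro!: exI[of _ 0])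
  have "prime_chain I' d' (%i. Q' (Suc i))" unfolding prime_chain_def
  proof (intro conjI allI impI)
   fix i
   show pr: "prime_idl (Q' (Suc i))" if "i <= d'" for i using Q'(1) that by (auto simp: prime_chain_def)
   show "Q' (Suc i) \<subset> Q' (Suc (Suc i))" if "i < d'" using Q'(1) that by (auto simp: prime_chain_def)
   have "I' <= Q' (Suc i)" if "i <= d'" for i using that
   proof (induction i)
    case 0
    have idQ: "idl (Q' (Suc 0))" using pr[of 0] prime_idl_idl by auto
    have IQ: "I <= Q' (Suc 0)" using Q'(1) by (auto simp: prime_chain_def)
    show ?case
    proof
     fix v assume "v : I'"
     then obtain w where "v - y k * w : I" unfolding I'_def mem_plus_range by blast
     thus "v : Q' (Suc 0)" using IQ idl_cong[OF idQ] idl_mult2[OF idQ Q'(3)] by blast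
    qed
   next
    case (Suc i)
    hence "Q' (Suc i) \<subset> Q' (Suc (Suc i))" using Q'(1) by (auto simp: prime_chain_def)
    thus ?case using Suc by auto
   qed
   thus "I' <= Q' (Suc i)" if "i <= d'" using that by blast
  qed
  hence "d' <= card N"
  proof (rule insert.IH[OF noeth_mono[OF insert.prems(1) I'], rotated 2])
   show "Q' (Suc d') = M" by (rule Q'(2))
   show "y j : M" if "j : N" for j using insert.prems(2) that by auto
   show "EX c. a - (SUM j:N. c j * y j) : I'" if a: "a : M" for a
   proof -
    obtain c where "a - (SUM j:insert k N. c j * y j) : I" using insert.prems(3)[OF a] by blast
    thus ?thesis using insert.hyps unfolding I'_def mem_plus_range by (auto simp: algebra_simps)
   qed
  qed
  thus ?thesis using Suc insert.hyps by simp
 qed simp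
qed

context nloc begin

lemma prime_sub_m: assumes "prime_idl Q" "J <= Q" shows "Q <= m"
proof
 fix z assume z: "z : Q"
 have idQ: "idl Q" using assms prime_idl_idl by blast
 show "z : m"
 proof (rule ccontr)
  assume "z ~: m"
  then obtain t where t: "z * t - 1 : J" using unit by blast
  thus False using idl_cong[OF idQ, of "z * t" 1] idl_mult2[OF idQ z] assms by (auto simp: prime_idl_def)
 qed
qed

lemma chain_bound:
 assumes N: "finite N" "!!j. j : N ==> y j : m" "!!a. a : m ==> EX c. a - (SUM j:N. c j * y j) : J"
  and Q: "prime_chain J d Q"
 shows "d <= card N"
proof -
 \<comment> \<open>The induction in \<open>dim_bound\<close> concerns chains that end in the ideal
   being generated.\<close>
 define Q' where "Q' = Q(d := m)"
 have "prime_chain J d Q'" unfolding prime_chain_def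
 proof (intro conjI allI impI)
  fix i
  show "prime_idl (Q' i)" "J <= Q' i" if "i <= d" using that Q prime_m Jm by (auto simp: Q'_def prime_chain_def)
  show "Q' i \<subset> Q' (Suc i)" if i: "i < d"
  proof (cases "Suc i = d")
   case True
   have "Q i \<subset> Q d" "prime_idl (Q d)" "J <= Q d" using Q True by (auto simp: prime_chain_def)
   thus ?thesis using True prime_sub_m[of "Q d"] by (auto simp: Q'_def)
  next
   case False
   thus ?thesis using Q i by (auto simp: Q'_def prime_chain_def)
  qed
 qed
 thus ?thesis using dim_bound[OF N(1) noeth_axioms N(2,3), of d Q'] by (simp add: Q'_def)
qed

lemma generators: "EX N y. finite (N::nat set) & (ALL j:N. y j : m) & (ALL a:m. EX c. a - (SUM j:N. c j * y j) : J)"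
proof -
 obtain n g where "ALL j<(n::nat). g j : m" "ALL a:m. EX c. a - (SUM j<n. c j * g j) : J" using fg[OF idm Jm] by blast
 thus ?thesis by auto
qed

text \<open>An associated prime of the ring itself starts the chain supplied by
  \<open>dep_chain\<close>.\<close>

lemma dep_prime_chain:
 assumes "dep m k (fr {0} J)" shows "EX Q. prime_chain J k Q"
proof -
 have g: "good (fr {0} J)" using good_fr idJ by auto
 have "(%_. 1) ~: fr {0} J" using one_m Jm by (auto simp: fr_def)
 then obtain c where c: "sm c (%_. 1) ~: fr {0} J" "prime_idl (ann (fr {0} J) (sm c (%_. 1)))" using ann_prime[OF g] by blast
 obtain Q where Q: "Q 0 = ann (fr {0} J) (sm c (%_. 1))" "ALL i<=k. prime_idl (Q i)" "ALL i<k. Q i \<subset> Q (Suc i)"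
  using dep_chain[OF g assms c] by blast
 have "J <= Q i" if "i <= k" for i using that
 proof (induction i)
  case 0
  thus ?case using Q(1) ann_J[OF g] by auto
 next
  case (Suc i)
  hence "Q i \<subset> Q (Suc i)" using Q(3) by auto
  thus ?case using Suc by auto
 qed
 thus ?thesis using Q unfolding prime_chain_def by blast
qed

lemma dep_finite: "EX n. ALL k. dep m k (fr {0} J) --> k <= n" using generators dep_prime_chain chain_bound by blast

text \<open>The Cohen--Macaulay case: an associated prime above \<open>P\<close> in a partial quotient would prolong
 a chain of primes inside \<open>P\<close> beyond the dimension.\<close>

lemma dep_at_prime:
 assumes P: "prime_idl P" "J <= P"
  and no: "!!Q. prime_chain J (Suc n) Q ==> ~P <= Q 0"
 shows "good U ==> dep m (i + n) U ==> dep P i U"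
proof (induction i arbitrary: U)
 case (Suc i)
 note U = \<open>good U\<close>
 have "EX x:P. ALL U:{U}. reg x U"
 proof (rule regular_element[OF prime_idl_idl[OF P(1)]])
  fix U' v assume "U' : {U}" and v: "v ~: U'" "prime_idl (ann U' v)"
  hence [simp]: "U' = U" by simp
  show "~P <= ann U' v"
  proof
   assume PA: "P <= ann U' v" obtain Q where Q: "Q 0 = ann U v" "ALL i<=Suc n. prime_idl (Q i)" "ALL i<Suc n. Q i \<subset> Q (Suc i)"
    using dep_chain[OF U _ , of "Suc n" v] v dep_mono Suc.prems by force
   have "J <= Q i" if "i <= Suc n" for i using that
   proof (induction i)
    case 0
    thus ?case using Q(1) ann_J[OF U] by auto
   next
    case (Suc i)
    hence "Q i \<subset> Q (Suc i)" using Q(3) by auto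
    thus ?case using Suc by auto
   qed
   hence "prime_chain J (Suc n) Q" using Q unfolding prime_chain_def by blast
   thus False using no PA Q(1) by auto
  qed
 qed (use U in auto)
 then obtain x where x: "x : P" "reg x U" by blast
 have "x : m" using x P prime_sub_m by blast
 hence "dep m (i + n) (U + range (sm x))" using dep_reg[OF U _ _ x(2)] Suc.prems(2) by simp
 thus ?case using x by (auto simp: Suc.IH good_plus U)
qed simp

end

context localiz begin

text \<open>A chain of length s below P exists since the local ring has depth at least s. A chain of
  t - s + 1 steps above P would then exceed the dimension, so \<open>dep_at_prime\<close> finds s
  regular elements inside P.\<close>

lemma dep_loc_of_max_depth:
 assumes "nloc J m" and U: "noeth.good J U" "fr N J <= U" "finite N" and t: "dep m t U"
  and dim: "!!n Q. prime_chain J n Q ==> n <= t"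
  and s: "dep m' s (fr {0} J')" "s <= t"
 shows "dep m' s (loc N U)"
proof -
 interpret M: nloc J m by fact
 obtain Q0 where "prime_chain J' s Q0" using L.dep_prime_chain[OF s(1)] by blast
 then obtain Q where Q: "prime_chain J s Q" "ALL i<=s. Q i <= P" using contract_chain by blast
 have "dep P s U"
 proof (rule M.dep_at_prime[OF P JP, where n = "t - s"])
  show "noeth.good J U" by (rule U(1))
  show "dep m (s + (t - s)) U" using t s(2) by simp
  fix Q' assume Q': "prime_chain J (Suc (t - s)) Q'"
  show "~P <= Q' 0"
  proof
   assume PQ: "P <= Q' 0"
   \<comment> \<open>Splice at P: from index s + 1 on the upper chain takes over. Its own index 0 is
     skipped, since it may coincide with the last prime below P.\<close>
   define R where "R i = (if i <= s then Q i else Q' (i - s))" for i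
   have "prime_chain J (Suc t) R" unfolding prime_chain_def
   proof (intro conjI allI impI)
    fix i
    show "prime_idl (R i)" "J <= R i" if "i <= Suc t" using that Q Q' by (auto simp: R_def prime_chain_def)
    show "R i \<subset> R (Suc i)" if i: "i < Suc t"
    proof (cases i s rule: linorder_cases)
     case less
     thus ?thesis using Q by (auto simp: R_def prime_chain_def)
    next
     case equal
     have "Q s <= Q' 0" "Q' 0 \<subset> Q' (Suc 0)" using Q Q' PQ by (auto simp: prime_chain_def)
     thus ?thesis using equal by (auto simp: R_def)
    next
     case greater
     thus ?thesis using Q' i by (auto simp: R_def prime_chain_def Suc_diff_le)
    qed
   qed
   thus False using dim by fastforce
  qed
 qed
 thus ?thesis by (rule dep_loc[OF U(3) good_submod[OF U(1)] U(2)])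
qed

end


section \<open>Derivations and regular sequences\<close>

text \<open>A derivation with values in X / I, given through representatives.\<close>

definition deriv_mod :: "'a::comm_ring_1 set => ('a => 'a) => bool" where
 "deriv_mod I D \<longleftrightarrow> (ALL a b. D (a + b) - (D a + D b) : I) & (ALL a b. D (a * b) - (a * D b + b * D a) : I)"

lemma deriv_power:
 assumes I: "idl I" and D: "deriv_mod I D" and y: "D y - 1 : I"
 shows "D (y ^ Suc k) - of_nat (Suc k) * y ^ k : I"
proof (induction k)
 case (Suc k)
 have 1: "D (y * y ^ Suc k) - (y * D (y ^ Suc k) + y ^ Suc k * D y) : I" using D by (auto simp: deriv_mod_def)
 have "D (y ^ Suc (Suc k)) - of_nat (Suc (Suc k)) * y ^ Suc k =
   (D (y * y ^ Suc k) - (y * D (y ^ Suc k) + y ^ Suc k * D y)) + y * (D (y ^ Suc k) - of_nat (Suc k) * y ^ k) + y ^ Suc k * (D y - 1)"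
  by (simp add: algebra_simps)
 also have "... : I" by (rule idl_add[OF I idl_add[OF I 1 idl_mult[OF I Suc.IH]] idl_mult[OF I y]])
 finally show ?case .
qed (use y in simp)

context nloc begin

text \<open>Applying the derivation \<open>k\<close> times to \<open>y * a = 0\<close> shows that \<open>k! * a\<close> is a multiple of
 \<open>y ^ k * (E ^^ k) a\<close>, an element killed by \<open>y\<close>.\<close>

lemma regular_of_derivation:
 assumes I: "idl I" "J <= I" and char: "!!n. n > 0 ==> of_nat n ~: m"
  and E: "deriv_mod I E" "!!a. a : I ==> E a : I" and y: "E y - 1 : I" and a: "y * a : I"
 shows "a : I"
proof -
 have claim: "y ^ Suc k * (E ^^ k) a : I & of_nat (fact k) * a - (- 1) ^ k * (y ^ k * (E ^^ k) a) : I" for k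
 proof (induction k)
  case 0
  thus ?case using a idl_0[OF I(1)] by simp
 next
  case (Suc k)
  define b where "b = (E ^^ k) a"
  have yb: "y ^ Suc k * b : I" and ka: "of_nat (fact k) * a - (- 1) ^ k * (y ^ k * b) : I" using Suc.IH by (simp_all add: b_def)
  have 1: "E (y ^ Suc k * b) - (y ^ Suc k * E b + b * E (y ^ Suc k)) : I" using E(1) by (auto simp: deriv_mod_def)
  have 2: "E (y ^ Suc k) - of_nat (Suc k) * y ^ k : I" by (rule deriv_power[OF I(1) E(1) y])
  have "y ^ Suc k * E b + of_nat (Suc k) * y ^ k * b = E (y ^ Suc k * b) - (E (y ^ Suc k * b) - (y ^ Suc k * E b + b * E (y ^ Suc k)))
   - b * (E (y ^ Suc k) - of_nat (Suc k) * y ^ k)" by (simp add: algebra_simps)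
  also have "... : I" by (rule idl_diff[OF I(1) idl_diff[OF I(1) E(2)[OF yb] 1] idl_mult[OF I(1) 2]])
  finally have 3: "y ^ Suc k * E b + of_nat (Suc k) * y ^ k * b : I" .
  have "y ^ Suc (Suc k) * E b = y * (y ^ Suc k * E b + of_nat (Suc k) * y ^ k * b) - of_nat (Suc k) * (y ^ Suc k * b)" by (simp add: algebra_simps)
  also have "... : I" by (rule idl_diff[OF I(1) idl_mult[OF I(1) 3] idl_mult[OF I(1) yb]])
  finally have 4: "y ^ Suc (Suc k) * E b : I" .
  have "of_nat (fact (Suc k)) * a - (- 1) ^ Suc k * (y ^ Suc k * E b) =
   of_nat (Suc k) * (of_nat (fact k) * a - (- 1) ^ k * (y ^ k * b)) + (- 1) ^ k * (y ^ Suc k * E b + of_nat (Suc k) * y ^ k * b)"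
   by (simp add: algebra_simps)
  also have "... : I" by (rule idl_add[OF I(1) idl_mult[OF I(1) ka] idl_mult[OF I(1) 3]])
  finally show ?case using 4 by (simp add: b_def)
 qed
 have col: "idl {a. y ^ k * a : I}" for k unfolding idl_def mem_Collect_eq distrib_left mult.left_commute[of "y ^ k"]
  using idl_0[OF I(1)] idl_add[OF I(1)] idl_mult[OF I(1)] by auto
 have colJ: "J <= {a. y ^ k * a : I}" for k using idl_mult[OF I(1)] I(2) by blast
 define Y where "Y k = {a. y ^ k * a : I}" for k
 have "EX W:range Y. ALL W':range Y. W <= W' --> W' = W" by (rule idl_max) (use col colJ in \<open>auto simp: Y_def\<close>)
 then obtain N where "ALL W':range Y. Y N <= W' --> W' = Y N" by auto
 hence N: "Y N <= Y k ==> Y k = Y N" for k by auto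
 note N = N[unfolded Y_def]
 \<comment> \<open>The colon ideals of the powers of y are stationary from N on, so the element
   killed by \<open>y ^ Suc N\<close> is already killed by \<open>y ^ N\<close>, and the claim
   leaves N! a in I.\<close>
 have "{a. y ^ N * a : I} <= {a. y ^ Suc N * a : I}" using idl_mult[OF I(1), of _ y] by (auto simp: mult.assoc)
 hence "{a. y ^ Suc N * a : I} = {a. y ^ N * a : I}" by (rule N)
 hence "y ^ N * (E ^^ N) a : I" using claim[of N] by blast
 hence f: "of_nat (fact N) * a : I" using claim[of N] idl_cong[OF I(1)] by (metis idl_mult I)
 obtain t where t: "of_nat (fact N) * t - 1 : J" using unit char by force
 have "t * (of_nat (fact N) * a) - a * (of_nat (fact N) * t - 1) : I"
  using t I(2) by (intro idl_diff[OF I(1) idl_mult[OF I(1) f] idl_mult[OF I(1)]]) auto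
 thus ?thesis by (simp add: algebra_simps)
qed

text \<open>\<open>y k\<close> is regular modulo I by \<open>regular_of_derivation\<close>.
  Subtracting from each remaining derivation a multiple of E, where E (y k) = 1 modulo I, makes it
  kill \<open>y k\<close>; so these derivations descend to I + (y k) and stay dual to the remaining
  y_j modulo m.\<close>

lemma depth_of_derivations:
 assumes char: "!!n. n > 0 ==> of_nat n ~: m" and "finite N"
 shows "idl I ==> J <= I ==> I <= m ==> (!!i. i : N ==> deriv_mod I (D i)) ==> (!!i a. i : N ==> a : I ==> D i a : I) ==>
  (!!j. j : N ==> y j : m) ==> (!!i j. i : N ==> j : N ==> D i (y j) - (if i = j then 1 else 0) : m) ==>
  dep m (card N) (fr {0} I)" using assms(2)
proof (induction N arbitrary: I D rule: finite_induct)
 case (insert k N)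
 note I = insert.prems(1-3)
 have Dk: "D k (y k) - 1 : m" using insert.prems(7)[of k k] by simp
 then obtain t where t: "D k (y k) * t - 1 : J" using one_m idl_cong[OF idm] unit by blast
 define E where "E a = t * D k a" for a
 have Eadd: "E (a + b) - (E a + E b) : I" for a b
 proof -
  have "D k (a + b) - (D k a + D k b) : I" using insert.prems(4)[of k] by (auto simp: deriv_mod_def)
  thus ?thesis by (metis idl_mult I E_def algebra_simps)
 qed
 have Emult: "E (a * b) - (a * E b + b * E a) : I" for a b
 proof -
  have "t * (D k (a * b) - (a * D k b + b * D k a)) : I" using insert.prems(4)[of k] by (auto simp: deriv_mod_def idl_mult I)
  thus ?thesis by (simp add: E_def algebra_simps)
 qed
 have E: "deriv_mod I E" using Eadd Emult by (simp add: deriv_mod_def)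
 have EI: "E a : I" if "a : I" for a unfolding E_def using insert.prems(5)[of k a] that by (intro idl_mult[OF I(1)]) auto
 have Ey: "E (y k) - 1 : I" using t I(2) by (auto simp: E_def mult.commute)
 have reg: "ALL a. y k * a : I --> a : I" using regular_of_derivation[OF I(1,2) char E EI Ey] by blast
 define I' where "I' = I + range ((*) (y k))"
 define D' where "D' i a = D i a - D i (y k) * E a" for i a
 have I'1: "idl I'" unfolding I'_def by (rule idl_plus[OF I(1) idl_range])
 have II': "I <= I'" unfolding I'_def by (auto simp: subset_iff mem_plus_range intro!: exI[of _ 0])
 have I'm: "I' <= m"
 proof
  fix v assume "v : I'"
  then obtain w where "v - y k * w : I" unfolding I'_def mem_plus_range by blast
  thus "v : m" using I(3) idl_cong[OF idm] idl_mult2[OF idm, of "y k" w] insert.prems(6)[of k] by blast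
 qed
 have yI': "y k : I'" unfolding I'_def mem_plus_range using idl_0[OF I(1)] by (auto intro!: exI[of _ 1])
 have D'1: "deriv_mod I (D' i)" if i: "i : N" for i unfolding deriv_mod_def
 proof (intro conjI allI)
  fix a b
  have 1: "D i (a + b) - (D i a + D i b) : I" "D i (a * b) - (a * D i b + b * D i a) : I" using insert.prems(4)[of i] i by (auto simp: deriv_mod_def)
  have "(D i (a + b) - (D i a + D i b)) - D i (y k) * (E (a + b) - (E a + E b)) : I" by (rule idl_diff[OF I(1) 1(1) idl_mult[OF I(1) Eadd]])
  thus "D' i (a + b) - (D' i a + D' i b) : I" by (simp add: D'_def algebra_simps)
  have "(D i (a * b) - (a * D i b + b * D i a)) - D i (y k) * (E (a * b) - (a * E b + b * E a)) : I"
   by (rule idl_diff[OF I(1) 1(2) idl_mult[OF I(1) Emult]])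
  thus "D' i (a * b) - (a * D' i b + b * D' i a) : I" by (simp add: D'_def algebra_simps)
 qed
 have D'I: "D' i a : I" if "i : N" "a : I" for i a
  unfolding D'_def using insert.prems(5)[of i a] that EI[of a] by (intro idl_diff[OF I(1)] idl_mult[OF I(1)]) auto
 have D'y: "D' i (y k) : I" if "i : N" for i
 proof -
  have "D' i (y k) = - (D i (y k) * (E (y k) - 1))" by (simp add: D'_def algebra_simps)
  thus ?thesis using idl_uminus[OF I(1) idl_mult[OF I(1) Ey]] by simp
 qed
 have "dep m (card N) (fr {0} I')"
 proof (rule insert.IH[OF I'1 _ I'm, of D'])
  show "J <= I'" using I(2) II' by blast
  show "deriv_mod I' (D' i)" if "i : N" for i using D'1[OF that] II' unfolding deriv_mod_def by blast
  show "D' i a : I'" if i: "i : N" and a: "a : I'" for i a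
  proof -
   obtain w where w: "a - y k * w : I" using a unfolding I'_def mem_plus_range by blast
   have d: "D' i (u + v) - (D' i u + D' i v) : I'" "D' i (u * v) - (u * D' i v + v * D' i u) : I'" for u v
    using D'1[OF i] II' unfolding deriv_mod_def by blast+
   have "D' i (a - y k * w + y k * w) - (D' i (a - y k * w) + D' i (y k * w)) : I'" by (rule d)
   hence 1: "D' i a - (D' i (a - y k * w) + D' i (y k * w)) : I'" by simp
   have 2: "D' i (a - y k * w) : I'" using D'I[OF i w] II' by blast
   have "y k * D' i w + w * D' i (y k) : I'" using D'y[OF i] II' by (intro idl_add[OF I'1 idl_mult2[OF I'1 yI'] idl_mult[OF I'1]]) blast
   thus ?thesis using d(2)[of "y k" w] 1 2 idl_cong[OF I'1] idl_add[OF I'1] by blast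
  qed
  show "y j : m" if "j : N" for j using insert.prems(6) that by auto
  show "D' i (y j) - (if i = j then 1 else 0) : m" if ij: "i : N" "j : N" for i j
  proof -
   have a: "D i (y j) - (if i = j then 1 else 0) : m" using insert.prems(7) ij by auto
   have "i ~= k" using ij insert.hyps by auto
   hence "D i (y j) - (if i = j then 1 else 0) - D i (y k) * E (y j) : m" using insert.prems(7)[of i k] ij by (auto simp: idl_diff idm a idl_mult2)
   thus ?thesis by (simp add: D'_def algebra_simps)
  qed
 qed
 thus ?case using reg insert.hyps insert.prems(6)[of k] reg_fr_iff by (auto simp: fr_plus_range I'_def)
qed simp

end

section \<open>Coefficient rings modulo the square of the maximal ideal\<close>

definition subrng :: "'a::comm_ring_1 set => bool" where
 "subrng B \<longleftrightarrow> 1 : B & (ALL a:B. ALL b:B. a - b : B & a * b : B)"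

lemma subrng_1: "subrng B ==> 1 : B" by (simp add: subrng_def)
lemma subrng_diff: "subrng B ==> a : B ==> b : B ==> a - b : B" by (simp add: subrng_def)
lemma subrng_mult: "subrng B ==> a : B ==> b : B ==> a * b : B" by (simp add: subrng_def)
lemma subrng_0: "subrng B ==> 0 : B" using subrng_diff[of B 1 1] subrng_1 by auto
lemma subrng_uminus: "subrng B ==> b : B ==> - b : B" using subrng_diff[of B 0 b] subrng_0 by auto
lemma subrng_add: "subrng B ==> a : B ==> b : B ==> a + b : B" using subrng_diff[of B a "-b"] subrng_uminus by auto
lemma subrng_sum: "subrng B ==> (!!x. x : S ==> f x : B) ==> sum f S : B"
 by (induction S rule: infinite_finite_induct) (auto simp: subrng_0 subrng_add)
lemma subrng_of_nat: "subrng B ==> of_nat n : B" by (induction n) (auto simp: subrng_0 subrng_add subrng_1)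

definition polys :: "'a::comm_ring_1 set => 'a poly set" where
 "polys B = {p. ALL i. poly.coeff p i : B}"

lemma polys_diff: "subrng B ==> p : polys B ==> q : polys B ==> p - q : polys B" by (simp add: polys_def subrng_diff)
lemma polys_add: "subrng B ==> p : polys B ==> q : polys B ==> p + q : polys B" by (simp add: polys_def subrng_add)
lemma polys_mult: "subrng B ==> p : polys B ==> q : polys B ==> p * q : polys B" by (simp add: polys_def coeff_mult subrng_sum subrng_mult)
lemma polys_monom: "subrng B ==> b : B ==> Polynomial.monom b n : polys B" by (simp add: polys_def subrng_0)
text \<open>The library's \<^const>\<open>pderiv\<close> requires a coefficient ring without zero divisors.\<close>

definition pdv :: "'a::comm_ring_1 poly => 'a poly" where
 "pdv p = (SUM i<degree p. Polynomial.monom (of_nat (Suc i) * poly.coeff p (Suc i)) i)"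

lemma coeff_pdv: "poly.coeff (pdv p) i = of_nat (Suc i) * poly.coeff p (Suc i)" by (simp add: pdv_def coeff_sum coeff_eq_0)

lemma degree_pdv: "degree p > 0 ==> degree (pdv p) < degree p"
 by (rule le_less_trans[OF degree_le[of "degree p - 1"]]) (auto simp: coeff_pdv coeff_eq_0)

lemma pdv_pCons: "pdv (pCons a p) = p + pCons 0 (pdv p)" by (rule poly_eqI) (auto simp: coeff_pdv coeff_pCons algebra_simps split: nat.split)

lemma polys_pdv: "subrng B ==> p : polys B ==> pdv p : polys B" unfolding polys_def
proof (intro CollectI allI)
 fix i assume B: "subrng B" "p : {p. ALL i. poly.coeff p i : B}"
 have "of_nat (Suc i) * poly.coeff p (Suc i) : B" by (rule subrng_mult[OF B(1) subrng_of_nat[OF B(1)]]) (use B in simp)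
 thus "poly.coeff (pdv p) i : B" by (simp add: coeff_pdv)
qed

lemma subrng_eval:
 assumes B: "subrng B" shows "subrng {poly p a |p. p : polys B}" unfolding subrng_def
proof (intro conjI ballI) show "1 : {poly p a |p. p : polys B}" using polys_monom[OF B subrng_1[OF B], of 0] by force
 fix u v assume "u : {poly p a |p. p : polys B}" "v : {poly p a |p. p : polys B}"
 then obtain p q where pq: "u = poly p a" "v = poly q a" "p : polys B" "q : polys B" by blast
 have "u - v = poly (p - q) a" "u * v = poly (p * q) a" using pq by simp_all
 thus "u - v : {poly p a |p. p : polys B}" "u * v : {poly p a |p. p : polys B}" using polys_diff[OF B pq(3,4)] polys_mult[OF B pq(3,4)] by blast+
qed

lemma eval_const: "subrng B ==> b : B ==> b : {poly p a |p. p : polys B}" using polys_monom[of B b 0] by (force simp: poly_monom)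

lemma eval_var: "subrng B ==> a : {poly p a |p. p : polys B}" using polys_monom[of B 1 1] subrng_1[of B] by (force simp: poly_monom)

lemma poly_taylor2: "EX q. poly p (x + h) = poly p x + h * poly (pdv p) x + h * h * q" for p :: "'a::comm_ring_1 poly"
proof (induction p)
 case (pCons a p)
 then obtain q where q: "poly p (x + h) = poly p x + h * poly (pdv p) x + h * h * q" by blast
 have "poly (pCons a p) (x + h) = poly (pCons a p) x + h * poly (pdv (pCons a p)) x + h * h * (poly (pdv p) x + (x + h) * q)"
  unfolding pdv_pCons poly_pCons q by (simp add: algebra_simps)
 thus ?case by blast
next
 case 0
 show ?case by (rule exI[of _ 0]) (simp add: pdv_def)
qed

lemma monic_division:
 assumes B: "subrng B" and g: "g : polys B" "poly.coeff g (degree g) = 1" "degree g > 0"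
 shows "h : polys B ==> EX q:polys B. EX r:polys B. h = q * g + r & degree r < degree g"
proof (induction "degree h" arbitrary: h rule: less_induct)
 case less
 show ?case
 proof (cases "degree h < degree g")
  case True
  have "0 : polys B" by (simp add: polys_def subrng_0[OF B])
  thus ?thesis using True less.prems by (intro bexI[of _ 0] bexI[of _ h]) auto
 next
  case False
  define d where "d = degree h - degree g"
  define c where "c = Polynomial.monom (poly.coeff h (degree h)) d"
  have c: "c : polys B" unfolding c_def using less.prems by (intro polys_monom[OF B]) (simp add: polys_def)
  define h' where "h' = h - c * g"
  have h': "h' : polys B" unfolding h'_def by (rule polys_diff[OF B less.prems polys_mult[OF B c g(1)]])
  have dg: "degree h = d + degree g" using False by (simp add: d_def)
  have "degree (c * g) <= degree h" using degree_mult_le[of c g] degree_monom_le[of "poly.coeff h (degree h)" d] dg by (simp add: c_def)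
  moreover have "poly.coeff (c * g) (degree h) = poly.coeff h (degree h)" unfolding c_def by (simp add: coeff_monom_mult dg g(2))
  ultimately have "degree h' < degree h" unfolding h'_def using False g(3) by (intro le_neq_implies_less[OF degree_diff_le[OF le_refl]])
    (auto, metis (no_types, lifting) coeff_0 coeff_diff diff_self degree_0 leading_coeff_0_iff less_nat_zero_code)
  then obtain q r where "q : polys B" "r : polys B" "h' = q * g + r" "degree r < degree g" using less.hyps h' by blast
  thus ?thesis using polys_add[OF B _ c, of q] by (intro bexI[of _ "q + c"] bexI[of _ r]) (auto simp: h'_def algebra_simps)
 qed
qed

text \<open>B meets m only inside m2, so its image modulo m2 embeds into the residue field. By Zorn
  take B maximal; it is a field modulo m2 and meets every residue class: for a transcendental a,
  B[a] is admissible too; for an algebraic a, separability lets a Newton step move a to a root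
  modulo m2 of a monic polynomial over B.\<close>

theorem coefficient_subring:
 fixes m m2 B0 :: "'a::comm_ring_1 set"
 assumes idm: "idl m" and one: "1 ~: m" and unit: "!!s. s ~: m ==> EX t. s * t - 1 : m"
  and id2: "idl m2" and m2m: "m2 <= m" and mm: "!!a b. a : m ==> b : m ==> a * b : m2"
  and char: "!!n::nat. n > 0 ==> of_nat n ~: m"
  and B0: "subrng B0" "B0 \<inter> m <= m2"
 shows "EX B. subrng B & B0 <= B & B \<inter> m <= m2 & (ALL a. EX b:B. a - b : m)"
proof -
 define S where "S = {B. subrng B & B0 <= B & B \<inter> m <= m2}"
 have "EX M:S. ALL W:S. M <= W --> W = M"
 proof (rule subset_Zorn_nonempty)
  show "S ~= {}" using B0 by (auto simp: S_def)
  fix C assume C: "C ~= {}" "subset.chain S C"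
  have CS: "W : S" if "W : C" for W using C that by (auto simp: subset_chain_def)
  have "subrng (\<Union>C)" unfolding subrng_def
  proof (intro conjI ballI)
   show "1 : \<Union>C" using C CS subrng_1 by (fastforce simp: S_def)
   fix a b assume "a : \<Union>C" "b : \<Union>C"
   then obtain W W0 where XY: "W : C" "W0 : C" "a : W" "b : W0" by blast
   hence "W <= W0 | W0 <= W" using C(2) by (simp add: subset_chain_def)
   then obtain Z where Z: "Z : C" "a : Z" "b : Z" using XY by blast
   hence "subrng Z" using CS by (auto simp: S_def)
   thus "a - b : \<Union>C" "a * b : \<Union>C" using Z subrng_diff subrng_mult by blast+
  qed
  moreover have "B0 <= \<Union>C" "\<Union>C \<inter> m <= m2" using C(1) CS by (auto simp: S_def)
  ultimately show "\<Union>C : S" by (simp add: S_def)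
 qed
 then obtain B where BS: "B : S" and max: "!!W. W : S ==> B <= W ==> W = B" by blast
 have B: "subrng B" "B0 <= B" "B \<inter> m <= m2" using BS by (auto simp: S_def)
 have ext: "W <= B" if "subrng W" "B <= W" "W \<inter> m <= m2" for W using max[of W] that B by (auto simp: S_def)
 have inv: "EX c:B. b * c - 1 : m2" if b: "b : B" "b ~: m" for b
 proof -
  \<comment> \<open>Fractions with denominators in B outside m, taken modulo m2; this ring is
    admissible, hence equals B.\<close>
  define W where "W = {a. EX b:B - m. EX c:B. a * b - c : m2}"
  have prime: "u * v ~: m" if uv: "u ~: m" "v ~: m" for u v
  proof
   assume a: "u * v : m"
   obtain t where t: "v * t - 1 : m" using unit uv by blast
   have "u * v * t - u * (v * t - 1) : m" by (rule idl_diff[OF idm idl_mult2[OF idm a] idl_mult[OF idm t]])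
   thus False using uv by (simp add: algebra_simps)
  qed
  have 1: "1 : B - m" using subrng_1[OF B(1)] one by simp
  have BX: "B <= W"
  proof
   fix a assume "a : B"
   thus "a : W" unfolding W_def using 1 idl_0[OF id2] by (intro CollectI bexI[of _ 1] bexI[of _ a]) auto
  qed
  have "W <= B"
  proof (rule ext[OF _ BX])
   show "subrng W" unfolding subrng_def
   proof (intro conjI ballI)
    show "1 : W" using BX 1 by blast
    fix a a' assume "a : W" "a' : W"
    then obtain b c b' c' where b: "b : B - m" "c : B" "a * b - c : m2" "b' : B - m" "c' : B" "a' * b' - c' : m2" unfolding W_def by blast
    have bb: "b * b' : B - m" using b prime subrng_mult[OF B(1)] by auto
    have "b' * (a * b - c) - b * (a' * b' - c') : m2" by (rule idl_diff[OF id2 idl_mult[OF id2 b(3)] idl_mult[OF id2 b(6)]])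
    hence "(a - a') * (b * b') - (b' * c - b * c') : m2" by (simp add: algebra_simps)
    moreover have "b' * c - b * c' : B" using b subrng_mult[OF B(1)] subrng_diff[OF B(1)] by auto
    ultimately show "a - a' : W" unfolding W_def using bb by blast
    have "a' * b' * (a * b - c) + c * (a' * b' - c') : m2" by (rule idl_add[OF id2 idl_mult[OF id2 b(3)] idl_mult[OF id2 b(6)]])
    hence "(a * a') * (b * b') - c * c' : m2" by (simp add: algebra_simps)
    moreover have "c * c' : B" using b subrng_mult[OF B(1)] by auto
    ultimately show "a * a' : W" unfolding W_def using bb by blast
   qed
   show "W \<inter> m <= m2"
   proof safe
    fix a assume "a : W" and am: "a : m"
    then obtain b c where b: "b : B - m" "c : B" "a * b - c : m2" unfolding W_def by blast
    have ab: "a * b : m2" using idl_cong[OF idm, of "a * b" c] m2m idl_mult2[OF idm am] b B(3) idl_cong[OF id2 b(3)] by blast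
    obtain t where t: "b * t - 1 : m" using unit b(1) by blast
    have "t * (a * b) - a * (b * t - 1) : m2" by (rule idl_diff[OF id2 idl_mult[OF id2 ab] mm[OF am t]])
    thus "a : m2" by (simp add: algebra_simps)
   qed
  qed
  moreover obtain t where t: "b * t - 1 : m" using unit b(2) by blast
  \<comment> \<open>One Newton step for the inverse: 1 - b c is (b t - 1)^2, which lies in
    m2.\<close>
  define c where "c = t * (1 - (b * t - 1))" have bc: "b * c - 1 : m2" using idl_uminus[OF id2 mm[OF t t]] by (simp add: c_def algebra_simps)
  hence "c : W" unfolding W_def using b subrng_1[OF B(1)] by (intro CollectI bexI[of _ b] bexI[of _ 1]) (auto simp: mult.commute)
  ultimately show ?thesis using bc by blast
 qed
 have "EX b:B. a - b : m" for a
 proof (rule ccontr)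
  assume neg: "~?thesis"
  \<comment> \<open>Polynomials over B whose residue polynomial has degree d and root a;
    \<open>trunc\<close> discards leading coefficients that lie in m.\<close>
  define good where "good d g \<longleftrightarrow> g : polys B & degree g <= d & poly.coeff g d ~: m & poly g a : m" for d g
  have trunc: "EX d' g. good d' g & d' <= d" if p: "p : polys B" "degree p <= d" "poly p a : m" "EX i. poly.coeff p i ~: m" for p d using p
  proof (induction d arbitrary: p)
   case 0
   thus ?case using coeff_eq_0[of p] idl_0[OF idm] by (metis bot_nat_0.not_eq_extremum le_zero_eq good_def)
  next
   case (Suc d)
   show ?case
   proof (cases "poly.coeff p (Suc d) : m")
    case True
    define p' where "p' = p - Polynomial.monom (poly.coeff p (Suc d)) (Suc d)"
    have c2: "poly.coeff p (Suc d) : B" using Suc.prems by (auto simp: polys_def)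
    have 1: "p' : polys B" unfolding p'_def by (rule polys_diff[OF B(1) Suc.prems(1) polys_monom[OF B(1) c2]])
    have "poly.coeff p' i = 0" if "i > d" for i using that coeff_eq_0[of p i] Suc.prems(2) by (cases "i = Suc d") (auto simp: p'_def)
    hence 2: "degree p' <= d" by (meson degree_le)
    have 3: "poly p' a : m" using idl_diff[OF idm Suc.prems(3) idl_mult2[OF idm True]] by (simp add: p'_def poly_monom)
    obtain i where i: "poly.coeff p i ~: m" using Suc.prems by blast
    hence "poly.coeff p' i ~: m" using True by (auto simp: p'_def)
    thus ?thesis using Suc.IH[OF 1 2 3] by (meson le_SucI)
   next
    case False
    thus ?thesis using Suc.prems unfolding good_def by blast
   qed
  qed
  have "EX d g. good d g"
  proof (rule ccontr)
   assume ng: "~?thesis"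
   \<comment> \<open>Transcendental case: a polynomial over B with value in m at a has all
     coefficients in m, hence in m2, so B[a] is admissible.\<close>
   have "{poly p a |p. p : polys B} <= B"
   proof (rule ext[OF subrng_eval[OF B(1)]])
    show "B <= {poly p a |p. p : polys B}" using eval_const[OF B(1)] by blast
    show "{poly p a |p. p : polys B} \<inter> m <= m2"
    proof safe
     fix p assume p: "p : polys B" "poly p a : m"
     have "poly.coeff p i : m" for i using trunc[OF p(1) le_refl p(2)] ng by blast
     hence "poly.coeff p i : m2" for i using B(3) p(1) by (auto simp: polys_def)
     thus "poly p a : m2" unfolding poly_altdef by (intro idl_sum[OF id2] idl_mult2[OF id2])
    qed
   qed
   thus False using eval_var[OF B(1)] neg idl_0[OF idm] by force
  qed
  then obtain d where "EX g. good d g" and dmin: "!!d' g. d' < d ==> ~good d' g" using exists_least_iff[of "%d. EX g. good d g"] by blast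
  then obtain g0 where g0: "g0 : polys B" "degree g0 <= d" "poly.coeff g0 d ~: m" "poly g0 a : m" unfolding good_def by blast
  have small: "poly.coeff r i : m" if r: "r : polys B" "degree r < d" "poly r a : m" for r i
  proof (rule ccontr)
   assume "poly.coeff r i ~: m"
   then obtain d' g where "good d' g" "d' <= degree r" using trunc[OF r(1) le_refl r(3)] by blast
   thus False using dmin[of d' g] r(2) by auto
  qed obtain c where c: "c : B" "poly.coeff g0 d * c - 1 : m2" using g0 inv by (auto simp: polys_def)
  define e where "e = c * poly.coeff g0 d - 1"
  have eB: "e : B" unfolding e_def using c g0(1) by (intro subrng_diff[OF B(1)] subrng_mult[OF B(1)] subrng_1[OF B(1)]) (auto simp: polys_def)
  have em: "e : m2" using c by (simp add: e_def mult.commute)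
  \<comment> \<open>\<open>c\<close> inverts the leading coefficient only modulo m2. Subtracting the
    error \<open>e\<close> makes it exactly 1, as division with remainder requires.\<close>
  define g where "g = Polynomial.monom c 0 * g0 - Polynomial.monom e d"
  have gB: "g : polys B" unfolding g_def by (intro polys_diff[OF B(1)] polys_mult[OF B(1)] polys_monom[OF B(1)] c eB g0)
  have gc: "poly.coeff g i = c * poly.coeff g0 i - (if i = d then e else 0)" for i by (simp add: g_def coeff_monom_mult)
  have gd: "poly.coeff g d = 1" by (simp add: gc e_def)
  have "poly.coeff g i = 0" if "i > d" for i using that g0(2) coeff_eq_0[of g0 i] by (simp add: gc)
  hence "degree g <= d" by (meson degree_le)
  moreover have "d <= degree g" using gd by (intro le_degree) auto
  ultimately have dg: "degree g = d" by simp
  have ga: "poly g a : m" using idl_diff[OF idm idl_mult[OF idm g0(4)] idl_mult2[OF idm]] em m2m by (auto simp: g_def poly_monom)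
  have d0: "d > 0" using dg degree_eq_zeroE gd ga one by force
  \<comment> \<open>Separability: the derivative has smaller degree, so by minimality of d a residue
    root a would put all its coefficients into m, among them d times 1.\<close>
  have "poly (pdv g) a ~: m"
  proof
   assume pd: "poly (pdv g) a : m" have "poly.coeff (pdv g) (d - 1) : m" using degree_pdv[of g] dg d0 small[OF polys_pdv[OF B(1) gB] _ pd] by simp
   thus False using d0 gd char[OF d0] by (simp add: coeff_pdv)
  qed
  then obtain u where u: "poly (pdv g) a * u - 1 : m" using unit by blast
  \<comment> \<open>Newton correction: g(a + h) is -g(a) (g'(a) u - 1) plus a multiple of h^2, and
    both terms are products of two elements of m.\<close>
  define h where "h = - (u * poly g a)"
  define al where "al = a + h"
  have hm: "h : m" unfolding h_def by (rule idl_uminus[OF idm idl_mult[OF idm ga]])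
  have gal: "poly g al : m2"
  proof -
   obtain q where "poly g (a + h) = poly g a + h * poly (pdv g) a + h * h * q" using poly_taylor2 by blast
   hence "poly g al = - (poly g a * (poly (pdv g) a * u - 1)) + h * h * q" by (simp add: al_def h_def algebra_simps)
   also have "... : m2" by (rule idl_add[OF id2 idl_uminus[OF id2 mm[OF ga u]] idl_mult2[OF id2 mm[OF hm hm]]])
   finally show ?thesis .
  qed
  have "{poly p al |p. p : polys B} <= B"
  proof (rule ext[OF subrng_eval[OF B(1)]])
   show "B <= {poly p al |p. p : polys B}" using eval_const[OF B(1)] by blast
   show "{poly p al |p. p : polys B} \<inter> m <= m2"
   proof safe
    fix p assume p: "p : polys B" "poly p al : m"
    \<comment> \<open>Modulo g, whose value at \<open>al\<close> is in m2, p becomes a remainder of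
      degree below d; by minimality of d its coefficients are in m, hence in m2.\<close>
    obtain q r where qr: "q : polys B" "r : polys B" "p = q * g + r" "degree r < d" using monic_division[OF B(1) gB _ _ p(1)] dg gd d0 by auto
    have "poly p al - poly q al * poly g al : m" using gal m2m by (intro idl_diff[OF idm p(2) idl_mult[OF idm]]) auto
    hence ral: "poly r al : m" using qr by simp
    obtain q' where "poly r (a + h) = poly r a + h * poly (pdv r) a + h * h * q'" using poly_taylor2 by blast
    hence "poly r a = poly r al - h * (poly (pdv r) a + h * q')" by (simp add: al_def algebra_simps)
    hence "poly.coeff r i : m2" for i using idl_diff[OF idm ral idl_mult2[OF idm hm]] B(3) qr(2) by (auto simp: small qr polys_def)
    hence "poly r al : m2" unfolding poly_altdef by (intro idl_sum[OF id2] idl_mult2[OF id2])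
    thus "poly p al : m2" using idl_add[OF id2 idl_mult[OF id2 gal, of "poly q al"]] qr by simp
   qed
  qed
  hence "al : B" using eval_var[OF B(1)] by blast
  moreover have "a - al : m" using idl_uminus[OF idm hm] by (simp add: al_def)
  ultimately show False using neg by blast
 qed
 thus ?thesis using B by blast
qed

section \<open>Minimal generators and derivations into the residue field\<close>

context nloc begin

text \<open>With the number of generators minimal, a relation with a unit coefficient would express
  one generator by the others.\<close>

lemma minimal_cover:
 assumes B: "finite B" and U: "submod U" "fr B J <= U"
 shows "EX N A. finite (N::nat set) & range (mv N A) + fr B J = U & (ALL c. mv N A c : fr B J --> c : fr N m)"
proof -
 define G where "G N A \<longleftrightarrow> finite (N::nat set) & range (mv N A) + fr B J = U" for N A
 obtain n0 g where g: "ALL j<(n0::nat). g j : U" "ALL w:U. EX c. w - (SUM j<n0. sm (c j) (g j)) : fr B J"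
  using fgmod_fr[OF B U] unfolding fgmod_def by blast
 have mvg: "mv {..<n0} (%i j. g j i) c = (SUM j<n0. sm (c j) (g j))" for c by (auto simp: mv_def sum_fun sm_def mult.commute)
 have "G {..<n0} (%i j. g j i)" unfolding G_def
 proof (intro conjI Set.set_eqI iffI)
  fix v assume "v : range (mv {..<n0} (%i j. g j i)) + fr B J"
  then obtain c where c: "v - (SUM j<n0. sm (c j) (g j)) : fr B J" unfolding mem_range_plus mvg by blast
  have "(SUM j<n0. sm (c j) (g j)) : U" using g(1) by (intro submod_sum[OF U(1)] submod_sm[OF U(1)]) auto
  thus "v : U" using c U(2) submod_cong[OF U(1)] by blast
 next
  show "v : range (mv {..<n0} (%i j. g j i)) + fr B J" if "v : U" for v unfolding mem_range_plus mvg using g(2) that by blast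
 qed simp
 then obtain n where "EX N A. card N = n & G N A" and min: "!!n'. n' < n ==> ~(EX N A. card N = n' & G N A)"
  using exists_least_iff[of "%n. EX N A. card N = n & G N A"] by blast
 then obtain N A where N: "card N = n" "G N A" by blast
 have fN: "finite N" using N by (simp add: G_def)
 have "c i : m" if c: "mv N A c : fr B J" and i: "i : N" for c i
 proof (rule ccontr)
  assume "c i ~: m"
  then obtain t where t: "c i * t - 1 : J" using unit by blast
  have s: "(SUM j:N. f j) = f i + (SUM j:N - {i}. f j)" for f :: "nat => 'a" using sum.remove[OF fN i] .
  have red: "mv N A b - mv (N - {i}) A (%j. b j - b i * t * c j) : fr B J" for b unfolding fr_def mem_Collect_eq
  proof
   fix k assume k: "k : B"
   have "(mv N A b - mv (N - {i}) A (%j. b j - b i * t * c j)) k = (b i * t) * mv N A c k - (A k i * b i) * (c i * t - 1)"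
    by (simp add: mv_def s algebra_simps sum_subtractf sum_distrib_left)
   also have "... : J" using c k by (intro idl_diff[OF idJ idl_mult[OF idJ] idl_mult[OF idJ t]]) (auto simp: fr_def)
   finally show "(mv N A b - mv (N - {i}) A (%j. b j - b i * t * c j)) k : J" .
  qed
  have "range (mv (N - {i}) A) + fr B J = range (mv N A) + fr B J"
  proof (intro Set.set_eqI iffI)
   fix v assume "v : range (mv (N - {i}) A) + fr B J"
   then obtain e where "v - mv (N - {i}) A e : fr B J" unfolding mem_range_plus by blast
   moreover have "mv (N - {i}) A e = mv N A (e(i := 0))" by (simp add: mv_def s)
   ultimately show "v : range (mv N A) + fr B J" unfolding mem_range_plus by metis
  next
   fix v assume "v : range (mv N A) + fr B J"
   then obtain b where "v - mv N A b : fr B J" unfolding mem_range_plus by blast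
   thus "v : range (mv (N - {i}) A) + fr B J" unfolding mem_range_plus using submod_trans[OF sJ _ red] by blast
  qed
  hence "G (N - {i}) A" using N by (auto simp: G_def)
  moreover have "card (N - {i}) < n" using N(1) fN i by (metis card_Diff1_less)
  ultimately show False using min by blast
 qed
 hence "ALL c. mv N A c : fr B J --> c : fr N m" unfolding fr_def[of N] by blast
 thus ?thesis using N(2) unfolding G_def by blast
qed

text \<open>Modulo m^2 + J every element is b plus a combination of the y_j, with b in the
  coefficient ring and coefficients unique modulo m. The i-th coefficient is a derivation because
  products of two combinations of the y_j disappear.\<close>

theorem dual_derivations:
 assumes char: "!!n. n > 0 ==> of_nat n ~: m" and B0: "subrng B0" "B0 \<inter> m <= J"
  and N: "finite N" and ym: "!!j. j : N ==> y j : m" and gen: "!!a. a : m ==> EX c. a - (SUM j:N. c j * y j) : J"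
  and min: "!!c j. (SUM j:N. c j * y j) : J ==> j : N ==> c j : m"
 shows "EX dl::nat => 'a => 'a. ALL i:N. deriv_mod m (dl i) & (ALL b:B0. dl i b : m) & (ALL a b. a - b : J --> dl i a - dl i b : m) &
  (ALL j:N. dl i (y j) - (if i = j then 1 else 0) : m)"
proof -
 \<comment> \<open>This is m^2 + J, since the y_j generate m modulo J.\<close>
 define m2 where "m2 = {a. EX c. (ALL j:N. c j : m) & a - (SUM j:N. c j * y j) : J}"
 have J2: "J <= m2" unfolding m2_def using idl_0[OF idm] by (auto intro!: exI[of _ "%_. 0"])
 have id2: "idl m2" unfolding idl_def
 proof (intro conjI ballI allI)
  show "0 : m2" using J2 idl_0[OF idJ] by blast
  fix a assume "a : m2"
  then obtain c where c: "ALL j:N. c j : m" "a - (SUM j:N. c j * y j) : J" unfolding m2_def by blast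
  { fix x
   have "x * a - (SUM j:N. (x * c j) * y j) = x * (a - (SUM j:N. c j * y j))" by (simp add: algebra_simps sum_distrib_left)
   thus "x * a : m2" unfolding m2_def using c idl_mult[OF idm] idl_mult[OF idJ c(2), of x] by (intro CollectI exI[of _ "%j. x * c j"]) auto }
  fix b assume "b : m2"
  then obtain d where d: "ALL j:N. d j : m" "b - (SUM j:N. d j * y j) : J" unfolding m2_def by blast
  have "(a + b) - (SUM j:N. (c j + d j) * y j) = (a - (SUM j:N. c j * y j)) + (b - (SUM j:N. d j * y j))" by (simp add: distrib_right sum.distrib)
  hence "(a + b) - (SUM j:N. (c j + d j) * y j) : J" using idl_add[OF idJ c(2) d(2)] by (simp only:)
  thus "a + b : m2" unfolding m2_def using c(1) d(1) idl_add[OF idm] by (intro CollectI exI[of _ "%j. c j + d j"] conjI) auto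
 qed
 have m2m: "m2 <= m"
 proof
  fix a assume "a : m2"
  then obtain c where c: "ALL j:N. c j : m" "a - (SUM j:N. c j * y j) : J" unfolding m2_def by blast
  have "(SUM j:N. c j * y j) : m" by (intro idl_sum[OF idm] idl_mult[OF idm] ym)
  thus "a : m" using idl_cong[OF idm] c(2) Jm by blast
 qed
 have mm: "a * b : m2" if a: "a : m" and b: "b : m" for a b
 proof -
  obtain c where c: "b - (SUM j:N. c j * y j) : J" using gen b by blast
  have "a * b - (SUM j:N. (a * c j) * y j) = a * (b - (SUM j:N. c j * y j))" by (simp add: algebra_simps sum_distrib_left)
  thus ?thesis unfolding m2_def using idl_mult2[OF idm a] idl_mult[OF idJ c, of a] by (intro CollectI exI[of _ "%j. a * c j"]) auto
 qed
 have min2: "c j : m" if c: "(SUM j:N. c j * y j) : m2" and j: "j : N" for c j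
 proof -
  obtain d where d: "ALL j:N. d j : m" "(SUM j:N. c j * y j) - (SUM j:N. d j * y j) : J" using c unfolding m2_def by blast
  have "(SUM j:N. (c j - d j) * y j) : J" using d(2) by (simp add: algebra_simps sum_subtractf)
  thus ?thesis using idl_cong[OF idm] d(1) by (metis min j)
 qed
 have unit': "EX t. s * t - 1 : m" if "s ~: m" for s using unit[OF that] Jm by blast
 obtain B where B: "subrng B" "B0 <= B" "B \<inter> m <= m2" "!!a. EX b:B. a - b : m"
  using coefficient_subring[OF idm one_m unit' id2 m2m mm char B0(1)] B0(2) J2 by blast
 define rep where "rep a b c \<longleftrightarrow> b : B & a - b - (SUM j:N. c j * y j) : m2" for a b c
 have ex: "EX b c. rep a b c" for a using B gen J2 unfolding rep_def by blast
 have uniq: "c j - c' j : m" if r: "rep a b c" "rep a' b' c'" "a - a' : m2" and j: "j : N" for a a' b b' c c' j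
 proof -
  have sm: "(SUM j:N. c j * y j) : m" for c by (intro idl_sum[OF idm] idl_mult[OF idm] ym)
  have e: "(b - b') + (SUM j:N. (c j - c' j) * y j) = (a - a') - (a - b - (SUM j:N. c j * y j)) + (a' - b' - (SUM j:N. c' j * y j))"
   by (simp add: algebra_simps sum_subtractf)
  also have "... : m2" using r unfolding rep_def by (intro idl_add[OF id2 idl_diff[OF id2]]) auto
  finally have 1: "(b - b') + (SUM j:N. (c j - c' j) * y j) : m2" .
  hence "(b - b') + (SUM j:N. (c j - c' j) * y j) - (SUM j:N. (c j - c' j) * y j) : m" using m2m by (intro idl_diff[OF idm _ sm]) blast
  hence "b - b' : m2" using B(3) subrng_diff[OF B(1)] r unfolding rep_def by auto
  hence "(b - b') + (SUM j:N. (c j - c' j) * y j) - (b - b') : m2" by (rule idl_diff[OF id2 1])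
  thus ?thesis using min2 j by force
 qed
 have "ALL a. EX p. rep a (fst p) (snd p)" using ex by auto
 from choice[OF this] obtain p where p: "!!a. rep a (fst (p a)) (snd (p a))" by blast
 define dl where "dl i a = snd (p a) i" for i a
 have dl: "dl i a - c i : m" if "rep a b c" "i : N" for a b c i unfolding dl_def using uniq[OF p that(1) _ that(2)] idl_0[OF id2] by simp
 have sum2: "(SUM j:N. c j * y j) * (SUM j:N. d j * y j) : m2" for c d by (intro mm idl_sum[OF idm] idl_mult[OF idm] ym)
 have radd: "rep (a + a') (b + b') (%j. c j + c' j)" if "rep a b c" "rep a' b' c'" for a b c a' b' c'
 proof -
  have "(a + a') - (b + b') - (SUM j:N. (c j + c' j) * y j) = (a - b - (SUM j:N. c j * y j)) + (a' - b' - (SUM j:N. c' j * y j))"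
   by (simp add: distrib_right sum.distrib)
  also have "... : m2" using that unfolding rep_def by (intro idl_add[OF id2]) auto
  finally show ?thesis using that subrng_add[OF B(1)] unfolding rep_def by blast
 qed
 have rmult: "rep (a * a') (b * b') (%j. b * c' j + b' * c j)" if r: "rep a b c" "rep a' b' c'" for a b c a' b' c'
 proof -
  define s where "s = (SUM j:N. c j * y j)"
  define s' where "s' = (SUM j:N. c' j * y j)"
  have 1: "a - b - s : m2" "a' - b' - s' : m2" using r by (auto simp: rep_def s_def s'_def)
  have ss: "s * s' : m2" unfolding s_def s'_def by (rule sum2)
  have "a * a' - b * b' - (SUM j:N. (b * c' j + b' * c j) * y j) = a' * (a - b - s) + (b + s) * (a' - b' - s') + s * s'"
   unfolding s_def s'_def by (simp add: algebra_simps sum.distrib sum_distrib_left)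
  also have "... : m2" by (rule idl_add[OF id2 idl_add[OF id2 idl_mult[OF id2 1(1)] idl_mult[OF id2 1(2)]] ss])
  finally show ?thesis using r subrng_mult[OF B(1)] unfolding rep_def by auto
 qed
 have rb: "a - b : m" if "rep a b c" for a b c
 proof -
  have "a - b - (SUM j:N. c j * y j) : m" using that m2m by (auto simp: rep_def)
  moreover have "(SUM j:N. c j * y j) : m" by (intro idl_sum[OF idm] idl_mult[OF idm] ym)
  ultimately show ?thesis using idl_cong[OF idm] by blast
 qed
 show ?thesis
 proof (intro exI[of _ dl] ballI conjI allI impI)
  fix i assume i: "i : N"
  show "deriv_mod m (dl i)" unfolding deriv_mod_def
  proof (intro conjI allI)
   fix a b
   show "dl i (a + b) - (dl i a + dl i b) : m" using dl[OF radd[OF p p] i] by (simp add: dl_def)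
   define f g where "f = fst (p a)" and "g = fst (p b)"
   have 1: "dl i (a * b) - (f * dl i b + g * dl i a) : m" using dl[OF rmult[OF p p] i] by (simp add: dl_def f_def g_def)
   have 2: "a - f : m" "b - g : m" using rb[OF p] by (auto simp: f_def g_def)
   have "dl i (a * b) - (a * dl i b + b * dl i a) = (dl i (a * b) - (f * dl i b + g * dl i a)) - (a - f) * dl i b - (b - g) * dl i a"
    by (simp add: algebra_simps)
   also have "... : m" by (rule idl_diff[OF idm idl_diff[OF idm 1 idl_mult2[OF idm 2(1)]] idl_mult2[OF idm 2(2)]])
   finally show "dl i (a * b) - (a * dl i b + b * dl i a) : m" .
  qed
  show "dl i b : m" if "b : B0" for b
  proof -
   have "rep b b (%_. 0)" using that B(2) idl_0[OF id2] by (auto simp: rep_def)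
   from dl[OF this i] show ?thesis by simp
  qed
  show "dl i a - dl i b : m" if "a - b : J" for a b unfolding dl_def using uniq[OF p p _ i] that J2 by blast
  fix j assume j: "j : N"
  have "(SUM l:N. (if l = j then 1 else 0) * y l) = y j"
  proof -
   have "(SUM l:N. (if l = j then 1 else 0) * y l) = (SUM l:N. if l = j then y l else 0)" by (intro sum.cong) auto
   thus ?thesis using N j by simp
  qed
  hence "rep (y j) 0 (%l. if l = j then 1 else 0)" using subrng_0[OF B(1)] idl_0[OF id2] by (simp add: rep_def)
  from dl[OF this i] show "dl i (y j) - (if i = j then 1 else 0) : m" by simp
 qed
qed

end


section \<open>A class-typed ring mapping onto every commutative ring on a given type\<close>

text \<open>A ring with a carrier set is not a type. The product of \<open>\<int>\<close> with all commutative
 rings on subsets of \<open>'r\<close> is a type of class \<^class>\<open>comm_ring_1\<close>, and each of these rings is a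
 quotient of it; the factor \<open>\<int>\<close> only ensures \<open>0 \<noteq> 1\<close>.\<close>

typedef 'r uni = "{p :: int \<times> ('r ring => 'r). ALL S. if cring S then snd p S : carrier S else snd p S = undefined}"
proof
 show "(0, %S. if cring S then 0{S} else undefined) : {p :: int \<times> ('r ring => 'r).
  ALL S. if cring S then snd p S : carrier S else snd p S = undefined}" by (auto simp: cring.cring_simprules)
qed

setup_lifting type_definition_uni

instantiation uni :: (type) comm_ring_1
begin

lift_definition zero_uni :: "'a uni" is "(0, %S. if cring S then 0{S} else undefined)" by (auto simp: cring.cring_simprules)
lift_definition one_uni :: "'a uni" is "(1, %S. if cring S then 1{S} else undefined)" by (auto simp: cring.cring_simprules)
lift_definition plus_uni :: "'a uni => 'a uni => 'a uni" is
 "%p q. (fst p + fst q, %S. if cring S then snd p S +{S} snd q S else undefined)"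
 by (simp add: cring.cring_simprules split: if_splits)
lift_definition times_uni :: "'a uni => 'a uni => 'a uni" is
 "%p q. (fst p * fst q, %S. if cring S then snd p S *{S} snd q S else undefined)"
 by (simp add: cring.cring_simprules split: if_splits)
lift_definition uminus_uni :: "'a uni => 'a uni" is
 "%p. (- fst p, %S. if cring S then \<ominus>\<^bsub>S\<^esub> snd p S else undefined)" by (simp add: cring.cring_simprules split: if_splits)
definition minus_uni :: "'a uni => 'a uni => 'a uni" where
 "a - b = a + - b" for a b :: "'a uni"

instance
proof
 fix a b c :: "'a uni"
 show "a + b + c = a + (b + c)" by transfer (auto simp: fun_eq_iff cring.cring_simprules prod_eq_iff)
 show "a + b = b + a" by transfer (auto simp: fun_eq_iff cring.cring_simprules prod_eq_iff)
 show "0 + a = a" by transfer (auto simp: fun_eq_iff cring.cring_simprules prod_eq_iff)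
 show "- a + a = 0" by transfer (auto simp: fun_eq_iff cring.cring_simprules prod_eq_iff)
 show "a - b = a + - b" by (simp add: minus_uni_def)
 show "a * b * c = a * (b * c)" by transfer (auto simp: fun_eq_iff cring.cring_simprules prod_eq_iff)
 show "a * b = b * a" by transfer (auto simp: fun_eq_iff cring.cring_simprules prod_eq_iff)
 show "1 * a = a" by transfer (auto simp: fun_eq_iff cring.cring_simprules prod_eq_iff)
 show "(a + b) * c = a * c + b * c" by transfer (auto simp: fun_eq_iff cring.cring_simprules prod_eq_iff distrib_right)
 show "(0::'a uni) ~= 1" by transfer simp
qed

end

lift_definition ev :: "'r ring => 'r uni => 'r" is "%R p. snd p R" .

lift_definition lft :: "'r ring => 'r => 'r uni" is
 "%R r. (0, %S. if cring S then if S = R & r : carrier R then r else 0{S} else undefined)" by (simp add: cring.cring_simprules)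

definition evk :: "'r ring => 'r uni set" where
 "evk R = {x. ev R x = 0{R}}"

locale uring = cring R for R :: "'r ring" (structure)
begin

lemma ev_closed [simp, intro]: "ev R x : carrier R" using cring_axioms by transfer metis
lemma ev_add [simp]: "ev R (x + y) = ev R x \<oplus> ev R y" using cring_axioms by transfer simp
lemma ev_mult [simp]: "ev R (x * y) = ev R x \<otimes> ev R y" using cring_axioms by transfer simp
lemma ev_0 [simp]: "ev R 0 = \<zero>" using cring_axioms by transfer simp
lemma ev_1 [simp]: "ev R 1 = \<one>" using cring_axioms by transfer simp
lemma ev_uminus [simp]: "ev R (- x) = \<ominus> ev R x" using cring_axioms by transfer simp
lemma ev_diff [simp]: "ev R (x - y) = ev R x \<ominus> ev R y" by (simp only: minus_uni_def ev_add ev_uminus a_minus_def)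
lemma ev_lft [simp]: "r : carrier R ==> ev R (lft R r) = r" using cring_axioms by transfer simp
lemma ev_surj: "r : carrier R ==> EX x. r = ev R x" using ev_lft by metis
lemma ev_sum: "finite S ==> ev R (sum f S) = (\<Oplus>i\<in>S. ev R (f i))" by (induction S rule: finite_induct) auto

lemma evk_diff_iff: "x - y : evk R \<longleftrightarrow> ev R x = ev R y" by (simp add: evk_def)

lemma evk_iff: "x : evk R \<longleftrightarrow> ev R x = \<zero>" by (simp add: evk_def)

lemma idl_vimage:
 assumes "ideal I R" shows "idl {x. ev R x : I}" "evk R <= {x. ev R x : I}"
proof -
 interpret I: ideal I R by fact
 show "idl {x. ev R x : I}" unfolding idl_def by (auto intro: I.I_l_closed)
 show "evk R <= {x. ev R x : I}" by (auto simp: evk_def)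
qed

lemma idl_evk: "idl (evk R)" unfolding idl_def evk_def by auto

lemma ideal_image:
 assumes I: "idl I" "evk R <= I"
 shows "ideal (ev R ` I) R" and "!!x. ev R x : ev R ` I \<longleftrightarrow> x : I"
proof -
 show mem: "ev R x : ev R ` I \<longleftrightarrow> x : I" for x using evk_diff_iff I idl_cong by blast
 show "ideal (ev R ` I) R"
 proof (rule idealI[OF ring_axioms])
  show "subgroup (ev R ` I) (add_monoid R)"
  proof (rule subgroup.intro)
   show "ev R ` I <= carrier (add_monoid R)" by auto
   fix x y assume "x : ev R ` I" "y : ev R ` I"
   then obtain a b where "a : I" "b : I" "x = ev R a" "y = ev R b" by blast
   thus "x *{add_monoid R} y : ev R ` I" using idl_add[OF I(1), of a b] by (auto simp flip: ev_add)
  next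
   show "1{add_monoid R} : ev R ` I" using idl_0[OF I(1)] ev_0 by (metis image_eqI monoid.simps(2))
  next
   fix x assume "x : ev R ` I"
   then obtain a where a: "a : I" "x = ev R a" by blast
   hence "inv\<^bsub>add_monoid R\<^esub> x = ev R (- a)" by (simp add: a_inv_def)
   thus "inv\<^bsub>add_monoid R\<^esub> x : ev R ` I" using idl_uminus[OF I(1) a(1)] by (metis imageI)
  qed
  fix a r assume "a : ev R ` I" and r: "r : carrier R"
  then obtain x where x: "x : I" "a = ev R x" by blast
  obtain y where y: "r = ev R y" using ev_surj r by blast
  show "r \<otimes> a : ev R ` I" using idl_mult[OF I(1) x(1), of y] x y by (metis ev_mult imageI)
  show "a \<otimes> r : ev R ` I" using idl_mult2[OF I(1) x(1), of y] x y by (metis ev_mult imageI)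
 qed
qed

lemma genideal_mem:
 assumes "!!j. j : N ==> ev R (g j) : B" "B <= carrier R"
 shows "ev R (SUM j:N. c j * g j) : Idl B"
proof -
 interpret I: ideal "Idl B" R by (rule genideal_ideal[OF assms(2)])
 have "idl {x. ev R x : Idl B}" by (rule idl_vimage(1)[OF I.ideal_axioms])
 hence "(SUM j:N. c j * g j) : {x. ev R x : Idl B}" using assms genideal_self[OF assms(2)] by (intro idl_sum idl_mult) auto
 thus ?thesis by simp
qed

lemma image_genideal:
 assumes I: "idl I" "evk R <= I" and g: "!!j. j : N ==> g j : I" "!!a. a : I ==> EX c. a - (SUM j:N. c j * g j) : evk R"
 shows "Idl ((%j. ev R (g j)) ` N) = ev R ` I"
proof
 show "Idl ((%j. ev R (g j)) ` N) <= ev R ` I" using g(1) by (intro genideal_minimal[OF ideal_image(1)[OF I]]) auto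
 show "ev R ` I <= Idl ((%j. ev R (g j)) ` N)"
 proof
  fix x assume "x : ev R ` I"
  then obtain a where a: "a : I" "x = ev R a" by blast
  obtain c where "a - (SUM j:N. c j * g j) : evk R" using g(2) a by blast
  thus "x : Idl ((%j. ev R (g j)) ` N)" using a evk_diff_iff by (auto intro!: genideal_mem)
 qed
qed

lemma noetherian_ring_of_noeth: assumes "noeth (evk R)" shows "noetherian_ring R"
proof
 interpret N: noeth "evk R" by fact
 fix I assume I: "ideal I R"
 note v = idl_vimage[OF I]
 obtain n g where g: "ALL j<(n::nat). g j : {x. ev R x : I}" "ALL a:{x. ev R x : I}. EX c. a - (SUM j<n. c j * g j) : evk R" using N.fg[OF v] by blast
 have "Idl ((%j. ev R (g j)) ` {..<n}) = ev R ` {x. ev R x : I}" by (rule image_genideal[OF v]) (use g in auto)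
 moreover have "ev R ` {x. ev R x : I} = I" using ideal.Icarr[OF I] ev_surj by blast
 ultimately show "EX A<=carrier R. finite A & I = Idl A" by (intro exI[of _ "(%j. ev R (g j)) ` {..<n}"]) auto
qed

lemma prime_idl_vimage:
 assumes "primeideal P R" shows "prime_idl {x. ev R x : P}"
proof -
 interpret P: primeideal P R by (rule assms)
 show ?thesis using P.I_notcarr P.one_imp_carrier idl_vimage[OF P.ideal_axioms] P.I_prime unfolding prime_idl_def by auto
qed

lemma primeideal_image:
 assumes P: "prime_idl P" "evk R <= P" shows "primeideal (ev R ` P) R"
proof -
 have iP: "idl P" using P prime_idl_idl by blast
 note im = ideal_image[OF iP P(2)]
 show ?thesis
 proof (rule primeidealI[OF im(1) cring_axioms])
  show "carrier R ~= ev R ` P" using im(2)[of 1] P(1) by (auto simp: prime_idl_def)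
  fix a b assume ab: "a : carrier R" "b : carrier R" "a \<otimes> b : ev R ` P"
  obtain x y where "a = ev R x" "b = ev R y" using ab ev_surj by metis
  thus "a : ev R ` P | b : ev R ` P" using ab(3) im(2) P(1) by (metis ev_mult prime_idl_def)
 qed
qed

end

definition local_with :: "('r, 'c) ring_scheme => 'r set => bool" where
 "local_with R mq \<longleftrightarrow> cring R & ideal mq R & 1{R} ~: mq & (ALL a:carrier R - mq. a : Units R)"

lemma local_with_maximal:
 assumes "local_with R mq" shows "maximalideal I R \<longleftrightarrow> I = mq"
proof -
 interpret cring R using assms by (simp add: local_with_def)
 interpret m: ideal mq R using assms by (simp add: local_with_def)
 have one: "1{R} ~: mq" and un: "!!a. a : carrier R ==> a ~: mq ==> a : Units R" using assms by (auto simp: local_with_def)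
 have sub: "H <= mq" if H: "ideal H R" "H ~= carrier R" for H
 proof
  interpret H: ideal H R by fact
  fix a assume a: "a : H"
  show "a : mq"
  proof (rule ccontr)
   assume "a ~: mq"
   hence u: "a : Units R" using un a by auto
   show False using Units_l_inv[OF u] H H.one_imp_carrier by (metis H.I_l_closed a Units_inv_closed u)
  qed
 qed
 have max: "maximalideal mq R" using maximalidealI m.ideal_axioms one sub by blast
 show ?thesis
 proof
  assume I: "maximalideal I R"
  then interpret I: maximalideal I R .
  have "mq = I | mq = carrier R" using sub[OF I.ideal_axioms] I.I_notcarr by (metis I.I_maximal m.ideal_axioms m.a_subset)
  thus "I = mq" using one by auto
 qed (use max in simp)
qed

lemma local_with_local: "local_with R mq ==> local_ring R" by (metis local_with_def local_with_maximal local_ring_def)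

lemma local_with_max_ideal: "local_with R mq ==> max_ideal R = mq" unfolding max_ideal_def using local_with_maximal[of R mq] by simp

lemma (in uring) nloc_ev:
 assumes N: "noeth (evk R)" and L: "local_with R mq"
 shows "nloc (evk R) {x. ev R x : mq}"
proof -
 interpret noeth "evk R" by (rule N)
 have m: "ideal mq R" "\<one> ~: mq" "!!a. a : carrier R ==> a ~: mq ==> a : Units R" using L by (auto simp: local_with_def)
 show ?thesis
 proof
  show "idl {x. ev R x : mq}" "evk R <= {x. ev R x : mq}" by (rule idl_vimage[OF m(1)])+
  show "1 ~: {x. ev R x : mq}" using m by simp
  fix s assume "s ~: {x. ev R x : mq}"
  hence u: "ev R s : Units R" using m(3) by auto
  have "s * lft R (inv (ev R s)) - 1 : evk R" using u by (simp add: evk_diff_iff)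
  thus "EX t. s * t - 1 : evk R" by blast
 qed
qed

section \<open>Finitely generated modules as quotients of free modules\<close>

locale genmod = module R M for R :: "'r ring" (structure) and M :: "('r, 'm) module" (structure) +
 fixes N :: "nat set" and w :: "nat => 'm"
 assumes finN: "finite N" and w: "!!i. i : N ==> w i : carrier M"
begin

abbreviation smul (infixl "**" 70) where "a ** x == a **{M} x"
abbreviation madd (infixl ".+" 65) where "x .+ y == x +{M} y"
abbreviation zM where "zM == 0{M}"

sublocale uring R ..

definition lc :: "(nat => 'r uni) => 'm" where
 "lc v = (\<Oplus>\<^bsub>M\<^esub>i\<in>N. ev R (v i) ** w i)"

text \<open>Once the \<open>w i\<close> generate, M is V modulo this kernel; statements about M pass
  to the encoded modules through it.\<close>

definition lck :: "(nat => 'r uni) set" where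
 "lck = {v. lc v = zM}"

lemma lc_closed [simp, intro]: "lc v : carrier M" unfolding lc_def using w by (intro M.finsum_closed) auto

lemma lc_add: "lc (u + v) = lc u .+ lc v"
proof -
 have "lc (u + v) = (\<Oplus>\<^bsub>M\<^esub>i\<in>N. ev R (u i) ** w i .+ ev R (v i) ** w i)"
  unfolding lc_def using w by (intro M.finsum_cong') (auto simp: smult_l_distr)
 also have "... = lc u .+ lc v" unfolding lc_def using w by (intro M.finsum_addf) auto
 finally show ?thesis .
qed

lemma lc_sm: "lc (sm c v) = ev R c ** lc v" by (simp add: lc_def w finN finsum_smult_ldistr M.finsum_cong' smult_assoc1 sm_def)

lemma lc_0 [simp]: "lc 0 = zM" by (metis M.add.r_cancel_one' add.right_neutral lc_add lc_closed)

lemma lc_eta [simp]: "lc (%_. 0) = zM" using lc_0 unfolding zero_fun_def .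

lemma lc_uminus: "lc (- v) = \<ominus>\<^bsub>M\<^esub> lc v" by (metis M.minus_equality add.left_inverse lc_0 lc_add lc_closed)

lemma lc_diff: "lc (u - v) = lc u \<ominus>\<^bsub>M\<^esub> lc v" using lc_add[of u "- v"] by (simp add: lc_uminus a_minus_def)

lemma lc_un: "i : N ==> lc (un i) = w i"
proof -
 assume i: "i : N"
 have "lc (un i) = (\<Oplus>\<^bsub>M\<^esub>j\<in>N. if i = j then w j else zM)"
  unfolding lc_def using w by (intro M.finsum_cong') (auto simp: un_def smult_l_null)
 also have "... = w i" using M.finsum_singleton[OF i finN, of w] w by auto
 finally show ?thesis .
qed

lemma Mminus_zero_iff: "a : carrier M ==> b : carrier M ==> (a \<ominus>\<^bsub>M\<^esub> b = zM) = (a = b)" using M.minus_equality M.r_neg unfolding a_minus_def by blast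

lemma lck_diff_iff: "u - v : lck \<longleftrightarrow> lc u = lc v" by (simp add: lck_def lc_diff Mminus_zero_iff)

lemma submod_lck: "submod lck" unfolding submod_def lck_def by (auto simp: lc_add lc_sm)

lemma fr_lck: "fr N (evk R) <= lck"
proof
 fix v assume "v : fr N (evk R)"
 hence "lc v = (\<Oplus>\<^bsub>M\<^esub>i\<in>N. zM)" unfolding lc_def using w by (intro M.finsum_cong') (auto simp: fr_def evk_def smult_l_null)
 thus "v : lck" by (simp add: lck_def)
qed

lemma lc_mv:
 assumes "finite B" shows "lc (mv B A v) = (\<Oplus>\<^bsub>M\<^esub>j\<in>B. ev R (v j) ** lc (%i. A i j))"
proof -
 have "mv B A v = (SUM j:B. sm (v j) (%i. A i j))" by (auto simp: mv_def sum_fun sm_def mult.commute)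
 moreover have "lc (SUM j:B. F j) = (\<Oplus>\<^bsub>M\<^esub>j\<in>B. lc (F j))" for F using assms
 proof (induction B rule: finite_induct)
  case (insert x B)
  have "lc (sum F (insert x B)) = lc (F x) .+ lc (sum F B)" unfolding sum.insert[OF insert.hyps] by (rule lc_add)
  also have "... = (\<Oplus>\<^bsub>M\<^esub>j\<in>insert x B. lc (F j))"
   unfolding insert.IH using insert.hyps by (intro M.finsum_insert[symmetric]) auto
  finally show ?case .
 qed simp
 ultimately show ?thesis by (simp add: lc_sm)
qed

end

locale genmods = genmod + assumes surj: "!!x. x : carrier M ==> EX v. x = lc v"

lemma finite_module_gen:
 fixes R :: "'r ring" and M :: "('r, 'm) module"
 assumes "finite_module R M"
 shows "EX n w. genmods R M {..<n} w"
proof -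
 interpret module R M using assms by (simp add: finite_module_def)
 obtain B where B: "finite B" "B <= carrier M" "!!H. submodule H R M ==> B <= H ==> H = carrier M" using assms by (auto simp: finite_module_def)
 obtain h where h: "bij_betw h {0..<card B} B" using ex_bij_betw_nat_finite[OF B(1)] by blast
 define n where "n = card B"
 have hB: "h ` {..<n} = B" using h by (simp add: bij_betw_def n_def atLeast0LessThan)
 interpret G: genmod R M "{..<n}" h using hB B(2) by unfold_locales auto
 have "submodule (range G.lc) R M"
 proof (rule submoduleI)
  show "range G.lc <= carrier M" by auto
  show "0{M} : range G.lc" using G.lc_0 by (metis rangeI)
  show "\<ominus>\<^bsub>M\<^esub> a : range G.lc" if "a : range G.lc" for a
  proof -
   obtain v where "a = G.lc v" using \<open>a : range G.lc\<close> by blast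
   thus ?thesis using G.lc_uminus[of v] by (metis rangeI)
  qed
  show "a +{M} b : range G.lc" if ab: "a : range G.lc" "b : range G.lc" for a b
  proof -
   obtain u v where "a = G.lc u" "b = G.lc v" using ab by blast
   thus ?thesis using G.lc_add[of u v] by (metis rangeI)
  qed
  show "a **{M} x : range G.lc" if a: "a : carrier R" and x: "x : range G.lc" for a x
  proof -
   obtain c v where "a = ev R c" "x = G.lc v" using a x G.ev_surj by blast
   thus ?thesis using G.lc_sm by (metis rangeI)
  qed
 qed
 moreover have "B <= range G.lc"
 proof
  fix b assume "b : B"
  then obtain i where "i < n" "b = h i" using hB by auto
  thus "b : range G.lc" using G.lc_un[of i] by (metis lessThan_iff rangeI)
 qed
 ultimately have "range G.lc = carrier M" by (rule B(3))
 hence "genmods R M {..<n} h" by unfold_locales auto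
 thus ?thesis by blast
qed

section \<open>Depth by regular sequences\<close>

definition seq_sum :: "'a::comm_ring_1 list => (nat => 'a) set" where
 "seq_sum xs = foldr (%x W. range (sm x) + W) xs {0}"

lemma seq_sum_simps [simp]: "seq_sum [] = {0}" "seq_sum (x # xs) = range (sm x) + seq_sum xs" by (simp_all add: seq_sum_def)

lemma submod_zero: "submod {0}" by (simp add: submod_def)

lemma dep_iff_sequence:
 "dep m k U \<longleftrightarrow> (EX xs. length xs = k & set xs <= m & (ALL i<k. reg (xs ! i) (U + seq_sum (take i xs))))"
proof (induction k arbitrary: U)
 case 0
 thus ?case by auto
next
 case (Suc k)
 have eq: "U + range (sm x) + seq_sum ys = U + seq_sum (x # ys)" for x ys by (simp add: add.assoc)
 show ?case
 proof
  assume "dep m (Suc k) U"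
  then obtain x where x: "x : m" "reg x U" "dep m k (U + range (sm x))" by auto
  then obtain xs where xs: "length xs = k" "set xs <= m" "ALL i<k. reg (xs ! i) (U + range (sm x) + seq_sum (take i xs))" using Suc.IH by blast
  have "ALL i<Suc k. reg ((x # xs) ! i) (U + seq_sum (take i (x # xs)))"
  proof (intro allI impI)
   fix i assume "i < Suc k"
   thus "reg ((x # xs) ! i) (U + seq_sum (take i (x # xs)))"
    using x(2) xs(3) by (cases i) (auto simp: eq[symmetric] simp del: seq_sum_simps(2))
  qed
  thus "EX xs. length xs = Suc k & set xs <= m & (ALL i<Suc k. reg (xs ! i) (U + seq_sum (take i xs)))"
   using x(1) xs(1,2) by (intro exI[of _ "x # xs"]) auto
 next
  assume "EX xs. length xs = Suc k & set xs <= m & (ALL i<Suc k. reg (xs ! i) (U + seq_sum (take i xs)))"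
  then obtain ys where ys: "length ys = Suc k" "set ys <= m" "ALL i<Suc k. reg (ys ! i) (U + seq_sum (take i ys))" by blast
  then obtain x xs where x: "ys = x # xs" by (cases ys) auto
  have "reg (xs ! i) (U + range (sm x) + seq_sum (take i xs))" if "i < k" for i using ys(3)[rule_format, of "Suc i"] that x by (simp add: add.assoc)
  hence "dep m k (U + range (sm x))" using Suc.IH ys x by auto
  moreover have "reg x U" using ys(3)[rule_format, of 0] x by simp
  ultimately show "dep m (Suc k) U" using ys(2) x by auto
 qed
qed

text \<open>Nakayama, one element at a time. It supplies the last clause of
  \<open>regular_sequence\<close>, that the quotient is nonzero, which \<open>dep\<close> does not
  record.\<close>

lemma (in nloc) seq_sum_UNIV: "good U ==> set xs <= m ==> U + seq_sum xs = UNIV ==> U = UNIV"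
proof (induction xs arbitrary: U)
 case Nil
 thus ?case by auto
next
 case (Cons x xs) have "EX w'. w - sm x w' : U" for w
  using Cons.IH[OF good_plus[OF Cons.prems(1)], of x] Cons.prems by (auto simp: add.assoc mem_plus_range)
 hence "UNIV <= U"
 proof (intro nakayama[OF Cons.prems(1)])
  show "submod UNIV" by (simp add: submod_def)
  fix w :: "nat => 'a"
  obtain w' where "w - sm x w' : U" using \<open>EX w'. w - sm x w' : U\<close> by blast
  thus "EX (S::nat set) c h. finite S & (ALL i:S. c i : m & h i : UNIV) & w - (SUM i:S. sm (c i) (h i)) : U"
   using Cons.prems(2) by (intro exI[of _ "{0}"] exI[of _ "%_. x"] exI[of _ "%_. w'"]) simp
 qed simp
 thus ?case by auto
qed

context genmods begin

lemma ideal_times_lc: "ideal_times R M (map (ev R) xs) = lc ` seq_sum xs"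
proof (induction xs)
 case (Cons x xs)
 show ?case
 proof
  show "ideal_times R M (map (ev R) (x # xs)) <= lc ` seq_sum (x # xs)"
  proof
   fix y assume "y : ideal_times R M (map (ev R) (x # xs))"
   then obtain u z where y: "y = ev R x **{M} u +{M} z" "u : carrier M" "z : lc ` seq_sum xs" using Cons by auto
   obtain v where v: "u = lc v" using surj y by blast
   obtain s where s: "s : seq_sum xs" "z = lc s" using y by blast
   have "y = lc (sm x v + s)" using y v s by (simp add: lc_add lc_sm)
   moreover have "sm x v + s : seq_sum (x # xs)" unfolding seq_sum_simps using s(1) by blast
   ultimately show "y : lc ` seq_sum (x # xs)" by blast
  qed
  show "lc ` seq_sum (x # xs) <= ideal_times R M (map (ev R) (x # xs))"
  proof safe
   fix v assume "v : seq_sum (x # xs)"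
   then obtain u s where "v = sm x u + s" "s : seq_sum xs" unfolding seq_sum_simps set_plus_iff by blast
   thus "lc v : ideal_times R M (map (ev R) (x # xs))" using Cons by (auto simp: lc_add lc_sm)
  qed
 qed
qed simp

lemma lc_mem_ideal_times: "lc v : ideal_times R M (map (ev R) xs) \<longleftrightarrow> v : lck + seq_sum xs"
 unfolding ideal_times_lc set_plus_diff_iff2 lck_diff_iff by auto

lemma zero_iff: "carrier M = {0{M}} \<longleftrightarrow> lck = UNIV" unfolding lck_def using surj by auto

text \<open>The bridge between the supremum in \<open>depth\<close> and the recursion in
  \<open>dep\<close>. For the zero module both sides hold for every k.\<close>

lemma depth_ge_iff:
 assumes N: "noeth (evk R)" and L: "local_with R mq"
 shows "enat k <= depth R M \<longleftrightarrow> dep {x. ev R x : mq} k lck"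
proof -
 define m where "m = {x. ev R x : mq}"
 interpret nl: nloc "evk R" m unfolding m_def by (rule nloc_ev[OF N L])
 have good: "nl.good lck" unfolding nl.good_def using submod_lck fr_lck finN by blast
 have max: "max_ideal R = mq" by (rule local_with_max_ideal[OF L])
 show ?thesis
 proof (cases "lck = UNIV")
  case True
  thus ?thesis using zero_iff dep_UNIV[OF nl.idm] by (simp add: depth_def m_def)
 next
  case False
  define A where "A = {length xs |xs. set xs <= max_ideal R & regular_sequence R M xs}"
  have key: "k : A \<longleftrightarrow> dep m k lck" for k
  proof
   assume "k : A"
   then obtain ys where ys: "length ys = k" "set ys <= mq" "regular_sequence R M ys" unfolding A_def max by blast
   define xs where "xs = map (lft R) ys"
   have ysx: "ys = map (ev R) xs" unfolding xs_def using ys(3) by (auto simp: regular_sequence_def subset_iff intro!: map_idI[symmetric])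
   have "reg (xs ! i) (lck + seq_sum (take i xs))" if i: "i < k" for i unfolding reg_def
   proof (intro allI impI)
    fix v assume "sm (xs ! i) v : lck + seq_sum (take i xs)"
    hence "lc (sm (xs ! i) v) : ideal_times R M (map (ev R) (take i xs))" using lc_mem_ideal_times by blast
    hence "(ys ! i) **{M} lc v : ideal_times R M (take i ys)" using i ys(1) ysx by (simp add: lc_sm take_map)
    hence "lc v : ideal_times R M (take i ys)" using ys(1,3) i by (auto simp: regular_sequence_def)
    thus "v : lck + seq_sum (take i xs)" unfolding ysx take_map lc_mem_ideal_times .
   qed
   moreover have "set xs <= m" unfolding m_def using ys(2) ysx by auto
   ultimately show "dep m k lck" unfolding dep_iff_sequence using ys(1) ysx by (intro exI[of _ xs]) auto
  next
   assume "dep m k lck"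
   then obtain xs where xs: "length xs = k" "set xs <= m" "ALL i<k. reg (xs ! i) (lck + seq_sum (take i xs))" unfolding dep_iff_sequence by blast
   have "regular_sequence R M (map (ev R) xs)" unfolding regular_sequence_def
   proof (intro conjI allI impI ballI)
    show "set (map (ev R) xs) <= carrier R" by auto
    fix i y assume i: "i < length (map (ev R) xs)" and y: "y : carrier M"
     "(map (ev R) xs ! i) **{M} y : ideal_times R M (take i (map (ev R) xs))"
    obtain v where v: "y = lc v" using surj y by blast
    have "lc (sm (xs ! i) v) : ideal_times R M (map (ev R) (take i xs))" using i y v by (simp add: lc_sm take_map)
    hence "v : lck + seq_sum (take i xs)" using lc_mem_ideal_times xs(1,3) i unfolding reg_def by auto
    thus "y : ideal_times R M (take i (map (ev R) xs))" unfolding take_map v lc_mem_ideal_times .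
   next
    show "ideal_times R M (map (ev R) xs) ~= carrier M" using lc_mem_ideal_times nl.seq_sum_UNIV good xs False by blast
   qed
   moreover have "set (map (ev R) xs) <= max_ideal R" using xs(2) by (auto simp: max m_def)
   ultimately show "k : A" unfolding A_def using xs(1) by (intro CollectI exI[of _ "map (ev R) xs"]) simp
  qed
  have "{enat (length xs) |xs. set xs <= max_ideal R & regular_sequence R M xs} = enat ` A" unfolding A_def by blast
  hence "depth R M = Sup (enat ` A)" using False zero_iff unfolding depth_def by simp
  moreover have "enat k <= Sup (enat ` A) \<longleftrightarrow> (EX a:A. k <= a)"
  proof
   assume le: "enat k <= Sup (enat ` A)"
   show "EX a:A. k <= a"
   proof (rule ccontr)
    assume n: "~?thesis" have k0: "k > 0" using key n by auto
    have "Sup (enat ` A) <= enat (k - 1)" using n by (intro Sup_least) (auto simp: not_le)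
    with le show False using k0 order_trans by force
   qed
  next
   assume "EX a:A. k <= a"
   then obtain a where "a : A" "k <= a" by blast
   hence "enat a <= Sup (enat ` A)" by (intro Sup_upper) auto
   moreover have "enat k <= enat a" using \<open>k <= a\<close> by simp
   ultimately show "enat k <= Sup (enat ` A)" by (rule order_trans[rotated])
  qed
  ultimately show ?thesis using key dep_mono m_def by auto
 qed
qed

end

lemma module_self: assumes "cring R" shows "module R (self_module R)"
proof -
 interpret cring R by fact
 have "abelian_group (self_module R)" by (rule abelian_groupI) (auto simp: self_module_def a_ac intro: l_neg)
 thus ?thesis by (rule moduleI[OF assms]) (auto simp: self_module_def l_distr r_distr m_assoc)
qed

lemma genmods_self:
 fixes R :: "'r ring"
 assumes "cring R"
 shows "genmods R (self_module R) {0} (%_. 1{R})" and "genmod.lck R (self_module R) {0} (%_. 1{R}) = fr {0} (evk R)"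
proof -
 interpret uring R using assms by (simp add: uring_def)
 interpret module R "self_module R" by (rule module_self[OF assms])
 interpret G: genmod R "self_module R" "{0}" "%_. 1{R}" by unfold_locales (auto simp: self_module_def)
 have lc: "G.lc v = ev R (v 0)" for v
 proof -
  have "G.lc v = ev R (v 0) **{self_module R} 1{R}" unfolding G.lc_def using G.w by (simp add: M.finsum_insert)
  thus ?thesis by (simp add: self_module_def)
 qed
 show "genmods R (self_module R) {0} (%_. 1{R})"
 proof
  fix x assume "x : carrier (self_module R)"
  then obtain y where "x = ev R y" using ev_surj by (auto simp: self_module_def)
  hence "x = G.lc (%_. y)" by (simp add: lc)
  thus "EX v. x = G.lc v" by blast
 qed
 have "G.lck = {v. ev R (v 0) = 0{R}}" unfolding G.lck_def lc by (simp add: self_module_def)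
 thus "G.lck = fr {0} (evk R)" by (simp add: fr_def evk_def)
qed


section \<open>Localization\<close>

lemma self_simps [simp]:
 "carrier (self_module R) = carrier R" "0{self_module R} = 0{R}"
 "a +{self_module R} b = a +{R} b" "a **{self_module R} b = a *{R} b"
 by (simp_all add: self_module_def)

lemma (in module) smult_left_commute:
 "a : carrier R ==> b : carrier R ==> x : carrier M ==> a **{M} (b **{M} x) = b **{M} (a **{M} x)"
 by (metis smult_assoc1 R.m_comm)

locale locmod = module R M for R :: "('r, 'c) ring_scheme" (structure) and M :: "('r, 'm, 'd) module_scheme" (structure) +
 fixes S :: "'r set"
 assumes S: "S <= carrier R" and S1: "\<one> : S" and Sm: "!!s t. s : S ==> t : S ==> s \<otimes> t : S"
begin

abbreviation smul (infixl "**" 70) where "a ** x == a **{M} x"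
abbreviation madd (infixl ".+" 65) where "x .+ y == x +{M} y"
abbreviation zM where "zM == 0{M}"

abbreviation frac :: "'m => 'r => ('m \<times> 'r) set" where "frac == fraction R S M"

lemma Sc [simp]: "s : S ==> s : carrier R" using S by blast

lemmas sm_ac = smult_assoc1 smult_r_distr smult_left_commute M.a_ac

text \<open>Classes are sets of pairs, so their equality amounts to transitivity of the relation
  between fractions, used in both directions.\<close>

lemma frac_eqI:
 assumes "x : carrier M" "y : carrier M" "s : S" "t : S" "u : S" "u ** (t ** x) = u ** (s ** y)"
 shows "frac x s = frac y t"
proof -
 have tr: "EX w:S. w ** (r ** b) = w ** (q ** z)"
  if "a : carrier M" "b : carrier M" "z : carrier M" "p : S" "q : S" "r : S" "v : S" "u : S"
   and 1: "u ** (q ** a) = u ** (p ** b)" and 2: "v ** (r ** a) = v ** (p ** z)" for a b z p q r u v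
 proof (intro bexI[of _ "u \<otimes> v \<otimes> p"])
  have "(u \<otimes> v \<otimes> p) ** (r ** b) = (v \<otimes> r) ** (u ** (p ** b))" using that by (simp add: sm_ac)
  also have "... = (u \<otimes> q) ** (v ** (r ** a))" using that(1-8) unfolding 1[symmetric] by (simp add: sm_ac)
  also have "... = (u \<otimes> v \<otimes> p) ** (q ** z)" using that(1-8) unfolding 2 by (simp add: sm_ac)
  finally show "(u \<otimes> v \<otimes> p) ** (r ** b) = (u \<otimes> v \<otimes> p) ** (q ** z)" .
  show "u \<otimes> v \<otimes> p : S" using that Sm by simp
 qed
 have "(EX v:S. v ** (r ** x) = v ** (s ** z)) \<longleftrightarrow> (EX w:S. w ** (r ** y) = w ** (t ** z))"
  if zr: "z : carrier M" "r : S" for z r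
  using tr[OF assms(1,2) zr(1) assms(3,4) zr(2) _ assms(5,6)] tr[OF assms(2,1) zr(1) assms(4,3) zr(2) _ assms(5) assms(6)[symmetric]] by blast
 thus ?thesis unfolding fraction_def by blast
qed

lemma frac_self: "x : carrier M ==> s : S ==> (x, s) : frac x s" unfolding fraction_def by auto

lemma frac_mem: "(y, t) : frac x s ==> x : carrier M ==> s : S ==> y : carrier M & t : S & frac y t = frac x s"
 by (frule subst[OF fraction_def, of "%A. (y, t) : A"]) (use frac_eqI[of x y s t] in auto)

lemma frac_eq_iff:
 "x : carrier M ==> y : carrier M ==> s : S ==> t : S ==> frac x s = frac y t \<longleftrightarrow> (EX u:S. u ** (t ** x) = u ** (s ** y))"
proof
 assume "x : carrier M" "y : carrier M" "s : S" "t : S" "frac x s = frac y t"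
 hence "(y, t) : frac x s" using frac_self by simp
 thus "EX u:S. u ** (t ** x) = u ** (s ** y)" by (simp add: fraction_def)
qed (use frac_eqI[of x y s t] in blast)

lemma frac_scale: "x : carrier M ==> s : S ==> r : S ==> frac (r ** x) (r \<otimes> s) = frac x s"
 by (rule frac_eqI[where u = \<one>]) (auto simp: Sm S1 sm_ac)

lemma loc_carrierE:
 assumes "A : carrier (localized_module R S M)" obtains x s where "x : carrier M" "s : S" "A = frac x s"
 using assms by (auto simp: localized_module_def)

lemma loc_carrierI: "x : carrier M ==> s : S ==> frac x s : carrier (localized_module R S M)" by (auto simp: localized_module_def)

lemma frac_add:
 assumes x: "x : carrier M" "s : S" and y: "y : carrier M" "t : S"
 shows "frac x s +{localized_module R S M} frac y t = frac ((t ** x) .+ (s ** y)) (s \<otimes> t)"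
proof -
 have eq: "frac ((t' ** x') .+ (s' ** y')) (s' \<otimes> t') = frac ((t ** x) .+ (s ** y)) (s \<otimes> t)"
  if x': "(x', s') : frac x s" and y': "(y', t') : frac y t" for x' s' y' t'
 proof -
  have c: "x' : carrier M" "s' : S" "y' : carrier M" "t' : S" using frac_mem[OF x' x] frac_mem[OF y' y] by auto
  obtain u where u: "u : S" "u ** (s' ** x) = u ** (s ** x')" using x' by (auto simp: fraction_def)
  obtain v where v: "v : S" "v ** (t' ** y) = v ** (t ** y')" using y' by (auto simp: fraction_def)
  have "(u \<otimes> v) ** ((s \<otimes> t) ** ((t' ** x') .+ (s' ** y')))
    = (v \<otimes> t \<otimes> t') ** (u ** (s ** x')) .+ (u \<otimes> s \<otimes> s') ** (v ** (t ** y'))" using x y c u(1) v(1) by (simp add: sm_ac)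
  also have "... = (u \<otimes> v) ** ((s' \<otimes> t') ** ((t ** x) .+ (s ** y)))"
   unfolding u(2)[symmetric] v(2)[symmetric] using x y c u(1) v(1) by (simp add: sm_ac)
  finally show ?thesis using x y c u(1) v(1) Sm by (intro frac_eqI[where u = "u \<otimes> v"]) auto
 qed
 have "frac x s +{localized_module R S M} frac y t = (UN (x', s'):frac x s. UN (y', t'):frac y t. frac ((t' ** x') .+ (s' ** y')) (s' \<otimes> t'))"
  by (simp add: localized_module_def)
 also have "... = frac ((t ** x) .+ (s ** y)) (s \<otimes> t)"
 proof (rule equalityI)
  show "(UN (x', s'):frac x s. UN (y', t'):frac y t. frac ((t' ** x') .+ (s' ** y')) (s' \<otimes> t')) <= frac ((t ** x) .+ (s ** y)) (s \<otimes> t)"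
   using eq by (intro UN_least) (auto split: prod.split)
  show "frac ((t ** x) .+ (s ** y)) (s \<otimes> t) <= (UN (x', s'):frac x s. UN (y', t'):frac y t. frac ((t' ** x') .+ (s' ** y')) (s' \<otimes> t'))"
   using frac_self[OF x] frac_self[OF y] by fastforce
 qed
 finally show ?thesis .
qed

lemma abelian_group_loc: "abelian_group (localized_module R S M)" (is "abelian_group ?L")
proof (rule abelian_groupI)
 fix A assume "A : carrier ?L"
 then obtain x s where x: "x : carrier M" "s : S" "A = frac x s" by (rule loc_carrierE)
 have z: "0{?L} = frac zM \<one>" by (simp add: localized_module_def)
 show "0{?L} +{?L} A = A" using x S1 by (simp add: z frac_add)
 have "frac (\<ominus>\<^bsub>M\<^esub> x) s +{?L} A = frac (s ** (\<ominus>\<^bsub>M\<^esub> x) .+ s ** x) (s \<otimes> s)" using x by (simp add: frac_add)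
 also have "s ** (\<ominus>\<^bsub>M\<^esub> x) .+ s ** x = zM" using x by (simp add: smult_r_minus M.l_neg)
 also have "frac zM (s \<otimes> s) = frac zM \<one>" using x S1 Sm by (intro frac_eqI[where u = \<one>]) auto
 finally show "EX B:carrier ?L. B +{?L} A = 0{?L}" using x by (auto simp: z intro!: bexI loc_carrierI)
 fix B assume "B : carrier ?L"
 then obtain y t where y: "y : carrier M" "t : S" "B = frac y t" by (rule loc_carrierE)
 show "A +{?L} B : carrier ?L" using x y by (auto simp: frac_add Sm intro!: loc_carrierI)
 show "A +{?L} B = B +{?L} A" using x y by (simp add: frac_add M.a_comm R.m_comm)
 fix C assume "C : carrier ?L"
 then obtain z r where z: "z : carrier M" "r : S" "C = frac z r" by (rule loc_carrierE)
 show "A +{?L} B +{?L} C = A +{?L} (B +{?L} C)" using x y z Sm by (simp add: frac_add sm_ac R.m_assoc)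
next
 show "0{?L} : carrier ?L" using S1 by (auto simp: localized_module_def)
qed

end

context locmod begin

lemma locmod_self: "locmod R (self_module R) S"
proof -
 interpret Z: module R "self_module R" by (rule module_self[OF R.cring_axioms])
 show ?thesis by unfold_locales (use S S1 Sm in auto)
qed

interpretation Z: locmod R "self_module R" S by (rule locmod_self)

lemma frac_smult:
 assumes a: "a : carrier R" "s : S" and x: "x : carrier M" "t : S"
 shows "Z.frac a s **{localized_module R S M} frac x t = frac (a ** x) (s \<otimes> t)"
proof -
 have ac: "a : carrier (self_module R)" using a by (simp add: self_simps)
 have eq: "frac (a' ** x') (s' \<otimes> t') = frac (a ** x) (s \<otimes> t)"
  if a': "(a', s') : Z.frac a s" and x': "(x', t') : frac x t" for x' s' a' t'
 proof -
  have c: "x' : carrier M" "s' : S" "a' : carrier R" "t' : S" using frac_mem[OF x' x] Z.frac_mem[OF a' ac a(2)] by (auto simp: self_simps)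
  obtain u where u: "u : S" "u \<otimes> (s' \<otimes> a) = u \<otimes> (s \<otimes> a')" using a' by (auto simp: fraction_def self_simps)
  obtain v where v: "v : S" "v ** (t' ** x) = v ** (t ** x')" using x' by (auto simp: fraction_def)
  have "(u \<otimes> v) ** ((s \<otimes> t) ** (a' ** x')) = (u \<otimes> (s \<otimes> a')) ** (v ** (t ** x'))"
   using a x c u(1) v(1) by (simp add: sm_ac)
  also have "... = (u \<otimes> v) ** ((s' \<otimes> t') ** (a ** x))"
   unfolding u(2)[symmetric] v(2)[symmetric] using a x c u(1) v(1) by (simp add: sm_ac)
  finally show ?thesis using a x c u(1) v(1) Sm by (intro frac_eqI[where u = "u \<otimes> v"]) auto
 qed
 have "Z.frac a s **{localized_module R S M} frac x t = (UN (a', s'):Z.frac a s. UN (x', t'):frac x t. frac (a' ** x') (s' \<otimes> t'))"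
  by (simp add: localized_module_def)
 also have "... = frac (a ** x) (s \<otimes> t)"
 proof (rule equalityI)
  show "(UN (a', s'):Z.frac a s. UN (x', t'):frac x t. frac (a' ** x') (s' \<otimes> t')) <= frac (a ** x) (s \<otimes> t)"
   using eq by (intro UN_least) (auto split: prod.split)
  show "frac (a ** x) (s \<otimes> t) <= (UN (a', s'):Z.frac a s. UN (x', t'):frac x t. frac (a' ** x') (s' \<otimes> t'))"
   using Z.frac_self[OF ac a(2)] frac_self[OF x] by fastforce
 qed
 finally show ?thesis .
qed

lemma loc_ring_simps:
 "carrier (localized_ring R S) = carrier (localized_module R S (self_module R))"
 "monoid.mult (localized_ring R S) = module.smult (localized_module R S (self_module R))"
 "1{localized_ring R S} = Z.frac \<one> \<one>"
 "0{localized_ring R S} = Z.frac \<zero> \<one>"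
 "add (localized_ring R S) = add (localized_module R S (self_module R))" by (simp_all add: localized_ring_def Let_def localized_module_def)

lemma loc_ringE:
 assumes "A : carrier (localized_ring R S)" obtains a s where "a : carrier R" "s : S" "A = Z.frac a s"
 using assms Z.loc_carrierE[of A] unfolding loc_ring_simps by (auto simp: self_simps)

lemma loc_ringI: "a : carrier R ==> s : S ==> Z.frac a s : carrier (localized_ring R S)"
 unfolding loc_ring_simps by (rule Z.loc_carrierI) (auto simp: self_simps)

lemma loc_ring_add:
 "a : carrier R ==> b : carrier R ==> s : S ==> t : S ==>
  Z.frac a s +{localized_ring R S} Z.frac b t = Z.frac (t \<otimes> a \<oplus> s \<otimes> b) (s \<otimes> t)"
 using Z.frac_add[of a s b t] unfolding loc_ring_simps by (simp add: self_simps)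

lemma loc_ring_eq_iff:
 "a : carrier R ==> b : carrier R ==> s : S ==> t : S ==>
  Z.frac a s = Z.frac b t \<longleftrightarrow> (EX u:S. u \<otimes> (t \<otimes> a) = u \<otimes> (s \<otimes> b))"
 using Z.frac_eq_iff[of a b s t] by (simp add: self_simps)

lemma loc_ring_scale: "a : carrier R ==> s : S ==> r : S ==> Z.frac (r \<otimes> a) (r \<otimes> s) = Z.frac a s"
 using Z.frac_scale[of a s r] by (simp add: self_simps)

end

context locmod begin

lemma loc_ring_mult:
 "a : carrier R ==> b : carrier R ==> s : S ==> t : S ==>
  fraction R S (self_module R) a s *{localized_ring R S} fraction R S (self_module R) b t = fraction R S (self_module R) (a \<otimes> b) (s \<otimes> t)"
 using locmod.frac_smult[OF locmod_self, of a s b t] unfolding loc_ring_simps by simp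

lemma cring_loc: "cring (localized_ring R S)" (is "cring ?Q")
proof (rule cringI)
 interpret A: abelian_group "localized_module R S (self_module R)" by (rule locmod.abelian_group_loc[OF locmod_self])
 have e: "carrier ?Q = carrier (localized_module R S (self_module R))" "!!x y. x +{?Q} y = x +{localized_module R S (self_module R)} y"
  "0{?Q} = 0{localized_module R S (self_module R)}" by (simp_all add: localized_ring_def Let_def)
 show "abelian_group ?Q"
  by (rule abelian_groupI; unfold e) (auto simp: A.a_ac intro: bexI[of _ "\<ominus>\<^bsub>localized_module R S (self_module R)\<^esub> _"] A.l_neg)
 show "comm_monoid ?Q"
 proof (rule comm_monoidI)
  fix A assume "A : carrier ?Q"
  then obtain a s where a: "a : carrier R" "s : S" "A = fraction R S (self_module R) a s" by (rule loc_ringE)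
  show "1{?Q} *{?Q} A = A" using a S1 by (simp add: loc_ring_simps(3) loc_ring_mult)
  fix B assume "B : carrier ?Q"
  then obtain b t where b: "b : carrier R" "t : S" "B = fraction R S (self_module R) b t" by (rule loc_ringE)
  show "A *{?Q} B : carrier ?Q" using a b by (auto simp: loc_ring_mult Sm intro!: loc_ringI)
  show "A *{?Q} B = B *{?Q} A" using a b by (simp add: loc_ring_mult R.m_comm)
  fix C assume "C : carrier ?Q"
  then obtain c r where c: "c : carrier R" "r : S" "C = fraction R S (self_module R) c r" by (rule loc_ringE)
  show "A *{?Q} B *{?Q} C = A *{?Q} (B *{?Q} C)" using a b c Sm by (simp add: loc_ring_mult R.m_assoc)
 qed (use S1 in \<open>auto simp: loc_ring_simps(3) intro!: loc_ringI\<close>)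
 fix A B C assume ABC: "A : carrier ?Q" "B : carrier ?Q" "C : carrier ?Q"
 obtain a s where a: "a : carrier R" "s : S" "A = fraction R S (self_module R) a s" using ABC(1) by (rule loc_ringE)
 obtain b t where b: "b : carrier R" "t : S" "B = fraction R S (self_module R) b t" using ABC(2) by (rule loc_ringE)
 obtain c r where c: "c : carrier R" "r : S" "C = fraction R S (self_module R) c r" using ABC(3) by (rule loc_ringE)
 have "(A +{?Q} B) *{?Q} C = fraction R S (self_module R) ((t \<otimes> a \<oplus> s \<otimes> b) \<otimes> c) (s \<otimes> t \<otimes> r)"
  using a b c Sm by (simp add: loc_ring_mult loc_ring_add)
 also have "... = fraction R S (self_module R) (r \<otimes> ((t \<otimes> a \<oplus> s \<otimes> b) \<otimes> c)) (r \<otimes> (s \<otimes> t \<otimes> r))"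
  using a b c Sm by (simp add: loc_ring_scale)
 also have "r \<otimes> ((t \<otimes> a \<oplus> s \<otimes> b) \<otimes> c) = (t \<otimes> r) \<otimes> (a \<otimes> c) \<oplus> (s \<otimes> r) \<otimes> (b \<otimes> c)"
  using a b c by (simp add: R.r_distr R.m_ac)
 also have "r \<otimes> (s \<otimes> t \<otimes> r) = (s \<otimes> r) \<otimes> (t \<otimes> r)" using a b c by (simp add: R.m_ac)
 also have "fraction R S (self_module R) ((t \<otimes> r) \<otimes> (a \<otimes> c) \<oplus> (s \<otimes> r) \<otimes> (b \<otimes> c)) ((s \<otimes> r) \<otimes> (t \<otimes> r)) =
   (A *{?Q} C) +{?Q} (B *{?Q} C)" using a b c Sm by (simp add: loc_ring_mult loc_ring_add)
 finally show "(A +{?Q} B) *{?Q} C = (A *{?Q} C) +{?Q} (B *{?Q} C)" .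
qed

lemma module_loc: "module (localized_ring R S) (localized_module R S M)" (is "module ?Q ?M")
proof (rule moduleI[OF cring_loc abelian_group_loc])
 fix A V assume A: "A : carrier ?Q" and V: "V : carrier ?M"
 obtain a s where a: "a : carrier R" "s : S" "A = fraction R S (self_module R) a s" using A by (rule loc_ringE)
 obtain x p where x: "x : carrier M" "p : S" "V = frac x p" using V by (rule loc_carrierE)
 show "A **{?M} V : carrier ?M" using a x Sm by (auto simp: frac_smult intro!: loc_carrierI)
 { fix B assume "B : carrier ?Q"
  then obtain b t where b: "b : carrier R" "t : S" "B = fraction R S (self_module R) b t" by (rule loc_ringE)
  show "(A *{?Q} B) **{?M} V = A **{?M} (B **{?M} V)"
   using a b x Sm by (simp add: frac_smult loc_ring_mult R.m_assoc smult_assoc1)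
  have "(A +{?Q} B) **{?M} V = frac ((t \<otimes> a \<oplus> s \<otimes> b) ** x) (s \<otimes> t \<otimes> p)"
   using a b x Sm by (simp add: frac_smult loc_ring_add)
  also have "... = frac (p ** ((t \<otimes> a \<oplus> s \<otimes> b) ** x)) (p \<otimes> (s \<otimes> t \<otimes> p))" using a b x Sm by (simp add: frac_scale)
  also have "p ** ((t \<otimes> a \<oplus> s \<otimes> b) ** x) = (t \<otimes> p) ** (a ** x) .+ (s \<otimes> p) ** (b ** x)"
   using a b x by (simp add: smult_l_distr sm_ac)
  also have "p \<otimes> (s \<otimes> t \<otimes> p) = (s \<otimes> p) \<otimes> (t \<otimes> p)" using a b x by (simp add: R.m_ac)
  also have "frac ((t \<otimes> p) ** (a ** x) .+ (s \<otimes> p) ** (b ** x)) ((s \<otimes> p) \<otimes> (t \<otimes> p))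
   = A **{?M} V +{?M} B **{?M} V" using a b x Sm by (simp add: frac_smult frac_add)
  finally show "(A +{?Q} B) **{?M} V = A **{?M} V +{?M} B **{?M} V" . }
 fix Y assume "Y : carrier ?M"
 then obtain y q where y: "y : carrier M" "q : S" "Y = frac y q" by (rule loc_carrierE)
 have "A **{?M} (V +{?M} Y) = frac (a ** (q ** x .+ p ** y)) (s \<otimes> (p \<otimes> q))"
  using a x y Sm by (simp add: frac_smult frac_add)
 also have "... = frac (s ** (a ** (q ** x .+ p ** y))) (s \<otimes> (s \<otimes> (p \<otimes> q)))" using a x y Sm by (simp add: frac_scale)
 also have "s ** (a ** (q ** x .+ p ** y)) = (s \<otimes> q) ** (a ** x) .+ (s \<otimes> p) ** (a ** y)" using a x y by (simp add: sm_ac)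
 also have "s \<otimes> (s \<otimes> (p \<otimes> q)) = (s \<otimes> p) \<otimes> (s \<otimes> q)" using a x y by (simp add: R.m_ac)
 also have "frac ((s \<otimes> q) ** (a ** x) .+ (s \<otimes> p) ** (a ** y)) ((s \<otimes> p) \<otimes> (s \<otimes> q)) = A **{?M} V +{?M} A **{?M} Y"
  using a x y Sm by (simp add: frac_smult frac_add)
 finally show "A **{?M} (V +{?M} Y) = A **{?M} V +{?M} A **{?M} Y" .
next
 fix V assume "V : carrier ?M"
 then obtain x p where x: "x : carrier M" "p : S" "V = frac x p" by (rule loc_carrierE)
 show "1{?Q} **{?M} V = V" using x S1 by (simp add: frac_smult loc_ring_simps(3))
qed

end


text \<open>The hypothesis \<open>surj\<close> asks that each z and some \<open>io a\<close>
  generate the same ideal modulo \<open>J'\<close>. This covers quotients, where z is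
  \<open>io a\<close>, and localizations, where the two differ by a unit.\<close>

lemma noeth_image:
 fixes io :: "'a::comm_ring_1 => 'b::comm_ring_1"
 assumes "noeth J" and J': "idl J'" and add: "!!x y. io (x + y) - (io x + io y) : J'"
  and mult: "!!x y. io (x * y) - io x * io y : J'" and ker: "!!x. x : J ==> io x : J'"
  and surj: "!!z. EX a u v. z - u * io a : J' & io a - v * z : J'"
 shows "noeth J'"
proof
 interpret noeth J by fact
 show "idl J'" by fact
 have sum: "io (SUM i<n. c i * g i) - (SUM i<n. io (c i) * io (g i)) : J'" for n :: nat and c g
 proof (induction n)
  case 0
  thus ?case using ker[OF idl_0[OF idJ]] by simp
 next
  case (Suc n)
  have "io (SUM i<Suc n. c i * g i) - (SUM i<Suc n. io (c i) * io (g i)) =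
   (io ((SUM i<n. c i * g i) + c n * g n) - (io (SUM i<n. c i * g i) + io (c n * g n))) +
   (io (SUM i<n. c i * g i) - (SUM i<n. io (c i) * io (g i))) + (io (c n * g n) - io (c n) * io (g n))" by auto
  also have "... : J'" by (rule idl_add[OF J' idl_add[OF J' add Suc] mult])
  finally show ?case .
 qed
 fix I :: "'b set" assume I: "idl I" "J' <= I"
 have "idl {a. io a : I}" unfolding idl_def mem_Collect_eq
 proof (intro conjI ballI allI)
  show "io 0 : I" using ker[OF idl_0[OF idJ]] I by blast
  show "io (x + y) : I" if "x : {a. io a : I}" "y : {a. io a : I}" for x y
   using idl_cong2[OF I(1)] add[of x y] I(2) idl_add[OF I(1), of "io x" "io y"] that by blast
  show "io (c * x) : I" if "x : {a. io a : I}" for x c using idl_cong2[OF I(1)] mult[of c x] I(2) idl_mult[OF I(1), of "io x" "io c"] that by blast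
 qed
 moreover have "J <= {a. io a : I}" using ker I by blast
 ultimately obtain n g where g: "ALL j<(n::nat). g j : {a. io a : I}" "ALL a:{a. io a : I}. EX c. a - (SUM j<n. c j * g j) : J" using fg by blast
 have "EX c. z - (SUM j<n. c j * io (g j)) : J'" if z: "z : I" for z
 proof -
  obtain a u v where a: "z - u * io a : J'" "io a - v * z : J'" using surj by blast
  have "io a : I" using idl_cong2[OF I(1) subsetD[OF I(2) a(2)] idl_mult[OF I(1) z]] .
  then obtain c where c: "a - (SUM j<n. c j * g j) : J" using g(2) by blast
  define w where "w = (SUM j<n. c j * g j)"
  have 1: "io a - (io (a - w) + io w) : J'" using add[of "a - w" w] by simp
  have 2: "io (a - w) : J'" using ker c w_def by blast
  have "z - (SUM j<n. (u * io (c j)) * io (g j)) = (z - u * io a) + u * ((io a - (io (a - w) + io w)) + io (a - w) + (io w - (SUM j<n. io (c j) * io (g j))))"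
   by (simp add: algebra_simps sum_distrib_left)
  also have "... : J'" using sum[where n = n and c = c and g = g] unfolding w_def[symmetric]
   by (intro idl_add[OF J' a(1)] idl_mult[OF J'] idl_add[OF J' idl_add[OF J' 1 2]])
  finally show ?thesis by auto
 qed
 thus "EX n g. (ALL j<(n::nat). g j : I) & (ALL a:I. EX c. a - (SUM j<n. c j * g j) : J')"
  using g(1) by (intro exI[of _ n] exI[of _ "%j. io (g j)"]) auto
qed

text \<open>The prime P is given in the encoding type of R, and its image p is the prime of R. The
  localized ring Q has elements of another type, hence an encoding type of its own, reached by
  \<open>io\<close>.\<close>

locale uprime = uring R for R :: "'r ring" (structure) +
 fixes P :: "'r uni set"
 assumes P: "prime_idl P" "evk R <= P"
begin

definition p :: "'r set" where "p = ev R ` P"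

lemma p_iff [simp]: "ev R x : p \<longleftrightarrow> x : P" unfolding p_def by (rule ideal_image(2)[OF prime_idl_idl[OF P(1)] P(2)])

lemma prime_p: "primeideal p R" unfolding p_def by (rule primeideal_image[OF P])

sublocale p: primeideal p R by (rule prime_p)

lemma one_p: "\<one> ~: p" using p.I_notcarr p.one_imp_carrier by blast

abbreviation S where "S == carrier R - p"

lemma locmod: "module R M ==> locmod R M S" using p.I_prime one_p by (auto simp: locmod_def locmod_axioms_def)

sublocale Z: locmod R "self_module R" S by (rule locmod[OF module_self[OF cring_axioms]])

definition Q :: "('r \<times> 'r) set ring" where "Q = localized_ring R S"
definition pQ :: "('r \<times> 'r) set set" where "pQ = {Z.frac a s | a s. a : p & s : S}"
definition io :: "'r uni => ('r \<times> 'r) set uni" where "io x = lft Q (Z.frac (ev R x) \<one>)"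

sublocale Q: uring Q unfolding Q_def uring_def by (rule Z.cring_loc)

lemma Q_zero: "Z.frac \<zero> \<one> = 0{Q}" and Q_one: "Z.frac \<one> \<one> = 1{Q}" by (simp_all add: Q_def Z.loc_ring_simps)

lemma ev_io [simp]: "ev Q (io x) = Z.frac (ev R x) \<one>" unfolding io_def by (rule Q.ev_lft) (simp add: Q_def Z.loc_ringI one_p)

lemma pQ_iff: "a : carrier R ==> s : S ==> Z.frac a s : pQ \<longleftrightarrow> a : p"
proof
 assume as: "a : carrier R" "s : S" "Z.frac a s : pQ"
 then obtain b t where b: "b : p" "t : S" "Z.frac a s = Z.frac b t" unfolding pQ_def by blast
 then obtain u where u: "u : S" "u \<otimes> (t \<otimes> a) = u \<otimes> (s \<otimes> b)" using Z.loc_ring_eq_iff[of a b s t] as by auto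
 have "u \<otimes> (t \<otimes> a) : p" unfolding u(2) using u(1) as(2) b(1) by (auto intro!: p.I_l_closed)
 thus "a : p" using p.I_prime u(1) b(2) as(1) by (metis DiffD1 DiffD2 m_closed)
qed (auto simp: pQ_def)

lemma local_Q: "local_with Q pQ" unfolding local_with_def
proof (intro conjI ballI)
 show "cring Q" by (rule Q.cring_axioms)
 show "1{Q} ~: pQ" using pQ_iff[of \<one> \<one>] one_p by (simp add: Q_one)
 have sub: "pQ <= carrier Q" unfolding pQ_def Q_def using Z.loc_ringI by auto
 have z: "0{Q} : pQ" using pQ_iff[of \<zero> \<one>] one_p by (simp add: Q_zero)
 have add: "x +{Q} y : pQ" if xy: "x : pQ" "y : pQ" for x y
 proof -
  obtain a s where a: "a : p" "s : S" "x = Z.frac a s" using xy(1) unfolding pQ_def by (elim CollectE exE conjE)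
  obtain b t where b: "b : p" "t : S" "y = Z.frac b t" using xy(2) unfolding pQ_def by (elim CollectE exE conjE)
  have "x +{Q} y = Z.frac (t \<otimes> a \<oplus> s \<otimes> b) (s \<otimes> t)" unfolding a b Q_def using a b by (intro Z.loc_ring_add) auto
  moreover have "t \<otimes> a \<oplus> s \<otimes> b : p" using a b by (intro p.a_closed p.I_l_closed) auto
  moreover have "s \<otimes> t : S" using a b by (intro Z.Sm)
  ultimately show ?thesis unfolding pQ_def by (intro CollectI exI conjI)
 qed
 have mult: "x *{Q} y : pQ" if x: "x : pQ" and y: "y : carrier Q" for x y
 proof -
  obtain a s where a: "a : p" "s : S" "x = Z.frac a s" using x unfolding pQ_def by (elim CollectE exE conjE)
  obtain b t where b: "b : carrier R" "t : S" "y = Z.frac b t" using y unfolding Q_def by (rule Z.loc_ringE)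
  have "x *{Q} y = Z.frac (a \<otimes> b) (s \<otimes> t)" unfolding a b Q_def using a b by (intro Z.loc_ring_mult) auto
  moreover have "a \<otimes> b : p" using a b by (intro p.I_r_closed) auto
  moreover have "s \<otimes> t : S" using a b by (intro Z.Sm)
  ultimately show ?thesis unfolding pQ_def by (intro CollectI exI conjI)
 qed
 show "ideal pQ Q"
 proof (rule idealI[OF Q.ring_axioms])
  show "subgroup pQ (add_monoid Q)"
  proof (rule subgroup.intro)
   fix x assume x: "x : pQ"
   have "inv\<^bsub>add_monoid Q\<^esub> x = \<ominus>\<^bsub>Q\<^esub> x" by (simp add: a_inv_def)
   also have "... = x *{Q} (\<ominus>\<^bsub>Q\<^esub> 1{Q})" using x sub by (simp add: Q.r_minus subset_iff)
   finally show "inv\<^bsub>add_monoid Q\<^esub> x : pQ" using mult x by simp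
  qed (use sub z add in auto)
  show "x *{Q} a : pQ" if "a : pQ" "x : carrier Q" for a x
   using mult[OF that] Q.m_comm[OF that(2) subsetD[OF sub that(1)]] by simp
  show "a *{Q} x : pQ" if "a : pQ" "x : carrier Q" for a x using mult that by blast
 qed
 fix x assume x: "x : carrier Q - pQ"
 then obtain a s where a: "a : carrier R" "s : S" "x = Z.frac a s" using Z.loc_ringE unfolding Q_def by blast
 hence aS: "a : S" using x pQ_iff by auto
 have "Z.frac s a *{Q} x = Z.frac (s \<otimes> a) (a \<otimes> s)" using a aS unfolding Q_def by (simp add: Z.loc_ring_mult)
 also have "... = 1{Q}" unfolding Q_one[symmetric] using a aS Z.S1 Z.Sm by (subst Z.loc_ring_eq_iff) (auto simp: m_ac)
 finally show "x : Units Q" using x a aS Q.m_comm[of "Z.frac s a" x] Z.loc_ringI[of s a] unfolding Units_def Q_def by auto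
qed

lemma io_surj: "EX a s. s ~: P & io s * z - io a : evk Q"
proof -
 obtain b t where b: "b : carrier R" "t : S" "ev Q z = Z.frac b t" using Q.ev_closed[of z] Z.loc_ringE unfolding Q_def by blast
 obtain a s where as: "b = ev R a" "t = ev R s" using ev_surj b by (metis DiffD1)
 have "Z.frac t \<one> *{Q} Z.frac b t = Z.frac (t \<otimes> b) (\<one> \<otimes> t)" using b one_p unfolding Q_def by (simp add: Z.loc_ring_mult)
 also have "... = Z.frac b \<one>" using b Z.S1 by (subst Z.loc_ring_eq_iff) auto
 finally have "io s * z - io a : evk Q" unfolding Q.evk_diff_iff using b as by simp
 thus ?thesis using b as by auto
qed

lemma io_hom: "io (x + y) - (io x + io y) : evk Q" "io (x * y) - io x * io y : evk Q" "io 1 - 1 : evk Q"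
 unfolding Q.evk_diff_iff Q.ev_add Q.ev_mult Q.ev_1 ev_io using one_p by (simp_all add: Q_def Z.loc_ring_add Z.loc_ring_mult Z.loc_ring_simps(3))

lemma io_ker: "io a : evk Q \<longleftrightarrow> (EX s. s ~: P & s * a : evk R)"
proof -
 have "io a : evk Q \<longleftrightarrow> Z.frac (ev R a) \<one> = Z.frac \<zero> \<one>" by (simp add: evk_def Q_zero)
 also have "... \<longleftrightarrow> (EX u:S. u \<otimes> ev R a = \<zero>)" using one_p by (subst Z.loc_ring_eq_iff) auto
 also have "... \<longleftrightarrow> (EX s. s ~: P & s * a : evk R)"
 proof
  assume "EX u:S. u \<otimes> ev R a = \<zero>"
  then obtain u where u: "u : S" "u \<otimes> ev R a = \<zero>" by blast
  obtain s where "u = ev R s" using u ev_surj by blast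
  thus "EX s. s ~: P & s * a : evk R" using u by (auto simp: evk_def)
 next
  assume "EX s. s ~: P & s * a : evk R"
  thus "EX u:S. u \<otimes> ev R a = \<zero>" by (auto simp: evk_def)
 qed
 finally show ?thesis .
qed

end

locale unprime = uprime + N: noeth "evk R"
begin

lemma io_unit: "s ~: P ==> EX t. io s * t - 1 : evk Q"
proof -
 assume "s ~: P"
 hence "io s * lft Q (inv\<^bsub>Q\<^esub> (ev Q (io s))) - 1 : evk Q" using local_Q pQ_iff[of "ev R s" \<one>] one_p unfolding Q.evk_diff_iff by (auto simp: local_with_def simp flip: ev_io)
 thus ?thesis by blast
qed

lemma noeth_Q: "noeth (evk Q)"
proof (rule noeth_image[OF N.noeth_axioms Q.idl_evk io_hom(1,2)])
 show "io x : evk Q" if "x : evk R" for x using io_ker[of x] that P(1) by (auto simp: prime_idl_def intro!: exI[of _ 1])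
 fix z
 obtain a s where a: "s ~: P" "io s * z - io a : evk Q" using io_surj by blast
 obtain t where t: "io s * t - 1 : evk Q" using io_unit a by blast
 have "z - t * io a = t * (io s * z - io a) - z * (io s * t - 1)" by (simp add: algebra_simps)
 also have "... : evk Q" by (rule idl_diff[OF Q.idl_evk idl_mult[OF Q.idl_evk a(2)] idl_mult[OF Q.idl_evk t]])
 finally have "z - t * io a : evk Q" .
 moreover have "io a - io s * z : evk Q" by (rule idl_minus_commute[OF Q.idl_evk a(2)])
 ultimately show "EX a u v. z - u * io a : evk Q & io a - v * z : evk Q" by blast
qed

sublocale Lz: localiz "evk R" "evk Q" "{x. ev Q x : pQ}" P io
proof -
 interpret nl: nloc "evk Q" "{x. ev Q x : pQ}" by (rule Q.nloc_ev[OF noeth_Q local_Q])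
 show "localiz (evk R) (evk Q) {x. ev Q x : pQ} P io"
 proof
  show "io s ~: {x. ev Q x : pQ}" if "s ~: P" for s using pQ_iff[of "ev R s" \<one>] one_p that by simp
 qed (use P io_hom io_ker io_surj in auto)
qed

text \<open>Localization is exact, so the relations among the fractions of the \<open>w i\<close>
  with denominator 1 are the localized relations among the \<open>w i\<close>.\<close>

lemma genmods_loc:
 assumes "genmods R M N w"
 shows "genmods Q (module_at_prime R p M) N (%i. fraction R S M (w i) \<one>)"
  and "genmod.lck Q (module_at_prime R p M) N (%i. fraction R S M (w i) \<one>) = Lz.loc N (genmod.lck R M N w)"
proof -
 interpret G: genmods R M N w by fact
 interpret T: locmod R M S by (rule locmod[OF G.module_axioms])
 have modQ: "module Q (module_at_prime R p M)" unfolding Q_def by (rule T.module_loc)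
 interpret H: genmod Q "module_at_prime R p M" N "%i. T.frac (w i) \<one>"
 proof -
  interpret module Q "module_at_prime R p M" by (rule modQ)
  show "genmod Q (module_at_prime R p M) N (%i. T.frac (w i) \<one>)"
   by unfold_locales (use G.finN G.w one_p in \<open>auto intro!: T.loc_carrierI\<close>)
 qed
 let ?M = "module_at_prime R p M"
 have zM: "0{?M} = T.frac 0{M} \<one>" by (simp add: localized_module_def)
 have fin: "finite B ==> B <= N ==> (\<Oplus>\<^bsub>?M\<^esub>i\<in>B. T.frac (ev R (v i) **{M} w i) \<one>) = T.frac (\<Oplus>\<^bsub>M\<^esub>i\<in>B. ev R (v i) **{M} w i) \<one>" for B v
 proof (induction B rule: finite_induct)
  case empty
  thus ?case by (simp add: zM)
 next
  case (insert b B)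
  have c: "ev R (v i) **{M} w i : carrier M" if "i : insert b B" for i using G.w that insert.prems by auto
  have "(\<Oplus>\<^bsub>?M\<^esub>i\<in>insert b B. T.frac (ev R (v i) **{M} w i) \<one>) =
   T.frac (ev R (v b) **{M} w b) \<one> +{?M} (\<Oplus>\<^bsub>?M\<^esub>i\<in>B. T.frac (ev R (v i) **{M} w i) \<one>)"
   using insert.hyps c one_p by (intro H.M.finsum_insert) (auto intro!: T.loc_carrierI)
  also have "... = T.frac (ev R (v b) **{M} w b) \<one> +{?M} T.frac (\<Oplus>\<^bsub>M\<^esub>i\<in>B. ev R (v i) **{M} w i) \<one>"
   using insert by simp
  also have "... = T.frac (ev R (v b) **{M} w b +{M} (\<Oplus>\<^bsub>M\<^esub>i\<in>B. ev R (v i) **{M} w i)) \<one>"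
   using c one_p by (subst T.frac_add) (auto intro!: G.M.finsum_closed)
  also have "ev R (v b) **{M} w b +{M} (\<Oplus>\<^bsub>M\<^esub>i\<in>B. ev R (v i) **{M} w i) = (\<Oplus>\<^bsub>M\<^esub>i\<in>insert b B. ev R (v i) **{M} w i)"
   using insert.hyps c by (intro G.M.finsum_insert[symmetric]) auto
  finally show ?case .
 qed
 have lcv: "H.lc (Lz.vl v) = T.frac (G.lc v) \<one>" for v
 proof -
  have "H.lc (Lz.vl v) = (\<Oplus>\<^bsub>?M\<^esub>i\<in>N. T.frac (ev R (v i) **{M} w i) \<one>)"
   unfolding H.lc_def by (simp add: H.M.finsum_cong' G.w one_p T.loc_carrierI T.frac_smult Lz.vl_def)
  also have "... = T.frac (G.lc v) \<one>" unfolding G.lc_def by (rule fin[OF G.finN order_refl])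
  finally show ?thesis .
 qed
 have scale: "ev Q (io s) **{?M} H.lc z = T.frac (G.lc v) \<one>" if "sm (io s) z - Lz.vl v : fr N (evk Q)" for s z v using that H.fr_lck H.lck_diff_iff H.lc_sm lcv by blast
 have unit: "EX t. ev Q t **{?M} (ev Q (io s) **{?M} x) = x" if s: "s ~: P" and x: "x : carrier ?M" for s x
 proof -
  obtain t where "io s * t - 1 : evk Q" using io_unit s by blast
  hence "ev Q t **{?M} (ev Q (io s) **{?M} x) = x" using x H.smult_assoc1[OF Q.ev_closed Q.ev_closed x, symmetric, of t "io s"] unfolding Q.evk_diff_iff by (simp add: Q.m_comm del: ev_io)
  thus ?thesis ..
 qed
 show "genmods Q ?M N (%i. T.frac (w i) \<one>)"
 proof
  fix x assume "x : carrier ?M"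
  then obtain y s where y: "y : carrier M" "s : S" "x = T.frac y s" by (rule T.loc_carrierE)
  obtain v where v: "y = G.lc v" using G.surj y by blast
  obtain b where b: "Z.frac \<one> s = ev Q b" using Q.ev_surj Z.loc_ringI[of \<one> s] y unfolding Q_def by auto
  have "H.lc (sm b (Lz.vl v)) = Z.frac \<one> s **{?M} T.frac y \<one>" by (simp add: H.lc_sm lcv v b)
  also have "... = x" using y one_p by (simp add: T.frac_smult)
  finally show "EX v. x = H.lc v" by blast
 qed
 show "H.lck = Lz.loc N G.lck"
 proof
  show "H.lck <= Lz.loc N G.lck"
  proof
   fix z assume z: "z : H.lck"
   obtain v s where v: "s ~: P" "sm (io s) z - Lz.vl v : fr N (evk Q)" using Lz.common_denominator[OF G.finN] by blast
   have "T.frac (G.lc v) \<one> = T.frac 0{M} \<one>" using scale[OF v(2)] z H.smult_r_null[OF Q.ev_closed] unfolding H.lck_def mem_Collect_eq zM[symmetric] by metis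
   then obtain u where u: "u : S" "u **{M} (\<one> **{M} G.lc v) = u **{M} (\<one> **{M} 0{M})"
    using T.frac_eq_iff[of "G.lc v" "0{M}" \<one> \<one>] one_p by auto
   obtain q where q: "u = ev R q" using u ev_surj by blast
   have "sm q v : G.lck" using u q by (simp add: G.lck_def G.lc_sm)
   moreover have "q ~: P" using u q by auto
   ultimately show "z : Lz.loc N G.lck" using v Lz.loc_scale[OF v(2), of q] Lz.P_mult[of q s] by (intro Lz.loc_memI)
  qed
  show "Lz.loc N G.lck <= H.lck"
  proof
   fix z assume "z : Lz.loc N G.lck"
   then obtain v s where v: "v : G.lck" "s ~: P" "sm (io s) z - Lz.vl v : fr N (evk Q)" unfolding Lz.loc_def by blast
   show "z : H.lck" using scale[OF v(3)] v(1) unit[OF v(2) H.lc_closed, of z] H.smult_r_null[OF Q.ev_closed] by (auto simp: G.lck_def zM H.lck_def)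
  qed
 qed
qed

end


section \<open>The universal property in coordinates\<close>

context uring begin

text \<open>The universal property quantifies over modules with elements of type
  \<open>(nat => 'r) set\<close> only, so the class of x modulo I is coded as a set of constant
  functions.\<close>

definition quo :: "'r uni set => 'r uni => (nat => 'r) set" where
 "quo I x = {(%_. ev R y) |y. y - x : I}"

definition rep :: "'r uni set => (nat => 'r) set => 'r uni" where
 "rep I A = (SOME x. A = quo I x)"

definition quo_module :: "'r uni set => ('r, (nat => 'r) set) module" where
 "quo_module I = \<lparr>carrier = range (quo I), monoid.mult = undefined, one = undefined, ring.zero = quo I 0,
   ring.add = (%A B. quo I (rep I A + rep I B)), module.smult = (%a A. quo I (lft R a * rep I A))\<rparr>"

context
 fixes I :: "'r uni set"
 assumes I: "idl I" "evk R <= I"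
begin

lemma quo_eq_iff: "quo I x = quo I y \<longleftrightarrow> x - y : I"
proof
 assume "quo I x = quo I y"
 moreover have "(%_. ev R x) : quo I x" unfolding quo_def using idl_0[OF I(1)] by auto
 ultimately obtain z where z: "ev R x = ev R z" "z - y : I" unfolding quo_def by (auto dest: fun_cong)
 thus "x - y : I" using evk_diff_iff I(2) idl_trans[OF I(1)] by blast
next
 assume xy: "x - y : I"
 have "z - x : I \<longleftrightarrow> z - y : I" for z
  using idl_trans[OF I(1) _ xy, of z] idl_trans[OF I(1) _ idl_minus_commute[OF I(1) xy], of z] by blast
 thus "quo I x = quo I y" by (simp add: quo_def)
qed

lemma rep: "rep I (quo I x) - x : I"
proof -
 have "quo I x = quo I (rep I (quo I x))" unfolding rep_def by (rule someI) simp
 thus ?thesis unfolding quo_eq_iff by (rule idl_minus_commute[OF I(1)])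
qed

lemma quo_ops:
 "quo I x +{quo_module I} quo I y = quo I (x + y)"
 "ev R c **{quo_module I} quo I x = quo I (c * x)"
 "0{quo_module I} = quo I 0"
 "carrier (quo_module I) = range (quo I)"
proof -
 have "rep I (quo I x) + rep I (quo I y) - (x + y) = (rep I (quo I x) - x) + (rep I (quo I y) - y)" by simp
 also have "... : I" by (rule idl_add[OF I(1) rep rep])
 finally show "quo I x +{quo_module I} quo I y = quo I (x + y)" by (simp add: quo_module_def quo_eq_iff)
 have c: "lft R (ev R c) - c : I" using evk_diff_iff I(2) ev_lft[OF ev_closed] by blast
 have "lft R (ev R c) * rep I (quo I x) - c * x = lft R (ev R c) * (rep I (quo I x) - x) + x * (lft R (ev R c) - c)" by (simp add: algebra_simps)
 also have "... : I" by (rule idl_add[OF I(1) idl_mult[OF I(1) rep] idl_mult[OF I(1) c]])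
 finally show "ev R c **{quo_module I} quo I x = quo I (c * x)" by (simp add: quo_module_def quo_eq_iff)
qed (simp_all add: quo_module_def)

lemma quo_moduleE: assumes "A : carrier (quo_module I)" obtains x where "A = quo I x" using assms unfolding quo_ops(4) by blast

lemma quo_closed [simp]: "quo I x : carrier (quo_module I)" by (simp add: quo_ops)

lemma module_quo: "module R (quo_module I)"
proof (rule moduleI[OF cring_axioms])
 show "abelian_group (quo_module I)"
 proof (rule abelian_groupI)
  fix A assume "A : carrier (quo_module I)"
  then obtain x where x: "A = quo I x" by (rule quo_moduleE)
  show "0{quo_module I} +{quo_module I} A = A" by (simp add: x quo_ops)
  show "EX B:carrier (quo_module I). B +{quo_module I} A = 0{quo_module I}"
   by (rule bexI[of _ "quo I (- x)"]) (simp_all add: x quo_ops)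
  fix B assume "B : carrier (quo_module I)"
  then obtain y where y: "B = quo I y" by (rule quo_moduleE)
  show "A +{quo_module I} B : carrier (quo_module I)" by (simp add: x y quo_ops)
  show "A +{quo_module I} B = B +{quo_module I} A" by (simp add: x y quo_ops add.commute)
  fix C assume "C : carrier (quo_module I)"
  then obtain z where z: "C = quo I z" by (rule quo_moduleE)
  show "A +{quo_module I} B +{quo_module I} C = A +{quo_module I} (B +{quo_module I} C)"
   by (simp add: x y z quo_ops add.assoc)
 qed (simp add: quo_ops)
 fix a A assume a: "a : carrier R" and "A : carrier (quo_module I)"
 then obtain c x where x: "a = ev R c" "A = quo I x" using ev_surj quo_moduleE by metis
 show "a **{quo_module I} A : carrier (quo_module I)" by (simp add: x quo_ops)
 { fix b assume "b : carrier R"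
  then obtain d where d: "b = ev R d" using ev_surj by metis
  show "(a \<oplus> b) **{quo_module I} A = a **{quo_module I} A +{quo_module I} b **{quo_module I} A"
   by (simp add: x d quo_ops distrib_right flip: ev_add)
  show "(a \<otimes> b) **{quo_module I} A = a **{quo_module I} (b **{quo_module I} A)"
   by (simp add: x d quo_ops mult.assoc flip: ev_mult) }
 fix B assume "B : carrier (quo_module I)"
 then obtain y where y: "B = quo I y" by (rule quo_moduleE)
 show "a **{quo_module I} (A +{quo_module I} B) = a **{quo_module I} A +{quo_module I} a **{quo_module I} B"
  by (simp add: x y quo_ops distrib_left)
next
 fix A assume "A : carrier (quo_module I)"
 then obtain x where x: "A = quo I x" by (rule quo_moduleE)
 show "\<one> **{quo_module I} A = A" by (simp add: x quo_ops flip: ev_1)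
qed

lemma finite_quo: "finite_module R (quo_module I)" unfolding finite_module_def
proof (intro conjI module_quo exI[of _ "{quo I 1}"] allI impI)
 fix H assume H: "submodule H R (quo_module I) & {quo I 1} <= H"
 show "H = carrier (quo_module I)"
 proof
  show "H <= carrier (quo_module I)" using H module.submoduleE(1)[OF module_quo] by blast
  show "carrier (quo_module I) <= H"
  proof
   fix A assume "A : carrier (quo_module I)"
   then obtain x where x: "A = quo I x" by (rule quo_moduleE)
   have "A = ev R x **{quo_module I} quo I 1" by (simp add: x quo_ops)
   also have "... : H" using H submodule.smult_closed[of H R "quo_module I" "ev R x" "quo I 1"] by auto
   finally show "A : H" .
  qed
 qed
qed auto

end

end

locale diffs = genmods R Om N w for R :: "'r ring" (structure) and Om :: "('r, 'm) module" (structure) and N w +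
 fixes K :: "'k ring" and ph :: "'k => 'r" and d :: "'r => 'm"
 assumes univ: "universally_finite_differentials K ph R Om d" and ph: "!!c. c : carrier K ==> ph c : carrier R"
begin

abbreviation dot :: "(nat => 'r uni) => (nat => 'r uni) => 'r uni" where "dot f v == SUM k:N. f k * v k"

lemma d_closed: "a : carrier R ==> d a : carrier Om" using univ by (auto simp: universally_finite_differentials_def derivations_def)

lemma d_add: "a : carrier R ==> b : carrier R ==> d (a \<oplus> b) = d a +{Om} d b"
 and d_mult: "a : carrier R ==> b : carrier R ==> d (a \<otimes> b) = (a **{Om} d b) +{Om} (b **{Om} d a)"
 and d_const: "c : carrier K ==> d (ph c) = 0{Om}" using univ by (auto simp: universally_finite_differentials_def derivations_def)

lemma hom_quo_lc:
 assumes I: "idl I" "evk R <= I" and h: "h : mod_hom R Om (quo_module I)" and mu: "!!k. k : N ==> h (w k) = quo I (mu k)"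
 shows "h (lc v) = quo I (dot mu v)"
proof -
 have hadd: "h (x +{Om} y) = h x +{quo_module I} h y" if "x : carrier Om" "y : carrier Om" for x y using h that by (auto simp: mod_hom_def)
 have hsm: "h (a **{Om} x) = a **{quo_module I} h x" if "x : carrier Om" "a : carrier R" for x a using h that by (auto simp: mod_hom_def)
 have "h 0{Om} : carrier (quo_module I)" using h by (auto simp: mod_hom_def)
 then obtain z where z: "h 0{Om} = quo I z" by (rule quo_moduleE[OF I])
 have z0: "h 0{Om} = quo I 0" using hsm[of "0{Om}" "ev R 0"] quo_ops(2)[OF I, of 0 z] by (simp add: z)
 have "finite B ==> B <= N ==> h (\<Oplus>\<^bsub>Om\<^esub>k\<in>B. ev R (v k) **{Om} w k) = quo I (SUM k:B. mu k * v k)" for B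
 proof (induction B rule: finite_induct)
  case (insert b B)
  have c: "ev R (v i) **{Om} w i : carrier Om" if "i : insert b B" for i using w that insert.prems by auto
  have "h (\<Oplus>\<^bsub>Om\<^esub>k\<in>insert b B. ev R (v k) **{Om} w k) = h (ev R (v b) **{Om} w b) +{quo_module I} h (\<Oplus>\<^bsub>Om\<^esub>k\<in>B. ev R (v k) **{Om} w k)"
   using insert.hyps c by (subst hadd[symmetric]) (auto intro!: M.finsum_closed)
  also have "h (ev R (v b) **{Om} w b) = quo I (v b * mu b)" using insert.prems mu w by (simp add: hsm quo_ops[OF I])
  finally show ?case using insert by (simp add: quo_ops[OF I] mult.commute)
 qed (simp add: z0)
 thus ?thesis unfolding lc_def using finN by blast
qed

text \<open>The universal property applied to the cyclic module R/I. The vector \<open>mu\<close>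
  lists lifts of the values on the generators \<open>w k\<close>; that it kills the relations
  \<open>lck\<close> modulo I is the well-definedness of the homomorphism.\<close>

lemma deriv_coordinates:
 assumes I: "idl I" "evk R <= I" and E: "deriv_mod I E" and EJ: "!!a b. a - b : evk R ==> E a - E b : I"
  and EK: "!!a. ev R a : ph ` carrier K ==> E a : I"
 shows "EX mu. (ALL v:lck. dot mu v : I) & (ALL a v. lc v = d (ev R a) --> E a - dot mu v : I)"
proof -
 define D where "D = (\<lambda>a\<in>carrier R. quo I (E (lft R a)))"
 have D: "D (ev R a) = quo I (E a)" for a unfolding D_def by (auto simp: quo_eq_iff[OF I] evk_diff_iff intro!: EJ)
 have "D : derivations K ph R (quo_module I)" unfolding derivations_def
 proof (intro CollectI conjI ballI)
  show "D : carrier R \<rightarrow>\<^sub>E carrier (quo_module I)" using quo_closed[OF I] by (auto simp: D_def)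
  show "D (ph c) = 0{quo_module I}" if c: "c : carrier K" for c
   using EK[of "lft R (ph c)"] ph[OF c] c by (simp add: D_def quo_ops[OF I] quo_eq_iff[OF I])
  fix a b assume ab: "a : carrier R" "b : carrier R"
  obtain x where x: "a = ev R x" using ev_surj ab by blast
  obtain y where y: "b = ev R y" using ev_surj ab by blast
  show "D (a \<oplus> b) = D a +{quo_module I} D b" "D (a \<otimes> b) = a **{quo_module I} D b +{quo_module I} b **{quo_module I} D a"
   using E unfolding x y ev_add[symmetric] ev_mult[symmetric] D by (simp_all add: quo_ops[OF I] quo_eq_iff[OF I] deriv_mod_def)
 qed
 hence "EX! h. h : mod_hom R Om (quo_module I) & (ALL a:carrier R. h (d a) = D a)"
  by (rule univ[unfolded universally_finite_differentials_def, THEN conjunct2, THEN conjunct2, rule_format, OF conjI[OF finite_quo[OF I]]])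
 then obtain h where h: "h : mod_hom R Om (quo_module I)" "ALL a:carrier R. h (d a) = D a" by auto
 have "h (w k) : range (quo I)" if "k : N" for k using h(1) w[OF that] by (auto simp: mod_hom_def quo_ops[OF I])
 hence "ALL k:N. EX x. h (w k) = quo I x" by blast
 then obtain mu where mu: "!!k. k : N ==> h (w k) = quo I (mu k)" by metis
 note hl = hom_quo_lc[OF I h(1) mu]
 show ?thesis
 proof (intro exI[of _ mu] conjI ballI allI impI)
  fix v assume "v : lck"
  thus "dot mu v : I" using hl[of v] hl[of 0] by (auto simp: lck_def quo_eq_iff I)
 next
  fix a v assume "lc v = d (ev R a)"
  thus "E a - dot mu v : I" using h(2) hl[of v] D[of a] by (simp add: quo_eq_iff[OF I])
 qed
qed

text \<open>The homomorphisms given by \<open>mu\<close> and by 0 both factor the zero derivation;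
  uniqueness in the universal property identifies them.\<close>

lemma coordinates_unique:
 assumes mu: "ALL v:lck. dot mu v : evk R" and mu0: "ALL a v. lc v = d (ev R a) --> dot mu v : evk R"
 shows "mu : fr N (evk R)"
proof -
 note I = idl_evk order_refl[of "evk R"]
 define h where "h nu = (\<lambda>x\<in>carrier Om. quo (evk R) (dot nu (SOME v. x = lc v)))" for nu
 have hl: "h nu (lc v) = quo (evk R) (dot nu v)" if nu: "ALL v:lck. dot nu v : evk R" for nu v
 proof -
  define u where "u = (SOME u. lc v = lc u)"
  have "lc v = lc u" unfolding u_def by (rule someI[of _ v]) simp
  thus ?thesis using bspec[OF nu, of "u - v"] unfolding h_def by (auto simp: lck_diff_iff algebra_simps sum_subtractf quo_eq_iff I u_def)
 qed
 have hom: "h nu : mod_hom R Om (quo_module (evk R))" if nu: "ALL v:lck. dot nu v : evk R" for nu unfolding mod_hom_def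
 proof (intro CollectI conjI ballI)
  show "h nu : carrier Om \<rightarrow>\<^sub>E carrier (quo_module (evk R))" using quo_closed[OF I] by (auto simp: h_def)
  fix x assume "x : carrier Om"
  then obtain u where u: "x = lc u" using surj by blast
  { fix y assume "y : carrier Om"
   then obtain v where v: "y = lc v" using surj by blast
   show "h nu (x +{Om} y) = h nu x +{quo_module (evk R)} h nu y"
    unfolding u v lc_add[symmetric] hl[of nu, OF nu] quo_ops[OF I] by (simp add: algebra_simps sum.distrib) }
  fix a assume "a : carrier R"
  then obtain c where c: "a = ev R c" using ev_surj by blast
  show "h nu (a **{Om} x) = a **{quo_module (evk R)} h nu x"
   unfolding u c lc_sm[symmetric] hl[of nu, OF nu] quo_ops[OF I] by (simp add: sm_def sum_distrib_left mult.left_commute)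
 qed
 have z: "ALL v:lck. dot 0 v : evk R" "ALL a v. lc v = d (ev R a) --> dot 0 v : evk R" using idl_0[OF idl_evk] by simp_all
 have q0: "h nu (d a) = quo (evk R) 0" if nu: "ALL v:lck. dot nu v : evk R" "ALL a v. lc v = d (ev R a) --> dot nu v : evk R"
  and a: "a : carrier R" for nu a
 proof -
  obtain x where x: "a = ev R x" using ev_surj a by blast
  obtain v where v: "d a = lc v" using surj[OF d_closed[OF a]] by blast
  show ?thesis unfolding v hl[of nu, OF nu(1)] quo_eq_iff[OF I] using nu(2)[rule_format, of v x] x v by simp
 qed
 have 0: "(\<lambda>a\<in>carrier R. quo (evk R) 0) : derivations K ph R (quo_module (evk R))"
  unfolding derivations_def using quo_closed[OF I] quo_ops(1)[OF I, of 0 0] quo_ops(2)[OF I, of _ 0] quo_ops(3)[OF I] ph by (auto dest!: ev_surj)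
 have "EX! g. g : mod_hom R Om (quo_module (evk R)) & (ALL a:carrier R. g (d a) = (\<lambda>a\<in>carrier R. quo (evk R) 0) a)"
  using univ[unfolded universally_finite_differentials_def, THEN conjunct2, THEN conjunct2, rule_format, OF conjI[OF finite_quo[OF I] 0]] .
 moreover have "ALL a:carrier R. h mu (d a) = (\<lambda>a\<in>carrier R. quo (evk R) 0) a" using q0[of mu, OF mu mu0] by simp
 moreover have "ALL a:carrier R. h 0 (d a) = (\<lambda>a\<in>carrier R. quo (evk R) 0) a" using q0[of 0, OF z] by simp
 ultimately have "h mu = h 0" using hom[of mu, OF mu] hom[of 0, OF z(1)] by blast
 hence "quo (evk R) (dot mu (un k)) = quo (evk R) (dot 0 (un k))" for k using hl[of mu, OF mu, of "un k"] hl[of 0, OF z(1), of "un k"] by metis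
 hence "dot mu (un k) : evk R" for k by (simp add: quo_eq_iff[OF I])
 moreover have "dot mu (un k) = mu k" if "k : N" for k using that finN by (simp add: un_def if_distrib cong: if_cong)
 ultimately show ?thesis by (auto simp: fr_def) metis
qed

end


section \<open>Free modules and lifting\<close>

definition bas :: "('r, 'c) ring_scheme => 'x => 'x => 'r" where
 "bas R y = (%x. if x = y then 1{R} else 0{R})"

lemma free_simps:
 "x +{free_module R S} y = (%i. x i +{R} y i)" "a **{free_module R S} x = (%i. a *{R} x i)"
 "0{free_module R S} = (%_. 0{R})" by (simp_all add: free_module_def)

lemma (in cring) free_carrier:
 "f : carrier (free_module R S) \<longleftrightarrow> (ALL x. f x : carrier R) & (ALL x. x ~: S --> f x = \<zero>) & finite {x. f x ~= \<zero>}"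
 by (simp add: free_module_def)

lemma (in cring) module_free: "module R (free_module R S)"
proof (rule moduleI[OF cring_axioms])
 let ?F = "free_module R S"
 have add: "f +{?F} g : carrier ?F" if "f : carrier ?F" "g : carrier ?F" for f g using that unfolding free_carrier free_simps
  by (auto intro: finite_subset[of _ "{x. f x ~= \<zero>} \<union> {x. g x ~= \<zero>}"])
 show "abelian_group ?F"
 proof (rule abelian_groupI)
  fix f assume f: "f : carrier ?F"
  show "0{?F} +{?F} f = f" using f by (auto simp: free_carrier free_simps)
  show "EX g:carrier ?F. g +{?F} f = 0{?F}"
   using f by (intro bexI[of _ "(\<ominus> \<one>) **{?F} f"]) (auto simp: free_simps free_carrier l_minus l_neg)
  fix g assume g: "g : carrier ?F"
  show "f +{?F} g : carrier ?F" by (rule add[OF f g])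
  show "f +{?F} g = g +{?F} f" using f g by (auto simp: free_carrier free_simps a_comm)
  fix h assume h: "h : carrier ?F"
  show "f +{?F} g +{?F} h = f +{?F} (g +{?F} h)" using f g h by (auto simp: free_carrier free_simps a_assoc)
 qed (simp add: free_carrier free_simps)
qed (auto simp: free_carrier free_simps l_distr r_distr m_assoc intro: finite_subset[rotated])

lemma (in cring) bas_closed: "y : S ==> bas R y : carrier (free_module R S)" by (auto simp: free_carrier bas_def intro: finite_subset[of _ "{y}"])

lemma (in cring) free_induct:
 assumes f: "f : carrier (free_module R S)" and 0: "(%_. \<zero>) : H"
  and add: "!!g a y. g : H ==> g : carrier (free_module R S) ==> a : carrier R ==> y : S ==>
   g +{free_module R S} a **{free_module R S} bas R y : H" shows "f : H"
proof -
 have "finite T ==> T <= S ==> f : carrier (free_module R S) ==> (!!x. x ~: T ==> f x = \<zero>) ==> f : H" for T f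
 proof (induction T arbitrary: f rule: finite_induct)
  case empty
  thus ?case using 0 by simp
 next
  case (insert y T)
  have c: "f(y := \<zero>) : carrier (free_module R S)"
   using insert.prems(2) by (auto simp: free_carrier intro: finite_subset[of _ "{x. f x ~= \<zero>}"])
  have "f(y := \<zero>) : H" using insert.prems by (intro insert.IH c) auto
  hence "f(y := \<zero>) +{free_module R S} f y **{free_module R S} bas R y : H"
   using insert.prems(1,2) c by (intro add) (auto simp: free_carrier)
  moreover have "f(y := \<zero>) +{free_module R S} f y **{free_module R S} bas R y = f"
   using insert.prems(2) by (auto simp: free_simps free_carrier bas_def)
  ultimately show ?case by simp
 qed
 from this[of "{x. f x ~= \<zero>}"] show ?thesis using f by (auto simp: free_carrier)
qed

lemma mod_homD:
 assumes "h : mod_hom R M M'"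
 shows "x : carrier M ==> h x : carrier M'"
  "x : carrier M ==> y : carrier M ==> h (x +{M} y) = h x +{M'} h y"
  "a : carrier R ==> x : carrier M ==> h (a **{M} x) = a **{M'} h x" using assms by (auto simp: mod_hom_def)

lemma mod_hom_0:
 assumes "h : mod_hom R M M'" "module R M" "module R M'" shows "h 0{M} = 0{M'}"
proof -
 interpret M: module R M by fact
 interpret M': module R M' by fact
 have "h 0{M} : carrier M'" using assms(1) by (simp add: mod_homD)
 moreover have "h (0{R} **{M} 0{M}) = 0{R} **{M'} h 0{M}" by (rule mod_homD(3)[OF assms(1)]) auto
 ultimately show ?thesis by auto
qed

lemma (in genmod) hom_lc:
 assumes h: "h : mod_hom R M M'" and M': "module R M'"
 shows "h (lc v) = (\<Oplus>\<^bsub>M'\<^esub>k\<in>N. ev R (v k) **{M'} h (w k))"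
proof -
 interpret M': module R M' by fact
 have "finite B ==> B <= N ==> h (\<Oplus>\<^bsub>M\<^esub>k\<in>B. ev R (v k) **{M} w k) = (\<Oplus>\<^bsub>M'\<^esub>k\<in>B. ev R (v k) **{M'} h (w k))" for B
 proof (induction B rule: finite_induct)
  case empty
  show ?case using mod_hom_0[OF h module_axioms M'] by simp
 next
  case (insert b B)
  have c: "ev R (v i) **{M} w i : carrier M" "ev R (v i) **{M'} h (w i) : carrier M'" if "i : insert b B" for i
   using w that insert.prems mod_homD(1)[OF h] by auto
   have "h (\<Oplus>\<^bsub>M\<^esub>k\<in>insert b B. ev R (v k) **{M} w k) = h (ev R (v b) **{M} w b) +{M'} h (\<Oplus>\<^bsub>M\<^esub>k\<in>B. ev R (v k) **{M} w k)"
   using insert.hyps c by (subst mod_homD(2)[OF h, symmetric]) (auto intro!: M.finsum_closed)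
  also have "h (ev R (v b) **{M} w b) = ev R (v b) **{M'} h (w b)" using insert.prems w by (intro mod_homD(3)[OF h]) auto
  also have "h (\<Oplus>\<^bsub>M\<^esub>k\<in>B. ev R (v k) **{M} w k) = (\<Oplus>\<^bsub>M'\<^esub>k\<in>B. ev R (v k) **{M'} h (w k))" using insert by simp
  also have "ev R (v b) **{M'} h (w b) +{M'} (\<Oplus>\<^bsub>M'\<^esub>k\<in>B. ev R (v k) **{M'} h (w k)) = (\<Oplus>\<^bsub>M'\<^esub>k\<in>insert b B. ev R (v k) **{M'} h (w k))"
   using insert.hyps c by (intro M'.finsum_insert[symmetric]) auto
  finally show ?case .
 qed
 thus ?thesis unfolding lc_def using finN by blast
qed

lemma (in genmod) hom_self_lc:
 assumes h: "h : mod_hom R M (self_module R)"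
 shows "h (lc v) = ev R (SUM k:N. v k * lft R (h (w k)))"
proof -
 interpret Z: module R "self_module R" by (rule module_self[OF R.cring_axioms])
 have e: "finite B ==> (\<Oplus>\<^bsub>self_module R\<^esub>k\<in>B. ev R (g k)) = ev R (sum g B)" for B :: "nat set" and g
  by (induction B rule: finite_induct) (simp_all add: Z.finsum_insert)
 have "h (lc v) = (\<Oplus>\<^bsub>self_module R\<^esub>k\<in>N. ev R (v k) **{self_module R} h (w k))"
  by (rule hom_lc[OF h Z.module_axioms])
 also have "... = (\<Oplus>\<^bsub>self_module R\<^esub>k\<in>N. ev R (v k * lft R (h (w k))))"
  using mod_homD(1)[OF h w] by (intro Z.finsum_cong') auto
 finally show ?thesis by (simp only: e[OF finN])
qed

context uring begin

lemma lft_0 [simp]: "lft R \<zero> = 0" using cring_axioms by transfer (auto simp: fun_eq_iff)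

text \<open>Maps from a module into the encoding type involve chosen representatives and are linear
  only modulo W.\<close>

definition qlin :: "('r, 'p) module => (nat => 'r uni) set => ('p => nat => 'r uni) => bool" where
 "qlin P W g \<longleftrightarrow> (ALL x:carrier P. ALL y:carrier P. g (x +{P} y) - (g x + g y) : W) &
   (ALL c. ALL x:carrier P. g (ev R c **{P} x) - sm c (g x) : W)"

lemma qlinD:
 assumes "qlin P W g" "x : carrier P"
 shows "y : carrier P ==> g (x +{P} y) - (g x + g y) : W" "g (ev R c **{P} x) - sm c (g x) : W"
 using assms by (auto simp: qlin_def)

lemma qlin_0: "qlin P W g ==> module R P ==> g 0{P} : W"
proof -
 assume g: "qlin P W g" and "module R P"
 then interpret P: module R P by blast
 show ?thesis using qlinD(2)[OF g, of "0{P}" 0] by simp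
qed

text \<open>On a free module the lift is chosen on the basis and extended by linear combination;
  restricting it along the section \<open>s\<close> gives the lift on the summand P. Representing
  coefficients by \<open>lft\<close> costs exact linearity, but only up to W.\<close>

lemma proj_lift:
 fixes P :: "('r, 'p) module"
 assumes P: "projective_module R P" and th: "qlin P U th" and A: "lin A" and W: "submod W" and U: "submod U"
  and WJ: "!!c v. c : evk R ==> sm c v : W" and AW: "!!v. v : W ==> A v : U"
  and ex: "!!x. x : carrier P ==> EX v. th x - A v : U"
 shows "EX g. qlin P W g & (ALL x:carrier P. th x - A (g x) : U)"
proof -
 obtain S :: "'p set" and s r where s: "s : mod_hom R P (free_module R S)" and r: "r : mod_hom R (free_module R S) P"
  and rs0: "ALL x:carrier P. r (s x) = x" using P unfolding projective_module_def by blast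
 note rs = bspec[OF rs0]
 have MP: "module R P" using P unfolding projective_module_def by (rule conjunct1)
 interpret P: module R P by fact
 define F where "F = free_module R S"
 have rb: "r (bas R y) : carrier P" if "y : S" for y using mod_homD(1)[OF r bas_closed[OF that]] .
 hence "ALL y:S. EX v. th (r (bas R y)) - A v : U" using ex by blast
 then obtain u where u: "!!y. y : S ==> th (r (bas R y)) - A (u y) : U" by metis
 define G where "G f = (SUM y:{y. f y ~= \<zero>}. sm (lft R (f y)) (u y))" for f
 have Gs: "G f = (SUM y:T. sm (lft R (f y)) (u y))" if "finite T" "{y. f y ~= \<zero>} <= T" for f T
  unfolding G_def using that by (intro sum.mono_neutral_left) auto
 have Gadd: "G (f +{F} g) - (G f + G g) : W" if f: "f : carrier F" and g: "g : carrier F" for f g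
 proof -
  define T where "T = {y. f y ~= \<zero>} \<union> {y. g y ~= \<zero>}"
  have T: "finite T" and c: "!!y. f y : carrier R" "!!y. g y : carrier R" using f g unfolding T_def F_def by (auto simp: free_carrier)
  have 1: "G (f +{F} g) = (SUM y:T. sm (lft R (f y \<oplus> g y)) (u y))" unfolding F_def free_simps by (rule Gs[OF T]) (auto simp: T_def)
  have 2: "G f = (SUM y:T. sm (lft R (f y)) (u y))" by (rule Gs[OF T]) (auto simp: T_def)
  have 3: "G g = (SUM y:T. sm (lft R (g y)) (u y))" by (rule Gs[OF T]) (auto simp: T_def)
  have "G (f +{F} g) - (G f + G g) = (SUM y:T. sm (lft R (f y \<oplus> g y) - (lft R (f y) + lft R (g y))) (u y))"
   unfolding 1 2 3 sum.distrib[symmetric] sum_subtractf[symmetric] by (rule sum.cong) (auto simp: sm_def fun_eq_iff algebra_simps)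
  also have "... : W" by (intro submod_sum[OF W] WJ) (simp add: evk_diff_iff c)
  finally show ?thesis .
 qed
 have Gsm: "G (ev R c **{F} f) - sm c (G f) : W" if f: "f : carrier F" for f c
 proof -
  define T where "T = {y. f y ~= \<zero>}"
  have T: "finite T" and fc: "!!y. f y : carrier R" using f unfolding T_def F_def by (auto simp: free_carrier)
  have 1: "G (ev R c **{F} f) = (SUM y:T. sm (lft R (ev R c \<otimes> f y)) (u y))" unfolding F_def free_simps by (rule Gs[OF T]) (auto simp: T_def)
  have "G (ev R c **{F} f) - sm c (G f) = (SUM y:T. sm (lft R (ev R c \<otimes> f y) - c * lft R (f y)) (u y))"
   unfolding 1 Gs[OF T, of f, unfolded T_def, simplified, folded T_def] sm_sum sum_subtractf[symmetric]
   by (rule sum.cong) (auto simp: sm_def fun_eq_iff algebra_simps)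
  also have "... : W" by (intro submod_sum[OF W] WJ) (simp add: evk_diff_iff fc)
  finally show ?thesis .
 qed
 have key: "th (r f) - A (G f) : U" if f: "f : carrier F" for f
 proof -
  have "f : {f. th (r f) - A (G f) : U}"
  proof (rule free_induct[OF f[unfolded F_def]])
   have "r (%_. \<zero>) = 0{P}" using mod_hom_0[OF r module_free MP] by (simp add: free_simps)
   moreover have "G (%_. \<zero>) = 0" by (simp add: G_def)
   ultimately show "(%_. \<zero>) : {f. th (r f) - A (G f) : U}" using qlin_0[OF th MP] by (simp add: lin_0[OF A])
   fix g a y assume g: "g : {f. th (r f) - A (G f) : U}" "g : carrier (free_module R S)" and a: "a : carrier R" and y: "y : S"
   obtain c where c: "a = ev R c" using ev_surj a by blast
   let ?b = "a **{F} bas R y"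
   interpret FM: module R F unfolding F_def by (rule module_free)
   have bc: "bas R y : carrier F" unfolding F_def by (rule bas_closed[OF y])
   have gc: "g : carrier F" using g(2) by (simp add: F_def)
   have b: "?b : carrier F" using a bc by simp
   have rg: "r g : carrier P" "r ?b : carrier P" using mod_homD(1)[OF r] gc b by (auto simp: F_def)
   have req: "r (g +{F} ?b) = r g +{P} r ?b" using mod_homD(2)[OF r] gc b by (auto simp: F_def)
   have rb': "r ?b = ev R c **{P} r (bas R y)" using mod_homD(3)[OF r a] bc c by (auto simp: F_def)
   have 1: "th (r g +{P} r ?b) - (th (r g) + th (r ?b)) : U" by (rule qlinD(1)[OF th rg])
   have 2: "th (r ?b) - sm c (th (r (bas R y))) : U" unfolding rb' by (rule qlinD(2)[OF th rb[OF y]])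
   have 3: "A (G (g +{F} ?b) - (G g + G ?b)) : U" by (rule AW[OF Gadd[OF gc b]])
   have 4: "A (G ?b - sm c (G (bas R y))) : U" unfolding c by (rule AW[OF Gsm[OF bc]])
   have 5: "G (bas R y) - u y : W"
   proof -
    have "G (bas R y) = (SUM z:{y}. sm (lft R (bas R y z)) (u z))" by (rule Gs) (auto simp: bas_def)
    hence "G (bas R y) - u y = sm (lft R \<one> - 1) (u y)" by (auto simp: bas_def sm_def algebra_simps)
    also have "... : W" by (rule WJ) (simp add: evk_diff_iff)
    finally show ?thesis .
   qed
   have "th (r (g +{F} ?b)) - A (G (g +{F} ?b)) =
    (th (r g +{P} r ?b) - (th (r g) + th (r ?b))) + (th (r g) - A (G g)) + (th (r ?b) - sm c (th (r (bas R y))))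
    + sm c (th (r (bas R y)) - A (u y)) - sm c (A (G (bas R y) - u y)) - A (G ?b - sm c (G (bas R y))) - A (G (g +{F} ?b) - (G g + G ?b))"
    unfolding req by (simp add: lin_diff[OF A] lin_add[OF A] lin_sm[OF A])
   also have "... : U" using g(1) unfolding mem_Collect_eq
    by (intro submod_diff[OF U submod_diff[OF U submod_diff[OF U submod_add[OF U submod_add[OF U submod_add[OF U 1 _] 2]
     submod_sm[OF U u[OF y]]] submod_sm[OF U AW[OF 5]]] 4] 3])
   finally show "g +{free_module R S} a **{free_module R S} bas R y : {f. th (r f) - A (G f) : U}" by (simp add: F_def)
  qed
  thus ?thesis by blast
 qed
 have sF: "s x : carrier F" if "x : carrier P" for x using mod_homD(1)[OF s that] by (simp add: F_def)
 show ?thesis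
 proof (intro exI[of _ "%x. G (s x)"] conjI ballI)
  show "qlin P W (%x. G (s x))" unfolding qlin_def
  proof (intro conjI ballI allI)
   show "G (s (x +{P} y)) - (G (s x) + G (s y)) : W" if "x : carrier P" "y : carrier P" for x y
    using Gadd[OF sF sF, of x y] that mod_homD(2)[OF s that] by (simp add: F_def)
   show "G (s (ev R c **{P} x)) - sm c (G (s x)) : W" if "x : carrier P" for x c
    using Gsm[OF sF, of x c] that mod_homD(3)[OF s _ that, of "ev R c"] by (simp add: F_def)
  qed
  show "th x - A (G (s x)) : U" if "x : carrier P" for x using key[OF sF[OF that]] rs[OF that] by simp
 qed
qed

end

text \<open>A map that is linear modulo W is determined modulo W by the basis vectors, so lifting
  their images column by column gives the matrix.\<close>

lemma linear_lift:
 fixes kp :: "(nat => 'a::comm_ring_1) => nat => 'a"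
 assumes N: "finite N" and W: "submod W"
  and add: "!!u v. kp (u + v) - (kp u + kp v) : W" and sc: "!!c v. kp (sm c v) - sm c (kp v) : W"
  and z: "!!v. v : fr N {0} ==> kp v : W"
  and ex: "!!k. k : N ==> EX u. kp (un k) - mv C A u : W"
 shows "EX H. ALL v. kp v - mv C A (mv N H v) : W"
proof -
 obtain h where h: "!!k. k : N ==> kp (un k) - mv C A (h k) : W" using ex by metis
 define H where "H i k = h k i" for i k
 have "kp v - mv C A (mv N H v) : W" for v
 proof -
  have sum: "kp (SUM k:B. sm (v k) (un k)) - (SUM k:B. sm (v k) (kp (un k))) : W" if "finite B" for B using that
  proof (induction B rule: finite_induct)
   case empty show ?case by (auto simp: z fr_def)
  next
   case (insert b B)
   have "kp (SUM k:insert b B. sm (v k) (un k)) - (SUM k:insert b B. sm (v k) (kp (un k))) =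
    (kp (sm (v b) (un b) + (SUM k:B. sm (v k) (un k))) - (kp (sm (v b) (un b)) + kp (SUM k:B. sm (v k) (un k))))
    + (kp (sm (v b) (un b)) - sm (v b) (kp (un b))) + (kp (SUM k:B. sm (v k) (un k)) - (SUM k:B. sm (v k) (kp (un k))))" using insert.hyps by simp
   also have "... : W" by (rule submod_add[OF W submod_add[OF W add sc] insert.IH])
   finally show ?case .
  qed
  define v' where "v' = (SUM k:N. sm (v k) (un k))"
  have "v' k = v k" if "k : N" for k
  proof -
   have "v' k = (SUM j:N. if j = k then v k else 0)" unfolding v'_def sum_fun by (rule sum.cong) (auto simp: sm_def un_def)
   thus ?thesis using N that by simp
  qed
  hence vz: "v - v' : fr N {0}" by (simp add: fr_def)
  have mvH: "mv C A (mv N H v) = (SUM k:N. sm (v k) (mv C A (h k)))"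
  proof -
   have "mv N H v = (SUM k:N. sm (v k) (h k))" by (auto simp: mv_def sum_fun sm_def H_def mult.commute)
   thus ?thesis by (simp add: lin_sum[OF lin_mv] lin_sm[OF lin_mv])
  qed
  have "kp v - mv C A (mv N H v) = (kp (v - v' + v') - (kp (v - v') + kp v')) + kp (v - v')
   + (kp v' - (SUM k:N. sm (v k) (kp (un k)))) + (SUM k:N. sm (v k) (kp (un k) - mv C A (h k)))" unfolding mvH by (simp add: sum_subtractf)
  also have "... : W" using sum[OF N] h unfolding v'_def[symmetric] by (intro submod_add[OF W] add z[OF vz] submod_sum[OF W] submod_sm[OF W])
  finally show ?thesis .
 qed
 thus ?thesis by blast
qed


section \<open>Comparison of a free with a projective resolution\<close>

text \<open>In degree 0 the cycles are U, the kernel of the augmentation onto V / U; so the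
  equations in \<open>free_res\<close> include that the lowest differential covers U.\<close>

definition cyc :: "'a::comm_ring_1 set => (nat => 'a) set => (nat => nat set) => (nat => nat => nat => 'a) => nat => (nat => 'a) set" where
 "cyc J U b A i = (case i of 0 => U | Suc i' => {v. mv (b (Suc i')) (A i') v : fr (b i') J})"

definition free_res :: "'a::comm_ring_1 set => (nat => 'a) set => (nat => nat set) => (nat => nat => nat => 'a) => bool" where
 "free_res J U b A \<longleftrightarrow> (ALL i. finite (b i)) & (ALL i. range (mv (b (Suc i)) (A i)) + fr (b i) J = cyc J U b A i)"

lemma cyc_simps [simp]: "cyc J U b A 0 = U" "cyc J U b A (Suc i) = {v. mv (b (Suc i)) (A i) v : fr (b i) J}" by (simp_all add: cyc_def)

text \<open>Minimal covers by dependent choice; the state is the current basis together with the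
  submodule still to be covered.\<close>

lemma (in nloc) minimal_resolution:
 assumes U: "finite B" "submod U" "fr B J <= U"
 shows "EX b A. b 0 = B & free_res J U b A & (ALL i. cyc J U b A (Suc i) <= fr (b (Suc i)) m)"
proof -
 define ok where "ok s \<longleftrightarrow> finite (fst s) & submod (snd s) & fr (fst s) J <= snd s" for s :: "nat set \<times> (nat => 'a) set"
 define st where "st s s' \<longleftrightarrow> (EX A. range (mv (fst s') A) + fr (fst s) J = snd s & snd s' = {v. mv (fst s') A v : fr (fst s) J} & snd s' <= fr (fst s') m)"
  for s s' :: "nat set \<times> (nat => 'a) set"
 have "EX f. ALL i. (ok (f i) & (i = 0 --> f i = (B, U))) & st (f i) (f (Suc i))"
 proof (rule dependent_nat_choice)
  show "EX s. ok s & (0 = 0 --> s = (B, U))" using U by (auto simp: ok_def)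
  fix s and i :: nat assume "ok s & (i = 0 --> s = (B, U))"
  hence s: "finite (fst s)" "submod (snd s)" "fr (fst s) J <= snd s" by (auto simp: ok_def)
  obtain N A where N: "finite (N::nat set)" "range (mv N A) + fr (fst s) J = snd s" "ALL c. mv N A c : fr (fst s) J --> c : fr N m"
   using minimal_cover[OF s] by blast
  have "fr N J <= {v. mv N A v : fr (fst s) J}" using lmap_fr[OF lmap_mv[OF N(1) s(1)] idJ order_refl] by blast
  moreover have "submod {v. mv N A v : fr (fst s) J}" using submod_vimage[OF lin_mv submod_fr[OF idJ], of N A "fst s"] by (simp add: vimage_def)
  ultimately have "ok (N, {v. mv N A v : fr (fst s) J})" using N(1) by (simp add: ok_def)
  moreover have "st s (N, {v. mv N A v : fr (fst s) J})" unfolding st_def using N by auto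
  ultimately show "EX s'. (ok s' & (Suc i = 0 --> s' = (B, U))) & st s s'" by auto
 qed
 then obtain f where f': "ALL i. (ok (f i) & (i = 0 --> f i = (B, U))) & st (f i) (f (Suc i))" by auto
 hence f: "!!i. ok (f i)" "f 0 = (B, U)" "!!i. st (f i) (f (Suc i))" by blast+
 define b where "b i = fst (f i)" for i
 obtain A where A: "!!i. range (mv (b (Suc i)) (A i)) + fr (b i) J = snd (f i)" "!!i. snd (f (Suc i)) = {v. mv (b (Suc i)) (A i) v : fr (b i) J}"
  "!!i. snd (f (Suc i)) <= fr (b (Suc i)) m" using f(3) unfolding st_def b_def by metis
 have c: "cyc J U b A i = snd (f i)" for i by (cases i) (simp_all add: f(2) A(2))
 have "free_res J U b A" unfolding free_res_def c using A(1) f(1) by (auto simp: ok_def b_def)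
 moreover have "b 0 = B" by (simp add: b_def f(2))
 ultimately show ?thesis using A(3) c by metis
qed

locale resolved = G: genmods R M N w + nloc "evk R" m for R :: "'r ring" (structure) and M :: "('r, 'm) module" (structure) and N w m +
 fixes b :: "nat => nat set" and A :: "nat => nat => nat => 'r uni"
 assumes b0: "b 0 = N" and res: "free_res (evk R) G.lck b A"
begin

abbreviation "F i == mv (b (Suc i)) (A i)"
abbreviation "frb i == fr (b i) (evk R)"
abbreviation "Z i == cyc (evk R) G.lck b A i"

lemma finb: "finite (b i)" and im: "range (F i) + frb i = Z i" using res by (auto simp: free_res_def)
lemma sfr: "submod (frb i)" by (rule submod_fr[OF idJ])
lemma F_Z: "F i v : Z i" unfolding im[symmetric] mem_range_plus using submod_0[OF sfr] by (intro exI[of _ v]) simp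
lemma Z_iff: "v : Z i \<longleftrightarrow> (EX u. v - F i u : frb i)" unfolding im[symmetric] mem_range_plus ..
lemma F_fr: "v : frb (Suc i) ==> F i v : frb i" by (rule lmap_fr[OF lmap_mv[OF finb finb] idJ order_refl])
lemma fr0: "fr (b i) {0} <= frb i" using idl_0[OF idJ] by (auto simp: fr_def)
lemma smJ: "c : evk R ==> sm c v : frb i" using idl_mult2[OF idJ] by (auto simp: fr_def sm_def)

definition dv where "dv i = (\<lambda>f\<in>carrier (free_module R (b (Suc i))). %k. if k : b i then ev R (F i (%j. lft R (f j)) k) else \<zero>)"
definition "aug = (\<lambda>f\<in>carrier (free_module R (b 0)). G.lc (%j. lft R (f j)))"

definition evv :: "nat => (nat => 'r uni) => nat => 'r" where "evv i v = (%k. if k : b i then ev R (v k) else \<zero>)"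

lemma evv_carrier: "evv i v : carrier (free_module R (b i))" unfolding G.free_carrier evv_def using finb by auto

lemma evv_surj: "f : carrier (free_module R (b i)) ==> f = evv i (%j. lft R (f j))" unfolding G.free_carrier evv_def by auto

lemma evv_eq_iff: "evv i u = evv i v \<longleftrightarrow> u - v : frb i" unfolding evv_def fr_def by (auto simp: fun_eq_iff G.evk_diff_iff)

lemma evv_add: "evv i u +{free_module R S} evv i v = evv i (u + v)" and evv_sm: "ev R c **{free_module R S} evv i v = evv i (sm c v)"
 and evv_zero: "0{free_module R S} = evv i 0" unfolding evv_def by (auto simp: free_simps sm_def)

lemma lft_evv: "(%j. lft R (evv i v j)) - v : frb i" by (auto simp: fr_def evv_def G.evk_diff_iff)

lemma dv_evv: "dv i (evv (Suc i) v) = evv i (F i v)"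
proof -
 have "dv i (evv (Suc i) v) = evv i (F i (%j. lft R (evv (Suc i) v j)))" unfolding dv_def using evv_carrier by (simp add: evv_def)
 also have "... = evv i (F i v)" unfolding evv_eq_iff using F_fr[OF lft_evv] by (simp only: lin_diff[OF lin_mv])
 finally show ?thesis .
qed

lemma aug_evv: "aug (evv 0 v) = G.lc v"
proof -
 have "aug (evv 0 v) = G.lc (%j. lft R (evv 0 v j))" unfolding aug_def using evv_carrier by simp
 also have "... = G.lc v" unfolding G.lck_diff_iff[symmetric] using lft_evv[of 0 v] G.fr_lck by (auto simp: b0)
 finally show ?thesis .
qed

lemma mod_hom_free:
 assumes "!!f. f : carrier (free_module R (b i)) ==> h f : carrier M'" "h : extensional (carrier (free_module R (b i)))"
  "!!u v. h (evv i (u + v)) = h (evv i u) +{M'} h (evv i v)" "!!c v. h (evv i (sm c v)) = ev R c **{M'} h (evv i v)"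
 shows "h : mod_hom R (free_module R (b i)) M'" unfolding mod_hom_def
proof (intro CollectI conjI ballI)
 show "h : carrier (free_module R (b i)) \<rightarrow>\<^sub>E carrier M'" using assms(1,2) by (auto simp: PiE_def)
 fix x assume x: "x : carrier (free_module R (b i))"
 { fix y assume y: "y : carrier (free_module R (b i))"
  show "h (x +{free_module R (b i)} y) = h x +{M'} h y" using evv_surj[OF x] evv_surj[OF y] evv_add assms(3) by metis }
 fix a assume "a : carrier R"
 then obtain c where "a = ev R c" using G.ev_surj by blast
 thus "h (a **{free_module R (b i)} x) = a **{M'} h x" using evv_surj[OF x] evv_sm assms(4) by metis
qed

lemma one_neq_zero: "\<one> ~= \<zero>" using Jm one_m by (force simp: evk_def)

lemma projective_free: "projective_module R (free_module R (b i))"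
proof -
 let ?F = "free_module R (b i)"
 \<comment> \<open>Projectivity is defined with index sets from the type of the elements, so the
   unit vectors themselves serve as indices; they are distinct because 1 is not 0.\<close>
 let ?S = "bas R ` b i"
 have inj: "bas R k = bas R l ==> k = l" for k l :: nat using one_neq_zero by (auto simp: bas_def fun_eq_iff split: if_splits)
 define s where "s = (\<lambda>f\<in>carrier ?F. %x. if x : ?S then f (THE k. x = bas R k) else \<zero>)"
 have sb: "s f (bas R k) = (if k : b i then f k else \<zero>)" if "f : carrier ?F" for f k
 proof -
  have "(THE l. bas R k = bas R l) = k" by (rule the_equality) (auto dest: inj)
  thus ?thesis using that inj by (auto simp: s_def)
 qed
 have s0: "s f x = \<zero>" if "f : carrier ?F" "x ~: ?S" for f x using that by (simp add: s_def)
 define r where "r = (\<lambda>f\<in>carrier (free_module R ?S). %k. if k : b i then f (bas R k) else \<zero>)"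
 have sc: "s f : carrier (free_module R ?S)" if f: "f : carrier ?F" for f unfolding G.free_carrier
 proof (intro conjI allI impI)
  show "s f x = \<zero>" if "x ~: ?S" for x by (rule s0[OF f that])
  show "s f x : carrier R" for x
  proof (cases "x : ?S")
   case True
   thus ?thesis using sb[OF f] f by (auto simp: G.free_carrier)
  qed (simp add: s0[OF f])
  have "{x. s f x ~= \<zero>} <= ?S" using s0[OF f] by blast
  thus "finite {x. s f x ~= \<zero>}" using finb finite_subset by blast
 qed
 interpret FM: module R ?F by (rule G.module_free)
 have "s : mod_hom R ?F (free_module R ?S)" unfolding mod_hom_def
 proof (intro CollectI conjI ballI)
  show "s : carrier ?F \<rightarrow>\<^sub>E carrier (free_module R ?S)" using sc by (auto simp: s_def)
  fix x assume x: "x : carrier ?F"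
  { fix y assume y: "y : carrier ?F"
   have "s (x +{?F} y) z = s x z \<oplus> s y z" for z
   proof (cases "z : ?S")
    case True
    thus ?thesis using sb[OF x] sb[OF y] sb[OF FM.a_closed[OF x y]] by (auto simp: free_simps)
   qed (simp add: s0[OF x] s0[OF y] s0[OF FM.a_closed[OF x y]])
   thus "s (x +{?F} y) = s x +{free_module R ?S} s y" by (simp add: free_simps fun_eq_iff) }
  fix a assume a: "a : carrier R"
  have "s (a **{?F} x) z = a \<otimes> s x z" for z
  proof (cases "z : ?S")
   case True
   thus ?thesis using sb[OF x] sb[OF FM.smult_closed[OF a x]] by (auto simp: free_simps)
  qed (simp add: s0[OF x] s0[OF FM.smult_closed[OF a x]] a)
  thus "s (a **{?F} x) = a **{free_module R ?S} s x" by (simp add: free_simps fun_eq_iff)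
 qed
 moreover have "r : mod_hom R (free_module R ?S) ?F" unfolding mod_hom_def
 proof (intro CollectI conjI ballI)
  interpret FS: module R "free_module R ?S" by (rule G.module_free)
  show "r : carrier (free_module R ?S) \<rightarrow>\<^sub>E carrier ?F" unfolding r_def
   using finb[of i] by (auto simp: G.free_carrier intro: finite_subset[of _ "b i"])
  fix x assume x: "x : carrier (free_module R ?S)"
  show "r (x +{free_module R ?S} y) = r x +{?F} r y" if y: "y : carrier (free_module R ?S)" for y
   using FS.a_closed[OF x y] x y by (auto simp: r_def free_simps)
  show "r (a **{free_module R ?S} x) = a **{?F} r x" if a: "a : carrier R" for a
   using FS.smult_closed[OF a x] x a by (auto simp: r_def free_simps)
 qed
 moreover have "ALL f:carrier ?F. r (s f) = f"
 proof
  fix f assume f: "f : carrier ?F"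
  thus "r (s f) = f" using sc[OF f] sb[OF f] by (auto simp: r_def G.free_carrier)
 qed
 ultimately show ?thesis unfolding projective_module_def using G.module_free by blast
qed

text \<open>A witness with carriers of type \<open>nat => 'r\<close>, so that
  \<open>chosen_resolution\<close> really is a resolution.\<close>

lemma resolution: "projective_resolution R M (%i. free_module R (b i)) dv aug" unfolding projective_resolution_def
proof (intro conjI allI)
 show "module R M" by (rule G.module_axioms)
 show "projective_module R (free_module R (b i))" for i by (rule projective_free)
 show "dv i : mod_hom R (free_module R (b (Suc i))) (free_module R (b i))" for i
 proof (rule mod_hom_free)
  show "dv i f : carrier (free_module R (b i))" if "f : carrier (free_module R (b (Suc i)))" for f using evv_surj[OF that] dv_evv evv_carrier by metis
  show "dv i : extensional (carrier (free_module R (b (Suc i))))" by (simp add: dv_def)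
 qed (simp_all only: dv_evv evv_add evv_sm lin_add[OF lin_mv] lin_sm[OF lin_mv])
 show "aug : mod_hom R (free_module R (b 0)) M"
 proof (rule mod_hom_free)
  show "aug f : carrier M" if "f : carrier (free_module R (b 0))" for f using that by (simp add: aug_def)
  show "aug : extensional (carrier (free_module R (b 0)))" by (simp add: aug_def)
 qed (simp_all only: aug_evv G.lc_add G.lc_sm)
 show "aug ` carrier (free_module R (b 0)) = carrier M"
 proof
  show "aug ` carrier (free_module R (b 0)) <= carrier M" by (auto simp: aug_def)
  show "carrier M <= aug ` carrier (free_module R (b 0))"
  proof
   fix x assume "x : carrier M"
   then obtain v where "x = aug (evv 0 v)" using G.surj aug_evv by metis
   thus "x : aug ` carrier (free_module R (b 0))" using evv_carrier by blast
  qed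
 qed
 have dvim: "dv i ` carrier (free_module R (b (Suc i))) = evv i ` Z i" for i
 proof
  show "dv i ` carrier (free_module R (b (Suc i))) <= evv i ` Z i"
  proof
   fix y assume "y : dv i ` carrier (free_module R (b (Suc i)))"
   then obtain f where "f : carrier (free_module R (b (Suc i)))" "y = dv i f" by blast
   thus "y : evv i ` Z i" using evv_surj[of f "Suc i"] dv_evv F_Z by (metis imageI)
  qed
  show "evv i ` Z i <= dv i ` carrier (free_module R (b (Suc i)))"
  proof
   fix y assume "y : evv i ` Z i"
   then obtain v where v: "v : Z i" "y = evv i v" by blast
   then obtain u where "v - F i u : frb i" using Z_iff by blast
   hence "y = dv i (evv (Suc i) u)" unfolding dv_evv v evv_eq_iff .
   thus "y : dv i ` carrier (free_module R (b (Suc i)))" using evv_carrier by blast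
  qed
 qed
 show "dv 0 ` carrier (free_module R (b 1)) = {x : carrier (free_module R (b 0)). aug x = 0{M}}" unfolding One_nat_def dvim
 proof
  show "evv 0 ` Z 0 <= {x : carrier (free_module R (b 0)). aug x = 0{M}}" using evv_carrier aug_evv by (auto simp: G.lck_def)
  show "{x : carrier (free_module R (b 0)). aug x = 0{M}} <= evv 0 ` Z 0"
  proof
   fix x assume x: "x : {x : carrier (free_module R (b 0)). aug x = 0{M}}"
   obtain v where v: "x = evv 0 v" using evv_surj x by blast
   thus "x : evv 0 ` Z 0" using x aug_evv by (simp add: G.lck_def)
  qed
 qed
 fix i
 show "dv (Suc i) ` carrier (free_module R (b (Suc (Suc i)))) = {x : carrier (free_module R (b (Suc i))). dv i x = 0{free_module R (b i)}}"
  unfolding dvim evv_zero[of _ i]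
 proof
  show "evv (Suc i) ` Z (Suc i) <= {x : carrier (free_module R (b (Suc i))). dv i x = evv i 0}" using evv_carrier dv_evv evv_eq_iff[of i _ 0] by auto
  show "{x : carrier (free_module R (b (Suc i))). dv i x = evv i 0} <= evv (Suc i) ` Z (Suc i)"
  proof
   fix x assume x: "x : {x : carrier (free_module R (b (Suc i))). dv i x = evv i 0}"
   obtain v where v: "x = evv (Suc i) v" using evv_surj x by blast
   thus "x : evv (Suc i) ` Z (Suc i)" using x dv_evv evv_eq_iff[of i _ 0] by simp
  qed
 qed
qed


section \<open>Chain maps and a homotopy between two resolutions\<close>

context
 fixes P :: "nat => ('r, 'p) module" and d and ep
 assumes proj_res: "projective_resolution R M P d ep"
begin

lemma proj: "projective_module R (P i)" and modP: "module R (P i)" and d_hom: "d i : mod_hom R (P (Suc i)) (P i)"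
 and eps_hom: "ep : mod_hom R (P 0) M" and eps_surj: "ep ` carrier (P 0) = carrier M"
 and d0_im: "d 0 ` carrier (P (Suc 0)) = {x : carrier (P 0). ep x = 0{M}}"
 and d_im: "d (Suc i) ` carrier (P (Suc (Suc i))) = {x : carrier (P (Suc i)). d i x = 0{P i}}"
 using proj_res by (auto simp: projective_resolution_def projective_module_def)

definition zyc where "zyc i = (case i of 0 => {x : carrier (P 0). ep x = 0{M}} | Suc i' => {x : carrier (P (Suc i')). d i' x = 0{P i'}})"

lemma zyc_simps: "zyc 0 = {x : carrier (P 0). ep x = 0{M}}" "zyc (Suc i) = {x : carrier (P (Suc i)). d i x = 0{P i}}"
 by (simp_all add: zyc_def)

lemma d_zyc: "d i ` carrier (P (Suc i)) = zyc i" using d0_im d_im by (cases i) (simp_all add: zyc_simps)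

text \<open>Comparison theorem, one degree at a time: the invariant that cycles go to cycles makes
  the next lifting problem solvable.\<close>

lemma chain_map_to_free:
 "EX g. (ALL i. G.qlin (P i) (frb i) (g i)) & (ALL x:carrier (P 0). G.lc (g 0 x) = ep x) &
   (ALL i. ALL x:carrier (P (Suc i)). g i (d i x) - F i (g (Suc i) x) : frb i)"
proof -
 define ok where "ok i g \<longleftrightarrow> G.qlin (P i) (frb i) g & (ALL x:zyc i. g x : Z i) & (i = 0 --> (ALL x:carrier (P 0). G.lc (g x) = ep x))" for i g
 define st where "st i g g' \<longleftrightarrow> (ALL x:carrier (P (Suc i)). g (d i x) - F i (g' x) : frb i)" for i and g g' :: "'p => nat => 'r uni"
 have "EX g. ALL i. ok i (g i) & st i (g i) (g (Suc i))"
 proof (rule dependent_nat_choice)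
  have "ALL x:carrier (P 0). EX v. ep x = G.lc v" using G.surj mod_homD(1)[OF eps_hom] by blast
  then obtain th where th: "!!x. x : carrier (P 0) ==> ep x = G.lc (th x)" by metis
  have q: "G.qlin (P 0) G.lck th" unfolding G.qlin_def
  proof (intro conjI ballI allI)
   interpret P0: module R "P 0" by (rule modP)
   show "th (x +{P 0} y) - (th x + th y) : G.lck" if "x : carrier (P 0)" "y : carrier (P 0)" for x y
    unfolding G.lck_diff_iff G.lc_add using that mod_homD(2)[OF eps_hom that] by (simp flip: th)
   show "th (ev R c **{P 0} x) - sm c (th x) : G.lck" if "x : carrier (P 0)" for x c
    unfolding G.lck_diff_iff G.lc_sm using that mod_homD(3)[OF eps_hom G.ev_closed that, of c] by (simp flip: th)
  qed
  have "EX g. G.qlin (P 0) (frb 0) g & (ALL x:carrier (P 0). th x - g x : G.lck)"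
  proof (rule G.proj_lift[OF proj q _ sfr G.submod_lck smJ])
   show "lin (%v. v)" by (simp add: lin_def)
   show "v : G.lck" if "v : frb 0" for v using G.fr_lck that b0 by auto
   show "EX v. th x - v : G.lck" for x using submod_0[OF G.submod_lck] by (intro exI[of _ "th x"]) simp
  qed
  then obtain g where g: "G.qlin (P 0) (frb 0) g" "!!x. x : carrier (P 0) ==> G.lc (th x) = G.lc (g x)" unfolding G.lck_diff_iff by blast
  hence "ok 0 g" using th unfolding ok_def by (auto simp: zyc_simps G.lck_def)
  thus "EX g. ok 0 g" by (rule exI[of "ok 0" g])
 next
  fix g i assume g: "ok i g"
  have zc: "zyc i <= carrier (P i)" by (cases i) (auto simp: zyc_simps)
  have dc: "d i x : zyc i" if "x : carrier (P (Suc i))" for x using d_zyc that by blast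
  have dP: "d i x : carrier (P i)" if "x : carrier (P (Suc i))" for x using dc[OF that] zc by blast
  have gq: "G.qlin (P i) (frb i) g" using g by (simp add: ok_def)
  have "G.qlin (P (Suc i)) (frb i) (%x. g (d i x))" unfolding G.qlin_def
  proof (intro conjI ballI allI)
   show "g (d i (x +{P (Suc i)} y)) - (g (d i x) + g (d i y)) : frb i" if "x : carrier (P (Suc i))" "y : carrier (P (Suc i))" for x y
    unfolding mod_homD(2)[OF d_hom that] by (rule G.qlinD(1)[OF gq dP[OF that(1)] dP[OF that(2)]])
   show "g (d i (ev R c **{P (Suc i)} x)) - sm c (g (d i x)) : frb i" if "x : carrier (P (Suc i))" for x c
    unfolding mod_homD(3)[OF d_hom G.ev_closed that] by (rule G.qlinD(2)[OF gq dP[OF that]])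
  qed
  moreover have "EX v. g (d i x) - F i v : frb i" if "x : carrier (P (Suc i))" for x using g dc[OF that] unfolding ok_def Z_iff by blast
  ultimately have "EX g'. G.qlin (P (Suc i)) (frb (Suc i)) g' & (ALL x:carrier (P (Suc i)). g (d i x) - F i (g' x) : frb i)"
   by (intro G.proj_lift[OF proj _ lin_mv sfr sfr smJ F_fr])
  then obtain g' where g': "G.qlin (P (Suc i)) (frb (Suc i)) g'" "ALL x:carrier (P (Suc i)). g (d i x) - F i (g' x) : frb i" by blast
  have "g' x : Z (Suc i)" if x: "x : zyc (Suc i)" for x
  proof -
   have x: "x : carrier (P (Suc i))" "d i x = 0{P i}" using x by (auto simp: zyc_simps)
   have "g (d i x) : frb i" unfolding x(2) by (rule G.qlin_0[OF gq modP])
   thus ?thesis using bspec[OF g'(2) x(1)] submod_cong[OF sfr] by auto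
  qed
  hence "ok (Suc i) g'" using g' by (simp add: ok_def)
  thus "EX g'. ok (Suc i) g' & st i g g'" using g'(2) unfolding st_def by blast
 qed
 then obtain g where "ALL i. ok i (g i) & st i (g i) (g (Suc i))" by (elim exE)
 thus ?thesis unfolding ok_def st_def by (intro exI[of _ g]) auto
qed

text \<open>Here the source is free, so suitable images of the basis vectors are chosen, and the map
  is the linear combination \<open>lc\<close> of these images.\<close>

lemma chain_map_from_free:
 "EX p. (ALL i. genmod R (P i) (b i) (p i)) & (ALL v. ep (genmod.lc R (P 0) (b 0) (p 0) v) = G.lc v) &
   (ALL i v. d i (genmod.lc R (P (Suc i)) (b (Suc i)) (p (Suc i)) v) = genmod.lc R (P i) (b i) (p i) (F i v))"
proof -
 define ok where "ok i p \<longleftrightarrow> genmod R (P i) (b i) p & (ALL v:Z i. genmod.lc R (P i) (b i) p v : zyc i) &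
  (i = 0 --> (ALL v. ep (genmod.lc R (P 0) (b 0) p v) = G.lc v))" for i p
 define st where "st i p p' \<longleftrightarrow> (ALL v. d i (genmod.lc R (P (Suc i)) (b (Suc i)) p' v) = genmod.lc R (P i) (b i) p (F i v))" for i p p'
 have gm: "genmod R (P i) (b i) p" if "!!k. k : b i ==> p k : carrier (P i)" for i p using modP that finb by (simp add: genmod_def genmod_axioms_def)
 have "EX p. ALL i. ok i (p i) & st i (p i) (p (Suc i))"
 proof (rule dependent_nat_choice)
  have "ALL k:b 0. EX x:carrier (P 0). ep x = w k" using eps_surj G.w b0 by (metis imageE)
  then obtain p where p: "!!k. k : b 0 ==> p k : carrier (P 0)" "!!k. k : b 0 ==> ep (p k) = w k" by metis
  interpret p: genmod R "P 0" "b 0" p by (rule gm[OF p(1)])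
  have e: "ep (p.lc v) = G.lc v" for v
  proof -
   have "ep (p.lc v) = (\<Oplus>\<^bsub>M\<^esub>k\<in>b 0. ev R (v k) **{M} ep (p k))" by (rule p.hom_lc[OF eps_hom G.module_axioms])
   also have "... = G.lc v" unfolding G.lc_def using p(2) G.w b0 by (intro G.M.finsum_cong') auto
   finally show ?thesis .
  qed
  have "ALL v:Z 0. p.lc v : zyc 0" using e by (auto simp: zyc_simps G.lck_def)
  hence "ok 0 p" unfolding ok_def using p.genmod_axioms e by blast
  thus "EX p. ok 0 p" by (rule exI[of "ok 0" p])
 next
  fix p i assume ok: "ok i p"
  interpret p: genmod R "P i" "b i" p using ok by (simp add: ok_def)
  have "EX x:carrier (P (Suc i)). d i x = p.lc (F i (un k))" for k
  proof -
   have "p.lc (F i (un k)) : zyc i" using ok F_Z by (simp add: ok_def)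
   thus ?thesis unfolding d_zyc[symmetric] by (metis imageE)
  qed
  then obtain q where q: "!!k. q k : carrier (P (Suc i))" "!!k. d i (q k) = p.lc (F i (un k))" by metis
  interpret q: genmod R "P (Suc i)" "b (Suc i)" q by (rule gm[OF q(1)])
  have e: "d i (q.lc v) = p.lc (F i v)" for v
  proof -
   have "d i (q.lc v) = (\<Oplus>\<^bsub>P i\<^esub>k\<in>b (Suc i). ev R (v k) **{P i} p.lc (F i (un k)))"
    unfolding q.hom_lc[OF d_hom modP] q(2) ..
   also have "... = p.lc (F i v)" unfolding p.lc_mv[OF finb, where v = v] by (intro p.M.finsum_cong') (auto simp: mv_un[OF finb])
   finally show ?thesis .
  qed
  have "q.lc v : zyc (Suc i)" if "v : Z (Suc i)" for v using that p.fr_lck e[of v] by (auto simp: zyc_simps p.lck_def)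
  hence "ok (Suc i) q" unfolding ok_def using q.genmod_axioms by blast
  thus "EX q. ok (Suc i) q & st i p q" using e unfolding st_def by blast
 qed
 then obtain p where "ALL i. ok i (p i) & st i (p i) (p (Suc i))" by (elim exE)
 thus ?thesis unfolding ok_def st_def by (intro exI[of _ p]) auto
qed

text \<open>\<open>kp\<close>, which is g f - 1, covers the zero map of M; subtracting the previous
  homotopy turns it into a map with values in cycles, and these lift. Only the composite on the free
  side matters, because information is carried from P to the free resolution.\<close>

lemma homotopy:
 assumes g: "!!i. G.qlin (P i) (frb i) (g i)" and g0: "!!x. x : carrier (P 0) ==> G.lc (g 0 x) = ep x"
  and gd: "!!i x. x : carrier (P (Suc i)) ==> g i (d i x) - F i (g (Suc i) x) : frb i"
  and gm: "!!i. genmod R (P i) (b i) (p i)" and f: "!!i. f i = genmod.lc R (P i) (b i) (p i)"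
  and f0: "!!v. ep (f 0 v) = G.lc v" and fd: "!!i v. d i (f (Suc i) v) = f i (F i v)"
 shows "EX H. ALL i v. g (Suc i) (f (Suc i) v) - v - F (Suc i) (mv (b (Suc i)) (H (Suc i)) v) - mv (b i) (H i) (F i v) : frb (Suc i)"
proof -
 define kp where "kp i v = g i (f i v) - v" for i v
 have fc: "f i v : carrier (P i)" for i v
 proof -
  interpret p: genmod R "P i" "b i" "p i" by (rule gm)
  show ?thesis by (simp add: f)
 qed
 have kpadd: "kp i (u + v) - (kp i u + kp i v) : frb i" for i u v
 proof -
  interpret p: genmod R "P i" "b i" "p i" by (rule gm)
  have "kp i (u + v) - (kp i u + kp i v) = g i (f i u +{P i} f i v) - (g i (f i u) + g i (f i v))"
   by (simp add: kp_def f p.lc_add)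
  also have "... : frb i" by (rule G.qlinD(1)[OF g fc fc])
  finally show ?thesis .
 qed
 have kpsm: "kp i (sm c v) - sm c (kp i v) : frb i" for i c v
 proof -
  interpret p: genmod R "P i" "b i" "p i" by (rule gm)
  have "kp i (sm c v) - sm c (kp i v) = g i (ev R c **{P i} f i v) - sm c (g i (f i v))" by (simp add: kp_def f p.lc_sm)
  also have "... : frb i" by (rule G.qlinD(2)[OF g fc])
  finally show ?thesis .
 qed
 have kpfr: "kp i v : frb i" if "v : frb i" for i v
 proof -
  interpret p: genmod R "P i" "b i" "p i" by (rule gm)
  have "f i v = 0{P i}" using p.fr_lck that by (auto simp: f p.lck_def)
  hence "g i (f i v) : frb i" using G.qlin_0[OF g modP] by simp
  thus ?thesis unfolding kp_def using that submod_diff[OF sfr] by blast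
 qed
 have cong: "kp i u - kp i v : frb i" if "u - v : frb i" for i u v using submod_add[OF sfr kpadd[of i "u - v" v] kpfr[OF that]] by simp
 have gcong: "g i x - g i y : frb i" if "x = y" for i x y using submod_0[OF sfr] that by simp
 have Fk: "F i (kp (Suc i) v) - kp i (F i v) : frb i" for i v
 proof -
  have "g i (d i (f (Suc i) v)) - F i (g (Suc i) (f (Suc i) v)) : frb i" by (rule gd[OF fc])
  hence "F i (g (Suc i) (f (Suc i) v)) - g i (f i (F i v)) : frb i" unfolding fd by (rule submod_minus_commute[OF sfr])
  thus ?thesis by (simp add: kp_def lin_diff[OF lin_mv])
 qed
 define HH where "HH i H v = mv (b i) H v" for i H v
 define ok where "ok i H \<longleftrightarrow> (ALL v:Z i. kp i v - F i (mv (b i) H v) : frb i)" for i H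
 define st where "st i H H' \<longleftrightarrow> (ALL v. kp (Suc i) v - F (Suc i) (mv (b (Suc i)) H' v) - mv (b i) H (F i v) : frb (Suc i))" for i H H'
 have "EX H. ALL i. ok i (H i) & st i (H i) (H (Suc i))"
 proof (rule dependent_nat_choice)
  have "EX u. kp 0 (un k) - F 0 u : frb 0" for k
  proof -
   have "kp 0 (un k) : G.lck" unfolding kp_def G.lck_diff_iff using g0[OF fc] f0 by simp
   thus ?thesis using Z_iff[of _ 0] by simp
  qed
  hence "EX H. ALL v. kp 0 v - F 0 (mv (b 0) H v) : frb 0" using fr0 by (intro linear_lift[OF finb sfr kpadd kpsm kpfr]) blast+
  thus "EX H. ok 0 H" by (auto simp: ok_def)
 next
  fix H i assume ok: "ok i H"
  define th where "th v = kp (Suc i) v - mv (b i) H (F i v)" for v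
  have Hfr: "mv (b i) H (F i v) : frb (Suc i)" if "v : Z (Suc i)" for v
   using lmap_fr[OF lmap_mv[OF finb[of i] finb[of "Suc i"], of H] idJ order_refl, of "F i v"] that by simp
  have "EX H'. ALL v. th v - F (Suc i) (mv (b (Suc i)) H' v) : frb (Suc i)"
  proof (rule linear_lift[OF finb sfr])
   show "th (u + v) - (th u + th v) : frb (Suc i)" for u v using kpadd[of "Suc i" u v] by (simp add: th_def lin_add[OF lin_mv] algebra_simps)
   show "th (sm c v) - sm c (th v) : frb (Suc i)" for c v using kpsm[of "Suc i" c v] by (simp add: th_def lin_sm[OF lin_mv] algebra_simps)
   show "th v : frb (Suc i)" if "v : fr (b (Suc i)) {0}" for v
   proof -
    have v: "v : frb (Suc i)" using that fr0 by blast
    hence "v : Z (Suc i)" using F_fr by simp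
    thus ?thesis unfolding th_def by (rule submod_diff[OF sfr kpfr[OF v] Hfr])
   qed
   show "EX u. th (un k) - F (Suc i) u : frb (Suc i)" for k
   proof -
    let ?v = "un k :: nat => 'r uni"
    have "F i (th ?v) = (F i (kp (Suc i) ?v) - kp i (F i ?v)) + (kp i (F i ?v) - F i (mv (b i) H (F i ?v)))" by (simp add: th_def lin_diff[OF lin_mv])
    also have "... : frb i" using ok F_Z[of i] unfolding ok_def by (intro submod_add[OF sfr Fk]) blast
    finally have "th ?v : Z (Suc i)" by simp
    thus ?thesis by (simp only: Z_iff)
   qed
  qed
  then obtain H' where H': "!!v. th v - F (Suc i) (mv (b (Suc i)) H' v) : frb (Suc i)" by blast
  have "kp (Suc i) v - F (Suc i) (mv (b (Suc i)) H' v) : frb (Suc i)" if "v : Z (Suc i)" for v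
   using submod_add[OF sfr H'[of v] Hfr[OF that]] by (simp add: th_def)
  hence "ok (Suc i) H'" by (simp only: ok_def) blast
  moreover have "st i H H'" unfolding st_def using H' by (simp add: th_def algebra_simps)
  ultimately show "EX H'. ok (Suc i) H' & st i H H'" by blast
 qed
 then obtain H where "ALL i. ok i (H i) & st i (H i) (H (Suc i))" by (elim exE)
 thus ?thesis unfolding st_def kp_def by blast
qed

lemma comparison:
 obtains p g H where "!!i. genmod R (P i) (b i) (p i)" "!!i. G.qlin (P i) (frb i) (g i)"
  "!!i x. x : carrier (P (Suc i)) ==> g i (d i x) - F i (g (Suc i) x) : frb i"
  "!!i v. d i (genmod.lc R (P (Suc i)) (b (Suc i)) (p (Suc i)) v) = genmod.lc R (P i) (b i) (p i) (F i v)"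
  "!!i v. g (Suc i) (genmod.lc R (P (Suc i)) (b (Suc i)) (p (Suc i)) v) - v - F (Suc i) (mv (b (Suc i)) (H (Suc i)) v)
    - mv (b i) (H i) (F i v) : frb (Suc i)"
proof -
 obtain g where g: "!!i. G.qlin (P i) (frb i) (g i)" "!!x. x : carrier (P 0) ==> G.lc (g 0 x) = ep x"
  "!!i x. x : carrier (P (Suc i)) ==> g i (d i x) - F i (g (Suc i) x) : frb i" using chain_map_to_free by (elim exE conjE) blast
 obtain p where p: "!!i. genmod R (P i) (b i) (p i)" "!!v. ep (genmod.lc R (P 0) (b 0) (p 0) v) = G.lc v"
   "!!i v. d i (genmod.lc R (P (Suc i)) (b (Suc i)) (p (Suc i)) v) = genmod.lc R (P i) (b i) (p i) (F i v)"
  using chain_map_from_free by (elim exE conjE) blast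
 obtain H where "ALL i v. g (Suc i) (genmod.lc R (P (Suc i)) (b (Suc i)) (p (Suc i)) v) - v - F (Suc i) (mv (b (Suc i)) (H (Suc i)) v)
    - mv (b i) (H i) (F i v) : frb (Suc i)" using homotopy[OF g p(1) refl p(2,3)] by blast thus thesis using that[OF p(1) g(1,3) p(3)] by blast
qed

end

end


section \<open>Vanishing of Ext and finite projective dimension\<close>

context resolved begin

text \<open>A cocycle v on the free side is pulled back along g to P, becomes a coboundary there,
  and returns along p. Since the composite is homotopic to the identity, v is the transpose of
  \<open>A i\<close> applied to the returned cochain corrected by v composed with the
  homotopy.\<close>

lemma exact_of_coboundaries:
 assumes P: "projective_resolution R M P d ep"
  and cob: "Hom_cocycles R P d (self_module R) (Suc i) <= Hom_coboundaries R P d (self_module R) (Suc i)"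
  and v: "mv (b (Suc i)) (tr (A (Suc i))) v : frb (Suc (Suc i))"
 shows "v : range (mv (b i) (tr (A i))) + frb (Suc i)"
proof -
 obtain p g H where gm: "!!i. genmod R (P i) (b i) (p i)" and g: "!!i. G.qlin (P i) (frb i) (g i)"
  and gd: "!!i x. x : carrier (P (Suc i)) ==> g i (d i x) - F i (g (Suc i) x) : frb i"
  and fd: "!!i v. d i (genmod.lc R (P (Suc i)) (b (Suc i)) (p (Suc i)) v) = genmod.lc R (P i) (b i) (p i) (F i v)"
  and H: "!!i v. g (Suc i) (genmod.lc R (P (Suc i)) (b (Suc i)) (p (Suc i)) v) - v - F (Suc i) (mv (b (Suc i)) (H (Suc i)) v)
    - mv (b i) (H i) (F i v) : frb (Suc i)" using comparison[OF P] by blast interpret f: genmod R "P i" "b i" "p i" by (rule gm)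
 interpret f': genmod R "P (Suc i)" "b (Suc i)" "p (Suc i)" by (rule gm)
 define ph where "ph x = (SUM k:b (Suc i). v k * x k)" for x
 have phadd: "ph (x + y) = ph x + ph y" "ph (x - y) = ph x - ph y" "ph (sm c x) = c * ph x" for x y c
  by (simp_all add: ph_def algebra_simps sum.distrib sum_subtractf sm_def sum_distrib_left)
 have phJ: "ph x : evk R" if "x : frb (Suc i)" for x unfolding ph_def using that by (intro idl_sum[OF idJ] idl_mult[OF idJ]) (auto simp: fr_def)
 have phev: "ev R (ph x) = ev R (ph y)" if "x - y : frb (Suc i)" for x y using phJ[OF that] unfolding phadd G.evk_diff_iff .
 have phF: "ph (F (Suc i) x) : evk R" for x
 proof -
  have "ph (F (Suc i) x) = (SUM k:b (Suc (Suc i)). x k * mv (b (Suc i)) (tr (A (Suc i))) v k)" unfolding ph_def by (rule dot_mv)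
  also have "... : evk R" using v by (intro idl_sum[OF idJ] idl_mult[OF idJ]) (auto simp: fr_def)
  finally show ?thesis .
 qed
 define c where "c = (\<lambda>x\<in>carrier (P (Suc i)). ev R (ph (g (Suc i) x)))"
 interpret PS: module R "P (Suc (Suc i))" by (rule modP[OF P])
 have "c : mod_hom R (P (Suc i)) (self_module R)" unfolding mod_hom_def
 proof (intro CollectI conjI ballI)
  show "c : carrier (P (Suc i)) \<rightarrow>\<^sub>E carrier (self_module R)" by (auto simp: c_def)
  fix x assume x: "x : carrier (P (Suc i))"
  show "c (x +{P (Suc i)} y) = c x +{self_module R} c y" if y: "y : carrier (P (Suc i))" for y
   using x y phev[OF G.qlinD(1)[OF g x y]] by (simp add: c_def phadd)
  show "c (a **{P (Suc i)} x) = a **{self_module R} c x" if a: "a : carrier R" for a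
  proof -
   obtain z where z: "a = ev R z" using G.ev_surj a by blast
   show ?thesis using x phev[OF G.qlinD(2)[OF g x, of z]] by (simp add: c_def phadd z)
  qed
 qed
 moreover have "compose (carrier (P (Suc (Suc i)))) c (d (Suc i)) = 0{Hom_module R (P (Suc (Suc i))) (self_module R)}"
 proof
  fix x
  show "compose (carrier (P (Suc (Suc i)))) c (d (Suc i)) x = 0{Hom_module R (P (Suc (Suc i))) (self_module R)} x"
  proof (cases "x : carrier (P (Suc (Suc i)))")
   case True
   have "ev R (ph (g (Suc i) (d (Suc i) x))) = ev R (ph (F (Suc i) (g (Suc (Suc i)) x)))" by (rule phev[OF gd[OF True]])
   also have "... = \<zero>" using phF by (simp add: evk_def)
   finally show ?thesis using mod_homD(1)[OF d_hom[OF P] True] by (simp add: compose_def c_def Hom_module_def)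
  qed (simp add: compose_def Hom_module_def)
 qed
 ultimately obtain th where th: "th : mod_hom R (P i) (self_module R)" "c = compose (carrier (P (Suc i))) th (d i)" using cob by (auto simp: Hom_cocycles_def)
 define mu where "mu q = lft R (th (p i q)) - ph (mv (b i) (H i) (un q))" for q
 have "v k - mv (b i) (tr (A i)) mu k : evk R" if k: "k : b (Suc i)" for k
 proof -
  define x where "x = F i (un k)"
  define y where "y = f'.lc (un k)"
  have yc: "y : carrier (P (Suc i))" by (simp add: y_def)
  have vk: "ph (un k) = v k" using k finb by (simp add: ph_def un_def if_distrib cong: if_cong)
  have 1: "ev R (ph (g (Suc i) y)) = th (f.lc x)"
  proof -
   have "ev R (ph (g (Suc i) y)) = c y" using yc by (simp add: c_def)
   also have "... = th (d i y)" using yc by (simp add: th(2) compose_def)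
   finally show ?thesis by (simp add: y_def x_def fd)
  qed
  from 1 have 2: "ph (g (Suc i) y) - (SUM q:b i. x q * lft R (th (p i q))) : evk R" unfolding G.evk_diff_iff by (auto simp: f.hom_self_lc th)
  have "ph (g (Suc i) y - un k - F (Suc i) (mv (b (Suc i)) (H (Suc i)) (un k)) - mv (b i) (H i) x) : evk R" unfolding x_def y_def by (rule phJ[OF H])
  hence 3: "ph (g (Suc i) y) - v k - ph (F (Suc i) (mv (b (Suc i)) (H (Suc i)) (un k))) - ph (mv (b i) (H i) x) : evk R" unfolding phadd vk .
  have 4: "ph (mv (b i) (H i) x) = (SUM q:b i. x q * ph (mv (b i) (H i) (un q)))"
  proof -
   have "ph (mv (b i) (H i) (un q)) = mv (b (Suc i)) (tr (H i)) v q" if "q : b i" for q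
    unfolding ph_def mv_un[OF finb that] by (simp add: mv_def tr_def mult.commute)
   moreover have "ph (mv (b i) (H i) x) = (SUM q:b i. x q * mv (b (Suc i)) (tr (H i)) v q)" unfolding ph_def by (rule dot_mv)
   ultimately show ?thesis by simp
  qed
  have 5: "mv (b i) (tr (A i)) mu k = (SUM q:b i. x q * mu q)" unfolding x_def mv_un[OF finb k] by (simp add: mv_def tr_def)
  have "v k - mv (b i) (tr (A i)) mu k = (ph (g (Suc i) y) - (SUM q:b i. x q * lft R (th (p i q))))
   - (ph (g (Suc i) y) - v k - ph (F (Suc i) (mv (b (Suc i)) (H (Suc i)) (un k))) - ph (mv (b i) (H i) x))
   - ph (F (Suc i) (mv (b (Suc i)) (H (Suc i)) (un k)))" unfolding 4 5 mu_def by (simp add: algebra_simps sum_subtractf)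
  also have "... : evk R" by (rule idl_diff[OF idJ idl_diff[OF idJ 2 3] phF])
  finally show ?thesis .
 qed
 thus ?thesis unfolding mem_range_plus by (intro exI[of _ mu]) (simp add: fr_def)
qed

lemma exact_of_Ext:
 assumes T: "trivial_group (Ext (Suc i) R M (self_module R))"
  and v: "mv (b (Suc i)) (tr (A (Suc i))) v : frb (Suc (Suc i))"
 shows "v : range (mv (b i) (tr (A i))) + frb (Suc i)"
proof -
 obtain P d ep where ch: "chosen_resolution R M = (P, d, ep)" by (metis prod_cases3)
 have "case chosen_resolution R M of (P, d, ep) => projective_resolution R M P d ep"
  unfolding chosen_resolution_def by (rule someI[of _ "(%i. free_module R (b i), dv, aug)"]) (simp add: resolution)
 hence P: "projective_resolution R M P d ep" by (simp add: ch)
 interpret Pi: module R "P (Suc i)" by (rule modP[OF P])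
 interpret P0: module R "P i" by (rule modP[OF P])
 let ?C = "Hom_cocycles R P d (self_module R) (Suc i)" and ?B = "Hom_coboundaries R P d (self_module R) (Suc i)"
 define H where "H = (add_monoid (Hom_module R (P (Suc i)) (self_module R)))\<lparr>carrier := ?C\<rparr>"
 have car: "carrier (H Mod ?B) = {1{H Mod ?B}}" using T by (simp add: Ext_def ch H_def trivial_group_def)
 have "?C <= ?B"
 proof
  \<comment> \<open>In the trivial quotient every coset is the subgroup itself. The zero map is a
    coboundary, so f lies in its own coset, hence among the coboundaries.\<close>
  fix f assume f: "f : ?C" have eq: "?B #>\<^bsub>H\<^esub> f = ?B" using f car unfolding FactGroup_def RCOSETS_def by (auto simp: H_def)
  define z where "z = (\<lambda>x\<in>carrier (P (Suc i)). \<zero>)"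
  have "(\<lambda>x\<in>carrier (P i). \<zero>) : mod_hom R (P i) (self_module R)" by (auto simp: mod_hom_def)
  moreover have "compose (carrier (P (Suc i))) (\<lambda>x\<in>carrier (P i). \<zero>) (d i) = z"
   using mod_homD(1)[OF d_hom[OF P]] by (auto simp: compose_def z_def)
  ultimately have z: "z : ?B" by auto
  have fh: "f : carrier (P (Suc i)) \<rightarrow>\<^sub>E carrier R" using f by (auto simp: Hom_cocycles_def mod_hom_def)
  have "z *{H} f = f" using fh by (auto simp: H_def Hom_module_def z_def PiE_def extensional_def Pi_def)
  moreover have "z *{H} f : ?B #>\<^bsub>H\<^esub> f" unfolding r_coset_def using z by blast
  ultimately show "f : ?B" using eq by simp
 qed
 thus ?thesis by (rule exact_of_coboundaries[OF P _ v])
qed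

text \<open>Beyond the length of a finite projective resolution the composite through P vanishes, so
  the identity is F H + H F up to sign; minimality puts this into m, which is impossible on a unit
  vector.\<close>

lemma minimal_finite:
 assumes pd: "proj_dim R M < \<infinity>" and min: "!!i. Z (Suc i) <= fr (b (Suc i)) m"
 shows "EX n. ALL i>=n. b i = {}"
proof -
 define T where "T = {enat n | n. EX (P :: nat => ('r, nat => 'r) module) d ep. projective_resolution R M P d ep & (ALL i>n. carrier (P i) = {0{P i}})}"
 have inf: "proj_dim R M = Inf T" unfolding proj_dim_def T_def ..
 have "T ~= {}" using pd inf by (auto simp: top_enat_def)
 then obtain n and P :: "nat => ('r, nat => 'r) module" and d ep
  where P: "projective_resolution R M P d ep" and Pn: "ALL i>n. carrier (P i) = {0{P i}}" unfolding T_def by blast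
 obtain p g H where gm: "!!i. genmod R (P i) (b i) (p i)" and g: "!!i. G.qlin (P i) (frb i) (g i)"
  and gd: "!!i x. x : carrier (P (Suc i)) ==> g i (d i x) - F i (g (Suc i) x) : frb i"
  and fd: "!!i v. d i (genmod.lc R (P (Suc i)) (b (Suc i)) (p (Suc i)) v) = genmod.lc R (P i) (b i) (p i) (F i v)"
  and H: "!!i v. g (Suc i) (genmod.lc R (P (Suc i)) (b (Suc i)) (p (Suc i)) v) - v - F (Suc i) (mv (b (Suc i)) (H (Suc i)) v)
    - mv (b i) (H i) (F i v) : frb (Suc i)" using comparison[OF P] by blast have sm': "submod (fr N m)" for N by (rule submod_fr[OF idm])
 have frJm: "frb i <= fr (b i) m" for i using Jm by (auto simp: fr_def)
 have "b (Suc (Suc i)) = {}" if i: "i >= n" for i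
 proof (rule ccontr)
  \<comment> \<open>The shift by one ensures that the images of \<open>F j\<close> and
    \<open>F (Suc j)\<close> are both covered by the minimality hypothesis, which speaks of positive
    degrees.\<close>
  define j where "j = Suc i"
  assume "b (Suc (Suc i)) ~= {}"
  then obtain k where k: "k : b (Suc j)" by (auto simp: j_def)
  interpret f: genmod R "P (Suc j)" "b (Suc j)" "p (Suc j)" by (rule gm)
  have "f.lc (un k) = 0{P (Suc j)}" using Pn i f.lc_closed by (simp add: j_def)
  hence 1: "g (Suc j) (f.lc (un k)) : fr (b (Suc j)) m" using G.qlin_0[OF g modP[OF P]] frJm by auto
  have 2: "F (Suc j) v : fr (b (Suc j)) m" for v using F_Z[of "Suc j"] min by blast
  have "F j (un k) : fr (b j) m" using F_Z[of j] min[of i] by (auto simp: j_def)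
  hence 3: "mv (b j) (H j) (F j (un k)) : fr (b (Suc j)) m" by (rule lmap_fr[OF lmap_mv[OF finb finb] idm Jm])
  have "un k = g (Suc j) (f.lc (un k)) - (g (Suc j) (f.lc (un k)) - un k - F (Suc j) (mv (b (Suc j)) (H (Suc j)) (un k))
    - mv (b j) (H j) (F j (un k))) - F (Suc j) (mv (b (Suc j)) (H (Suc j)) (un k)) - mv (b j) (H j) (F j (un k))" by simp
  also have "... : fr (b (Suc j)) m" by (rule submod_diff[OF sm' submod_diff[OF sm' submod_diff[OF sm' 1 subsetD[OF frJm H]] 2] 3])
  finally have "(un k :: nat => 'r uni) k : m" using k unfolding fr_def by blast
  thus False using one_m by (simp add: un_def)
 qed
 hence "ALL i>=Suc (Suc n). b i = {}" by (metis Suc_le_D Suc_le_mono)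
 thus ?thesis ..
qed

end

section \<open>Derivations lift along the residue map\<close>

locale loc_diffs = diffs R Om N w K ph d + nloc "evk R" m
 for R :: "'r ring" (structure) and Om :: "('r, 'm) module" (structure) and N w and K :: "'k ring" and ph d m +
 fixes b A
 assumes resOm: "b 0 = N" "free_res (evk R) lck b A"
begin

sublocale res: resolved R Om N w m b A by unfold_locales (rule resOm)+

text \<open>The columns of \<open>A 0\<close> generate the relations \<open>lck\<close>, so a vector
  of values on the generators defines a map from Omega to X / I as soon as it kills them. It serves
  for I = \<open>evk R\<close> and for I = \<open>m\<close>.\<close>

lemma dual_iff:
 assumes I: "idl I" "evk R <= I"
 shows "mv N (tr (A 0)) mu : fr (b 1) I \<longleftrightarrow> (ALL v:lck. dot mu v : I)"
proof
 assume h: "mv N (tr (A 0)) mu : fr (b 1) I"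
 show "ALL v:lck. dot mu v : I"
 proof
  fix v assume "v : lck"
  then obtain u where u: "v - mv (b 1) (A 0) u : fr N (evk R)" using res.Z_iff[of v 0] resOm by auto
  have "dot mu (v - mv (b 1) (A 0) u) : I" using u I by (intro idl_sum[OF I(1)] idl_mult[OF I(1)]) (auto simp: fr_def)
  moreover have "dot mu (mv (b 1) (A 0) u) : I"
  proof -
   have "dot mu (mv (b 1) (A 0) u) = (SUM k:b 1. u k * mv N (tr (A 0)) mu k)" by (rule dot_mv)
   also have "... : I" using h by (intro idl_sum[OF I(1)] idl_mult[OF I(1)]) (auto simp: fr_def)
   finally show ?thesis .
  qed
  ultimately show "dot mu v : I" using idl_cong[OF I(1), of "dot mu v" "dot mu (mv (b 1) (A 0) u)"] by (simp add: algebra_simps sum_subtractf)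
 qed
next
 assume h: "ALL v:lck. dot mu v : I"
 show "mv N (tr (A 0)) mu : fr (b 1) I" unfolding fr_def mem_Collect_eq
 proof
  fix k assume k: "k : b 1" have "dot mu (mv (b 1) (A 0) (un k)) : I" using res.F_Z[of 0 "un k"] h by simp
  moreover have "dot mu (mv (b 1) (A 0) (un k)) = mv N (tr (A 0)) mu k" unfolding mv_un[OF res.finb k] by (simp add: mv_def tr_def mult.commute)
  ultimately show "mv N (tr (A 0)) mu k : I" by simp
 qed
qed

text \<open>Representatives of Hom(Omega, R), the kernel of the dual of the first map of the
  resolution.\<close>

definition dual :: "(nat => 'r uni) set" where "dual = {mu. mv N (tr (A 0)) mu : fr (b 1) (evk R)}"

lemma dual_eq: "mu : dual \<longleftrightarrow> (ALL v:lck. dot mu v : evk R)" using dual_iff[OF idJ order_refl] by (simp add: dual_def)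

lemma submod_dual: "submod dual" using submod_vimage[OF lin_mv submod_fr[OF idJ]] by (simp add: dual_def vimage_def)

lemma fr_dual: "fr N (evk R) <= dual" unfolding dual_def using lmap_fr[OF lmap_mv[OF finN res.finb[of 1]] idJ order_refl] by blast

definition vd :: "'r => nat => 'r uni" where "vd a = (SOME v. d a = lc v)"

lemma vd: "a : carrier R ==> lc (vd a) = d a" unfolding vd_def using someI_ex[OF surj[OF d_closed[of a]]] by simp

text \<open>The derivation that a map from Omega to R induces by composition with d; the next lemmas
  identify Der with \<open>dual\<close> modulo \<open>fr N (evk R)\<close>.\<close>

definition dr :: "(nat => 'r uni) => 'r => 'r" where "dr mu = (\<lambda>a\<in>carrier R. ev R (dot mu (vd a)))"

lemma dr_eq:
 assumes "mu : dual" "a : carrier R" "lc v = d a" shows "dr mu a = ev R (dot mu v)"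
proof -
 have "vd a - v : lck" unfolding lck_diff_iff using vd assms by simp
 thus ?thesis using assms(1) dual_eq assms(2) by (auto simp: algebra_simps sum_subtractf dr_def evk_diff_iff)
qed

lemma dr_deriv: assumes mu: "mu : dual" shows "dr mu : carrier (Der K ph R)"
proof -
 have "dr mu : derivations K ph R (self_module R)" unfolding derivations_def
 proof (intro CollectI conjI ballI)
  show "dr mu : carrier R \<rightarrow>\<^sub>E carrier (self_module R)" by (auto simp: dr_def)
  show "dr mu (ph c) = 0{self_module R}" if c: "c : carrier K" for c using dr_eq[OF mu ph[OF c], of 0] d_const[OF c] by simp
  fix x y assume xy: "x : carrier R" "y : carrier R"
  have "lc (vd x + vd y) = d (x \<oplus> y)" using xy by (simp only: lc_add vd d_add)
  from dr_eq[OF mu _ this] show "dr mu (x \<oplus> y) = dr mu x +{self_module R} dr mu y"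
   using xy by (simp add: dr_def algebra_simps sum.distrib)
  obtain p where p: "x = ev R p" using ev_surj xy by blast
  obtain q where q: "y = ev R q" using ev_surj xy by blast
  have "lc (sm p (vd y) + sm q (vd x)) = d (x \<otimes> y)" by (simp only: lc_add lc_sm vd d_mult p q ev_closed)
  moreover have "dot mu (sm p (vd y) + sm q (vd x)) = p * dot mu (vd y) + q * dot mu (vd x)"
   by (simp add: sm_def algebra_simps sum.distrib sum_distrib_left)
  ultimately show "dr mu (x \<otimes> y) = (x **{self_module R} dr mu y) +{self_module R} (y **{self_module R} dr mu x)" using dr_eq[OF mu] by (simp add: dr_def p q)
 qed
 thus ?thesis by (simp add: Der_def)
qed

lemma dr_add: "dr (mu + nu) = dr mu +{Der K ph R} dr nu" by (auto simp: dr_def Der_def algebra_simps sum.distrib)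

lemma dr_sm: "dr (sm c mu) = ev R c **{Der K ph R} dr mu"
proof -
 have "dot (sm c mu) v = c * dot mu v" for v by (simp add: sm_def sum_distrib_left mult.assoc)
 thus ?thesis by (auto simp: dr_def Der_def)
qed

lemma dr_zero: "0{Der K ph R} = dr 0" by (auto simp: dr_def Der_def)

lemma dr_eq_zero_iff: assumes mu: "mu : dual" shows "dr mu = 0{Der K ph R} \<longleftrightarrow> mu : fr N (evk R)"
proof
 assume z: "dr mu = 0{Der K ph R}"
 show "mu : fr N (evk R)"
 proof (rule coordinates_unique)
  show "ALL v:lck. dot mu v : evk R" using mu dual_eq by blast
  show "ALL a v. lc v = d (ev R a) --> dot mu v : evk R"
  proof (intro allI impI)
   fix a v assume "lc v = d (ev R a)"
   thus "dot mu v : evk R" using fun_cong[OF z, of "ev R a"] by (auto simp: dr_eq mu Der_def evk_def)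
  qed
 qed
next
 assume mu': "mu : fr N (evk R)"
 have "dot mu v : evk R" for v using mu' by (intro idl_sum[OF idJ] idl_mult2[OF idJ]) (auto simp: fr_def)
 thus "dr mu = 0{Der K ph R}" by (auto simp: dr_def Der_def evk_def)
qed

lemma dr_surj: assumes D: "D : carrier (Der K ph R)" shows "EX mu:dual. D = dr mu"
proof -
 have D: "D : derivations K ph R (self_module R)" using D by (simp add: Der_def)
 define E where "E a = lft R (D (ev R a))" for a
 have Dc: "D (ev R a) : carrier R" for a using D by (auto simp: derivations_def)
 have evE: "ev R (E a) = D (ev R a)" for a using Dc by (simp add: E_def)
 have Dadd: "D (ev R a \<oplus> ev R c) = D (ev R a) \<oplus> D (ev R c)"
  and Dmult: "D (ev R a \<otimes> ev R c) = (ev R a \<otimes> D (ev R c)) \<oplus> (ev R c \<otimes> D (ev R a))" for a c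
  using D by (simp_all add: derivations_def)
 have E: "deriv_mod (evk R) E" unfolding deriv_mod_def by (simp add: evk_diff_iff evE Dadd Dmult)
 obtain mu where mu: "ALL v:lck. dot mu v : evk R" "ALL a v. lc v = d (ev R a) --> E a - dot mu v : evk R"
 proof -
  have "EX mu. (ALL v:lck. dot mu v : evk R) & (ALL a v. lc v = d (ev R a) --> E a - dot mu v : evk R)"
  proof (rule deriv_coordinates[OF idJ order_refl E])
   show "E a - E c : evk R" if "a - c : evk R" for a c using that unfolding evk_diff_iff evE by simp
   show "E a : evk R" if "ev R a : ph ` carrier K" for a
   proof -
    obtain c where "c : carrier K" "ev R a = ph c" using \<open>ev R a : ph ` carrier K\<close> by blast
    thus ?thesis using D evE[of a] by (simp add: derivations_def evk_def)
   qed
  qed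
  thus thesis using that by blast
 qed
 have mud: "mu : dual" using mu(1) dual_eq by blast
 have "D = dr mu"
 proof
  fix a show "D a = dr mu a"
  proof (cases "a : carrier R")
   case True
   obtain x where x: "a = ev R x" using ev_surj True by blast
   show ?thesis using mu(2) vd[OF True] x unfolding evk_diff_iff evE by (simp add: dr_def)
  next
   case False
   thus ?thesis using D by (auto simp: dr_def derivations_def)
  qed
 qed
 thus ?thesis using mud by blast
qed

lemma genmods_Der:
 assumes mod: "module R (Der K ph R)" and C: "finite C" and cov: "range (mv C gq) + fr N (evk R) = dual"
 shows "genmods R (Der K ph R) C (%j. dr (%i. gq i j))"
  and "genmod.lck R (Der K ph R) C (%j. dr (%i. gq i j)) = {c. mv C gq c : fr N (evk R)}"
proof -
 interpret D: module R "Der K ph R" by (rule mod)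
 have col: "(%i. gq i j) : dual" if "j : C" for j
  unfolding cov[symmetric] mem_range_plus using mv_un[OF C that, of gq] submod_0[OF submod_fr[OF idJ], of N]
  by (intro exI[of _ "un j"]) (simp add: fr_def)
 interpret G: genmod R "Der K ph R" C "%j. dr (%i. gq i j)" by unfold_locales (use C col dr_deriv in auto)
 have mvd: "mv C gq c : dual" for c unfolding cov[symmetric] mem_range_plus using submod_0[OF submod_fr[OF idJ], of N] by (intro exI[of _ c]) simp
 have lc: "G.lc c = dr (mv C gq c)" for c
 proof -
  have "finite B ==> B <= C ==> (\<Oplus>\<^bsub>Der K ph R\<^esub>j\<in>B. ev R (c j) **{Der K ph R} dr (%i. gq i j)) = dr (SUM j:B. sm (c j) (%i. gq i j))" for B
  proof (induction B rule: finite_induct)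
   case empty
   thus ?case by (simp only: D.finsum_empty dr_zero sum.empty)
  next
   case (insert k B)
   have "(\<Oplus>\<^bsub>Der K ph R\<^esub>j\<in>insert k B. ev R (c j) **{Der K ph R} dr (%i. gq i j)) =
    ev R (c k) **{Der K ph R} dr (%i. gq i k) +{Der K ph R} (\<Oplus>\<^bsub>Der K ph R\<^esub>j\<in>B. ev R (c j) **{Der K ph R} dr (%i. gq i j))"
    using insert.hyps insert.prems col dr_deriv by (intro D.finsum_insert) auto
   also have "... = dr (sm (c k) (%i. gq i k) + (SUM j:B. sm (c j) (%i. gq i j)))" unfolding dr_add dr_sm using insert by simp
   finally show ?case unfolding sum.insert[OF insert.hyps] .
  qed
  moreover have "mv C gq c = (SUM j:C. sm (c j) (%i. gq i j))" by (auto simp: mv_def sum_fun sm_def mult.commute)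
  ultimately show ?thesis unfolding G.lc_def using C by simp
 qed
 show "genmods R (Der K ph R) C (%j. dr (%i. gq i j))"
 proof
  fix D assume "D : carrier (Der K ph R)"
  then obtain mu where mu: "mu : dual" "D = dr mu" using dr_surj by blast
  obtain c where c: "mu - mv C gq c : fr N (evk R)" using mu(1) unfolding cov[symmetric] mem_range_plus by blast
  have "dr mu = dr ((mu - mv C gq c) + mv C gq c)" by simp
  also have "... = G.lc c" unfolding dr_add lc using c fr_dual dr_eq_zero_iff[of "mu - mv C gq c"] dr_deriv[OF mvd[of c]] by auto
  finally show "EX c. D = G.lc c" using mu(2) by blast
 qed
 show "G.lck = {c. mv C gq c : fr N (evk R)}" unfolding G.lck_def lc using dr_eq_zero_iff[OF mvd] by simp
qed

text \<open>E corresponds to a map from Omega to the residue field. By \<open>ex\<close> that map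
  agrees modulo m with one to R, and the latter gives D.\<close>

lemma lift_derivation:
 assumes cov: "range (mv C gq) + fr N (evk R) = dual"
  and ex: "!!mu. mv N (tr (A 0)) mu : fr (b 1) m ==> mu : range (mv C gq) + fr N m"
  and E: "deriv_mod m E" and EJ: "!!x y. x - y : evk R ==> E x - E y : m"
  and EK: "!!x. ev R x : ph ` carrier K ==> E x : m"
 shows "EX D. deriv_mod (evk R) D & (ALL x:evk R. D x : evk R) & (ALL x. E x - D x : m)"
proof -
 obtain mu where mu: "ALL v:lck. dot mu v : m" "ALL a v. lc v = d (ev R a) --> E a - dot mu v : m"
  using deriv_coordinates[OF idm Jm E EJ EK] by blast
  obtain c where c: "mu - mv C gq c : fr N m" using dual_iff[OF idm Jm] mu(1) ex unfolding mem_range_plus by blast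
 define nu where "nu = mv C gq c"
 have nu: "nu : dual" unfolding nu_def cov[symmetric] mem_range_plus using submod_0[OF submod_fr[OF idJ], of N] by (intro exI[of _ c]) simp
 define D where "D x = dot nu (vd (ev R x))" for x
 have evD: "ev R (D x) = dr nu (ev R x)" for x by (simp add: D_def dr_def)
 have der: "dr nu : derivations K ph R (self_module R)" using dr_deriv[OF nu] by (simp add: Der_def)
 have "deriv_mod (evk R) D" unfolding deriv_mod_def evk_diff_iff ev_add ev_mult evD using der by (simp add: derivations_def)
 moreover have "D x : evk R" if "x : evk R" for x
 proof -
  have "lc 0 = d (ev R x)" using d_add d_closed that by (force simp: evk_def)
  hence "dr nu (ev R x) = ev R (dot nu 0)" by (rule dr_eq[OF nu ev_closed])
  thus ?thesis using evD[of x] by (simp add: evk_def)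
 qed
 moreover have "E x - D x : m" for x
 proof -
  have 1: "E x - dot mu (vd (ev R x)) : m" using mu(2) vd by blast
  have "dot (mu - nu) (vd (ev R x)) : m" using c unfolding nu_def[symmetric] by (intro idl_sum[OF idm] idl_mult2[OF idm]) (auto simp: fr_def)
  hence 2: "dot mu (vd (ev R x)) - D x : m" by (simp add: D_def algebra_simps sum_subtractf)
  show ?thesis by (rule idl_trans[OF idm 1 2])
 qed
 ultimately show ?thesis by blast
qed

end


section \<open>Depth of syzygies at a prime\<close>

context localiz begin

lemma loc_cyc:
 assumes res: "free_res J U b A"
 shows "loc (b i) (cyc J U b A i) = range (mv (b (Suc i)) (ml (A i))) + fr (b i) J'"
  and "loc (b (Suc i)) (cyc J U b A (Suc i)) = mv (b (Suc i)) (ml (A i)) -` fr (b i) J'"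
proof -
 have fin: "finite (b k)" and im: "range (mv (b (Suc k)) (A k)) + fr (b k) J = cyc J U b A k" for k using res by (auto simp: free_res_def)
 have eq: "loc (b k) (cyc J U b A k) = range (mv (b (Suc k)) (ml (A k))) + fr (b k) J'" for k unfolding im[symmetric] by (rule loc_range[OF fin fin])
 show "loc (b i) (cyc J U b A i) = range (mv (b (Suc i)) (ml (A i))) + fr (b i) J'" by (rule eq)
 let ?f = "mv (b (Suc i)) (ml (A i))"
 have ex: "L.exact_mod J' (b i) ?f (b (Suc i)) (mv (b (Suc (Suc i))) (ml (A (Suc i))))"
  by (rule exact_loc[OF fin fin fin]) (use im[of "Suc i"] in auto)
 show "loc (b (Suc i)) (cyc J U b A (Suc i)) = ?f -` fr (b i) J'"
 proof
  show "?f -` fr (b i) J' <= loc (b (Suc i)) (cyc J U b A (Suc i))" using ex unfolding L.exact_mod_def eq[of "Suc i"] by auto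
  show "loc (b (Suc i)) (cyc J U b A (Suc i)) <= ?f -` fr (b i) J'"
  proof
   fix z assume "z : loc (b (Suc i)) (cyc J U b A (Suc i))"
   then obtain v s where v: "mv (b (Suc i)) (A i) v : fr (b i) J" "s ~: P" "sm (io s) z - vl v : fr (b (Suc i)) J'" unfolding loc_def by auto
   have 1: "?f (sm (io s) z - vl v) : fr (b i) J'" by (rule L.lmap_fr[OF L.lmap_mv[OF fin fin] L.idJ order_refl v(3)])
   have 2: "?f (vl v) : fr (b i) J'" using submod_cong[OF sJ' vl_mv[of "b (Suc i)" "A i" v "b i"]] vl_J[OF v(1)] by blast
   have "sm (io s) (?f z) = ?f (sm (io s) z - vl v) + ?f (vl v)" by (simp add: lin_diff[OF lin_mv] lin_sm[OF lin_mv])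
   also have "... : fr (b i) J'" by (rule submod_add[OF sJ' 1 2])
   finally show "z : ?f -` fr (b i) J'" using L.unit_cancel[OF L.good_fr[OF fin L.idJ order_refl] io_unit[OF v(2)]] by auto
  qed
 qed
qed

text \<open>Each syzygy gains one in depth by \<open>depth_syzygy\<close>, until the bound e coming
  from the free modules is reached.\<close>

lemma dep_loc_cyc:
 assumes res: "free_res J U b A" and U: "submod U"
  and r: "dep m' (min r e) (loc (b 0) U)" and e: "dep m' e (fr {0} J')"
 shows "dep m' (min (r + i) e) (loc (b i) (cyc J U b A i))"
proof (induction i)
 case 0
 thus ?case using r by simp
next
 case (Suc i)
 have fin: "finite (b k)" for k using res by (simp add: free_res_def)
 let ?f = "mv (b (Suc i)) (ml (A i))"
 have sc: "submod (cyc J U b A (Suc i))" using submod_vimage[OF lin_mv submod_fr[OF idJ]] by (simp add: vimage_def)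
 show ?case
 proof (cases "min (r + Suc i) e")
  case (Suc q)
  have "dep m' (Suc q) (?f -` fr (b i) J')"
  proof (rule L.depth_syzygy[OF lin_mv])
   show "L.good (fr (b i) J')" by (rule L.good_fr[OF fin L.idJ order_refl])
   show "L.good (?f -` fr (b i) J')" unfolding loc_cyc(2)[OF res, symmetric] by (rule good_loc[OF fin sc])
   show "dep m' q (range ?f + fr (b i) J')" unfolding loc_cyc(1)[OF res, symmetric] by (rule dep_mono[OF Suc.IH]) (use Suc in auto)
   show "dep m' (Suc q) (fr (b i) J')" by (rule dep_fr[OF fin dep_mono[OF e]]) (use Suc in auto)
  qed
  thus ?thesis unfolding Suc loc_cyc(2)[OF res] .
 qed simp
qed

end

section \<open>Splitting of the dual complex\<close>

context loc_diffs begin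

theorem residue_exact:
 assumes t: "dep m t (fr {0} (evk R))" "~dep m (Suc t) (fr {0} (evk R))"
  and pd: "proj_dim R (Der K ph R) < \<infinity>"
  and ext: "!!i. 1 <= i ==> i <= n ==> trivial_group (Ext i R Om (self_module R))"
  and local: "!!P. prime_idl P ==> evk R <= P ==> EX (J' :: ('r \<times> 'r) set uni set) m' io. localiz (evk R) J' m' P io &
    (ALL e<=t. dep m' e (fr {0} J') --> dep m' e (localiz.loc J' P io (b n) (res.Z n)))" shows "EX C gq. range (mv C gq) + fr N (evk R) = dual &
  (ALL mu. mv N (tr (A 0)) mu : fr (b 1) m --> mu : range (mv C gq) + fr N m)"
proof -
 obtain C gq where C: "finite (C::nat set)" and cov: "range (mv C gq) + fr N (evk R) = dual"
  and Cmin: "ALL c. mv C gq c : fr N (evk R) --> c : fr C m" using minimal_cover[OF finN submod_dual fr_dual] by blast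
 \<comment> \<open>Finite projective dimension provides a resolution, and with it the fact that Der
   is a module: the infimum of the empty set is infinity.\<close>
 have modDer: "module R (Der K ph R)" using ccontr pd by (force simp: proj_dim_def top_enat_def projective_resolution_def)
 define W where "W = genmod.lck R (Der K ph R) C (%j. dr (%i. gq i j))"
 have W: "W = {c. mv C gq c : fr N (evk R)}" unfolding W_def by (rule genmods_Der(2)[OF modDer C cov])
 interpret D: genmods R "Der K ph R" C "%j. dr (%i. gq i j)" by (rule genmods_Der(1)[OF modDer C cov])
 obtain g B where g0: "g 0 = C" and gres: "free_res (evk R) W g B" and gmin: "ALL i. cyc (evk R) W g B (Suc i) <= fr (g (Suc i)) m"
  using minimal_resolution[OF C D.submod_lck D.fr_lck] unfolding W_def by blast
 interpret Dr: resolved R "Der K ph R" C "%j. dr (%i. gq i j)" m g B by unfold_locales (use g0 gres in \<open>simp_all add: W_def\<close>)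
 obtain q where q: "!!i. q <= i ==> g i = {}" using Dr.minimal_finite[OF pd] gmin unfolding W_def by blast
 \<comment> \<open>Places 0 to n + 1 hold the duals of F_(n+1), ..., F_0, and the places from n + 2
   on hold G_0, G_1, and so on. The splice is \<open>gq\<close>, with index n + 1, which maps G_0
   onto Hom(Omega, R) inside the dual of F_0.\<close>
 define l where "l j = (if j <= Suc n then b (Suc n - j) else g (j - (n + 2)))" for j
 define T where "T j = (if j <= n then tr (A (n - j)) else if j = Suc n then gq else B (j - (n + 2)))" for j
 have l1: "l j = b (Suc (n - j))" if "j <= n" for j using that by (simp add: l_def Suc_diff_le)
 have l2: "l (Suc j) = b (n - j)" if "j <= n" for j using that by (simp add: l_def)
 have l3: "l (n + 2 + i) = g i" for i by (simp add: l_def)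
 have l3': "l (Suc (Suc n)) = C" "l (Suc (Suc (Suc (n + i)))) = g (Suc i)" for i using l3[of 0] l3[of "Suc i"] g0 by simp_all
 have T1: "T j = tr (A (n - j))" if "j <= n" for j using that by (simp add: T_def)
 have T2: "T (Suc n) = gq" "T (n + 2 + i) = B i" "T (Suc (Suc (n + i))) = B i" for i by (simp_all add: T_def)
 have cases4: "j < n | j = n | j = Suc n | (EX i. j = Suc (Suc (n + i)))" for j by (metis Suc_lessI less_imp_Suc_add linorder_neqE_nat)
 have dd: "mv (b k) (tr (A k)) (mv (b (k - 1)) (tr (A (k - 1))) v) : fr (b (Suc k)) (evk R)" if k: "k > 0" for k v unfolding fr_def mem_Collect_eq
 proof
  fix p assume p: "p : b (Suc k)"
  obtain k' where k': "k = Suc k'" using k by (cases k) auto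
  define x where "x = res.F k (un p)" have xJ: "(SUM a:b k'. v a * res.F k' x a) : evk R" using res.F_Z[of k "un p"] by (auto simp: k' x_def idl_sum idJ idl_mult fr_def)
  have "mv (b k) (tr (A k)) (mv (b k') (tr (A k')) v) p = (SUM a:b k. x a * mv (b k') (tr (A k')) v a)"
   unfolding x_def mv_un[OF res.finb p] by (simp add: mv_def tr_def)
  also have "... = (SUM a:b k'. v a * mv (b k) (tr (tr (A k'))) x a)" by (rule dot_mv)
  also have "... : evk R" using xJ by (simp add: tr_def k')
  finally show "mv (b k) (tr (A k)) (mv (b (k - 1)) (tr (A (k - 1))) v) p : evk R" by (simp add: k')
 qed
 define s where "s = Suc (n + q)"
 have "exact_mod m (l n) (mv (l (Suc n)) (T n)) (l (Suc n)) (mv (l (Suc (Suc n))) (T (Suc n)))"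
 proof (rule split_of_local_depth[OF t, where s = s and l = l and M = T and j = n])
  show "finite (l j)" for j using res.finb Dr.finb by (simp add: l_def)
  show "mv (l (Suc j)) (T j) (mv (l (Suc (Suc j))) (T (Suc j)) v) : fr (l j) (evk R)" for j v
  proof -
   consider "j < n" | "j = n" | "j = Suc n" | i where "j = Suc (Suc (n + i))" using cases4[of j] by blast
   thus ?thesis
   proof cases
    case 1
    thus ?thesis using dd[of "n - j" v] Suc_diff_Suc[of j n] by (simp add: l1 l2 T1)
   next
    case 2
    have "mv C gq v : dual" unfolding cov[symmetric] mem_range_plus using submod_0[OF submod_fr[OF idJ], of N] by (intro exI[of _ v]) simp
    thus ?thesis using 2 by (simp add: l1 l2 l3' T1 T2 dual_def resOm(1))
   next
    case 3
    have "mv (g (Suc 0)) (B 0) v : W" using Dr.F_Z[of 0 v] by (simp add: W_def)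
    thus ?thesis using 3 l3'(2)[of 0] by (simp add: l2 l3' T2 T2(3)[of 0, simplified] W resOm(1))
   next
    case 4
    have "mv (g (Suc (Suc i))) (B (Suc i)) v : Dr.Z (Suc i)" by (rule Dr.F_Z)
    thus ?thesis using 4 l3(1)[of i] l3'(2)[of i] l3'(2)[of "Suc i"] T2(3)[of i] T2(3)[of "Suc i"] by simp
   qed
  qed
  show "l (Suc s) = {}" using q[of q] l3[of q] by (simp add: s_def)
  show "exact_mod (evk R) (l j) (mv (l (Suc j)) (T j)) (l (Suc j)) (mv (l (Suc (Suc j))) (T (Suc j)))" for j unfolding exact_mod_def
  proof (intro allI impI)
   fix v assume v: "mv (l (Suc j)) (T j) v : fr (l j) (evk R)"
   consider "j < n" | "j = n" | "j = Suc n" | i where "j = Suc (Suc (n + i))" using cases4[of j] by blast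
   thus "v : range (mv (l (Suc (Suc j))) (T (Suc j))) + fr (l (Suc j)) (evk R)"
   proof cases
    case 1
    then obtain k where k: "n - j = Suc k" by (metis Suc_diff_Suc)
    have k': "n - Suc j = k" using k by simp
    show ?thesis using res.exact_of_Ext[of k v] v k k' by (auto simp: ext l1 l2 T1)
   next
    case 2
    hence "v : dual" using v by (simp add: l1 l2 T1 dual_def resOm(1))
    thus ?thesis unfolding cov[symmetric] using 2 by (simp add: l2 l3' T2 resOm(1))
   next
    case 3
    hence "v : W" using v by (simp add: l2 l3' T2 W resOm(1))
    thus ?thesis using Dr.im[of 0] 3 l3'(2)[of 0] T2(3)[of 0] by (auto simp: W_def l3' g0)
   next
    case 4
    thus ?thesis using v l3(1)[of i] T2(3)[of i] Dr.im[of "Suc i"] l3'(2)[of i] l3'(2)[of "Suc i"] T2(3)[of "Suc i"] by simp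
   qed
  qed
  show "n < s" by (simp add: s_def)
  fix P :: "'r uni set" assume P: "prime_idl P" "evk R <= P"
  \<comment> \<open>Dualized once more, the lowest map is the one from F_(n+1) to F_n; its cokernel
    is the n-th syzygy of Omega.\<close>
  have "range (mv (l 0) (tr (T 0))) + fr (l 1) (evk R) = res.Z n" using res.im[of n] l1[of 0] l2[of 0] T1[of 0] by (simp add: tr_def)
  moreover have "l 1 = b n" using l2[of 0] by simp
  ultimately show "EX (J' :: ('r \<times> 'r) set uni set) m' io. localiz (evk R) J' m' P io &
    (ALL e<=t. dep m' e (fr {0} J') --> dep m' e (localiz.loc J' P io (l 1) (range (mv (l 0) (tr (T 0))) + fr (l 1) (evk R))))"
   using local[OF P] by simp
 qed
 thus ?thesis using cov by (auto simp: exact_mod_def l1 l2 l3' T1 T2 resOm)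
qed

end

section \<open>Regularity\<close>

lemma (in uring) prime_chain_iff:
 "(EX Q. prime_chain (evk R) n Q) \<longleftrightarrow> (EX P :: nat => 'r set. (ALL i<=n. primeideal (P i) R) & (ALL i<n. P i \<subset> P (Suc i)))"
proof
 assume "EX Q. prime_chain (evk R) n Q"
 then obtain Q where Q: "prime_chain (evk R) n Q" by blast
 have p: "prime_idl (Q i)" "evk R <= Q i" if "i <= n" for i using Q that by (auto simp: prime_chain_def)
 have mem: "ev R x : ev R ` Q i \<longleftrightarrow> x : Q i" if "i <= n" for i x
  by (rule ideal_image(2)[OF prime_idl_idl[OF p(1)[OF that]] p(2)[OF that]])
 have "ev R ` Q i \<subset> ev R ` Q (Suc i)" if i: "i < n" for i
 proof -
  have "Q i \<subset> Q (Suc i)" using Q i by (simp add: prime_chain_def)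
  then obtain x where x: "x : Q (Suc i)" "x ~: Q i" "Q i <= Q (Suc i)" by blast
  thus ?thesis using mem[of i x] i by auto
 qed
 thus "EX P :: nat => 'r set. (ALL i<=n. primeideal (P i) R) & (ALL i<n. P i \<subset> P (Suc i))"
  using primeideal_image[OF p] by (intro exI[of _ "%i. ev R ` Q i"]) blast
next
 assume "EX P :: nat => 'r set. (ALL i<=n. primeideal (P i) R) & (ALL i<n. P i \<subset> P (Suc i))"
 then obtain P :: "nat => 'r set" where P: "!!i. i <= n ==> primeideal (P i) R" "!!i. i < n ==> P i \<subset> P (Suc i)" by blast
 have "prime_chain (evk R) n (%i. {x. ev R x : P i})" unfolding prime_chain_def
 proof (intro conjI allI impI)
  fix i assume i: "i <= n"
  interpret Pi: primeideal "P i" R by (rule P(1)[OF i])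
  show "prime_idl {x. ev R x : P i}" by (rule prime_idl_vimage[OF P(1)[OF i]])
  show "evk R <= {x. ev R x : P i}" by (rule idl_vimage(2)[OF Pi.ideal_axioms])
 next
  fix i assume i: "i < n"
  interpret Pi: primeideal "P (Suc i)" R using P(1) i by simp
  obtain a where a: "a : P (Suc i)" "a ~: P i" "P i <= P (Suc i)" using P(2)[OF i] by blast
  obtain x where "a = ev R x" using ev_surj Pi.Icarr a(1) by blast
  thus "{x. ev R x : P i} \<subset> {x. ev R x : P (Suc i)}" using a by auto
 qed
 thus "EX Q. prime_chain (evk R) n Q" by blast
qed

context loc_diffs begin

theorem regular:
 assumes L: "local_with R mq" "m = {x. ev R x : mq}"
  and char: "!!n. n > 0 ==> of_nat n ~: m"
  and B0: "subrng {x. ev R x : ph ` carrier K}" "{x. ev R x : ph ` carrier K} \<inter> m <= evk R"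
  and cov: "range (mv C gq) + fr N (evk R) = dual"
  and ex: "!!mu. mv N (tr (A 0)) mu : fr (b 1) m ==> mu : range (mv C gq) + fr N m"
 shows "regular_local_ring R"
proof -
 have sub: "submod (fr {0} m)" "fr {0} (evk R) <= fr {0} m" by (rule submod_fr[OF idm]) (use Jm in \<open>auto simp: fr_def\<close>)
 obtain G y' where G: "finite (G::nat set)" and y': "range (mv G y') + fr {0} (evk R) = fr {0} m"
  "ALL c. mv G y' c : fr {0} (evk R) --> c : fr G m" using minimal_cover[OF _ sub] by blast
 define y where "y j = y' 0 j" for j
 have mv0: "mv G y' c 0 = (SUM j:G. c j * y j)" for c by (simp add: mv_def y_def mult.commute)
 have ym: "y j : m" if j: "j : G" for j
 proof -
  have "mv G y' (un j) : fr {0} m" unfolding y'(1)[symmetric] mem_range_plus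
   using submod_0[OF submod_fr[OF idJ], of "{0}"] by (intro exI[of _ "un j"]) simp
  thus ?thesis unfolding mv_un[OF G j] by (simp add: fr_def y_def)
 qed
 have gen: "EX c. a - (SUM j:G. c j * y j) : evk R" if "a : m" for a
 proof -
  have "(%_. a) : range (mv G y') + fr {0} (evk R)" unfolding y'(1) using that by (simp add: fr_def)
  then obtain c where "(%_. a) - mv G y' c : fr {0} (evk R)" unfolding mem_range_plus by blast
  hence "a - mv G y' c 0 : evk R" by (simp add: fr_def)
  thus ?thesis unfolding mv0 by blast
 qed
 have min: "c j : m" if "(SUM j:G. c j * y j) : evk R" "j : G" for c j using y'(2)[rule_format, of c] that by (simp add: fr_def mv0)
 obtain dl where dl: "!!i. i : G ==> deriv_mod m (dl i)" "!!i x. i : G ==> ev R x : ph ` carrier K ==> dl i x : m"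
  "!!i x z. i : G ==> x - z : evk R ==> dl i x - dl i z : m"
  "!!i j. i : G ==> j : G ==> dl i (y j) - (if i = j then 1 else 0) : m"
 proof -
  have "EX dl::nat => 'r uni => 'r uni. ALL i:G. deriv_mod m (dl i) & (ALL x:{x. ev R x : ph ` carrier K}. dl i x : m) &
   (ALL x z. x - z : evk R --> dl i x - dl i z : m) & (ALL j:G. dl i (y j) - (if i = j then 1 else 0) : m)"
   by (rule dual_derivations[OF char B0 G]) (use ym gen min in blast)+
  thus thesis using that by blast
 qed
 have "EX D. deriv_mod (evk R) D & (ALL x:evk R. D x : evk R) & (ALL x. dl i x - D x : m)" if i: "i : G" for i
  by (rule lift_derivation[OF cov ex dl(1,3,2)]) (use i in auto)
 then obtain D where D: "!!i. i : G ==> deriv_mod (evk R) (D i)" "!!i x. i : G ==> x : evk R ==> D i x : evk R"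
  "!!i x. i : G ==> dl i x - D i x : m" by metis
 have "D i (y j) - (if i = j then 1 else 0) : m" if "i : G" "j : G" for i j
  by (rule idl_trans[OF idm idl_minus_commute[OF idm D(3)[OF that(1)]] dl(4)[OF that]])
 hence "dep m (card G) (fr {0} (evk R))" by (intro depth_of_derivations[OF char G idJ order_refl Jm D(1,2) ym])
 hence chain: "EX Q. prime_chain (evk R) (card G) Q" by (rule dep_prime_chain)
 have bound: "n <= card G" if "prime_chain (evk R) n Q" for n Q by (rule chain_bound[OF G ym gen that])
 have dim: "krull_dim R = enat (card G)" unfolding krull_dim_def prime_chain_iff[symmetric]
 proof (rule antisym)
  show "Sup {enat n |n. EX Q. prime_chain (evk R) n Q} <= enat (card G)" using bound by (intro Sup_least) auto
  show "enat (card G) <= Sup {enat n |n. EX Q. prime_chain (evk R) n Q}" using chain by (intro Sup_upper) blast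
 qed
 have inj: "inj_on (%j. ev R (y j)) G"
 proof (rule inj_onI, rule ccontr)
  fix i j assume ij: "i : G" "j : G" "ev R (y i) = ev R (y j)" "i ~= j"
  \<comment> \<open>Equal generators would give the relation y_i - y_j = 0 with a unit coefficient.
    Distinctness matters because regularity counts the elements of a generating set.\<close>
  define c where "c k = (if k = i then 1 else if k = j then - 1 else 0 :: 'r uni)" for k
  have "(SUM k:G. c k * y k) = c i * y i + (c j * y j + (SUM k:G - {i} - {j}. c k * y k))"
   using sum.remove[OF G ij(1), of "%k. c k * y k"] sum.remove[of "G - {i}" j "%k. c k * y k"] ij G by simp
  also have "(SUM k:G - {i} - {j}. c k * y k) = 0" by (rule sum.neutral) (simp add: c_def)
  finally have "(SUM k:G. c k * y k) = y i - y j" using ij(4) by (simp add: c_def)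
  thus False using ij(3) min ij(1) one_m by (metis evk_diff_iff c_def)
 qed
 have "Idl ((%j. ev R (y j)) ` G) = ev R ` m" by (rule image_genideal[OF idm Jm ym gen])
 also have "ev R ` m = mq"
 proof -
  interpret M: ideal mq R using L(1) by (simp add: local_with_def)
  show ?thesis unfolding L(2) using M.Icarr ev_surj by blast
 qed
 also have "mq = max_ideal R" by (rule local_with_max_ideal[OF L(1), symmetric])
 finally have gen_max: "Idl ((%j. ev R (y j)) ` G) = max_ideal R" .
 have "card ((%j. ev R (y j)) ` G) = card G" by (rule card_image[OF inj])
 hence "EX A. finite A & A <= carrier R & Idl A = max_ideal R & enat (card A) = krull_dim R"
  using G gen_max dim by (intro exI[of _ "(%j. ev R (y j)) ` G"]) auto
 thus ?thesis unfolding regular_local_ring_def using noetherian_ring_of_noeth[OF noeth_axioms] local_with_local[OF L(1)] by blast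
qed

end


section \<open>Power series and polynomials over a field\<close>

definition conv :: "('x multiset => 'a::comm_ring_1) => ('x multiset => 'a) => 'x multiset => 'a" where
 "conv F G = (%mu. SUM nu:{nu. nu <=# mu}. F nu * G (mu - nu))"

definition mon :: "'x multiset => 'a::comm_ring_1 => 'x multiset => 'a" where
 "mon kp a = (%mu. if mu = kp then a else 0)"

lemma finite_submsets [simp]: "finite {nu. nu <=# mu}"
proof (induction mu)
 case (add x mu)
 have "{nu. nu <=# add_mset x mu} <= {nu. nu <=# mu} \<union> add_mset x ` {nu. nu <=# mu}"
 proof
  fix nu assume "nu : {nu. nu <=# add_mset x mu}"
  hence s: "nu <=# add_mset x mu" by simp
  show "nu : {nu. nu <=# mu} \<union> add_mset x ` {nu. nu <=# mu}"
  proof (cases "x :# nu")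
   case True
   then obtain kp where kp: "nu = add_mset x kp" by (metis mset_add)
   hence "kp <=# mu" using s by simp
   thus ?thesis using kp by blast
  next
   case False
   have "nu <=# mu"
   proof (rule mset_subset_eqI)
    fix a show "count nu a <= count mu a" using mset_subset_eq_count[OF s, of a] False by (cases "a = x") (auto simp: not_in_iff)
   qed
   thus ?thesis by simp
  qed
 qed
 thus ?case using add finite_subset by fastforce
qed simp

text \<open>Summation over pairs turns commutativity and associativity into reindexing.\<close>

lemma conv_pairs: "conv F G mu = (SUM (nu, kp):{(nu, kp). nu + kp = mu}. F nu * G kp)"
 unfolding conv_def by (rule sum.reindex_bij_witness[of _ fst "%nu. (nu, mu - nu)"]) auto

lemma finite_pairs [simp]: "finite {(nu, kp). nu + kp = (mu :: 'x multiset)}"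
 by (rule finite_subset[of _ "(%nu. (nu, mu - nu)) ` {nu. nu <=# mu}"]) auto

lemma conv_commute: "conv F G = conv G F" unfolding conv_pairs fun_eq_iff
 by (intro allI sum.reindex_bij_witness[of _ "%(a, b). (b, a)" "%(a, b). (b, a)"]) (auto simp: add.commute mult.commute)

lemma conv_assoc: "conv (conv F G) H = conv F (conv G H)"
proof
 fix mu
 have "conv (conv F G) H mu = (SUM p:{(nu, kp). nu + kp = mu}. SUM q:{(al, be). al + be = fst p}. F (fst q) * G (snd q) * H (snd p))"
  unfolding conv_pairs by (auto simp: sum_distrib_right case_prod_unfold)
 also have "... = (SUM (p, q):Sigma {(nu, kp). nu + kp = mu} (%p. {(al, be). al + be = fst p}). F (fst q) * G (snd q) * H (snd p))"
  by (subst sum.Sigma) auto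
 also have "... = (SUM (p, q):Sigma {(nu, kp). nu + kp = mu} (%p. {(al, be). al + be = snd p}). F (fst p) * (G (fst q) * H (snd q)))"
  by (rule sum.reindex_bij_witness[of _ "%((a, _), (b, c)). ((a + b, c), (a, b))" "%((_, c), (a, b)). ((a, b + c), (b, c))"])
   (auto simp: add.assoc mult.assoc)
 also have "... = (SUM p:{(nu, kp). nu + kp = mu}. SUM q:{(al, be). al + be = snd p}. F (fst p) * (G (fst q) * H (snd q)))" by (subst sum.Sigma) auto
 also have "... = conv F (conv G H) mu" unfolding conv_pairs by (auto simp: sum_distrib_left case_prod_unfold)
 finally show "conv (conv F G) H mu = conv F (conv G H) mu" .
qed

lemma conv_add: "conv (F + F') G = conv F G + conv F' G" "conv F (G + G') = conv F G + conv F G'" by (auto simp: conv_def algebra_simps sum.distrib)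

lemma conv_mon: "conv (mon kp a) G mu = (if kp <=# mu then a * G (mu - kp) else 0)"
proof -
 have "conv (mon kp a) G mu = (SUM nu:{nu. nu <=# mu}. if nu = kp then a * G (mu - kp) else 0)"
  unfolding conv_def by (rule sum.cong) (auto simp: mon_def)
 thus ?thesis by simp
qed

text \<open>Induction on the number of variables. Forgetting the last exponent gives a finite
  \<open>E'\<close>; a monomial whose last exponent is at least the largest one in \<open>E'\<close>
  is covered by it, and each smaller exponent is treated separately.\<close>

lemma dickson:
 fixes E :: "nat multiset set"
 assumes "!!e. e : E ==> set_mset e <= {..<m}"
 shows "EX E0. finite E0 & E0 <= E & (ALL e:E. EX e0:E0. e0 <=# e)" using assms
proof (induction m arbitrary: E)
 case 0
 hence "E <= {{#}}" by auto
 thus ?case using finite_subset by (intro exI[of _ E]) auto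
next
 case (Suc m)
 define pj where "pj = filter_mset (%x. x ~= m)"
 have sub: "pj e <=# pj e' ==> count e m <= count e' m ==> e <=# e'" for e e' :: "nat multiset"
 proof (rule mset_subset_eqI)
  fix a assume h: "pj e <=# pj e'" "count e m <= count e' m"
  show "count e a <= count e' a" using mset_subset_eq_count[OF h(1), of a] h(2) by (cases "a = m") (auto simp: pj_def)
 qed
 have base: "EX E0. finite E0 & E0 <= F & (ALL e:F. EX e0:E0. pj e0 <=# pj e)" if F: "F <= E" for F
 proof -
  have "set_mset e <= {..<m}" if "e : pj ` F" for e using that F Suc.prems unfolding pj_def by fastforce
  then obtain G where G: "finite G" "G <= pj ` F" "ALL e:pj ` F. EX e0:G. e0 <=# e" by (metis Suc.IH)
  obtain E0 where E0: "E0 <= F" "finite E0" "G = pj ` E0" using finite_subset_image[OF G(1,2)] by blast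
  thus ?thesis using G(3) by (intro exI[of _ E0]) auto
 qed
 obtain E' where E': "finite E'" "E' <= E" "ALL e:E. EX e0:E'. pj e0 <=# pj e" using base[of E] by blast
 define M where "M = Max (insert 0 ((%e. count e m) ` E'))"
 have "ALL i. EX E0. finite E0 & E0 <= {e : E. count e m = i} & (ALL e:{e : E. count e m = i}. EX e0:E0. pj e0 <=# pj e)" by (intro allI base) blast
 from choice[OF this] obtain S where
  "ALL i. finite (S i) & S i <= {e : E. count e m = i} & (ALL e:{e : E. count e m = i}. EX e0:S i. pj e0 <=# pj e)" ..
 hence S: "!!i. finite (S i)" "!!i. S i <= {e : E. count e m = i}"
  "!!i. ALL e:{e : E. count e m = i}. EX e0:S i. pj e0 <=# pj e" by simp_all
 show ?case
 proof (intro exI[of _ "E' \<union> (\<Union>i<M. S i)"] conjI ballI)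
  show "finite (E' \<union> (\<Union>i<M. S i))" using E'(1) S(1) by blast
  show "E' \<union> (\<Union>i<M. S i) <= E" using E'(2) S(2) by blast
  fix e assume e: "e : E"
  show "EX e0:E' \<union> (\<Union>i<M. S i). e0 <=# e"
  proof (cases "count e m < M")
   case True
   obtain e0 where e0: "e0 : S (count e m)" "pj e0 <=# pj e" using S(3) e by blast
   hence "count e0 m = count e m" using S(2) by blast
   thus ?thesis using sub[OF e0(2)] e0(1) True by auto
  next
   case False
   obtain e0 where e0: "e0 : E'" "pj e0 <=# pj e" using E'(3) e by blast
   have "count e0 m <= M" unfolding M_def using E'(1) e0(1) by (intro Max_ge) auto
   thus ?thesis using sub[OF e0(2)] e0(1) False by auto
  qed
 qed
qed

lemma sum_trichotomy:
 fixes k :: "'b => 'c::linorder"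
 assumes "finite S"
 shows "sum h S = sum h (S \<inter> {x. k x < a}) + sum h (S \<inter> {x. k x = a}) + sum h (S \<inter> {x. a < k x})"
proof -
 have "sum h S = (SUM x:S. (if k x < a then h x else 0) + (if k x = a then h x else 0) + (if a < k x then h x else 0))" by (rule sum.cong) auto
 thus ?thesis by (simp add: sum.distrib sum.inter_restrict[OF assms])
qed

locale coeff_field =
 fixes J :: "'a::comm_ring_1 set"
 assumes idJ: "idl J" and inverse: "!!a. a ~: J ==> EX b. a * b - 1 : J"
begin

text \<open>Division of power series: the coefficient of the quotients that belongs to the monomial \<open>mu\<close> is
 determined by well-founded recursion on \<open>mu\<close>, because the divisors have their least
 monomials as leading monomials.\<close>

lemma series_division:
 fixes g :: "nat => nat multiset => 'a" and ld :: "nat => nat multiset"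
 assumes ldm: "!!j. j < n ==> set_mset (ld j) <= {..<m}" and lead: "!!j. j < n ==> g j (ld j) ~: J"
  and below: "!!j mu. j < n ==> mu < ld j ==> g j mu : J"
 shows "EX c. (ALL j nu. ~set_mset nu <= {..<m} --> c j nu = 0) &
  (ALL mu j. set_mset mu <= {..<m} --> j < n --> ld j <=# mu --> f mu - (SUM i<n. conv (c i) (g i) mu) : J)"
proof -
 have "ALL j:{..<n}. EX b. g j (ld j) * b - 1 : J" using inverse lead by blast
 from bchoice[OF this] obtain u where u: "!!j. j < n ==> g j (ld j) * u j - 1 : J" by blast
 \<comment> \<open>\<open>sel\<close> names the divisor responsible for a monomial, so that only one
   quotient is charged with it; \<open>A\<close> collects the contributions from smaller monomials,
   which the recursion knows already.\<close>
 define sel where "sel mu = (LEAST j. j < n & ld j <=# mu)" for mu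
 define A where "A mu j = {nu. nu <=# mu & set_mset nu <= {..<m} & nu + ld j < mu & sel (nu + ld j) = j}" for mu j
 define r where "r = {(x, y). x < (y :: nat multiset)}"
 have wf: "wf r" unfolding r_def by (rule wf)
 define step where "step q mu = u (sel mu) * (f mu - (SUM j<n. SUM nu:A mu j. q (nu + ld j) * g j (mu - nu)))" for q mu
 define q where "q = wfrec r step"
 have q: "q mu = u (sel mu) * (f mu - (SUM j<n. SUM nu:A mu j. q (nu + ld j) * g j (mu - nu)))" for mu
 proof -
  have "q mu = step (cut q r mu) mu" unfolding q_def by (rule wfrec[OF wf])
  also have "... = step q mu" unfolding step_def
   by (intro arg_cong2[of _ _ _ _ "(*)"] refl arg_cong2[of _ _ _ _ "(-)"] sum.cong) (auto simp: A_def cut_def r_def)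
  finally show ?thesis by (simp only: step_def)
 qed
 define c where "c j nu = (if set_mset nu <= {..<m} & sel (nu + ld j) = j then q (nu + ld j) else 0)" for j nu
 show ?thesis
 proof (intro exI[of _ c] conjI allI impI)
  show "c j nu = 0" if "~set_mset nu <= {..<m}" for j nu using that by (simp add: c_def)
  fix mu j assume mu: "set_mset mu <= {..<m}" and j: "j < n" "ld j <=# mu"
  define s where "s = sel mu"
  have s: "s < n" "ld s <=# mu" unfolding s_def sel_def using LeastI[of "%j. j < n & ld j <=# mu" j] j by auto
  have split: "conv (c i) (g i) mu - ((SUM nu:A mu i. q (nu + ld i) * g i (mu - nu)) + (if i = s then q mu * g i (ld i) else 0)) : J"
   if i: "i < n" for i
  proof -
   define Sb where "Sb = {nu. nu <=# mu}"
   have 1: "conv (c i) (g i) mu = (SUM nu:Sb \<inter> {nu. nu + ld i < mu}. c i nu * g i (mu - nu))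
    + (SUM nu:Sb \<inter> {nu. nu + ld i = mu}. c i nu * g i (mu - nu)) + (SUM nu:Sb \<inter> {nu. mu < nu + ld i}. c i nu * g i (mu - nu))"
    unfolding conv_def Sb_def[symmetric] by (rule sum_trichotomy) (simp add: Sb_def)
   have 2: "(SUM nu:Sb \<inter> {nu. nu + ld i < mu}. c i nu * g i (mu - nu)) = (SUM nu:A mu i. q (nu + ld i) * g i (mu - nu))"
    by (rule sum.mono_neutral_cong_right) (auto simp: Sb_def A_def c_def)
   have 3: "(SUM nu:Sb \<inter> {nu. nu + ld i = mu}. c i nu * g i (mu - nu)) = (if i = s then q mu * g i (ld i) else 0)"
   proof (cases "ld i <=# mu")
    case True
    hence e: "Sb \<inter> {nu. nu + ld i = mu} = {mu - ld i}" by (auto simp: Sb_def)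
    have sm: "set_mset (mu - ld i) <= {..<m}" using mu by (meson in_diffD subset_iff)
    have "mu - (mu - ld i) = ld i" using True by (metis add_diff_cancel_left' subset_mset.diff_add)
    thus ?thesis unfolding e using True sm by (auto simp: c_def s_def)
   next
    case False
    hence "Sb \<inter> {nu. nu + ld i = mu} = {}" by auto
    moreover have "i ~= s" using False s by blast
    ultimately show ?thesis by simp
   qed
   \<comment> \<open>Where \<open>nu + ld i\<close> exceeds \<open>mu\<close>, the coefficient of
     \<open>g i\<close> is taken below its least monomial.\<close>
   have 4: "(SUM nu:Sb \<inter> {nu. mu < nu + ld i}. c i nu * g i (mu - nu)) : J"
   proof (intro idl_sum[OF idJ] idl_mult[OF idJ] below[OF i])
    fix nu assume "nu : Sb \<inter> {nu. mu < nu + ld i}"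
    hence "nu + (mu - nu) < nu + ld i" by (auto simp: Sb_def)
    thus "mu - nu < ld i" by auto
   qed
   show ?thesis using 4 unfolding 1 2 3 by simp
  qed
  define a where "a = (SUM j<n. SUM nu:A mu j. q (nu + ld j) * g j (mu - nu))"
  have "(SUM i<n. conv (c i) (g i) mu - ((SUM nu:A mu i. q (nu + ld i) * g i (mu - nu)) + (if i = s then q mu * g i (ld i) else 0))) : J"
   using split by (intro idl_sum[OF idJ]) auto
  hence "(SUM i<n. conv (c i) (g i) mu) - (a + q mu * g s (ld s)) : J" using s(1) by (simp add: sum_subtractf sum.distrib a_def)
  moreover have "a + q mu * g s (ld s) - f mu : J"
  proof -
   have e: "q mu = u s * (f mu - a)" unfolding a_def s_def by (rule q)
   have "a + q mu * g s (ld s) - f mu = (f mu - a) * (g s (ld s) * u s - 1)" unfolding e by (simp add: algebra_simps)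
   thus ?thesis using idl_mult[OF idJ u[OF s(1)]] by simp
  qed
  ultimately have "(SUM i<n. conv (c i) (g i) mu) - f mu : J" by (rule idl_trans[OF idJ])
  thus "f mu - (SUM i<n. conv (c i) (g i) mu) : J" by (rule idl_minus_commute[OF idJ])
 qed
qed

section \<open>Hilbert's basis theorem by leading monomials\<close>

definition supp :: "(nat multiset => 'a) => nat multiset set" where "supp F = {mu. F mu ~: J}"

definition series :: "nat => (nat multiset => 'a) set" where
 "series m = {F. ALL mu. ~set_mset mu <= {..<m} --> F mu : J}"

definition polynomials :: "nat => (nat multiset => 'a) set" where
 "polynomials m = {F : series m. finite (supp F)}"

definition ideal_in :: "(nat multiset => 'a) set => (nat multiset => 'a) set => bool" where
 "ideal_in V I \<longleftrightarrow> I <= V & (ALL F:I. ALL G:I. F + G : I) & (ALL C:V. ALL F:I. conv C F : I) &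
   (ALL F:I. ALL G. (ALL mu. F mu - G mu : J) --> G : I)"

lemma ideal_inD:
 assumes "ideal_in V I" shows "F : I ==> F : V" "F : I ==> G : I ==> F + G : I" "C : V ==> F : I ==> conv C F : I"
  "F : I ==> (!!mu. F mu - G mu : J) ==> G : I" using assms unfolding ideal_in_def by blast+

lemma mon_series: "set_mset kp <= {..<m} ==> mon kp a : polynomials m"
proof -
 assume "set_mset kp <= {..<m}"
 hence "mon kp a : series m" using idl_0[OF idJ] by (auto simp: series_def mon_def)
 moreover have "finite (supp (mon kp a))" by (rule finite_subset[of _ "{kp}"]) (use idl_0[OF idJ] in \<open>auto simp: supp_def mon_def\<close>)
 ultimately show ?thesis by (simp add: polynomials_def)
qed

lemma ideal_in_diff:
 assumes I: "ideal_in V I" and V: "mon {#} (- 1) : V" and FG: "F : I" "G : I" shows "F - G : I"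
proof -
 have "conv (mon {#} (- 1)) G : I" by (rule ideal_inD(3)[OF I V FG(2)])
 moreover have "conv (mon {#} (- 1)) G = - G" by (auto simp: conv_mon)
 ultimately show ?thesis using ideal_inD(2)[OF I FG(1)] by fastforce
qed

lemma ideal_in_sum:
 fixes n :: nat
 assumes I: "ideal_in V I" and ne: "0 : I" and C: "!!j. j < n ==> c j : V" and g: "!!j. j < n ==> g j : I"
 shows "(%mu. SUM j<n. conv (c j) (g j) mu) : I" using C g
proof (induction n)
 case 0
 thus ?case using ne by (simp add: zero_fun_def)
next
 case (Suc n)
 have "(%mu. SUM j<n. conv (c j) (g j) mu) + conv (c n) (g n) : I" using Suc.prems by (intro ideal_inD(2)[OF I Suc.IH] ideal_inD(3)[OF I]) auto
 thus ?case by (simp add: plus_fun_def)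
qed

text \<open>Dickson's lemma for the set of leading monomials. The choice \<open>lm\<close> stays
  abstract so that least monomials of series and greatest monomials of polynomials are covered
  together.\<close>

lemma leading_basis:
 assumes I: "I <= series m" and lead: "!!F. F : I ==> supp F ~= {} ==> lm F : supp F"
 shows "EX n g. (ALL j<(n::nat). g j : I & supp (g j) ~= {}) & (ALL F:I. supp F ~= {} --> (EX j<n. lm (g j) <=# lm F))"
proof -
  define E where "E = lm ` {F : I. supp F ~= {}}"
  have "set_mset e <= {..<m}" if "e : E" for e using that lead I unfolding E_def series_def supp_def by blast
  then obtain E0 where E0: "finite E0" "E0 <= E" "ALL e:E. EX e0:E0. e0 <=# e" using dickson[of E m] by blast
  obtain S where S: "S <= {F : I. supp F ~= {}}" "finite S" "E0 = lm ` S" using finite_subset_image[OF E0(1) E0(2)[unfolded E_def]] by blast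
  obtain h where h: "bij_betw h {0..<card S} S" using ex_bij_betw_nat_finite[OF S(2)] by blast
  hence hS: "h ` {..<card S} = S" by (simp add: bij_betw_def atLeast0LessThan)
  show ?thesis
  proof (rule exI[of _ "card S"], rule exI[of _ h], intro conjI allI impI ballI)
   show "h j : I" "supp (h j) ~= {}" if "j < card S" for j using hS S(1) that by auto
   fix F assume "F : I" "supp F ~= {}"
   then obtain G where "G : S" "lm G <=# lm F" using E0(3) S(3) unfolding E_def by blast
   thus "EX j<card S. lm (h j) <=# lm F" using hS by force
  qed
qed

text \<open>Least monomials lead. The remainder of the division lies in I and has no monomial
  divisible by a leading one, so its support is empty.\<close>

theorem series_ideal_fg:
 assumes I: "ideal_in (series m) I" and 0: "0 : I"
 shows "EX n g. (ALL j<(n::nat). g j : I) & (ALL F:I. EX c. (ALL j. c j : series m) & (ALL mu. F mu - (SUM j<n. conv (c j) (g j) mu) : J))"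
proof -
 define lm where "lm F = (LEAST mu. mu : supp F)" for F
 have lm: "lm F : supp F" if "supp F ~= {}" for F unfolding lm_def using that by (metis LeastI ex_in_conv)
 have lml: "mu ~: supp F" if "mu < lm F" for F mu using not_less_Least that unfolding lm_def by blast
 have Iser: "I <= series m" using ideal_inD(1)[OF I] by blast
 obtain n g where g: "ALL j<(n::nat). g j : I & supp (g j) ~= {}" "ALL F:I. supp F ~= {} --> (EX j<n. lm (g j) <=# lm F)"
  using leading_basis[OF Iser lm] by blast
 have suppm: "set_mset mu <= {..<m}" if "F : I" "mu : supp F" for F mu using Iser that by (auto simp: series_def supp_def)
 have "EX c. (ALL j. c j : series m) & (ALL mu. F mu - (SUM j<n. conv (c j) (g j) mu) : J)" if F: "F : I" for F
 proof -
  obtain c where c0: "!!j nu. ~set_mset nu <= {..<m} ==> c j nu = 0"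
   and c: "!!mu j. set_mset mu <= {..<m} ==> j < n ==> lm (g j) <=# mu ==> F mu - (SUM i<n. conv (c i) (g i) mu) : J"
  proof -
   have "EX c. (ALL j nu. ~set_mset nu <= {..<m} --> c j nu = 0) &
    (ALL mu j. set_mset mu <= {..<m} --> j < n --> lm (g j) <=# mu --> F mu - (SUM i<n. conv (c i) (g i) mu) : J)" proof (rule series_division)
    show "set_mset (lm (g j)) <= {..<m}" if "j < n" for j using suppm lm g(1) that by blast
    show "g j (lm (g j)) ~: J" if "j < n" for j using lm[of "g j"] g(1) that by (auto simp: supp_def)
    show "g j mu : J" if "j < n" "mu < lm (g j)" for j mu using lml[OF that(2)] by (auto simp: supp_def)
   qed
   thus thesis using that by blast
  qed
  have cs: "c j : series m" for j using c0 idl_0[OF idJ] by (auto simp: series_def)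
  define H where "H = F - (%mu. SUM j<n. conv (c j) (g j) mu)"
  have "H : I" unfolding H_def
   by (rule ideal_in_diff[OF I _ F ideal_in_sum[OF I 0 cs]]) (use g(1) mon_series[of "{#}"] in \<open>auto simp: polynomials_def\<close>)
  have "supp H = {}"
  proof (rule ccontr)
   assume ne: "supp H ~= {}"
   obtain j where j: "j < n" "lm (g j) <=# lm H" using g(2) \<open>H : I\<close> ne by blast
   show False using c[OF suppm[OF \<open>H : I\<close> lm[OF ne]] j] lm[OF ne] by (auto simp: H_def supp_def)
  qed
  thus ?thesis using cs by (auto simp: supp_def H_def)
 qed
 thus ?thesis using g(1) by blast
qed

text \<open>Greatest monomials lead, and subtracting a multiple of one generator lowers the leading
  monomial; the multiset order is well-founded, so this ends with polynomial quotients.\<close>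

theorem polynomial_ideal_fg:
 assumes I: "ideal_in (polynomials m) I" and 0: "0 : I"
 shows "EX n g. (ALL j<(n::nat). g j : I) & (ALL F:I. EX c. (ALL j. c j : polynomials m) & (ALL mu. F mu - (SUM j<n. conv (c j) (g j) mu) : J))"
proof -
 define lm where "lm F = Max (supp F)" for F
 have Ipol: "I <= polynomials m" using ideal_inD(1)[OF I] by blast
 hence Iser: "I <= series m" by (auto simp: polynomials_def)
 have fin: "finite (supp F)" if "F : I" for F using Ipol that by (auto simp: polynomials_def)
 have lm: "lm F : supp F" if "F : I" "supp F ~= {}" for F unfolding lm_def using that fin by (intro Max_in)
 have lml: "mu ~: supp F" if "F : I" "lm F < mu" for F mu using Max_ge[OF fin[OF that(1)], of mu] that(2) unfolding lm_def by auto
 obtain n g where g: "ALL j<(n::nat). g j : I & supp (g j) ~= {}" "ALL F:I. supp F ~= {} --> (EX j<n. lm (g j) <=# lm F)"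
  using leading_basis[OF Iser lm] by blast
 have suppm: "set_mset mu <= {..<m}" if "F : I" "mu : supp F" for F mu using Iser that by (auto simp: series_def supp_def)
 have one: "mon {#} (- 1) : polynomials m" by (rule mon_series) simp
 have zc: "(%_. 0) : polynomials m" using idl_0[OF idJ] by (simp add: polynomials_def series_def supp_def)
 have "EX c. (ALL j. c j : polynomials m) & (ALL mu. F mu - (SUM j<n. conv (c j) (g j) mu) : J)"
  if "F : I" "supp F <= {..be}" for F be using that
 proof (induction be arbitrary: F rule: less_induct)
  case (less be)
  show ?case
  proof (cases "supp F = {}")
   case True show ?thesis using True zc by (auto simp: conv_def supp_def)
  next
   case False
   define La where "La = lm F"
   have La: "La : supp F" unfolding La_def by (rule lm[OF less.prems(1) False])
   obtain j where j: "j < n" "lm (g j) <=# La" using g(2) less.prems(1) False unfolding La_def by blast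
   have gj: "g j : I" "lm (g j) : supp (g j)" using g(1) j(1) lm by auto
   obtain u where u: "g j (lm (g j)) * u - 1 : J" using inverse gj(2) by (auto simp: supp_def)
   define kp where "kp = La - lm (g j)"
   have kp: "kp + lm (g j) = La" using j(2) by (simp add: kp_def)
   have kpm: "set_mset kp <= {..<m}" using suppm[OF less.prems(1) La] unfolding kp_def by (meson in_diffD subset_iff)
   define F' where "F' = F - conv (mon kp (F La * u)) (g j)"
   have F'I: "F' : I" unfolding F'_def by (rule ideal_in_diff[OF I one less.prems(1) ideal_inD(3)[OF I mon_series[OF kpm] gj(1)]])
   have F'0: "F' mu : J" if "La <= mu" for mu
   proof (cases "mu = La")
    case True show ?thesis using True kp idl_mult[OF idJ u, of "- F La"] by (auto simp: F'_def conv_mon algebra_simps)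
   next
    case False
    hence lt: "La < mu" using that by simp
    have Fm: "F mu : J" using lml[OF less.prems(1), of mu] lt by (auto simp: La_def supp_def)
    have "conv (mon kp (F La * u)) (g j) mu : J"
    proof (cases "kp <=# mu")
     case True
     hence "kp + lm (g j) < kp + (mu - kp)" using lt kp by simp
     hence "lm (g j) < mu - kp" by auto
     thus ?thesis using lml[OF gj(1)] True idl_mult[OF idJ] by (auto simp: supp_def conv_mon)
    qed (simp add: conv_mon idl_0[OF idJ])
    thus ?thesis unfolding F'_def using idl_diff[OF idJ Fm] by simp
   qed
   have "EX c. (ALL j. c j : polynomials m) & (ALL mu. F' mu - (SUM j<n. conv (c j) (g j) mu) : J)"
   proof (cases "supp F' = {}")
    case True show ?thesis using True zc by (auto simp: conv_def supp_def)
   next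
    case False
    have "lm F' < La" using F'0[of "lm F'"] lm[OF F'I False] by (auto simp: supp_def not_le[symmetric])
    moreover have "La <= be" using less.prems(2) La by auto
    ultimately have "lm F' < be" by simp
    moreover have "supp F' <= {..lm F'}" using Max_ge[OF fin[OF F'I]] unfolding lm_def by auto
    ultimately show ?thesis using less.IH[of "lm F'" F'] F'I by blast
   qed
   then obtain c where c: "!!j. c j : polynomials m" "!!mu. F' mu - (SUM j<n. conv (c j) (g j) mu) : J" by blast
   define c' where "c' i = (if i = j then c i + mon kp (F La * u) else c i)" for i
   have "c' i : polynomials m" for i
   proof -
    have mm: "mon kp (F La * u) : polynomials m" by (rule mon_series[OF kpm])
    have "supp (c i + mon kp (F La * u)) <= supp (c i) \<union> supp (mon kp (F La * u))" using idl_add[OF idJ] by (auto simp: supp_def)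
    hence "finite (supp (c i + mon kp (F La * u)))" using c(1)[of i] mm finite_subset by (auto simp: polynomials_def)
    moreover have "c i + mon kp (F La * u) : series m" using c(1)[of i] mm idl_add[OF idJ] by (auto simp: polynomials_def series_def)
    ultimately show ?thesis using c(1)[of i] by (cases "i = j") (simp_all add: c'_def polynomials_def)
   qed
   moreover have "F mu - (SUM i<n. conv (c' i) (g i) mu) : J" for mu
   proof -
    have "(SUM i<n. conv (c' i) (g i) mu) = (SUM i<n. conv (c i) (g i) mu + (if i = j then conv (mon kp (F La * u)) (g j) mu else 0))"
     by (rule sum.cong) (auto simp: c'_def conv_add)
    also have "... = (SUM i<n. conv (c i) (g i) mu) + conv (mon kp (F La * u)) (g j) mu" using j(1) by (simp add: sum.distrib)
    finally have "F mu - (SUM i<n. conv (c' i) (g i) mu) = F' mu - (SUM i<n. conv (c i) (g i) mu)" by (simp add: F'_def)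
    thus ?thesis using c(2) by simp
   qed
   ultimately show ?thesis by auto
  qed
 qed
 moreover have "supp F <= {..lm F}" if "F : I" for F using Max_ge[OF fin[OF that]] unfolding lm_def by auto
 ultimately show ?thesis using g(1) by blast
qed

end


locale field_series = field K for K :: "'k ring" (structure) +
 fixes m :: nat
begin

sublocale u: uring K ..

sublocale coeff_field "evk K"
proof
 show "idl (evk K)" by (rule u.idl_evk)
 fix a assume "a ~: evk K"
 hence "ev K a : Units K" by (simp add: evk_def field_Units)
 hence "a * lft K (inv (ev K a)) - 1 : evk K" by (simp add: u.evk_diff_iff)
 thus "EX b. a * b - 1 : evk K" by blast
qed

definition pw :: "(nat multiset => 'k uni) => nat multiset => 'k" where "pw F = (%mu. ev K (F mu))"
definition lf :: "(nat multiset => 'k) => nat multiset => 'k uni" where "lf f = (%mu. lft K (f mu))"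

text \<open>With V the series or the polynomials this is the power series or the polynomial ring, so
  that the ring laws are proved once for both.\<close>

definition ser_ring :: "(nat multiset => 'k uni) set => (nat multiset => 'k) ring" where
 "ser_ring V = (power_series_ring K m)\<lparr>carrier := pw ` V\<rparr>"

definition subalg :: "(nat multiset => 'k uni) set => bool" where
 "subalg V \<longleftrightarrow> (ALL a. mon {#} a : V) & (ALL F:V. ALL G:V. F + G : V & conv F G : V) &
   (ALL F:V. ALL G. (ALL mu. F mu - G mu : evk K) --> G : V)"

lemma subalgD: assumes "subalg V"
 shows "mon {#} a : V" "F : V ==> G : V ==> F + G : V" "F : V ==> G : V ==> conv F G : V"
  "F : V ==> (!!mu. F mu - G mu : evk K) ==> G : V" using assms unfolding subalg_def by blast+

lemma pw_eq_iff: "pw F = pw G \<longleftrightarrow> (ALL mu. F mu - G mu : evk K)" by (simp add: pw_def fun_eq_iff u.evk_diff_iff)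

lemma pw_lf: "(!!mu. f mu : carrier K) ==> pw (lf f) = f" by (simp add: pw_def lf_def)

lemma const_eq: "c : carrier K ==> ring.indexed_const K c = pw (mon {#} (lft K c))" by (auto simp: pw_def mon_def indexed_const_def)

lemma pw_mem: "subalg V ==> pw F : pw ` V \<longleftrightarrow> F : V" using subalgD(4)[of V] pw_eq_iff by (metis (no_types, lifting) image_iff)

lemma ser_ops:
 "pw F +{ser_ring V} pw G = pw (F + G)" "pw F *{ser_ring V} pw G = pw (conv F G)"
 "1{ser_ring V} = pw (mon {#} 1)" "0{ser_ring V} = pw 0" "carrier (ser_ring V) = pw ` V" by (auto simp: ser_ring_def power_series_ring_def pw_def conv_def u.ev_sum const_eq mon_def)

lemma conv_one: "conv (mon {#} 1) F = F" by (simp add: conv_mon fun_eq_iff)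

lemma cring_ser: assumes V: "subalg V" shows "cring (ser_ring V)"
proof (rule cringI)
 note D = subalgD[OF V]
 show "abelian_group (ser_ring V)"
 proof (rule abelian_groupI; unfold ser_ops(4,5))
  have "0 = mon {#} (0 :: 'k uni)" by (auto simp: mon_def)
  thus "pw 0 : pw ` V" using D(1) by (metis imageI)
  fix x assume "x : pw ` V"
  then obtain F where F: "F : V" "x = pw F" by blast
  show "pw 0 +{ser_ring V} x = x" unfolding F ser_ops by simp
  have "conv (mon {#} (- 1)) F = - F" by (simp add: conv_mon fun_eq_iff)
  hence "- F : V" using D(3)[OF D(1) F(1), of "- 1"] by simp
  moreover have "pw (- F) +{ser_ring V} x = pw 0" unfolding F ser_ops by simp
  ultimately show "EX y:pw ` V. y +{ser_ring V} x = pw 0" by blast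
  fix y assume "y : pw ` V"
  then obtain G where G: "G : V" "y = pw G" by blast
  show "x +{ser_ring V} y : pw ` V" unfolding F G ser_ops using D(2)[OF F(1) G(1)] by (rule imageI)
  show "x +{ser_ring V} y = y +{ser_ring V} x" unfolding F G ser_ops by (simp only: add.commute)
  fix z assume "z : pw ` V"
  then obtain H where H: "H : V" "z = pw H" by blast
  show "x +{ser_ring V} y +{ser_ring V} z = x +{ser_ring V} (y +{ser_ring V} z)"
   unfolding F G H ser_ops by (simp only: add.assoc)
 qed
 show "comm_monoid (ser_ring V)"
 proof (rule comm_monoidI; unfold ser_ops(3,5))
  show "pw (mon {#} 1) : pw ` V" using D(1) by blast
  fix x assume "x : pw ` V"
  then obtain F where F: "F : V" "x = pw F" by blast
  show "pw (mon {#} 1) *{ser_ring V} x = x" unfolding F ser_ops conv_one ..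
  fix y assume "y : pw ` V"
  then obtain G where G: "G : V" "y = pw G" by blast
  show "x *{ser_ring V} y : pw ` V" unfolding F G ser_ops using D(3)[OF F(1) G(1)] by (rule imageI)
  show "x *{ser_ring V} y = y *{ser_ring V} x" unfolding F G ser_ops by (simp only: conv_commute)
  fix z assume "z : pw ` V"
  then obtain H where H: "H : V" "z = pw H" by blast
  show "x *{ser_ring V} y *{ser_ring V} z = x *{ser_ring V} (y *{ser_ring V} z)"
   unfolding F G H ser_ops by (simp only: conv_assoc)
 qed
 fix x y z assume "x : carrier (ser_ring V)" "y : carrier (ser_ring V)" "z : carrier (ser_ring V)"
 then obtain F G H where e: "x = pw F" "y = pw G" "z = pw H" unfolding ser_ops by blast
 show "(x +{ser_ring V} y) *{ser_ring V} z = x *{ser_ring V} z +{ser_ring V} y *{ser_ring V} z"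
  unfolding e ser_ops conv_add ..
qed

lemma noeth_ser:
 assumes V: "subalg V"
  and fg: "!!I. ideal_in V I ==> 0 : I ==> EX n g. (ALL j<(n::nat). g j : I) &
   (ALL F:I. EX c. (ALL j. c j : V) & (ALL mu. F mu - (SUM j<n. conv (c j) (g j) mu) : evk K))" shows "noeth (evk (ser_ring V))"
proof
 interpret B: uring "ser_ring V" using cring_ser[OF V] by (simp add: uring_def)
 show "idl (evk (ser_ring V))" by (rule B.idl_evk)
 fix I assume I: "idl I" "evk (ser_ring V) <= I"
 define T where "T = {F. EX x:I. ev (ser_ring V) x = pw F}"
 have TV: "F : V" if "F : T" for F
 proof -
  have "pw F : carrier (ser_ring V)" using that unfolding T_def by (auto dest: sym)
  thus ?thesis unfolding ser_ops pw_mem[OF V] .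
 qed
 have lift: "EX x. ev (ser_ring V) x = pw F" if "F : V" for F using B.ev_surj[of "pw F"] that unfolding ser_ops by auto
 have "ideal_in V T" unfolding ideal_in_def
 proof (intro conjI ballI allI impI)
  show "T <= V" using TV by blast
  show "F + G : T" if FG: "F : T" "G : T" for F G
  proof -
   obtain x y where xy: "x : I" "ev (ser_ring V) x = pw F" "y : I" "ev (ser_ring V) y = pw G" using FG unfolding T_def by blast
   have "ev (ser_ring V) (x + y) = pw (F + G)" unfolding B.ev_add xy ser_ops ..
   thus ?thesis using idl_add[OF I(1) xy(1,3)] unfolding T_def by blast
  qed
  show "conv C F : T" if C: "C : V" and F: "F : T" for C F
  proof -
   obtain x where x: "x : I" "ev (ser_ring V) x = pw F" using F unfolding T_def by blast
   obtain z where z: "ev (ser_ring V) z = pw C" using lift[OF C] by blast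
   have "ev (ser_ring V) (z * x) = pw (conv C F)" unfolding B.ev_mult x z ser_ops ..
   thus ?thesis using idl_mult[OF I(1) x(1)] unfolding T_def by blast
  qed
  show "G : T" if "F : T" "ALL mu. F mu - G mu : evk K" for F G using that pw_eq_iff[of F G] unfolding T_def by auto
 qed
 moreover have "ev (ser_ring V) 0 = pw 0" by (simp only: B.ev_0 ser_ops(4))
 hence "0 : T" unfolding T_def using idl_0[OF I(1)] by blast
 ultimately obtain n g where g: "ALL j<(n::nat). g j : T"
  "ALL F:T. EX c. (ALL j. c j : V) & (ALL mu. F mu - (SUM j<n. conv (c j) (g j) mu) : evk K)" using fg by blast
 have "ALL j. EX x. j < n --> x : I & ev (ser_ring V) x = pw (g j)" using g(1) unfolding T_def by blast
 from choice[OF this] obtain x where x: "!!j. j < n ==> x j : I" "!!j. j < n ==> ev (ser_ring V) (x j) = pw (g j)" by blast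
 have "EX z. a - (SUM j<n. z j * x j) : evk (ser_ring V)" if a: "a : I" for a
 proof -
  have "ev (ser_ring V) a : pw ` V" using B.ev_closed unfolding ser_ops .
  then obtain F where F: "F : V" "ev (ser_ring V) a = pw F" by blast
  then obtain c where c: "ALL j. c j : V" "ALL mu. F mu - (SUM j<n. conv (c j) (g j) mu) : evk K" using a g(2) unfolding T_def by blast
  have "ALL j. EX z. ev (ser_ring V) z = pw (c j)" using c(1) lift by blast
  from choice[OF this] obtain z where z: "!!j. ev (ser_ring V) (z j) = pw (c j)" by blast
  have "k <= n ==> ev (ser_ring V) (SUM j<k. z j * x j) = pw (%mu. SUM j<k. conv (c j) (g j) mu)" for k
  proof (induction k)
   case 0
   thus ?case using ser_ops(4)[of V] by (simp add: zero_fun_def)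
  next
   case (Suc k)
   have "ev (ser_ring V) (SUM j<Suc k. z j * x j) = pw (%mu. SUM j<k. conv (c j) (g j) mu) +{ser_ring V} pw (c k) *{ser_ring V} pw (g k)"
    using Suc x(2)[of k] z[of k] by simp
   thus ?case unfolding ser_ops by (simp add: plus_fun_def)
  qed
  moreover have "pw F = pw (%mu. SUM j<n. conv (c j) (g j) mu)" unfolding pw_eq_iff by (rule c(2))
  ultimately have "ev (ser_ring V) (SUM j<n. z j * x j) = pw F" by simp
  thus ?thesis unfolding B.evk_diff_iff F(2) by (metis )
 qed
 thus "EX n g. (ALL j<(n::nat). g j : I) & (ALL a:I. EX c. a - (SUM j<n. c j * g j) : evk (ser_ring V))" using x(1) by (intro exI[of _ n]) blast
qed

lemma subalg_series: "subalg (series m)" unfolding subalg_def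
proof (intro conjI ballI allI impI)
 show "mon {#} a : series m" for a using mon_series[of "{#}" m a] by (simp add: polynomials_def)
 fix F assume F: "F : series m"
 { fix G assume G: "G : series m"
  show "F + G : series m" using F G idl_add[OF idJ] by (auto simp: series_def)
  show "conv F G : series m" unfolding series_def
  proof (intro CollectI allI impI)
   fix mu assume mu: "~set_mset mu <= {..<m}"
   show "conv F G mu : evk K" unfolding conv_def
   proof (rule idl_sum[OF idJ])
    fix nu assume "nu : {nu. nu <=# mu}"
    hence "mu = nu + (mu - nu)" by simp
    hence "set_mset mu = set_mset nu \<union> set_mset (mu - nu)" by (metis set_mset_union)
    thus "F nu * G (mu - nu) : evk K" using mu F G idl_mult[OF idJ] idl_mult2[OF idJ] unfolding series_def by auto
   qed
  qed }
 show "G : series m" if "ALL mu. F mu - G mu : evk K" for G using F that idl_cong[OF idJ] unfolding series_def by blast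
qed

lemma subalg_polynomials: "subalg (polynomials m)" unfolding subalg_def
proof (intro conjI ballI allI impI)
 note S = subalgD[OF subalg_series]
 show "mon {#} a : polynomials m" for a using mon_series[of "{#}" m a] by simp
 fix F assume "F : polynomials m"
 hence F: "F : series m" "finite (supp F)" by (auto simp: polynomials_def)
 { fix G assume "G : polynomials m"
  hence G: "G : series m" "finite (supp G)" by (auto simp: polynomials_def)
  have "supp (F + G) <= supp F \<union> supp G" using idl_add[OF idJ] by (auto simp: supp_def)
  thus "F + G : polynomials m" using S(2)[OF F(1) G(1)] F(2) G(2) finite_subset by (auto simp: polynomials_def)
  have "supp (conv F G) <= (%(nu, kp). nu + kp) ` (supp F \<times> supp G)"
  proof
   fix mu assume mu: "mu : supp (conv F G)"
   show "mu : (%(nu, kp). nu + kp) ` (supp F \<times> supp G)"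
   proof (rule ccontr)
    assume n: "mu ~: (%(nu, kp). nu + kp) ` (supp F \<times> supp G)"
    have "conv F G mu : evk K" unfolding conv_pairs
    proof (rule idl_sum[OF idJ])
     fix p assume p: "p : {(nu, kp). nu + kp = mu}"
     then obtain nu kp where e: "p = (nu, kp)" "nu + kp = mu" by blast
     thus "(case p of (nu, kp) => F nu * G kp) : evk K" using n idl_mult[OF idJ] idl_mult2[OF idJ] unfolding supp_def by force
    qed
    thus False using mu by (simp add: supp_def)
   qed
  qed
  hence "finite (supp (conv F G))" using F(2) G(2) finite_subset by blast
  thus "conv F G : polynomials m" using S(3)[OF F(1) G(1)] by (simp add: polynomials_def) }
 show "G : polynomials m" if "ALL mu. F mu - G mu : evk K" for G
 proof -
  have "supp G = supp F" using that idl_cong[OF idJ] unfolding supp_def by blast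
  thus ?thesis using S(4)[OF F(1)] that F(2) by (simp add: polynomials_def)
 qed
qed

lemma power_series_eq: "power_series_ring K m = ser_ring (series m)"
proof -
 have "carrier (power_series_ring K m) = pw ` series m"
 proof
  show "carrier (power_series_ring K m) <= pw ` series m"
  proof
   fix f assume f: "f : carrier (power_series_ring K m)"
   hence "f = pw (lf f)" by (intro pw_lf[symmetric]) (simp add: power_series_ring_def)
   moreover have "lf f : series m" using f by (auto simp: power_series_ring_def series_def lf_def u.evk_iff)
   ultimately show "f : pw ` series m" by blast
  qed
  show "pw ` series m <= carrier (power_series_ring K m)" by (auto simp: power_series_ring_def series_def pw_def u.evk_iff)
 qed
 thus ?thesis by (simp add: ser_ring_def)
qed

lemma polynomial_eq: "polynomial_ring K m = ser_ring (polynomials m)"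
proof -
 have "{f : carrier (power_series_ring K m). finite {mu. f mu ~= \<zero>}} = pw ` polynomials m" using u.evk_iff power_series_eq ser_ops by (auto simp: supp_def pw_def polynomials_def)
 thus ?thesis by (simp add: polynomial_ring_def ser_ring_def)
qed

lemma cring_power_series: "cring (power_series_ring K m)"
 and noeth_power_series: "noeth (evk (power_series_ring K m))"
 unfolding power_series_eq using cring_ser[OF subalg_series] noeth_ser[OF subalg_series series_ideal_fg] by blast+

lemma cring_polynomials: "cring (polynomial_ring K m)"
 and noeth_polynomials: "noeth (evk (polynomial_ring K m))"
 unfolding polynomial_eq using cring_ser[OF subalg_polynomials] noeth_ser[OF subalg_polynomials polynomial_ideal_fg] by blast+

lemma const_hom:
 assumes V: "subalg V" shows "ring.indexed_const K : ring_hom K (ser_ring V)"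
proof (rule ring_hom_memI)
 fix c d assume c: "c : carrier K" and d: "d : carrier K"
 show "indexed_const c : carrier (ser_ring V)" using subalgD(1)[OF V] c by (simp add: const_eq ser_ops)
 show "indexed_const (c \<otimes> d) = indexed_const c *{ser_ring V} indexed_const d"
  using c d by (simp add: const_eq ser_ops pw_eq_iff conv_mon) (auto simp: mon_def u.evk_diff_iff)
 show "indexed_const (c \<oplus> d) = indexed_const c +{ser_ring V} indexed_const d"
  using c d by (simp add: const_eq ser_ops pw_eq_iff) (auto simp: mon_def u.evk_diff_iff)
qed (simp add: ser_ops const_eq pw_eq_iff, auto simp: mon_def u.evk_diff_iff)

lemma local_power_series:
 "local_with (power_series_ring K m) {f : carrier (power_series_ring K m). f {#} = \<zero>}" (is "local_with ?S ?m") unfolding local_with_def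
proof (intro conjI ballI)
 interpret S: cring ?S by (rule cring_power_series)

 have ops': "pw F +{?S} pw G = pw (F + G)" "pw F *{?S} pw G = pw (conv F G)" for F G
  unfolding power_series_eq ser_ops by simp_all
 have ops'': "1{?S} = pw (mon {#} 1)" "0{?S} = pw 0" "carrier ?S = pw ` series m"
  unfolding power_series_eq ser_ops by simp_all
 have conv0: "conv F G {#} = F {#} * G {#}" for F G :: "nat multiset => 'k uni" by (simp add: conv_def)
 have add0: "(f +{?S} g) {#} = f {#} \<oplus> g {#}" for f g by (simp add: power_series_ring_def)
 have mult0: "(f *{?S} g) {#} = f {#} \<otimes> g {#}" if "f : carrier ?S" "g : carrier ?S" for f g
 proof -
  obtain F G where "f = pw F" "g = pw G" using \<open>f : carrier ?S\<close> \<open>g : carrier ?S\<close> unfolding ops'' by blast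
  thus ?thesis using ops' pw_def conv0 by force
 qed
 have c0: "f {#} : carrier K" if "f : carrier ?S" for f using that by (simp add: power_series_ring_def)
 show "cring ?S" by (rule cring_power_series)
 show "1{?S} ~: ?m" unfolding ops'' by (simp add: pw_def mon_def)
 show "ideal ?m ?S"
 proof (rule idealI[OF S.ring_axioms])
  show "subgroup ?m (add_monoid ?S)"
  proof (rule subgroup.intro)
   show "1{add_monoid ?S} : ?m" using S.zero_closed unfolding ops'' by (simp add: pw_def)
   fix f assume f: "f : ?m"
   have "inv\<^bsub>add_monoid ?S\<^esub> f = \<ominus>\<^bsub>?S\<^esub> f" by (simp add: a_inv_def)
   also have "... = (\<ominus>\<^bsub>?S\<^esub> 1{?S}) *{?S} f" using f by (simp add: S.l_minus)
   finally show "inv\<^bsub>add_monoid ?S\<^esub> f : ?m" using f mult0[of "\<ominus>\<^bsub>?S\<^esub> 1{?S}" f] c0 by simp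
  qed (auto simp: add0)
  show "g *{?S} f : ?m" "f *{?S} g : ?m" if "f : ?m" "g : carrier ?S" for f g
   using that mult0[of f g] mult0[of g f] c0 by auto
 qed
 fix f assume f: "f : carrier ?S - ?m"
 then obtain F where F: "F : series m" "f = pw F" unfolding ops'' by blast
 have F0: "F {#} ~: evk K" using f F by (auto simp: pw_def u.evk_iff)
 \<comment> \<open>A series with nonzero constant term has the empty monomial as leading monomial;
   dividing 1 by it leaves no remainder.\<close>
 have "EX c. (ALL j nu. ~set_mset nu <= {..<m} --> c j nu = 0) &
  (ALL mu j. set_mset mu <= {..<m} --> j < Suc 0 --> {#} <=# mu --> mon {#} 1 mu - (SUM i<Suc 0. conv (c i) F mu) : evk K)"
  by (rule series_division) (use F0 in auto)
 then obtain c where c: "!!nu. ~set_mset nu <= {..<m} ==> c 0 nu = (0 :: 'k uni)"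
  "!!mu. set_mset mu <= {..<m} ==> mon {#} 1 mu - conv (c (0::nat)) F mu : evk K" by auto
 have cs: "c 0 : series m" using c(1) idl_0[OF idJ] by (simp add: series_def)
 have "mon {#} 1 mu - conv (c 0) F mu : evk K" for mu
 proof (cases "set_mset mu <= {..<m}")
  case False
  hence "conv (c 0) F mu : evk K" using subalgD(3)[OF subalg_series cs F(1)] by (simp add: series_def)
  moreover have "mon {#} 1 mu = (0 :: 'k uni)" using False by (auto simp: mon_def)
  ultimately show ?thesis using idl_uminus[OF idJ] by simp
 qed (rule c(2))
 hence "pw (mon {#} 1) = pw (conv (c 0) F)" unfolding pw_eq_iff by blast
 hence "pw (c 0) *{?S} f = 1{?S}" unfolding F(2) ops' ops'' by (rule sym)
 moreover have "pw (c 0) : carrier ?S" using cs unfolding ops'' by blast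
 ultimately show "f : Units ?S" using f S.m_comm[of "pw (c 0)" f] unfolding Units_def by auto
qed

end

section \<open>Homomorphic images\<close>

lemma noeth_hom_image:
 fixes L :: "'a ring" and R :: "'r ring"
 assumes "cring L" "cring R" and h: "h : ring_hom L R" "h ` carrier L = carrier R" and N: "noeth (evk L)"
 shows "noeth (evk R)"
proof -
 interpret L: uring L using assms by (simp add: uring_def)
 interpret R: uring R using assms by (simp add: uring_def)
 define io where "io x = lft R (h (ev L x))" for x
 have hc: "h x : carrier R" if "x : carrier L" for x using ring_hom_closed[OF h(1) that] .
 have ev: "ev R (io x) = h (ev L x)" for x unfolding io_def using hc by simp
 show ?thesis
 proof (rule noeth_image[OF N R.idl_evk])
  show "io (x + y) - (io x + io y) : evk R" for x y unfolding R.evk_diff_iff R.ev_add ev by (simp add: ring_hom_add[OF h(1)])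
  show "io (x * y) - io x * io y : evk R" for x y unfolding R.evk_diff_iff R.ev_mult ev by (simp add: ring_hom_mult[OF h(1)])
  show "io x : evk R" if "x : evk L" for x using that ring_hom_zero[OF h(1) L.ring_axioms R.ring_axioms] by (simp add: evk_def ev)
  show "EX a u v. z - u * io a : evk R & io a - v * z : evk R" for z
  proof -
   obtain a where "ev R z = h a" "a : carrier L" using h(2) R.ev_closed[of z] by (metis imageE)
   hence "z - 1 * io (lft L a) : evk R & io (lft L a) - 1 * z : evk R" by (auto simp: ev R.evk_diff_iff)
   thus ?thesis by blast
  qed
 qed
qed

lemma local_hom_image:
 assumes L: "local_with L mq" and R: "cring R" "1{R} ~= 0{R}" and h: "h : ring_hom L R" "h ` carrier L = carrier R"
 shows "local_with R (h ` mq)"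
proof -
 interpret L: cring L using L by (simp add: local_with_def)
 interpret R: cring R by fact
 interpret h: ring_hom_cring L R h by unfold_locales (rule h)
 interpret M: ideal mq L using L by (simp add: local_with_def)
 have unit: "h a : Units R" if "a : carrier L" "a ~: mq" for a
 proof -
  have u: "a : Units L" using L that by (simp add: local_with_def)
  have "h a *{R} h (inv\<^bsub>L\<^esub> a) = 1{R}" using u that(1) by (simp flip: h.hom_mult)
  moreover have "h (inv\<^bsub>L\<^esub> a) : carrier R" using u by simp
  ultimately show ?thesis using that(1) R.m_comm[of "h a" "h (inv\<^bsub>L\<^esub> a)"] unfolding Units_def by auto
 qed
 show ?thesis unfolding local_with_def
 proof (intro conjI ballI)
  show "cring R" by fact
  show "ideal (h ` mq) R"
  proof (rule idealI[OF R.ring_axioms])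
   show "subgroup (h ` mq) (add_monoid R)"
   proof (rule subgroup.intro)
    show "h ` mq <= carrier (add_monoid R)" by auto
    show "1{add_monoid R} : h ` mq" by (auto intro: image_eqI[of _ _ "0{L}"])
    fix x y assume "x : h ` mq" "y : h ` mq"
    then obtain a c where "a : mq" "c : mq" "x = h a" "y = h c" by blast
    thus "x *{add_monoid R} y : h ` mq" by (auto intro!: image_eqI[of _ _ "a +{L} c"] M.a_closed simp: M.Icarr)
   next
    fix x assume "x : h ` mq"
    then obtain a where a: "a : mq" "x = h a" by blast
    hence "inv\<^bsub>add_monoid R\<^esub> x = h (\<ominus>\<^bsub>L\<^esub> a)" by (simp add: a_inv_def[of R, symmetric])
    thus "inv\<^bsub>add_monoid R\<^esub> x : h ` mq" using a by blast
   qed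
   fix x r assume "x : h ` mq" "r : carrier R"
   then obtain a c where "a : mq" "x = h a" "c : carrier L" "r = h c" using h(2) by (metis imageE)
   thus "r *{R} x : h ` mq" "x *{R} r : h ` mq"
    using M.I_l_closed[of a c] M.I_r_closed[of a c] by (auto simp: M.Icarr simp flip: h.hom_mult)
  qed
  show "1{R} ~: h ` mq"
  proof
   assume "1{R} : h ` mq"
   then obtain a where a: "a : mq" "h a = 1{R}" by auto
   have ac: "a : carrier L" using a M.Icarr by blast
   have "1{L} \<ominus>\<^bsub>L\<^esub> a ~: mq"
   proof
    assume "1{L} \<ominus>\<^bsub>L\<^esub> a : mq"
    hence "(1{L} \<ominus>\<^bsub>L\<^esub> a) +{L} a : mq" using a(1) by (rule M.a_closed)
    thus False using ac L by (auto simp: a_minus_def L.a_assoc L.l_neg local_with_def)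
   qed
   moreover have "1{L} \<ominus>\<^bsub>L\<^esub> a : carrier L" using ac by simp
   ultimately have "h (1{L} \<ominus>\<^bsub>L\<^esub> a) : Units R" by (rule unit[rotated])
   moreover have "h (1{L} \<ominus>\<^bsub>L\<^esub> a) = 0{R}" using ac a(2) by (simp add: a_minus_def R.r_neg)
   ultimately show False using R(2) by (auto simp: Units_def)
  qed
  show "x : Units R" if x: "x : carrier R - h ` mq" for x
  proof -
   obtain a where "a : carrier L" "x = h a" using x h(2) by blast
   thus ?thesis using unit x by blast
  qed
 qed
qed

lemma quotient_hom:
 assumes "cring L" "ideal I L" "I ~= carrier L" "ps : ring_iso (L Quot I) R" "cring R"
 shows "(%a. ps (I +>\<^bsub>L\<^esub> a)) : ring_hom L R" "(%a. ps (I +>\<^bsub>L\<^esub> a)) ` carrier L = carrier R" "1{R} ~= 0{R}"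
proof -
 interpret I: ideal I L by fact
 interpret R: cring R by fact
 have ps: "ps : ring_hom (L Quot I) R" "bij_betw ps (carrier (L Quot I)) (carrier R)" using assms(4) by (auto simp: ring_iso_def)
 have "(ps \<circ> (+>\<^bsub>L\<^esub>) I) : ring_hom L R" by (rule ring_hom_trans[OF I.rcos_ring_hom ps(1)])
 thus "(%a. ps (I +>\<^bsub>L\<^esub> a)) : ring_hom L R" by (simp add: comp_def)
 have cq: "carrier (L Quot I) = (%a. I +>\<^bsub>L\<^esub> a) ` carrier L" by (auto simp: FactRing_def A_RCOSETS_def')
 thus "(%a. ps (I +>\<^bsub>L\<^esub> a)) ` carrier L = carrier R" using ps(2) by (auto simp: bij_betw_def)
 show "1{R} ~= 0{R}" by (metis ps cq I.one_closed I.zero_closed R.l_null R.l_one imageI bij_betw_def inj_on_def I.a_rcos_self I.a_coset_add_zero I.a_subset I.one_imp_carrier assms)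
qed


section \<open>The presented rings\<close>

text \<open>The structure map is prescribed on the carrier of K only; what can be extracted is a
  ring homomorphism that agrees with it there.\<close>

lemma presentation_local:
 fixes K :: "'k ring" and R :: "'r ring"
 assumes K: "field K" and R: "cring R"
  and pres: "localized_affine_presentation K m ph R | power_series_presentation K m ph R"
 shows "EX mq. noeth (evk R) & local_with R mq & (EX et:ring_hom K R. ALL c:carrier K. ph c = et c)"
proof -
 interpret K: field_series K m using K by (simp add: field_series_def)
 from pres show ?thesis
 proof
  assume "power_series_presentation K m ph R"
  then obtain I ps where I: "ideal I (power_series_ring K m)" "I ~= carrier (power_series_ring K m)"
   and ps: "ps : ring_iso (power_series_ring K m Quot I) R"
   and ph: "ALL c:carrier K. ph c = ps (I +>\<^bsub>power_series_ring K m\<^esub> ring.indexed_const K c)"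
   unfolding power_series_presentation_def radical_ideal_def Let_def by blast
  note q = quotient_hom[OF K.cring_power_series I ps R]
  have "noeth (evk R)" by (rule noeth_hom_image[OF K.cring_power_series R q(1,2) K.noeth_power_series])
  moreover note local_hom_image[OF K.local_power_series R q(3,1,2)]
  moreover have "ring.indexed_const K : ring_hom K (power_series_ring K m)" unfolding K.power_series_eq by (rule K.const_hom[OF K.subalg_series])
  hence "(%a. ps (I +>\<^bsub>power_series_ring K m\<^esub> a)) \<circ> ring.indexed_const K : ring_hom K R" using q(1) by (rule ring_hom_trans)
  hence "EX et:ring_hom K R. ALL c:carrier K. ph c = et c" by (rule bexI[rotated]) (use ph in simp)
  ultimately show ?thesis by blast
 next
  assume "localized_affine_presentation K m ph R"
  then obtain p I ps where p: "primeideal p (polynomial_ring K m)"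
   and I: "ideal I (ring_at_prime (polynomial_ring K m) p)" "I ~= carrier (ring_at_prime (polynomial_ring K m) p)"
   and ps: "ps : ring_iso (ring_at_prime (polynomial_ring K m) p Quot I) R"
   and ph: "ALL c:carrier K. ph c = ps (I +>\<^bsub>ring_at_prime (polynomial_ring K m) p\<^esub>
    fraction (polynomial_ring K m) (carrier (polynomial_ring K m) - p) (self_module (polynomial_ring K m)) (ring.indexed_const K c) 1{polynomial_ring K m})"
   unfolding localized_affine_presentation_def radical_ideal_def Let_def by blast
  define B where "B = polynomial_ring K m"
  note I = I[folded B_def] and ps = ps[folded B_def] and ph = ph[folded B_def]
  define P where "P = {x. ev B x : p}"
  interpret B: uring B unfolding B_def uring_def by (rule K.cring_polynomials)
  interpret p: primeideal p B using p by (simp add: B_def)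
  interpret U: unprime B P
  proof -
   interpret noeth "evk B" unfolding B_def by (rule K.noeth_polynomials)
   show "unprime B P"
    by unfold_locales (use B.prime_idl_vimage[OF p.primeideal_axioms] B.idl_vimage(2)[OF p.ideal_axioms] in \<open>simp_all add: P_def\<close>)
  qed
  have pp: "U.p = p"
  proof
   show "U.p <= p" unfolding U.p_def by (auto simp: P_def)
   show "p <= U.p"
   proof
    fix a assume a: "a : p"
    then obtain x where x: "a = ev B x" using B.ev_surj[OF p.Icarr] by blast
    thus "a : U.p" using a unfolding U.p_def by (simp add: P_def)
   qed
  qed
  have Q: "ring_at_prime B p = U.Q" by (simp only: U.Q_def pp)
  note q = quotient_hom[OF U.Q.cring_axioms I[unfolded Q] ps[unfolded Q] R]
  have "noeth (evk R)" by (rule noeth_hom_image[OF U.Q.cring_axioms R q(1,2) U.noeth_Q])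
  moreover note local_hom_image[OF U.local_Q R q(3,1,2)]
  moreover have "EX et:ring_hom K R. ALL c:carrier K. ph c = et c"
  proof -
   have 1: "ring.indexed_const K : ring_hom K B" unfolding B_def K.polynomial_eq by (rule K.const_hom[OF K.subalg_polynomials])
   have 2: "(%a. U.Z.frac a 1{B}) : ring_hom B U.Q"
    by (rule ring_hom_memI) (use U.one_p in \<open>simp_all add: U.Q_def U.Z.loc_ringI U.Z.loc_ring_add U.Z.loc_ring_mult U.Z.loc_ring_simps(3)\<close>)
   have "(%a. ps (I +>\<^bsub>U.Q\<^esub> a)) \<circ> ((%a. U.Z.frac a 1{B}) \<circ> ring.indexed_const K) : ring_hom K R"
    by (rule ring_hom_trans[OF ring_hom_trans[OF 1 2] q(1)])
   thus ?thesis by (rule bexI[rotated]) (use ph in \<open>simp add: Q pp\<close>)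
  qed
  ultimately show ?thesis by blast
 qed
qed

text \<open>A nonzero element of the field is sent to a unit. This provides the start
  \<open>B0\<close> of the Zorn argument and, with characteristic 0, the invertibility of the
  positive integers.\<close>

lemma (in uring) coefficients_meet_maximal:
 fixes K :: "'k ring"
 assumes "field K" and et: "et : ring_hom K R" and L: "local_with R mq"
  and char_0: "ALL n::nat. n > 0 --> [n] \<cdot>\<^bsub>K\<^esub> 1{K} ~= 0{K}"
 shows "subrng {x. ev R x : et ` carrier K}" "{x. ev R x : et ` carrier K} \<inter> {x. ev R x : mq} <= evk R"
  "n > 0 ==> of_nat n ~: {x. ev R x : mq}"
proof -
 interpret K: field K by fact
 interpret h: ring_hom_cring K R et by unfold_locales (rule et)
 interpret M: ideal mq R using L by (simp add: local_with_def)
 have meet: "c = 0{K}" if c: "c : carrier K" "et c : mq" for c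
 proof (rule ccontr)
  assume "c ~= 0{K}"
  hence u: "c : Units K" using c K.field_Units by blast
  hence ic: "inv\<^bsub>K\<^esub> c : carrier K" by simp
  have "et c \<otimes> et (inv\<^bsub>K\<^esub> c) : mq" using c(2) ic by (intro M.I_r_closed) auto
  moreover have "et c \<otimes> et (inv\<^bsub>K\<^esub> c) = \<one>" using u c(1) by (simp flip: h.hom_mult)
  ultimately show False using L by (simp add: local_with_def)
 qed
 show "subrng {x. ev R x : et ` carrier K}" unfolding subrng_def
 proof (intro conjI ballI)
  show "1 : {x. ev R x : et ` carrier K}" by (auto intro: image_eqI[of _ _ "1{K}"])
  fix a b assume "a : {x. ev R x : et ` carrier K}" "b : {x. ev R x : et ` carrier K}"
  then obtain c d where c: "c : carrier K" "ev R a = et c" and d: "d : carrier K" "ev R b = et d" by blast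
  have "ev R (a - b) = et (c \<ominus>\<^bsub>K\<^esub> d)" using c d by simp
  thus "a - b : {x. ev R x : et ` carrier K}" using c d by blast
  have "ev R (a * b) = et (c *{K} d)" using c d by simp
  thus "a * b : {x. ev R x : et ` carrier K}" using c d by blast
 qed
 show "{x. ev R x : et ` carrier K} \<inter> {x. ev R x : mq} <= evk R" using meet by (force simp: evk_def)
 have nat: "ev R (of_nat k) = et ([k] \<cdot>\<^bsub>K\<^esub> 1{K})" for k :: nat by (induction k) (simp_all add: a_comm)
 show "of_nat n ~: {x. ev R x : mq}" if "n > 0" using meet[of "[n] \<cdot>\<^bsub>K\<^esub> 1{K}"] char_0 that by (auto simp: nat)
qed

context loc_diffs begin

text \<open>The hypothesis \<open>depth\<close> is the common form of both parts of the theorem: the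
  Serre condition gives it with n = t - r, and the Cohen-Macaulay case with r = t and n = 0, where
  the Ext condition is vacuous.\<close>

lemma regular_of_depth:
 assumes K: "field K" and et: "et : ring_hom K R" "ALL c:carrier K. ph c = et c"
  and char_0: "ALL n::nat. n > 0 --> [n] \<cdot>\<^bsub>K\<^esub> 1{K} ~= 0{K}"
  and L: "local_with R mq" "m = {x. ev R x : mq}"
  and t: "dep m t (fr {0} (evk R))" "~dep m (Suc t) (fr {0} (evk R))"
  and pd: "proj_dim R (Der K ph R) < \<infinity>"
  and ext: "!!i. 1 <= i ==> i <= n ==> trivial_group (Ext i R Om (self_module R))"
  and r: "r + n = t"
  and depth: "!!P e. unprime R P ==> e <= t ==> dep {x. ev (uprime.Q R P) x : uprime.pQ R P} e (fr {0} (evk (uprime.Q R P))) ==>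
   dep {x. ev (uprime.Q R P) x : uprime.pQ R P} (min r e) (localiz.loc (evk (uprime.Q R P)) P (uprime.io R P) N lck)" shows "regular_local_ring R"
proof -
 have "EX C gq. range (mv C gq) + fr N (evk R) = dual & (ALL mu. mv N (tr (A 0)) mu : fr (b 1) m --> mu : range (mv C gq) + fr N m)"
 proof (rule residue_exact[OF t pd ext])
  fix P :: "'r uni set" assume P: "prime_idl P" "evk R <= P"
  interpret U: unprime R P by unfold_locales (rule P)+ show "EX (J' :: ('r \<times> 'r) set uni set) m' io. localiz (evk R) J' m' P io &
    (ALL e<=t. dep m' e (fr {0} J') --> dep m' e (localiz.loc J' P io (b n) (res.Z n)))"
   using U.Lz.localiz_axioms by (metis resOm depth U.unprime_axioms U.Lz.dep_loc_cyc submod_lck r min.absorb2)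
 qed
 then obtain C gq where cov: "range (mv C gq) + fr N (evk R) = dual"
  and ex: "!!mu. mv N (tr (A 0)) mu : fr (b 1) m ==> mu : range (mv C gq) + fr N m" by blast
 have im: "ph ` carrier K = et ` carrier K" using et(2) by auto
 note coeff = coefficients_meet_maximal[OF K et(1) L(1) char_0]
 show ?thesis by (rule regular[OF L _ _ _ cov ex]) (use coeff in \<open>simp_all add: im L(2)\<close>)
qed

end

theorem corollary50:
  fixes K :: "'k ring" and R :: "'r ring" and \<phi> :: "'k \<Rightarrow> 'r"
    and \<Omega> :: "('r, 'w) module" and d :: "'r \<Rightarrow> 'w" and m :: nat and t :: enat
  assumes "field K"
    and char_0: "\<forall>n::nat. n > 0 \<longrightarrow> [n] \<cdot>\<^bsub>K\<^esub> \<one>\<^bsub>K\<^esub> \<noteq> \<zero>\<^bsub>K\<^esub>"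
    and "cring R"
    and "localized_affine_presentation K m \<phi> R \<or> power_series_presentation K m \<phi> R"
    and "universally_finite_differentials K \<phi> R \<Omega> d"
    and "t = ring_depth R"
  shows
    "((\<exists>r::nat. enat r \<le> t \<and> serre_tilde r R \<Omega> \<and>
         (enat r < t \<longrightarrow>
           (\<forall>i::nat. 1 \<le> i \<and> enat i \<le> t - enat r \<longrightarrow> trivial_group (Ext i R \<Omega> (self_module R)))))
       \<longrightarrow> proj_dim R (Der K \<phi> R) < \<infinity> \<longrightarrow> regular_local_ring R)
     \<and> (cohen_macaulay_local_ring R \<longrightarrow> maximal_cohen_macaulay R \<Omega> \<longrightarrow>
          proj_dim R (Der K \<phi> R) < \<infinity> \<longrightarrow> regular_local_ring R)"
proof -
 interpret R: uring R using \<open>cring R\<close> by (simp add: uring_def)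
 obtain mq et where N: "noeth (evk R)" and L: "local_with R mq"
  and et: "et : ring_hom K R" "ALL c:carrier K. \<phi> c = et c" using presentation_local[OF assms(1,3,4)] by blast
 define M where "M = {x. ev R x : mq}"
 interpret nl: nloc "evk R" M unfolding M_def by (rule R.nloc_ev[OF N L])
 have "finite_module R \<Omega>" using assms(5) by (simp add: universally_finite_differentials_def)
 then obtain g w where "genmods R \<Omega> {..<(g::nat)} w" using finite_module_gen by blast
 then interpret G: genmods R \<Omega> "{..<g}" w .
 obtain b A where b: "b 0 = {..<g}" "free_res (evk R) G.lck b A" using nl.minimal_resolution[OF _ G.submod_lck G.fr_lck] by blast
 interpret D: loc_diffs R \<Omega> "{..<g}" w K \<phi> d M b A by unfold_locales (use assms(5) et b ring_hom_closed[OF et(1)] in auto)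
 interpret S: genmods R "self_module R" "{0}" "%_. 1{R}" by (rule genmods_self(1)[OF \<open>cring R\<close>])
 have dep_t: "enat k <= t \<longleftrightarrow> dep M k (fr {0} (evk R))" for k
  using S.depth_ge_iff[OF N L, of k] unfolding genmods_self(2)[OF \<open>cring R\<close>] M_def assms(6) .
 \<comment> \<open>The depth is finite, being bounded by the number of generators of the maximal
   ideal; so t - r is a natural number.\<close>
 obtain T where T: "t = enat T"
 proof (cases t)
  case infinity
  obtain k where "ALL j. dep M j (fr {0} (evk R)) --> j <= k" using nl.dep_finite by blast
  hence "~dep M (Suc k) (fr {0} (evk R))" by (metis Suc_n_not_le_n)
  thus thesis using dep_t[of "Suc k"] infinity by (simp del: dep.simps)
 qed
 have T': "dep M T (fr {0} (evk R))" "~dep M (Suc T) (fr {0} (evk R))" using dep_t[of T] dep_t[of "Suc T"] T by simp_all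
 note regular = D.regular_of_depth[OF assms(1) et char_0 L M_def T']
 show ?thesis
 proof (intro conjI impI)
  assume "EX r::nat. enat r <= t & serre_tilde r R \<Omega> & (enat r < t -->
   (ALL i::nat. 1 <= i & enat i <= t - enat r --> trivial_group (Ext i R \<Omega> (self_module R))))"
  then obtain r where r: "r <= T" "serre_tilde r R \<Omega>"
   and ext: "r < T ==> 1 <= i ==> i <= T - r ==> trivial_group (Ext i R \<Omega> (self_module R))" for i by (auto simp: T)
  assume pd: "proj_dim R (Der K \<phi> R) < \<infinity>"
  show "regular_local_ring R"
  proof (rule regular[OF pd, where n = "T - r" and r = r])
   show "trivial_group (Ext i R \<Omega> (self_module R))" if "1 <= i" "i <= T - r" for i using ext that by simp
   fix P e assume P: "unprime R P" and e: "dep {x. ev (uprime.Q R P) x : uprime.pQ R P} e (fr {0} (evk (uprime.Q R P)))"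
   interpret U: unprime R P by (rule P)
   have cQ: "cring U.Q" by (rule U.Q.cring_axioms)
   interpret SQ: genmods U.Q "self_module U.Q" "{0}" "%_. 1{U.Q}" by (rule genmods_self(1)[OF cQ])
   interpret MQ: genmods U.Q "module_at_prime R U.p \<Omega>" "{..<g}" "%i. fraction R U.S \<Omega> (w i) 1{R}"
    by (rule U.genmods_loc(1)[OF G.genmods_axioms])
   have "enat e <= ring_depth U.Q" using SQ.depth_ge_iff[OF U.noeth_Q U.local_Q, of e] e unfolding genmods_self(2)[OF cQ] by blast
   hence "enat (min r e) <= min (enat r) (ring_depth U.Q)" by (metis enat_ord_simps(1) min.bounded_iff min.cobounded1 min.cobounded2 order_trans)
   also have "... <= depth U.Q (module_at_prime R U.p \<Omega>)" using r(2) U.prime_p unfolding serre_tilde_def U.Q_def by blast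
   finally show "dep {x. ev U.Q x : U.pQ} (min r e) (localiz.loc (evk U.Q) P U.io {..<g} G.lck)"
    using MQ.depth_ge_iff[OF U.noeth_Q U.local_Q] U.genmods_loc(2)[OF G.genmods_axioms] by simp
  qed (use r in simp)
 next
  assume CM: "cohen_macaulay_local_ring R" "maximal_cohen_macaulay R \<Omega>" and pd: "proj_dim R (Der K \<phi> R) < \<infinity>"
  have dim: "krull_dim R = enat T" using CM(1) T assms(6) by (simp add: cohen_macaulay_local_ring_def)
  have "enat T <= depth R \<Omega>" using CM(2) dim by (simp add: maximal_cohen_macaulay_def)
  hence dO: "dep M T G.lck" using G.depth_ge_iff[OF N L] by (simp add: M_def)
  \<comment> \<open>The dimension equals the depth T; \<open>dep_loc_of_max_depth\<close> uses this
    to exclude longer chains through P.\<close>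
  have chain: "n <= T" if "prime_chain (evk R) n Q" for n Q
  proof -
   have "enat n <= krull_dim R" unfolding krull_dim_def R.prime_chain_iff[symmetric] by (rule Sup_upper) (use that in blast)
   thus ?thesis by (simp add: dim)
  qed
  show "regular_local_ring R"
  proof (rule regular[OF pd, where n = 0 and r = T])
   fix P e assume P: "unprime R P" and e: "e <= T" "dep {x. ev (uprime.Q R P) x : uprime.pQ R P} e (fr {0} (evk (uprime.Q R P)))"
   interpret U: unprime R P by (rule P)
   have good: "nl.good G.lck" unfolding nl.good_def using G.submod_lck G.fr_lck G.finN by blast
   have "dep {x. ev U.Q x : U.pQ} e (U.Lz.loc {..<g} G.lck)"
    by (rule U.Lz.dep_loc_of_max_depth[OF nl.nloc_axioms good G.fr_lck G.finN dO chain e(2,1)])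
   thus "dep {x. ev U.Q x : U.pQ} (min T e) (localiz.loc (evk U.Q) P U.io {..<g} G.lck)" using e(1) by (simp add: min_def)
  qed simp_all
 qed
qed

end
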